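(* Let $\Psi \in \mathbf{H}^3(\Omega)\cap\mathbf{X}$ be a regular solution to the continuous problem. Fix $\Gamma\ge 0$ and let $\rho>0$ be sufficiently small (the smallness depending on $\Gamma$ and $\Psi$, but not on $\mathcal D$). Assume $C_{\mathcal D}\le \Gamma$, $\Gamma(E_{\mathcal D})\le \Gamma$, $\omega(E_{\mathcal D})\le\rho$, $\alpha_{\mathcal D}\le\rho$, $\gamma_{\mathcal D}\le\rho$ and $\delta(E_{\mathcal D}) \le \rho$. Then there exists a solution $\Psi_{\mathcal D} \in \mathbf{X}_{\mathcal D,0}$ to the Hessian scheme that satisfies $\| \Psi_{\mathcal D}-P_{\mathcal D} \Psi\|_{\mathcal D}\lesssim \rho$, as well as the following estimates: \begin{align*} \|\mathcal H \Psi-\mathcal H_{\mathcal D}\Psi_{\mathcal D}\|&\lesssim \rho,\quad \|\nabla \Psi-\nabla_{\mathcal D}\Psi_{\mathcal D}\| \lesssim \rho,\quad\mbox{ and }\quad \| \Psi-\Pi_{\mathcal D}\Psi_{\mathcal D}\|\lesssim \rho, \end{align*} where the hidden constants in ``$\lesssim$'' depend on $\hat{\beta}$, $\Gamma$, $\Psi$ but not on $\rho$ or $\mathcal D$.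
   Context: Setting: $\Omega \subsetneq \mathbb{R}^d$, $d \le 3$, is a bounded convex domain; $k\ge1$ is an integer and for a space $E$, $\mathbf{E}=E^k$; $X=H^2_0(\Omega)$, $\mathbf X = X^k$. The bilinear form is $\mathcal{A}(\Phi,\Theta)=\int_{\Omega}\Phi:\Theta \,dx$ on $\mathbf{L}^2(\Omega;\mathbb{R}^{d\times d})$, and $\mathcal{B}(\Phi,\Theta,\Xi)=\int_{\Omega}\Phi:h(\Theta, \Xi)\,dx$ with $h$ bilinear on $\mathbb{R}^{dk}\times\mathbb{R}^{dk}$; $\mathcal B$ is a continuous trilinear form on $\mathbf{L}^2(\Omega;\mathbb{R}^{d\times d}) \times \mathbf{L}^4(\Omega;\mathbb{R}^d) \times \mathbf{L}^4(\Omega;\mathbb{R}^d)$ with $\mathcal{B}(\Xi,\Theta,\Theta)=0$ for all $\Xi,\Theta$; $\mathcal L\in\mathbf H^{-1}(\Omega)$. The continuous problem seeks $\Psi\in\mathbf X$ with $\mathcal{A}(\mathcal H \Psi,\mathcal H \Phi)+\mathcal{B}(\mathcal H \Psi, \nabla \Psi, \nabla \Phi)=\mathcal{L}(\Phi)$ for all $\Phi \in \mathbf{X}$ (operators acting componentwise). A Hessian discretisation $\mathcal D=(X_{\mathcal D,0},\Pi_{\mathcal D},\nabla_{\mathcal D},\mathcal H_{\mathcal D})$ consists of a finite-dimensional space $X_{\mathcal D,0}$ and linear maps $\Pi_{\mathcal D}:X_{\mathcal D,0}\to L^2(\Omega)$, $\nabla_{\mathcal D}:X_{\mathcal D,0}\to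 L^4(\Omega;\mathbb R^d)$, $\mathcal H_{\mathcal D}:X_{\mathcal D,0}\to L^2(\Omega;\mathbb R^{d\times d})$ such that $\|\cdot\|_{\mathcal D}:=\|\mathcal H_{\mathcal D}\cdot\|$ is a norm; $\mathbf X_{\mathcal D,0}=X_{\mathcal D,0}^k$. $E_{\mathcal D}:X_{\mathcal D,0}\to X$ is a linear companion operator with $\delta(E_{\mathcal D})=\sup\|\Pi_{\mathcal D}\psi_{\mathcal D}-E_{\mathcal D}\psi_{\mathcal D}\|/\|\psi_{\mathcal D}\|_{\mathcal D}$, $\omega(E_{\mathcal D})=\sup\|\nabla_{\mathcal D}\psi_{\mathcal D}-\nabla E_{\mathcal D}\psi_{\mathcal D}\|/\|\psi_{\mathcal D}\|_{\mathcal D}$, $\Gamma(E_{\mathcal D})=\sup\|\mathcal H E_{\mathcal D}\psi_{\mathcal D}\|/\|\psi_{\mathcal D}\|_{\mathcal D}$. The Hessian scheme seeks $\Psi_{\mathcal D}\in\mathbf X_{\mathcal D,0}$ with $\mathcal{A}(\mathcal H_{\mathcal D} \Psi_{\mathcal D},\mathcal H_{\mathcal D} \Phi_{\mathcal D})+\mathcal{B}(\mathcal H_{\mathcal D} \Psi_{\mathcal D}, \nabla_{\mathcal D} \Psi_{\mathcal D}, \nabla_{\mathcal D} \Phi_{\mathcal D})=\mathcal{L}(E_{\mathcal D}\Phi_{\mathcal D})$ for all $\Phi_{\mathcal D}\in\mathbf X_{\mathcal D,0}$. $C_{\mathcal D}=\max_{w}\max\{\|\Pi_{\mathcal D}w\|,\|\nabla_{\mathcal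 D}w\|_{0,4}\}/\|w\|_{\mathcal D}$; $S_{\mathcal D}(\varphi)=\min_{w}(\|\Pi_{\mathcal D}w-\varphi\|+\|\nabla_{\mathcal D}w-\nabla\varphi\|_{0,4}+\|\mathcal H_{\mathcal D}w-\mathcal H\varphi\|)$ and $P_{\mathcal D}\Phi$ is the corresponding argmin (componentwise); $\widetilde W_{\mathcal D}(\xi)=\max_{w}\frac{1}{\|w\|_{\mathcal D}}|\int_\Omega(\xi:\mathcal H_{\mathcal D}w+(\mathrm{div}\,\xi)\cdot\nabla_{\mathcal D}w)\,dx|$; $\alpha_{\mathcal D}=\sup_{\phi\in H^3(\Omega)\cap X}S_{\mathcal D}(\phi)/\|\phi\|_3$ and $\gamma_{\mathcal D}=\sup_{\xi\in H^1(\Omega;\mathbb R^{d\times d})}\widetilde W_{\mathcal D}(\xi)/\|\xi\|_1$. $\Psi$ is a regular solution if the linearized form $\mathbb{A}_\Psi(\Theta,\Phi)=\mathcal{A}(\mathcal H \Theta,\mathcal H \Phi)+\mathcal{B}(\mathcal H \Psi, \nabla \Theta, \nabla \Phi)+\mathcal{B}(\mathcal H \Theta, \nabla \Psi, \nabla \Phi)$ satisfies an inf-sup condition on $\mathbf X\times\mathbf X$ with constant $\beta>0$. Under the stated smallness assumptions the discrete linearized form $\mathbb{A}_{\mathcal D,\Psi}(\Theta_{\mathcal D}, \Phi_{\mathcal D})=\mathcal{A}(\mathcal H_{\mathcal D} \Theta_{\mathcal D},\mathcal H_{\mathcal D} \Phi_{\mathcal D})+\mathcal{B}(\mathcal H \Psi,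 \nabla_{\mathcal D} \Theta_{\mathcal D}, \nabla_{\mathcal D} \Phi_{\mathcal D})+\mathcal{B}(\mathcal H_{\mathcal D} \Theta_{\mathcal D}, \nabla \Psi, \nabla_{\mathcal D} \Phi_{\mathcal D})$ satisfies a discrete inf-sup condition with constant $\hat\beta>0$ depending on $\Gamma$ and $\beta$. $a\lesssim b$ means $a\le Cb$ with a generic constant. *)

theory Defs
  imports "HOL-Analysis.Analysis"
begin

definition L2fun :: "(real^'n) set \<Rightarrow> (real^'n \<Rightarrow> 'b::euclidean_space) \<Rightarrow> bool" where
  "L2fun \<Omega> f \<longleftrightarrow> f \<in> borel_measurable (lebesgue_on \<Omega>)
      \<and> integrable (lebesgue_on \<Omega>) (\<lambda>x. (norm (f x))^2)"

definition L4fun :: "(real^'n) set \<Rightarrow> (real^'n \<Rightarrow> 'b::euclidean_space) \<Rightarrow> bool" where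
  "L4fun \<Omega> f \<longleftrightarrow> f \<in> borel_measurable (lebesgue_on \<Omega>)
      \<and> integrable (lebesgue_on \<Omega>) (\<lambda>x. (norm (f x))^4)"

definition L2n :: "(real^'n) set \<Rightarrow> (real^'n \<Rightarrow> 'b::euclidean_space) \<Rightarrow> real" where
  "L2n \<Omega> f = sqrt (LINT x|lebesgue_on \<Omega>. (norm (f x))^2)"

definition L4n :: "(real^'n) set \<Rightarrow> (real^'n \<Rightarrow> 'b::euclidean_space) \<Rightarrow> real" where
  "L4n \<Omega> f = (LINT x|lebesgue_on \<Omega>. (norm (f x))^4) powr (1/4)"

text \<open>k-tuples of functions, viewed pointwise as vectors (norms of the product space).\<close>
definition tup :: "('k \<Rightarrow> 'a \<Rightarrow> 'b) \<Rightarrow> 'a \<Rightarrow> 'b^'k" where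
  "tup F x = (\<chi> i. F i x)"

fun iter_pd :: "'n list \<Rightarrow> (real^'n \<Rightarrow> real) \<Rightarrow> real^'n \<Rightarrow> real" where
  "iter_pd [] f = f"
| "iter_pd (j # js) f = (\<lambda>x. frechet_derivative (iter_pd js f) (at x) (axis j 1))"

definition smooth_fun :: "(real^'n \<Rightarrow> real) \<Rightarrow> bool" where
  "smooth_fun f \<longleftrightarrow> (\<forall>js x. iter_pd js f differentiable (at x))"

definition test_fun :: "(real^'n) set \<Rightarrow> (real^'n \<Rightarrow> real) \<Rightarrow> bool" where
  "test_fun \<Omega> \<phi> \<longleftrightarrow> smooth_fun \<phi> \<and> compact (closure {x. \<phi> x \<noteq> 0})
      \<and> closure {x. \<phi> x \<noteq> 0} \<subseteq> \<Omega>"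

definition weak_D :: "(real^'n) set \<Rightarrow> 'n list \<Rightarrow> (real^'n \<Rightarrow> real) \<Rightarrow> (real^'n \<Rightarrow> real) \<Rightarrow> bool" where
  "weak_D \<Omega> js u g \<longleftrightarrow> (\<forall>\<phi>. test_fun \<Omega> \<phi> \<longrightarrow>
      (LINT x|lebesgue_on \<Omega>. u x * iter_pd js \<phi> x)
        = (-1)^(length js) * (LINT x|lebesgue_on \<Omega>. g x * \<phi> x))"

definition wD :: "(real^'n) set \<Rightarrow> 'n list \<Rightarrow> (real^'n \<Rightarrow> real) \<Rightarrow> real^'n \<Rightarrow> real" where
  "wD \<Omega> js u = (SOME g. L2fun \<Omega> g \<and> weak_D \<Omega> js u g)"

definition sob :: "(real^'n) set \<Rightarrow> nat \<Rightarrow> (real^'n \<Rightarrow> real) \<Rightarrow> bool" where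
  "sob \<Omega> m u \<longleftrightarrow> L2fun \<Omega> u \<and>
      (\<forall>js::'n list. length js \<le> m \<longrightarrow> (\<exists>g. L2fun \<Omega> g \<and> weak_D \<Omega> js u g))"

definition sob_norm :: "(real^'n) set \<Rightarrow> nat \<Rightarrow> (real^'n \<Rightarrow> real) \<Rightarrow> real" where
  "sob_norm \<Omega> m u = sqrt (\<Sum>js\<in>{js::'n list. length js \<le> m}. (L2n \<Omega> (wD \<Omega> js u))^2)"

definition sob0 :: "(real^'n) set \<Rightarrow> nat \<Rightarrow> (real^'n \<Rightarrow> real) \<Rightarrow> bool" where
  "sob0 \<Omega> m u \<longleftrightarrow> sob \<Omega> m u \<and>
      (\<exists>\<phi>s. (\<forall>i. test_fun \<Omega> (\<phi>s i)) \<and>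
            (\<lambda>i. sob_norm \<Omega> m (\<lambda>x. \<phi>s i x - u x)) \<longlonglongrightarrow> 0)"

definition wgrad :: "(real^'n) set \<Rightarrow> (real^'n \<Rightarrow> real) \<Rightarrow> real^'n \<Rightarrow> real^'n" where
  "wgrad \<Omega> u = (\<lambda>x. \<chi> j. wD \<Omega> [j] u x)"

definition whess :: "(real^'n) set \<Rightarrow> (real^'n \<Rightarrow> real) \<Rightarrow> real^'n \<Rightarrow> real^'n^'n" where
  "whess \<Omega> u = (\<lambda>x. \<chi> i j. wD \<Omega> [i, j] u x)"

definition wdiv :: "(real^'n) set \<Rightarrow> (real^'n \<Rightarrow> real^'n^'n) \<Rightarrow> real^'n \<Rightarrow> real^'n" where
  "wdiv \<Omega> \<xi> = (\<lambda>x. \<chi> j. \<Sum>i\<in>UNIV. wD \<Omega> [i] (\<lambda>y. \<xi> y $ i $ j) x)"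

definition sobM1 :: "(real^'n) set \<Rightarrow> (real^'n \<Rightarrow> real^'n^'n) \<Rightarrow> bool" where
  "sobM1 \<Omega> \<xi> \<longleftrightarrow> (\<forall>i j. sob \<Omega> 1 (\<lambda>x. \<xi> x $ i $ j))"

definition sobM1_norm :: "(real^'n) set \<Rightarrow> (real^'n \<Rightarrow> real^'n^'n) \<Rightarrow> real" where
  "sobM1_norm \<Omega> \<xi> = sqrt (\<Sum>i\<in>UNIV. \<Sum>j\<in>UNIV. (sob_norm \<Omega> 1 (\<lambda>x. \<xi> x $ i $ j))^2)"

definition Xsp :: "(real^'n) set \<Rightarrow> ('k \<Rightarrow> real^'n \<Rightarrow> real) \<Rightarrow> bool" where
  "Xsp \<Omega> \<Psi> \<longleftrightarrow> (\<forall>i. sob0 \<Omega> 2 (\<Psi> i))"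

definition HT :: "(real^'n) set \<Rightarrow> ('k \<Rightarrow> real^'n \<Rightarrow> real) \<Rightarrow> real^'n \<Rightarrow> real^'n^'n^'k" where
  "HT \<Omega> \<Psi> = tup (\<lambda>i. whess \<Omega> (\<Psi> i))"

definition GradT :: "(real^'n) set \<Rightarrow> ('k \<Rightarrow> real^'n \<Rightarrow> real) \<Rightarrow> real^'n \<Rightarrow> real^'n^'k" where
  "GradT \<Omega> \<Psi> = tup (\<lambda>i. wgrad \<Omega> (\<Psi> i))"

definition Aform :: "(real^'n) set \<Rightarrow> (real^'n \<Rightarrow> real^'n^'n^'k) \<Rightarrow> (real^'n \<Rightarrow> real^'n^'n^'k) \<Rightarrow> real" where
  "Aform \<Omega> \<Phi> \<Theta> = (LINT x|lebesgue_on \<Omega>. inner (\<Phi> x) (\<Theta> x))"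

definition Bform :: "(real^'n) set \<Rightarrow> (real^'n^'k \<Rightarrow> real^'n^'k \<Rightarrow> real^'n^'n^'k)
     \<Rightarrow> (real^'n \<Rightarrow> real^'n^'n^'k) \<Rightarrow> (real^'n \<Rightarrow> real^'n^'k) \<Rightarrow> (real^'n \<Rightarrow> real^'n^'k) \<Rightarrow> real" where
  "Bform \<Omega> h \<Phi> \<Theta> \<Xi> = (LINT x|lebesgue_on \<Omega>. inner (\<Phi> x) (h (\<Theta> x) (\<Xi> x)))"

definition Hminus1 :: "(real^'n) set \<Rightarrow> (('k \<Rightarrow> real^'n \<Rightarrow> real) \<Rightarrow> real) \<Rightarrow> bool" where
  "Hminus1 \<Omega> L \<longleftrightarrow>
     (\<forall>u v a b. (\<forall>i. sob0 \<Omega> 1 (u i)) \<longrightarrow> (\<forall>i. sob0 \<Omega> 1 (v i)) \<longrightarrow>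
        L (\<lambda>i x. a * u i x + b * v i x) = a * L u + b * L v)
   \<and> (\<exists>M. \<forall>u. (\<forall>i. sob0 \<Omega> 1 (u i)) \<longrightarrow>
        \<bar>L u\<bar> \<le> M * sqrt (\<Sum>i\<in>UNIV. (sob_norm \<Omega> 1 (u i))^2))"

definition cont_sol :: "(real^'n) set \<Rightarrow> (real^'n^'k \<Rightarrow> real^'n^'k \<Rightarrow> real^'n^'n^'k)
     \<Rightarrow> (('k \<Rightarrow> real^'n \<Rightarrow> real) \<Rightarrow> real) \<Rightarrow> ('k \<Rightarrow> real^'n \<Rightarrow> real) \<Rightarrow> bool" where
  "cont_sol \<Omega> h L \<Psi> \<longleftrightarrow> Xsp \<Omega> \<Psi> \<and>
     (\<forall>\<Phi>. Xsp \<Omega> \<Phi> \<longrightarrow>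
        Aform \<Omega> (HT \<Omega> \<Psi>) (HT \<Omega> \<Phi>) + Bform \<Omega> h (HT \<Omega> \<Psi>) (GradT \<Omega> \<Psi>) (GradT \<Omega> \<Phi>) = L \<Phi>)"

definition linA :: "(real^'n) set \<Rightarrow> (real^'n^'k \<Rightarrow> real^'n^'k \<Rightarrow> real^'n^'n^'k)
     \<Rightarrow> ('k \<Rightarrow> real^'n \<Rightarrow> real) \<Rightarrow> ('k \<Rightarrow> real^'n \<Rightarrow> real) \<Rightarrow> ('k \<Rightarrow> real^'n \<Rightarrow> real) \<Rightarrow> real" where
  "linA \<Omega> h \<Psi> \<Theta> \<Phi> = Aform \<Omega> (HT \<Omega> \<Theta>) (HT \<Omega> \<Phi>)
      + Bform \<Omega> h (HT \<Omega> \<Psi>) (GradT \<Omega> \<Theta>) (GradT \<Omega> \<Phi>)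
      + Bform \<Omega> h (HT \<Omega> \<Theta>) (GradT \<Omega> \<Psi>) (GradT \<Omega> \<Phi>)"

text \<open>Regular solution: inf-sup condition of \<open>\<bbbA>_\<Psi>\<close> on \<open>\<mathbf>X \<times> \<mathbf>X\<close> (norm \<open>\<parallel>\<H> \<cdot>\<parallel>\<close> on \<open>\<mathbf>X\<close>).\<close>
definition regular_sol :: "(real^'n) set \<Rightarrow> (real^'n^'k \<Rightarrow> real^'n^'k \<Rightarrow> real^'n^'n^'k)
     \<Rightarrow> (('k \<Rightarrow> real^'n \<Rightarrow> real) \<Rightarrow> real) \<Rightarrow> ('k \<Rightarrow> real^'n \<Rightarrow> real) \<Rightarrow> bool" where
  "regular_sol \<Omega> h L \<Psi> \<longleftrightarrow> cont_sol \<Omega> h L \<Psi> \<and>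
     (\<exists>\<beta>>0. \<forall>\<Theta>. Xsp \<Omega> \<Theta> \<longrightarrow>
        \<beta> * L2n \<Omega> (HT \<Omega> \<Theta>) \<le>
          Sup {linA \<Omega> h \<Psi> \<Theta> \<Phi> / L2n \<Omega> (HT \<Omega> \<Phi>) | \<Phi>. Xsp \<Omega> \<Phi> \<and> L2n \<Omega> (HT \<Omega> \<Phi>) \<noteq> 0})"

text \<open>The finite-dimensional space \<open>X_{\<D>,0}\<close> is represented (up to isomorphism) as \<open>\<real>^N\<close>,
  i.e. real sequences vanishing from index \<open>N\<close> on.\<close>
definition Vsp :: "nat \<Rightarrow> (nat \<Rightarrow> real) set" where
  "Vsp N = {v. \<forall>i\<ge>N. v i = 0}"

definition lin_map :: "(nat \<Rightarrow> real) set \<Rightarrow> ((nat \<Rightarrow> real) \<Rightarrow> 'a \<Rightarrow> 'b::real_vector) \<Rightarrow> bool" where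
  "lin_map V F \<longleftrightarrow> (\<forall>v w a b. v \<in> V \<longrightarrow> w \<in> V \<longrightarrow>
      F (\<lambda>i. a * v i + b * w i) = (\<lambda>x. a *\<^sub>R F v x + b *\<^sub>R F w x))"

definition hess_disc :: "(real^'n) set \<Rightarrow> nat \<Rightarrow> ((nat \<Rightarrow> real) \<Rightarrow> real^'n \<Rightarrow> real)
     \<Rightarrow> ((nat \<Rightarrow> real) \<Rightarrow> real^'n \<Rightarrow> real^'n) \<Rightarrow> ((nat \<Rightarrow> real) \<Rightarrow> real^'n \<Rightarrow> real^'n^'n) \<Rightarrow> bool" where
  "hess_disc \<Omega> N PiD Gr Hs \<longleftrightarrow>
     lin_map (Vsp N) PiD \<and> lin_map (Vsp N) Gr \<and> lin_map (Vsp N) Hs \<and>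
     (\<forall>w\<in>Vsp N. L2fun \<Omega> (PiD w) \<and> L4fun \<Omega> (Gr w) \<and> L2fun \<Omega> (Hs w)) \<and>
     (\<forall>w\<in>Vsp N. L2n \<Omega> (Hs w) = 0 \<longrightarrow> w = (\<lambda>_. 0))"

definition companion :: "(real^'n) set \<Rightarrow> nat \<Rightarrow> ((nat \<Rightarrow> real) \<Rightarrow> real^'n \<Rightarrow> real) \<Rightarrow> bool" where
  "companion \<Omega> N E \<longleftrightarrow> lin_map (Vsp N) E \<and> (\<forall>w\<in>Vsp N. sob0 \<Omega> 2 (E w))"

text \<open>Suprema over nonzero \<open>w\<close> (0 included to avoid the empty supremum; all ratios are \<open>\<ge> 0\<close>).\<close>
definition CD :: "(real^'n) set \<Rightarrow> nat \<Rightarrow> ((nat \<Rightarrow> real) \<Rightarrow> real^'n \<Rightarrow> real)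
     \<Rightarrow> ((nat \<Rightarrow> real) \<Rightarrow> real^'n \<Rightarrow> real^'n) \<Rightarrow> ((nat \<Rightarrow> real) \<Rightarrow> real^'n \<Rightarrow> real^'n^'n) \<Rightarrow> real" where
  "CD \<Omega> N PiD Gr Hs = Sup (insert 0
     {max (L2n \<Omega> (PiD w)) (L4n \<Omega> (Gr w)) / L2n \<Omega> (Hs w) | w. w \<in> Vsp N \<and> w \<noteq> (\<lambda>_. 0)})"

definition deltaE :: "(real^'n) set \<Rightarrow> nat \<Rightarrow> ((nat \<Rightarrow> real) \<Rightarrow> real^'n \<Rightarrow> real)
     \<Rightarrow> ((nat \<Rightarrow> real) \<Rightarrow> real^'n \<Rightarrow> real^'n^'n) \<Rightarrow> ((nat \<Rightarrow> real) \<Rightarrow> real^'n \<Rightarrow> real) \<Rightarrow> real" where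
  "deltaE \<Omega> N PiD Hs E = Sup (insert 0
     {L2n \<Omega> (\<lambda>x. PiD w x - E w x) / L2n \<Omega> (Hs w) | w. w \<in> Vsp N \<and> w \<noteq> (\<lambda>_. 0)})"

definition omegaE :: "(real^'n) set \<Rightarrow> nat \<Rightarrow> ((nat \<Rightarrow> real) \<Rightarrow> real^'n \<Rightarrow> real^'n)
     \<Rightarrow> ((nat \<Rightarrow> real) \<Rightarrow> real^'n \<Rightarrow> real^'n^'n) \<Rightarrow> ((nat \<Rightarrow> real) \<Rightarrow> real^'n \<Rightarrow> real) \<Rightarrow> real" where
  "omegaE \<Omega> N Gr Hs E = Sup (insert 0
     {L2n \<Omega> (\<lambda>x. Gr w x - wgrad \<Omega> (E w) x) / L2n \<Omega> (Hs w) | w. w \<in> Vsp N \<and> w \<noteq> (\<lambda>_. 0)})"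

definition GammaE :: "(real^'n) set \<Rightarrow> nat
     \<Rightarrow> ((nat \<Rightarrow> real) \<Rightarrow> real^'n \<Rightarrow> real^'n^'n) \<Rightarrow> ((nat \<Rightarrow> real) \<Rightarrow> real^'n \<Rightarrow> real) \<Rightarrow> real" where
  "GammaE \<Omega> N Hs E = Sup (insert 0
     {L2n \<Omega> (whess \<Omega> (E w)) / L2n \<Omega> (Hs w) | w. w \<in> Vsp N \<and> w \<noteq> (\<lambda>_. 0)})"

definition SD_val :: "(real^'n) set \<Rightarrow> ((nat \<Rightarrow> real) \<Rightarrow> real^'n \<Rightarrow> real)
     \<Rightarrow> ((nat \<Rightarrow> real) \<Rightarrow> real^'n \<Rightarrow> real^'n) \<Rightarrow> ((nat \<Rightarrow> real) \<Rightarrow> real^'n \<Rightarrow> real^'n^'n)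
     \<Rightarrow> (real^'n \<Rightarrow> real) \<Rightarrow> (nat \<Rightarrow> real) \<Rightarrow> real" where
  "SD_val \<Omega> PiD Gr Hs \<phi> w = L2n \<Omega> (\<lambda>x. PiD w x - \<phi> x) + L4n \<Omega> (\<lambda>x. Gr w x - wgrad \<Omega> \<phi> x)
      + L2n \<Omega> (\<lambda>x. Hs w x - whess \<Omega> \<phi> x)"

definition SD :: "(real^'n) set \<Rightarrow> nat \<Rightarrow> ((nat \<Rightarrow> real) \<Rightarrow> real^'n \<Rightarrow> real)
     \<Rightarrow> ((nat \<Rightarrow> real) \<Rightarrow> real^'n \<Rightarrow> real^'n) \<Rightarrow> ((nat \<Rightarrow> real) \<Rightarrow> real^'n \<Rightarrow> real^'n^'n)
     \<Rightarrow> (real^'n \<Rightarrow> real) \<Rightarrow> real" where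
  "SD \<Omega> N PiD Gr Hs \<phi> = Inf {SD_val \<Omega> PiD Gr Hs \<phi> w | w. w \<in> Vsp N}"

definition PD :: "(real^'n) set \<Rightarrow> nat \<Rightarrow> ((nat \<Rightarrow> real) \<Rightarrow> real^'n \<Rightarrow> real)
     \<Rightarrow> ((nat \<Rightarrow> real) \<Rightarrow> real^'n \<Rightarrow> real^'n) \<Rightarrow> ((nat \<Rightarrow> real) \<Rightarrow> real^'n \<Rightarrow> real^'n^'n)
     \<Rightarrow> (real^'n \<Rightarrow> real) \<Rightarrow> nat \<Rightarrow> real" where
  "PD \<Omega> N PiD Gr Hs \<phi> = (SOME w. w \<in> Vsp N \<and> SD_val \<Omega> PiD Gr Hs \<phi> w = SD \<Omega> N PiD Gr Hs \<phi>)"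

definition WD :: "(real^'n) set \<Rightarrow> nat
     \<Rightarrow> ((nat \<Rightarrow> real) \<Rightarrow> real^'n \<Rightarrow> real^'n) \<Rightarrow> ((nat \<Rightarrow> real) \<Rightarrow> real^'n \<Rightarrow> real^'n^'n)
     \<Rightarrow> (real^'n \<Rightarrow> real^'n^'n) \<Rightarrow> real" where
  "WD \<Omega> N Gr Hs \<xi> = Sup (insert 0
     {\<bar>LINT x|lebesgue_on \<Omega>. inner (\<xi> x) (Hs w x) + inner (wdiv \<Omega> \<xi> x) (Gr w x)\<bar> / L2n \<Omega> (Hs w)
       | w. w \<in> Vsp N \<and> w \<noteq> (\<lambda>_. 0)})"

definition alphaD :: "(real^'n) set \<Rightarrow> nat \<Rightarrow> ((nat \<Rightarrow> real) \<Rightarrow> real^'n \<Rightarrow> real)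
     \<Rightarrow> ((nat \<Rightarrow> real) \<Rightarrow> real^'n \<Rightarrow> real^'n) \<Rightarrow> ((nat \<Rightarrow> real) \<Rightarrow> real^'n \<Rightarrow> real^'n^'n) \<Rightarrow> real" where
  "alphaD \<Omega> N PiD Gr Hs = Sup (insert 0
     {SD \<Omega> N PiD Gr Hs \<phi> / sob_norm \<Omega> 3 \<phi> | \<phi>. sob \<Omega> 3 \<phi> \<and> sob0 \<Omega> 2 \<phi> \<and> sob_norm \<Omega> 3 \<phi> \<noteq> 0})"

definition gammaD :: "(real^'n) set \<Rightarrow> nat
     \<Rightarrow> ((nat \<Rightarrow> real) \<Rightarrow> real^'n \<Rightarrow> real^'n) \<Rightarrow> ((nat \<Rightarrow> real) \<Rightarrow> real^'n \<Rightarrow> real^'n^'n) \<Rightarrow> real" where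
  "gammaD \<Omega> N Gr Hs = Sup (insert 0
     {WD \<Omega> N Gr Hs \<xi> / sobM1_norm \<Omega> \<xi> | \<xi>. sobM1 \<Omega> \<xi> \<and> sobM1_norm \<Omega> \<xi> \<noteq> 0})"

definition scheme_sol :: "(real^'n) set \<Rightarrow> (real^'n^'k \<Rightarrow> real^'n^'k \<Rightarrow> real^'n^'n^'k)
     \<Rightarrow> (('k \<Rightarrow> real^'n \<Rightarrow> real) \<Rightarrow> real) \<Rightarrow> nat
     \<Rightarrow> ((nat \<Rightarrow> real) \<Rightarrow> real^'n \<Rightarrow> real^'n) \<Rightarrow> ((nat \<Rightarrow> real) \<Rightarrow> real^'n \<Rightarrow> real^'n^'n)
     \<Rightarrow> ((nat \<Rightarrow> real) \<Rightarrow> real^'n \<Rightarrow> real) \<Rightarrow> ('k \<Rightarrow> nat \<Rightarrow> real) \<Rightarrow> bool" where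
  "scheme_sol \<Omega> h L N Gr Hs E \<Psi>D \<longleftrightarrow> (\<forall>i. \<Psi>D i \<in> Vsp N) \<and>
     (\<forall>\<Phi>D. (\<forall>i. \<Phi>D i \<in> Vsp N) \<longrightarrow>
        Aform \<Omega> (tup (\<lambda>i. Hs (\<Psi>D i))) (tup (\<lambda>i. Hs (\<Phi>D i)))
        + Bform \<Omega> h (tup (\<lambda>i. Hs (\<Psi>D i))) (tup (\<lambda>i. Gr (\<Psi>D i))) (tup (\<lambda>i. Gr (\<Phi>D i)))
        = L (\<lambda>i. E (\<Phi>D i)))"

end

theory Submission
  imports Defs "HOL-Library.Function_Algebras"
begin

text \<open>Averaging a function over copies of the convex domain shrunk towards a point, and telescoping over
  dyadic scales, gives the embedding of \<open>H\<^sup>1\<close> into \<open>L\<^sup>4\<close> for \<open>d \<le> 3\<close>, the boundedness of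
  functions with gradient in \<open>L\<^sup>4\<close> (applied to the gradient of the solution), and Ehrling's inequality: up to
  finitely many functionals the \<open>L\<^sup>4\<close> norm is small compared with the \<open>H\<^sup>1\<close> norm. Hence on test
  functions the gradient is small in \<open>L\<^sup>4\<close> off a finite-dimensional space, spanned by finitely many test
  functions \<open>e\<^sub>m\<close>.

  This replaces compactness in the discrete inf-sup condition. For discrete \<open>\<Theta>\<close> the lower-order part of the
  linearised form is, up to \<open>\<epsilon>\<close>, represented by a combination \<open>\<xi>\<close> of the \<open>e\<^sub>m\<close>; no elliptic
  regularity is needed, since the finitely many \<open>e\<^sub>m\<close> are smooth and so are approximated at rate \<open>\<rho>\<close>.
  The continuous inf-sup condition applied to \<open>\<xi>\<close> bounds \<open>\<Theta>\<close> by
  \<open>\<H>\<Theta> + \<H>\<xi>\<close>, and testing with \<open>\<Theta> + P\<xi>\<close> gives coercivity up to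
  \<open>O(\<epsilon> + \<rho>)\<close>. The discrete solution is then \<open>P\<Psi>\<close> plus the fixed point of a contraction,
  because the residual of \<open>P\<Psi>\<close> is \<open>O(\<rho>)\<close>.\<close>

section \<open>Square and fourth-power integrable functions\<close>

text \<open>The usual test function for a discrete inf-sup condition solves a fourth-order problem
  driven by the lower-order part, and it can be interpolated at rate \<rho> only if that problem
  gains regularity. The finite family \<open>e\<close> removes this demand: it is fixed before any
  discretisation appears, so third-order norms of its members are mere constants, and \<rho> is made
  small last. The form of the test function comes from completing a square: up to small terms the
  linearised form at (\<Theta>, \<Theta> + P\<xi>) is the squared norm of \<H>\<Theta> + \<H>\<xi>.
  The gradient error of the companion is small only in L2, so the other two factors of a trilinear
  term containing it must multiply into L2; the H3 regularity of \<Psi> supplies this, through a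
  Hessian in L4 and a bounded gradient. Weak derivatives are arbitrary representatives, hence linear
  only almost everywhere; classical derivatives of test functions stand in where exact linearity is
  wanted. A bound on a real supremum carries information only once the set is known to be bounded
  above, which has to be proved for the constants of a discretisation.\<close>

lemma L2fun_meas: "L2fun U f \<Longrightarrow> f \<in> borel_measurable (lebesgue_on U)"
  by (simp add: L2fun_def)

lemma L2fun_sq: "L2fun U f \<Longrightarrow> integrable (lebesgue_on U) (\<lambda>x. (norm (f x))^2)"
  by (simp add: L2fun_def)

lemma L2n_nonneg [simp]: "0 \<le> L2n U f"
  by (simp add: L2n_def)

lemma L2n_sq: "(L2n U f)^2 = (LINT x|lebesgue_on U. (norm (f x))^2)"
  by (simp add: L2n_def)

lemma L2fun_mono:
  fixes f :: "real^'n \<Rightarrow> 'b::euclidean_space" and g :: "real^'n \<Rightarrow> 'c::euclidean_space"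
  assumes "L2fun U g" "f \<in> borel_measurable (lebesgue_on U)"
    "AE x in lebesgue_on U. norm (f x) \<le> norm (g x)"
  shows "L2fun U f" "L2n U f \<le> L2n U g"
proof -
  note [measurable] = assms(2)
  have i: "integrable (lebesgue_on U) (\<lambda>x. (norm (f x))^2)"
    using assms(1)
    by (intro Bochner_Integration.integrable_bound[OF L2fun_sq[OF assms(1)]])
      (use assms(3) in \<open>auto simp: power_mono\<close>)
  then show "L2fun U f" using assms by (simp add: L2fun_def)
  show "L2n U f \<le> L2n U g" unfolding L2n_def
    using i assms(3) L2fun_sq[OF assms(1)]
    by (auto intro!: integral_mono_AE simp: power_mono)
qed

lemma L2fun_scale:
  fixes f :: "real^'n \<Rightarrow> 'b::euclidean_space"
  assumes "L2fun U f"
  shows "L2fun U (\<lambda>x. c *\<^sub>R f x)" "L2n U (\<lambda>x. c *\<^sub>R f x) = \<bar>c\<bar> * L2n U f"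
  using assms by (auto simp: L2fun_def L2n_def power_mult_distrib real_sqrt_mult)

lemma L2fun_zero [simp]: "L2fun U (\<lambda>x. 0)" "L2n U (\<lambda>x. 0) = 0"
  by (auto simp: L2fun_def L2n_def)

lemma L2_mult_integrable:
  fixes f :: "real^'n \<Rightarrow> 'b::euclidean_space" and g :: "real^'n \<Rightarrow> 'c::euclidean_space"
  assumes "L2fun U f" "L2fun U g"
  shows "integrable (lebesgue_on U) (\<lambda>x. norm (f x) * norm (g x))"
proof -
  note [measurable] = L2fun_meas[OF assms(1)] L2fun_meas[OF assms(2)]
  have b: "norm (f x) * norm (g x) \<le> (norm (f x))^2 + (norm (g x))^2" for x
    using sum_squares_bound[of "norm (f x)" "norm (g x)"]
      mult_nonneg_nonneg[OF norm_ge_zero[of "f x"] norm_ge_zero[of "g x"]] by linarith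
  show ?thesis
    by (rule Bochner_Integration.integrable_bound[OF Bochner_Integration.integrable_add[OF L2fun_sq[OF assms(1)] L2fun_sq[OF assms(2)]]])
      (use b in auto)
qed

text \<open>The integral of (|f| - t|g|)^2 is a non-negative quadratic in t; for B > 0 the choice t
  = C/B minimises it.\<close>

lemma L2_Cauchy_Schwarz:
  fixes f :: "real^'n \<Rightarrow> 'b::euclidean_space" and g :: "real^'n \<Rightarrow> 'c::euclidean_space"
  assumes "L2fun U f" "L2fun U g"
  shows "(LINT x|lebesgue_on U. norm (f x) * norm (g x)) \<le> L2n U f * L2n U g"
proof -
  let ?A = "(L2n U f)^2" and ?B = "(L2n U g)^2"
  let ?C = "LINT x|lebesgue_on U. norm (f x) * norm (g x)"
  have q: "0 \<le> ?A - 2 * t * ?C + t^2 * ?B" for t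
  proof -
    have "0 \<le> (LINT x|lebesgue_on U. (norm (f x) - t * norm (g x))^2)" by simp
    also have "\<dots> = (LINT x|lebesgue_on U. (norm (f x))^2 - 2 * t * (norm (f x) * norm (g x)) + t^2 * (norm (g x))^2)"
      by (intro Bochner_Integration.integral_cong) (auto simp: power2_eq_square algebra_simps)
    also have "\<dots> = ?A - 2 * t * ?C + t^2 * ?B"
      using L2fun_sq[OF assms(1)] L2fun_sq[OF assms(2)] L2_mult_integrable[OF assms]
      by (simp add: L2n_sq)
    finally show ?thesis .
  qed
  have C0: "0 \<le> ?C" by simp
  have "?C^2 \<le> ?A * ?B"
  proof (cases "?B = 0")
    case True
    have "?C = 0"
    proof (rule ccontr)
      assume "?C \<noteq> 0"
      then have "?C > 0" using C0 by linarith
      \<comment> \<open>With B = 0 the quadratic is affine in t, and t = (A + 1)/C would make it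
        negative.\<close>
      then have "0 \<le> - ?A - 2" using q[of "(?A + 1) / ?C"] True by simp
      then show False using zero_le_power2[of "L2n U f"] by linarith
    qed
    then show ?thesis by simp
  next
    case False
    then have B: "?B > 0" by simp
    have "0 \<le> ?A - 2 * (?C/?B) * ?C + (?C/?B)^2 * ?B" by (rule q)
    also have "\<dots> = ?A - ?C^2 / ?B" using B by (simp add: power2_eq_square field_simps)
    finally show ?thesis using B by (simp add: field_simps)
  qed
  then have "?C^2 \<le> (L2n U f * L2n U g)^2" by (simp add: power_mult_distrib)
  then show ?thesis by (rule power2_le_imp_le) simp
qed

lemma L2_inner_integrable:
  fixes f g :: "real^'n \<Rightarrow> 'b::euclidean_space"
  assumes "L2fun U f" "L2fun U g"
  shows "integrable (lebesgue_on U) (\<lambda>x. inner (f x) (g x))"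
proof -
  note [measurable] = L2fun_meas[OF assms(1)] L2fun_meas[OF assms(2)]
  show ?thesis
    by (rule Bochner_Integration.integrable_bound[OF L2_mult_integrable[OF assms]])
      (auto simp: Cauchy_Schwarz_ineq2)
qed

lemma L2_inner_bound:
  fixes f g :: "real^'n \<Rightarrow> 'b::euclidean_space"
  assumes "L2fun U f" "L2fun U g"
  shows "\<bar>LINT x|lebesgue_on U. inner (f x) (g x)\<bar> \<le> L2n U f * L2n U g"
proof -
  have "\<bar>LINT x|lebesgue_on U. inner (f x) (g x)\<bar> \<le> (LINT x|lebesgue_on U. norm (f x) * norm (g x))"
    by (intro order_trans[OF integral_abs_bound] integral_mono L2_mult_integrable[OF assms]
        integrable_abs L2_inner_integrable[OF assms] Cauchy_Schwarz_ineq2)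
  also note L2_Cauchy_Schwarz[OF assms]
  finally show ?thesis .
qed

lemma L2_real_integrable:
  fixes f g :: "real^'n \<Rightarrow> real"
  assumes "L2fun U f" "L2fun U g"
  shows "integrable (lebesgue_on U) (\<lambda>x. f x * g x)"
    "\<bar>LINT x|lebesgue_on U. f x * g x\<bar> \<le> L2n U f * L2n U g"
  using L2_inner_integrable[OF assms] L2_inner_bound[OF assms] by (simp_all add: inner_real_def)

lemma L2fun_add:
  fixes f g :: "real^'n \<Rightarrow> 'b::euclidean_space"
  assumes "L2fun U f" "L2fun U g"
  shows "L2fun U (\<lambda>x. f x + g x)" "L2n U (\<lambda>x. f x + g x) \<le> L2n U f + L2n U g"
proof -
  note [measurable] = L2fun_meas[OF assms(1)] L2fun_meas[OF assms(2)]
  have e: "(norm (f x + g x))^2 \<le> (norm (f x))^2 + 2 * (norm (f x) * norm (g x)) + (norm (g x))^2" for x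
    using power_mono[OF norm_triangle_ineq[of "f x" "g x"], of 2]
    by (simp add: power2_eq_square algebra_simps)
  have ii: "integrable (lebesgue_on U) (\<lambda>x. (norm (f x))^2 + 2 * (norm (f x) * norm (g x)) + (norm (g x))^2)"
    using L2fun_sq[OF assms(1)] L2fun_sq[OF assms(2)] L2_mult_integrable[OF assms] by simp
  have i: "integrable (lebesgue_on U) (\<lambda>x. (norm (f x + g x))^2)"
    by (rule Bochner_Integration.integrable_bound[OF ii]) (use e in \<open>auto intro: order_trans\<close>)
  then show "L2fun U (\<lambda>x. f x + g x)" by (simp add: L2fun_def)
  have "(L2n U (\<lambda>x. f x + g x))^2 \<le> (LINT x|lebesgue_on U. (norm (f x))^2 + 2 * (norm (f x) * norm (g x)) + (norm (g x))^2)"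
    unfolding L2n_sq by (intro integral_mono i ii e)
  also have "\<dots> = (L2n U f)^2 + 2 * (LINT x|lebesgue_on U. norm (f x) * norm (g x)) + (L2n U g)^2"
    using L2fun_sq[OF assms(1)] L2fun_sq[OF assms(2)] L2_mult_integrable[OF assms] by (simp add: L2n_sq)
  also have "\<dots> \<le> (L2n U f + L2n U g)^2"
    using L2_Cauchy_Schwarz[OF assms] by (simp add: power2_sum)
  finally show "L2n U (\<lambda>x. f x + g x) \<le> L2n U f + L2n U g"
    by (rule power2_le_imp_le) simp
qed

lemma L2fun_minus:
  fixes f :: "real^'n \<Rightarrow> 'b::euclidean_space"
  assumes "L2fun U f"
  shows "L2fun U (\<lambda>x. - f x)" "L2n U (\<lambda>x. - f x) = L2n U f"
  using L2fun_scale[OF assms, of "-1"] by auto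

lemma L2fun_diff:
  fixes f g :: "real^'n \<Rightarrow> 'b::euclidean_space"
  assumes "L2fun U f" "L2fun U g"
  shows "L2fun U (\<lambda>x. f x - g x)" "L2n U (\<lambda>x. f x - g x) \<le> L2n U f + L2n U g"
  using L2fun_add[OF assms(1) L2fun_minus(1)[OF assms(2)]] L2fun_minus(2)[OF assms(2)] by auto

lemma L2fun_sum:
  fixes f :: "'i \<Rightarrow> real^'n \<Rightarrow> 'b::euclidean_space"
  assumes "\<And>i. i \<in> I \<Longrightarrow> L2fun U (f i)"
  shows "L2fun U (\<lambda>x. \<Sum>i\<in>I. f i x) \<and> L2n U (\<lambda>x. \<Sum>i\<in>I. f i x) \<le> (\<Sum>i\<in>I. L2n U (f i))"
  using assms
proof (induction I rule: infinite_finite_induct)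
  case (insert i I)
  then have "L2fun U (f i)" "L2fun U (\<lambda>x. \<Sum>i\<in>I. f i x)" by auto
  from L2fun_add[OF this] insert show ?case by auto
qed auto

lemma L2n_cong_AE:
  fixes f g :: "real^'n \<Rightarrow> 'b::euclidean_space"
  assumes "L2fun U f" "g \<in> borel_measurable (lebesgue_on U)" "AE x in lebesgue_on U. f x = g x"
  shows "L2fun U g" "L2n U f = L2n U g"
proof -
  have a: "AE x in lebesgue_on U. norm (g x) \<le> norm (f x)" "AE x in lebesgue_on U. norm (f x) \<le> norm (g x)"
    using assms(3) by auto
  show g: "L2fun U g" using L2fun_mono(1)[OF assms(1,2) a(1)] .
  show "L2n U f = L2n U g"
    using L2fun_mono(2)[OF assms(1,2) a(1)] L2fun_mono(2)[OF g L2fun_meas[OF assms(1)] a(2)] by simp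
qed

section \<open>Fourth powers\<close>

lemma L4fun_meas: "L4fun U f \<Longrightarrow> f \<in> borel_measurable (lebesgue_on U)"
  by (simp add: L4fun_def)

lemma L4fun_iff_L2:
  fixes f :: "real^'n \<Rightarrow> 'b::euclidean_space"
  assumes "f \<in> borel_measurable (lebesgue_on U)"
  shows "L4fun U f \<longleftrightarrow> L2fun U (\<lambda>x. (norm (f x))^2)"
  using assms by (simp add: L4fun_def L2fun_def flip: power_mult)

lemma L4n_nonneg [simp]: "0 \<le> L4n U f"
  by (simp add: L4n_def)

text \<open>Every \<open>L4n\<close> estimate is reduced by this identity to an L2 estimate for the
  squared norm, so Cauchy-Schwarz takes the place of the general Hoelder inequality.\<close>

lemma L4n_sq: "(L4n U f)^2 = L2n U (\<lambda>x. (norm (f x))^2)"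
proof -
  let ?I = "LINT x|lebesgue_on U. (norm (f x))^4"
  have "0 \<le> ?I" by simp
  then have "(?I powr (1/4))^2 = sqrt ?I"
    by (cases "?I = 0") (simp_all add: powr_half_sqrt[symmetric] powr_power)
  then show ?thesis by (simp add: L4n_def L2n_def flip: power_mult)
qed

lemma L4n_pow4: "(L4n U f)^4 = (LINT x|lebesgue_on U. (norm (f x))^4)"
proof -
  have "(L4n U f)^4 = ((L4n U f)^2)^2" by (simp flip: power_mult)
  then show ?thesis unfolding L4n_sq L2n_sq by (simp flip: power_mult)
qed

lemma L4fun_L2sq: "L4fun U f \<Longrightarrow> L2fun U (\<lambda>x. (norm (f x))^2)"
  using L4fun_iff_L2 L4fun_meas by blast

lemma L4_mult:
  fixes f :: "real^'n \<Rightarrow> 'b::euclidean_space" and g :: "real^'n \<Rightarrow> 'c::euclidean_space"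
  assumes "L4fun U f" "L4fun U g"
  shows "L2fun U (\<lambda>x. norm (f x) * norm (g x))"
    "L2n U (\<lambda>x. norm (f x) * norm (g x)) \<le> L4n U f * L4n U g"
proof -
  note [measurable] = L4fun_meas[OF assms(1)] L4fun_meas[OF assms(2)]
  note a = L4fun_L2sq[OF assms(1)] L4fun_L2sq[OF assms(2)]
  show "L2fun U (\<lambda>x. norm (f x) * norm (g x))"
    using L2_mult_integrable[OF a] by (simp add: L2fun_def power_mult_distrib)
  have "(L2n U (\<lambda>x. norm (f x) * norm (g x)))^2 \<le> (L4n U f * L4n U g)^2"
    using L2_Cauchy_Schwarz[OF a] by (simp add: L2n_sq power_mult_distrib L4n_sq)
  then show "L2n U (\<lambda>x. norm (f x) * norm (g x)) \<le> L4n U f * L4n U g"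
    by (rule power2_le_imp_le) simp
qed

lemma L4fun_mono:
  fixes f :: "real^'n \<Rightarrow> 'b::euclidean_space" and g :: "real^'n \<Rightarrow> 'c::euclidean_space"
  assumes "L4fun U g" "f \<in> borel_measurable (lebesgue_on U)"
    "AE x in lebesgue_on U. norm (f x) \<le> norm (g x)"
  shows "L4fun U f" "L4n U f \<le> L4n U g"
proof -
  note [measurable] = assms(2)
  have m: "(\<lambda>x. (norm (f x))\<^sup>2) \<in> borel_measurable (lebesgue_on U)" by measurable
  have ae: "AE x in lebesgue_on U. norm ((norm (f x))\<^sup>2) \<le> norm ((norm (g x))\<^sup>2)"
    using assms(3) by (auto simp: power_mono)
  note a = L2fun_mono[OF L4fun_L2sq[OF assms(1)] m ae]
  show "L4fun U f" using a(1) L4fun_iff_L2[OF assms(2)] by simp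
  have "(L4n U f)^2 \<le> (L4n U g)^2" unfolding L4n_sq by (rule a(2))
  then show "L4n U f \<le> L4n U g" by (rule power2_le_imp_le) simp
qed

lemma L4fun_scale:
  fixes f :: "real^'n \<Rightarrow> 'b::euclidean_space"
  assumes "L4fun U f"
  shows "L4fun U (\<lambda>x. c *\<^sub>R f x)" "L4n U (\<lambda>x. c *\<^sub>R f x) = \<bar>c\<bar> * L4n U f"
proof -
  note m = L4fun_meas[OF assms]
  have m': "(\<lambda>x. c *\<^sub>R f x) \<in> borel_measurable (lebesgue_on U)" using m by measurable
  note a = L2fun_scale[OF L4fun_L2sq[OF assms], of "c^2"]
  show "L4fun U (\<lambda>x. c *\<^sub>R f x)"
    using a(1) by (subst L4fun_iff_L2[OF m']) (simp add: power_mult_distrib)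
  have "(L4n U (\<lambda>x. c *\<^sub>R f x))^2 = (\<bar>c\<bar> * L4n U f)^2"
    using a(2) by (simp add: L4n_sq power_mult_distrib)
  then show "L4n U (\<lambda>x. c *\<^sub>R f x) = \<bar>c\<bar> * L4n U f"
    by (rule power2_eq_imp_eq) simp_all
qed

lemma L4fun_zero [simp]: "L4fun U (\<lambda>x. 0)" "L4n U (\<lambda>x. 0) = 0"
  by (auto simp: L4fun_def L4n_def)

text \<open>Minkowski's inequality from the pointwise expansion of (|f| + |g|)^2: its middle term is
  an L2 product controlled by \<open>L4_mult\<close>, and the three L2 norms add up to a
  square.\<close>

lemma L4fun_add:
  fixes f g :: "real^'n \<Rightarrow> 'b::euclidean_space"
  assumes "L4fun U f" "L4fun U g"
  shows "L4fun U (\<lambda>x. f x + g x)" "L4n U (\<lambda>x. f x + g x) \<le> L4n U f + L4n U g"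
proof -
  note [measurable] = L4fun_meas[OF assms(1)] L4fun_meas[OF assms(2)]
  have m: "(\<lambda>x. f x + g x) \<in> borel_measurable (lebesgue_on U)"
    "(\<lambda>x. (norm (f x + g x))^2) \<in> borel_measurable (lebesgue_on U)" by measurable
  have e: "(norm (f x + g x))^2 \<le> ((norm (f x))^2 + 2 *\<^sub>R (norm (f x) * norm (g x))) + (norm (g x))^2" for x
    using power_mono[OF norm_triangle_ineq[of "f x" "g x"], of 2]
    by (simp add: power2_eq_square algebra_simps)
  note a = L4fun_L2sq[OF assms(1)] L4fun_L2sq[OF assms(2)] L4_mult[OF assms]
  note b = L2fun_scale[OF a(3), of 2]
  note c = L2fun_add[OF a(1) b(1)]
  note d = L2fun_add[OF c(1) a(2)]
  have "AE x in lebesgue_on U. norm ((norm (f x + g x))^2) \<le> norm (((norm (f x))^2 + 2 *\<^sub>R (norm (f x) * norm (g x))) + (norm (g x))^2)"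
    using e by (auto intro: order_trans)
  note mm = L2fun_mono[OF d(1) m(2) this]
  show "L4fun U (\<lambda>x. f x + g x)" using mm(1) L4fun_iff_L2[OF m(1)] by simp
  have "(L4n U (\<lambda>x. f x + g x))^2 \<le> (L4n U f)^2 + 2 * (L4n U f * L4n U g) + (L4n U g)^2"
    using mm(2) d(2) c(2) b(2) a(4) unfolding L4n_sq by linarith
  also have "\<dots> = (L4n U f + L4n U g)^2" by (simp add: power2_sum)
  finally show "L4n U (\<lambda>x. f x + g x) \<le> L4n U f + L4n U g"
    by (rule power2_le_imp_le) simp
qed

lemma L4fun_minus:
  fixes f :: "real^'n \<Rightarrow> 'b::euclidean_space"
  assumes "L4fun U f"
  shows "L4fun U (\<lambda>x. - f x)" "L4n U (\<lambda>x. - f x) = L4n U f"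
  using L4fun_scale[OF assms, of "-1"] by auto

lemma L4fun_diff:
  fixes f g :: "real^'n \<Rightarrow> 'b::euclidean_space"
  assumes "L4fun U f" "L4fun U g"
  shows "L4fun U (\<lambda>x. f x - g x)" "L4n U (\<lambda>x. f x - g x) \<le> L4n U f + L4n U g"
  using L4fun_add[OF assms(1) L4fun_minus(1)[OF assms(2)]] L4fun_minus(2)[OF assms(2)] by auto

lemma L4fun_sum:
  fixes f :: "'i \<Rightarrow> real^'n \<Rightarrow> 'b::euclidean_space"
  assumes "\<And>i. i \<in> I \<Longrightarrow> L4fun U (f i)"
  shows "L4fun U (\<lambda>x. \<Sum>i\<in>I. f i x) \<and> L4n U (\<lambda>x. \<Sum>i\<in>I. f i x) \<le> (\<Sum>i\<in>I. L4n U (f i))"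
  using assms
proof (induction I rule: infinite_finite_induct)
  case (insert i I)
  then have "L4fun U (f i)" "L4fun U (\<lambda>x. \<Sum>i\<in>I. f i x)" by auto
  from L4fun_add[OF this] insert show ?case by auto
qed auto

lemma L4n_cong_AE:
  fixes f g :: "real^'n \<Rightarrow> 'b::euclidean_space"
  assumes "L4fun U f" "g \<in> borel_measurable (lebesgue_on U)" "AE x in lebesgue_on U. f x = g x"
  shows "L4fun U g" "L4n U f = L4n U g"
proof -
  have a: "AE x in lebesgue_on U. norm (g x) \<le> norm (f x)" "AE x in lebesgue_on U. norm (f x) \<le> norm (g x)"
    using assms(3) by auto
  show g: "L4fun U g" using L4fun_mono(1)[OF assms(1,2) a(1)] .
  show "L4n U f = L4n U g"
    using L4fun_mono(2)[OF assms(1,2) a(1)] L4fun_mono(2)[OF g L4fun_meas[OF assms(1)] a(2)] by simp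
qed

section \<open>Vector-valued functions by components\<close>

lemma vec_measurable_iff:
  fixes f :: "'a \<Rightarrow> 'b::euclidean_space^'k"
  shows "f \<in> borel_measurable M \<longleftrightarrow> (\<forall>i. (\<lambda>x. f x $ i) \<in> borel_measurable M)"
proof
  assume "f \<in> borel_measurable M"
  then show "\<forall>i. (\<lambda>x. f x $ i) \<in> borel_measurable M"
    by (intro allI borel_measurable_continuous_on[where f="\<lambda>v. v $ i" for i]) (auto intro: continuous_intros)
next
  assume a: "\<forall>i. (\<lambda>x. f x $ i) \<in> borel_measurable M"
  have "(\<lambda>x. f x \<bullet> b) \<in> borel_measurable M" if "b \<in> Basis" for b
    unfolding inner_vec_def using a by (intro borel_measurable_sum borel_measurable_inner) auto
  then show "f \<in> borel_measurable M"
    by (subst borel_measurable_euclidean_space) auto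
qed

lemma norm_vec_le_sum: "norm (v :: 'b::euclidean_space^'k) \<le> (\<Sum>i\<in>UNIV. norm (v $ i))"
  by (simp add: norm_vec_def L2_set_le_sum)

lemma L2fun_nth:
  fixes f :: "real^'n \<Rightarrow> 'b::euclidean_space^'k"
  assumes "L2fun U f"
  shows "L2fun U (\<lambda>x. f x $ i)" "L2n U (\<lambda>x. f x $ i) \<le> L2n U f"
proof -
  have "(\<lambda>x. f x $ i) \<in> borel_measurable (lebesgue_on U)"
    using L2fun_meas[OF assms] vec_measurable_iff by blast
  note m = L2fun_mono[OF assms this]
  show "L2fun U (\<lambda>x. f x $ i)" "L2n U (\<lambda>x. f x $ i) \<le> L2n U f"
    by (auto intro!: m always_eventually simp: Finite_Cartesian_Product.norm_nth_le)
qed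

lemma L4fun_nth:
  fixes f :: "real^'n \<Rightarrow> 'b::euclidean_space^'k"
  assumes "L4fun U f"
  shows "L4fun U (\<lambda>x. f x $ i)" "L4n U (\<lambda>x. f x $ i) \<le> L4n U f"
proof -
  have "(\<lambda>x. f x $ i) \<in> borel_measurable (lebesgue_on U)"
    using L4fun_meas[OF assms] vec_measurable_iff by blast
  note m = L4fun_mono[OF assms this]
  show "L4fun U (\<lambda>x. f x $ i)" "L4n U (\<lambda>x. f x $ i) \<le> L4n U f"
    by (auto intro!: m always_eventually simp: Finite_Cartesian_Product.norm_nth_le)
qed

lemma L2fun_norm:
  fixes f :: "real^'n \<Rightarrow> 'b::euclidean_space"
  assumes "L2fun U f" shows "L2fun U (\<lambda>x. norm (f x))" "L2n U (\<lambda>x. norm (f x)) = L2n U f"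
  using assms by (auto simp: L2fun_def L2n_def)

lemma L4fun_norm:
  fixes f :: "real^'n \<Rightarrow> 'b::euclidean_space"
  assumes "L4fun U f" shows "L4fun U (\<lambda>x. norm (f x))" "L4n U (\<lambda>x. norm (f x)) = L4n U f"
  using assms by (auto simp: L4fun_def L4n_def)

lemma L2fun_vec:
  fixes f :: "real^'n \<Rightarrow> 'b::euclidean_space^'k"
  assumes "\<And>i. L2fun U (\<lambda>x. f x $ i)"
  shows "L2fun U f" "L2n U f \<le> (\<Sum>i\<in>UNIV. L2n U (\<lambda>x. f x $ i))"
proof -
  have m: "f \<in> borel_measurable (lebesgue_on U)"
    using L2fun_meas[OF assms] vec_measurable_iff by blast
  have s: "L2fun U (\<lambda>x. \<Sum>i\<in>UNIV. norm (f x $ i)) \<and>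
     L2n U (\<lambda>x. \<Sum>i\<in>UNIV. norm (f x $ i)) \<le> (\<Sum>i\<in>UNIV. L2n U (\<lambda>x. norm (f x $ i)))"
    by (rule L2fun_sum) (rule L2fun_norm(1)[OF assms])
  have ae: "AE x in lebesgue_on U. norm (f x) \<le> norm (\<Sum>i\<in>UNIV. norm (f x $ i))"
    using norm_vec_le_sum by (auto simp: sum_nonneg)
  note t = L2fun_mono[OF conjunct1[OF s] m ae]
  show "L2fun U f" by (rule t(1))
  show "L2n U f \<le> (\<Sum>i\<in>UNIV. L2n U (\<lambda>x. f x $ i))"
    using t(2) s by (simp add: L2fun_norm(2)[OF assms])
qed

lemma L4fun_vec:
  fixes f :: "real^'n \<Rightarrow> 'b::euclidean_space^'k"
  assumes "\<And>i. L4fun U (\<lambda>x. f x $ i)"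
  shows "L4fun U f" "L4n U f \<le> (\<Sum>i\<in>UNIV. L4n U (\<lambda>x. f x $ i))"
proof -
  have m: "f \<in> borel_measurable (lebesgue_on U)"
    using L4fun_meas[OF assms] vec_measurable_iff by blast
  have s: "L4fun U (\<lambda>x. \<Sum>i\<in>UNIV. norm (f x $ i)) \<and>
     L4n U (\<lambda>x. \<Sum>i\<in>UNIV. norm (f x $ i)) \<le> (\<Sum>i\<in>UNIV. L4n U (\<lambda>x. norm (f x $ i)))"
    by (rule L4fun_sum) (rule L4fun_norm(1)[OF assms])
  have ae: "AE x in lebesgue_on U. norm (f x) \<le> norm (\<Sum>i\<in>UNIV. norm (f x $ i))"
    using norm_vec_le_sum by (auto simp: sum_nonneg)
  note t = L4fun_mono[OF conjunct1[OF s] m ae]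
  show "L4fun U f" by (rule t(1))
  show "L4n U f \<le> (\<Sum>i\<in>UNIV. L4n U (\<lambda>x. f x $ i))"
    using t(2) s by (simp add: L4fun_norm(2)[OF assms])
qed

text \<open>Cauchy-Schwarz of the squared norm against the constant 1, which produces the fourth
  root of the measure.\<close>

lemma L4fun_imp_L2fun:
  fixes f :: "real^'n \<Rightarrow> 'b::euclidean_space"
  assumes "finite_measure (lebesgue_on U)" "L4fun U f"
  shows "L2fun U f" "L2n U f \<le> sqrt (sqrt (measure (lebesgue_on U) U)) * L4n U f"
proof -
  interpret finite_measure "lebesgue_on U" by fact
  note [measurable] = L4fun_meas[OF assms(2)]
  have one: "L2fun U (\<lambda>x. 1::real)" "L2n U (\<lambda>x. 1::real) = sqrt (measure (lebesgue_on U) U)"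
    by (auto simp: L2fun_def L2n_def)
  note a = L4fun_L2sq[OF assms(2)]
  have i: "integrable (lebesgue_on U) (\<lambda>x. (norm (f x))^2)"
    using L2_mult_integrable[OF a one(1)] by simp
  then show "L2fun U f" using assms by (simp add: L2fun_def)
  have "(L2n U f)^2 \<le> (L4n U f)^2 * sqrt (measure (lebesgue_on U) U)"
    using L2_Cauchy_Schwarz[OF a one(1)] by (simp add: L2n_sq[of _ f] one(2) L4n_sq)
  also have "\<dots> = (sqrt (sqrt (measure (lebesgue_on U) U)) * L4n U f)^2"
    by (simp add: power_mult_distrib)
  finally show "L2n U f \<le> sqrt (sqrt (measure (lebesgue_on U) U)) * L4n U f"
    by (rule power2_le_imp_le) simp
qed

section \<open>Smooth functions and test functions\<close>

lemma iter_pd_append: "iter_pd (ks @ js) f = iter_pd ks (iter_pd js f)"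
  by (induction ks) auto

lemma iter_pd_Cons: "iter_pd (j # js) f = iter_pd [j] (iter_pd js f)"
  by (simp only: iter_pd.simps)

declare iter_pd.simps(2) [simp del]

lemma iter_pd_single: "iter_pd [j] f = (\<lambda>x. frechet_derivative f (at x) (axis j 1))"
  by (simp only: iter_pd.simps)

text \<open>Smoothness speaks of all iterated partial derivatives at once; a set of differentiable
  functions closed under single partial derivatives contains them all, by induction on the
  list.\<close>

lemma smooth_fun_coinduct:
  assumes "f \<in> S" and d: "\<And>f x. f \<in> S \<Longrightarrow> f differentiable (at x)"
    and c: "\<And>f j. f \<in> S \<Longrightarrow> iter_pd [j] f \<in> S"
  shows "smooth_fun f"
proof -
  have "iter_pd js f \<in> S" for js
  proof (induction js)
    case (Cons j js)
    show ?case using c[OF Cons] by (subst iter_pd_Cons)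
  qed (simp only: iter_pd.simps \<open>f \<in> S\<close>)
  then show ?thesis using d by (simp only: smooth_fun_def) simp
qed

lemma sum_axis: "(\<Sum>i\<in>UNIV. axis j a $ i * g i) = a * (g j :: real)"
proof -
  have "(\<Sum>i\<in>UNIV. axis j a $ i * g i) = (\<Sum>i\<in>UNIV. if i = j then a * g i else 0)"
    by (intro sum.cong) (auto simp: axis_def)
  then show ?thesis by simp
qed

lemma smooth_differentiable: "smooth_fun f \<Longrightarrow> f differentiable (at x)"
  unfolding smooth_fun_def by (drule spec[of _ "[]"]) (simp add: iter_pd.simps)

lemma smooth_iter_pd: "smooth_fun f \<Longrightarrow> smooth_fun (iter_pd js f)"
  unfolding smooth_fun_def iter_pd_append[symmetric] by blast

lemma smooth_has_derivative:
  assumes "smooth_fun f"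
  shows "(f has_derivative (\<lambda>v. \<Sum>j\<in>UNIV. v $ j * iter_pd [j] f x)) (at x)"
proof -
  have h: "(f has_derivative frechet_derivative f (at x)) (at x)"
    using smooth_differentiable[OF assms] frechet_derivative_works by blast
  then have l: "linear (frechet_derivative f (at x))" by (rule has_derivative_linear)
  have "frechet_derivative f (at x) v = (\<Sum>j\<in>UNIV. v $ j * iter_pd [j] f x)" for v
  proof -
    have "frechet_derivative f (at x) v = frechet_derivative f (at x) (\<Sum>j\<in>UNIV. v $ j *\<^sub>R axis j 1)"
      by (simp add: basis_expansion flip: scalar_mult_eq_scaleR)
    also have "\<dots> = (\<Sum>j\<in>UNIV. v $ j * iter_pd [j] f x)"
      using l by (simp add: linear_sum linear_scale iter_pd_single)
    finally show ?thesis .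
  qed
  then have "frechet_derivative f (at x) = (\<lambda>v. \<Sum>j\<in>UNIV. v $ j * iter_pd [j] f x)" by blast
  then show ?thesis using h by simp
qed

lemma pd_eqI:
  assumes "(f has_derivative D) (at x)" shows "iter_pd [j] f x = D (axis j 1)"
  using frechet_derivative_at[OF assms] by (simp add: iter_pd_single)

lemma smooth_line_deriv:
  assumes "smooth_fun f"
  shows "((\<lambda>t. f (x + t *\<^sub>R v)) has_real_derivative (\<Sum>j\<in>UNIV. v $ j * iter_pd [j] f (x + t *\<^sub>R v))) (at t within T)"
proof -
  have "((\<lambda>t. x + t *\<^sub>R v) has_derivative (\<lambda>h. h *\<^sub>R v)) (at t within T)"
    by (auto intro!: derivative_eq_intros)
  from has_derivative_compose[OF this smooth_has_derivative[OF assms]]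
  show ?thesis
    by (rule has_derivative_imp_has_field_derivative) (simp add: sum_distrib_left sum_distrib_right algebra_simps)
qed

lemma smooth_axis_deriv:
  assumes "smooth_fun f"
  shows "((\<lambda>t. f (x + t *\<^sub>R axis j 1)) has_real_derivative iter_pd [j] f (x + t *\<^sub>R axis j 1)) (at t within T)"
proof -
  have "(\<Sum>i\<in>UNIV. axis j 1 $ i * iter_pd [i] f (x + t *\<^sub>R axis j 1)) = iter_pd [j] f (x + t *\<^sub>R axis j 1)"
    by (simp add: sum_axis)
  then show ?thesis using smooth_line_deriv[OF assms, of x "axis j 1" t T] by simp
qed

lemma smooth_continuous: "smooth_fun f \<Longrightarrow> continuous_on S f"
  by (intro continuous_at_imp_continuous_on ballI differentiable_imp_continuous_within smooth_differentiable)

lemma smooth_measurable: "smooth_fun f \<Longrightarrow> f \<in> borel_measurable borel"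
  by (rule borel_measurable_continuous_onI[OF smooth_continuous])

text \<open>A partial derivative of a product is a sum of products, so products alone are not closed
  under differentiation; this larger closure is the set fed to
  \<open>smooth_fun_coinduct\<close>.\<close>

inductive sm :: "(real^'n \<Rightarrow> real) \<Rightarrow> bool" where
  base: "smooth_fun f \<Longrightarrow> sm f"
| mult: "sm f \<Longrightarrow> sm g \<Longrightarrow> sm (\<lambda>x. f x * g x)"
| add: "sm f \<Longrightarrow> sm g \<Longrightarrow> sm (\<lambda>x. f x + g x)"

lemma pd_mult:
  assumes "f differentiable (at x)" "g differentiable (at x)"
  shows "iter_pd [j] (\<lambda>x. f x * g x) x = f x * iter_pd [j] g x + iter_pd [j] f x * g x"
    and "iter_pd [j] (\<lambda>x. f x + g x) x = iter_pd [j] f x + iter_pd [j] g x"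
proof -
  have h: "(f has_derivative frechet_derivative f (at x)) (at x)"
    "(g has_derivative frechet_derivative g (at x)) (at x)"
    using assms frechet_derivative_works by blast+
  show "iter_pd [j] (\<lambda>x. f x * g x) x = f x * iter_pd [j] g x + iter_pd [j] f x * g x"
    using pd_eqI[OF has_derivative_mult[OF h]] by (simp add: iter_pd_single)
  show "iter_pd [j] (\<lambda>x. f x + g x) x = iter_pd [j] f x + iter_pd [j] g x"
    using pd_eqI[OF has_derivative_add[OF h]] by (simp add: iter_pd_single)
qed

lemma sm_closed: "sm f \<Longrightarrow> (\<forall>x. f differentiable (at x)) \<and> (\<forall>j. sm (iter_pd [j] f))"
proof (induction rule: sm.induct)
  case (base f)
  show ?case using smooth_differentiable[OF base] sm.base[OF smooth_iter_pd[OF base]] by simp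
next
  case (mult f g)
  have "iter_pd [j] (\<lambda>x. f x * g x) = (\<lambda>x. f x * iter_pd [j] g x + iter_pd [j] f x * g x)" for j
    by (rule ext, rule pd_mult(1)) (simp_all add: mult.IH)
  moreover have "sm (\<lambda>x. f x * iter_pd [j] g x + iter_pd [j] f x * g x)" for j
    by (intro sm.add sm.mult) (simp_all add: mult.IH mult.hyps)
  ultimately show ?case using mult.IH by (simp add: differentiable_mult)
next
  case (add f g)
  have "iter_pd [j] (\<lambda>x. f x + g x) = (\<lambda>x. iter_pd [j] f x + iter_pd [j] g x)" for j
    by (rule ext, rule pd_mult(2)) (simp_all add: add.IH)
  moreover have "sm (\<lambda>x. iter_pd [j] f x + iter_pd [j] g x)" for j
    by (intro sm.add) (simp_all add: add.IH)
  ultimately show ?case using add.IH by (simp add: differentiable_add)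
qed

lemma sm_smooth: "sm f \<Longrightarrow> smooth_fun f"
  by (rule smooth_fun_coinduct[of f "{f. sm f}"]) (simp_all add: sm_closed)

lemma smooth_mult: "smooth_fun f \<Longrightarrow> smooth_fun g \<Longrightarrow> smooth_fun (\<lambda>x. f x * g x)"
  and smooth_add: "smooth_fun f \<Longrightarrow> smooth_fun g \<Longrightarrow> smooth_fun (\<lambda>x. f x + g x)"
  by (rule sm_smooth[OF sm.mult[OF sm.base sm.base]], assumption+)
    (rule sm_smooth[OF sm.add[OF sm.base sm.base]], assumption+)

lemma pd_const: "iter_pd [j] (\<lambda>x. c) = (\<lambda>x. 0)"
  using pd_eqI[OF has_derivative_const] by blast

lemma smooth_const: "smooth_fun (\<lambda>x. c)"
  by (rule smooth_fun_coinduct[of _ "range (\<lambda>c x. c)"]) (auto simp: pd_const)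

lemma pd_nth: "iter_pd [j] (\<lambda>x. x $ i) = (\<lambda>x::real^'n. if i = j then 1 else 0)"
proof
  fix x :: "real^'n"
  have "((\<lambda>x::real^'n. x $ i) has_derivative (\<lambda>x. x $ i)) (at x)"
    by (rule bounded_linear_imp_has_derivative) (rule bounded_linear_vec_nth)
  from pd_eqI[OF this, of j] show "iter_pd [j] (\<lambda>x. x $ i) x = (if i = j then 1 else 0)"
    by (simp add: axis_def)
qed

lemma smooth_nth: "smooth_fun (\<lambda>x. x $ i)"
  by (rule smooth_fun_coinduct[of _ "insert (\<lambda>x. x $ i) (range (\<lambda>c x. c))"])
    (auto simp: pd_const pd_nth intro: bounded_linear_imp_differentiable[OF bounded_linear_vec_nth] differentiable_const)

lemma smooth_scale: "smooth_fun f \<Longrightarrow> smooth_fun (\<lambda>x. c * f x)"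
  by (rule smooth_mult[OF smooth_const])

lemma smooth_diff: "smooth_fun f \<Longrightarrow> smooth_fun g \<Longrightarrow> smooth_fun (\<lambda>x. f x - g x)"
  using smooth_add[OF _ smooth_scale, of f g "-1"] by simp

lemma smooth_prod: "(\<And>i. i \<in> I \<Longrightarrow> smooth_fun (f i)) \<Longrightarrow> smooth_fun (\<lambda>x. \<Prod>i\<in>I. f i x)"
  by (induction I rule: infinite_finite_induct) (auto intro!: smooth_mult smooth_const)

lemma pd_affine:
  assumes "smooth_fun f"
  shows "iter_pd [j] (\<lambda>x. a * f (c *\<^sub>R x + b)) = (\<lambda>x. (a * c) * iter_pd [j] f (c *\<^sub>R x + b))"
    "(\<lambda>x. a * f (c *\<^sub>R x + b)) differentiable (at y)"
proof -
  have h: "((\<lambda>x. a * f (c *\<^sub>R x + b)) has_derivative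
      (\<lambda>v. a * (\<Sum>j\<in>UNIV. (c *\<^sub>R v) $ j * iter_pd [j] f (c *\<^sub>R x + b)))) (at x)" for x
  proof -
    have "((\<lambda>x. c *\<^sub>R x + b) has_derivative (\<lambda>v. c *\<^sub>R v)) (at x)"
      by (auto intro!: derivative_eq_intros)
    from has_derivative_compose[OF this smooth_has_derivative[OF assms]]
    show ?thesis by (rule has_derivative_mult_right)
  qed
  show "iter_pd [j] (\<lambda>x. a * f (c *\<^sub>R x + b)) = (\<lambda>x. (a * c) * iter_pd [j] f (c *\<^sub>R x + b))"
    using pd_eqI[OF h, of j] by (simp add: fun_eq_iff mult.assoc sum_axis flip: sum_distrib_left)
  show "(\<lambda>x. a * f (c *\<^sub>R x + b)) differentiable (at y)"
    using h differentiable_def by blast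
qed

lemma smooth_affine:
  fixes f :: "real^'n \<Rightarrow> real"
  assumes "smooth_fun f" shows "smooth_fun (\<lambda>x. f (c *\<^sub>R x + b))"
proof -
  let ?S = "{(\<lambda>x. a * f (c *\<^sub>R x + b)) |a f. smooth_fun f}"
  have "(\<lambda>x. f (c *\<^sub>R x + b)) \<in> ?S" using assms by (auto intro!: exI[of _ "1::real"])
  then show ?thesis
  proof (rule smooth_fun_coinduct)
    fix g :: "real^'n \<Rightarrow> real" and j assume "g \<in> ?S"
    then obtain a f where "smooth_fun f" "g = (\<lambda>x. a * f (c *\<^sub>R x + b))" by auto
    then show "iter_pd [j] g \<in> ?S"
      using pd_affine(1) smooth_iter_pd by blast
  next
    fix g :: "real^'n \<Rightarrow> real" and x assume "g \<in> ?S"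
    then obtain a f where "smooth_fun f" "g = (\<lambda>x. a * f (c *\<^sub>R x + b))" by auto
    then show "g differentiable (at x)" using pd_affine(2)[of f a c b x] by simp
  qed
qed

text \<open>The mean value theorem is applied along axis j to the increment of \<open>f\<close> in
  direction i, and then along axis i to the j-th derivative. The second difference itself is
  symmetric in i and j.\<close>

lemma mixed_second_difference:
  assumes f: "smooth_fun (f :: real^'n \<Rightarrow> real)" and s: "s > 0"
  obtains \<sigma> \<tau> where "0 < \<sigma>" "\<sigma> < s" "0 < \<tau>" "\<tau> < s"
    "f (x + s *\<^sub>R axis i 1 + s *\<^sub>R axis j 1) - f (x + s *\<^sub>R axis j 1) - f (x + s *\<^sub>R axis i 1) + f x
      = s^2 * iter_pd [i, j] f (x + \<sigma> *\<^sub>R axis i 1 + \<tau> *\<^sub>R axis j 1)"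
proof -
  define g where "g t = f ((x + s *\<^sub>R axis i 1) + t *\<^sub>R axis j 1) - f (x + t *\<^sub>R axis j 1)" for t
  define g' where "g' t = iter_pd [j] f ((x + s *\<^sub>R axis i 1) + t *\<^sub>R axis j 1) - iter_pd [j] f (x + t *\<^sub>R axis j 1)" for t
  have d: "(g has_real_derivative g' t) (at t)" for t
    unfolding g_def g'_def by (intro derivative_intros smooth_axis_deriv f)
  obtain \<tau> where t: "0 < \<tau>" "\<tau> < s" "g s - g 0 = (s - 0) * g' \<tau>"
    using MVT2[OF s, of g g'] d by auto
  define k where "k r = iter_pd [j] f ((x + \<tau> *\<^sub>R axis j 1) + r *\<^sub>R axis i 1)" for r
  have d2: "(k has_real_derivative iter_pd [i] (iter_pd [j] f) ((x + \<tau> *\<^sub>R axis j 1) + r *\<^sub>R axis i 1)) (at r)" for r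
    unfolding k_def by (intro smooth_axis_deriv smooth_iter_pd f)
  obtain \<sigma> where "0 < \<sigma>" "\<sigma> < s"
    "k s - k 0 = (s - 0) * iter_pd [i] (iter_pd [j] f) ((x + \<tau> *\<^sub>R axis j 1) + \<sigma> *\<^sub>R axis i 1)"
    using MVT2[OF s, of k "\<lambda>r. iter_pd [i] (iter_pd [j] f) ((x + \<tau> *\<^sub>R axis j 1) + r *\<^sub>R axis i 1)"] d2 by auto
  moreover have "g' \<tau> = k s - k 0" by (simp add: g'_def k_def algebra_simps)
  ultimately show ?thesis using t that[of \<sigma> \<tau>]
    by (simp add: g_def power2_eq_square algebra_simps iter_pd_Cons[of i "[j]" f])
qed

text \<open>Both orders of differentiation are limits of the same second difference quotient, by
  continuity of the second derivatives. Weak derivatives of test functions come with the list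
  reversed, and \<open>sob0_by_parts\<close> has to restore the order.\<close>

lemma pd_commute:
  assumes f: "smooth_fun (f :: real^'n \<Rightarrow> real)"
  shows "iter_pd [i, j] f = iter_pd [j, i] f"
proof (rule ccontr)
  let ?a = "iter_pd [i, j] f" and ?b = "iter_pd [j, i] f"
  assume "?a \<noteq> ?b"
  then obtain x where ne: "?a x \<noteq> ?b x" by auto
  define e where "e = \<bar>?a x - ?b x\<bar> / 2"
  have e: "e > 0" using ne by (simp add: e_def)
  have ca: "isCont ?a x" "isCont ?b x"
    by (auto intro!: continuous_on_interior[of UNIV] smooth_continuous smooth_iter_pd f)
  obtain d1 where d1: "d1 > 0" "\<And>y. dist y x < d1 \<Longrightarrow> dist (?a y) (?a x) < e"
    using ca(1) e unfolding continuous_at_eps_delta by (metis dist_norm)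
  obtain d2 where d2: "d2 > 0" "\<And>y. dist y x < d2 \<Longrightarrow> dist (?b y) (?b x) < e"
    using ca(2) e unfolding continuous_at_eps_delta by (metis dist_norm)
  \<comment> \<open>Each of the two displacements is below s, so a third of the smaller radius keeps
    their sum inside both balls.\<close>
  define s where "s = min d1 d2 / 3"
  have s: "s > 0" using d1 d2 by (simp add: s_def)
  have near: "dist (x + \<sigma> *\<^sub>R axis k 1 + \<tau> *\<^sub>R axis l 1) x < d1 \<and> dist (x + \<sigma> *\<^sub>R axis k 1 + \<tau> *\<^sub>R axis l 1) x < d2"
    if "0 < \<sigma>" "\<sigma> < s" "0 < \<tau>" "\<tau> < s" for \<sigma> \<tau> k l
  proof -
    have "dist (x + \<sigma> *\<^sub>R axis k 1 + \<tau> *\<^sub>R axis l 1) x = norm (\<sigma> *\<^sub>R axis k 1 + \<tau> *\<^sub>R axis l (1::real))"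
      by (simp add: dist_norm)
    also have "\<dots> \<le> \<sigma> + \<tau>" using norm_triangle_ineq[of "\<sigma> *\<^sub>R axis k 1" "\<tau> *\<^sub>R axis l (1::real)"] that
      by (simp add: norm_axis_1)
    finally show ?thesis using that s d1(1) d2(1) by (simp add: s_def)
  qed
  obtain \<sigma> \<tau> where 1: "0 < \<sigma>" "\<sigma> < s" "0 < \<tau>" "\<tau> < s"
    "f (x + s *\<^sub>R axis i 1 + s *\<^sub>R axis j 1) - f (x + s *\<^sub>R axis j 1) - f (x + s *\<^sub>R axis i 1) + f x
      = s^2 * ?a (x + \<sigma> *\<^sub>R axis i 1 + \<tau> *\<^sub>R axis j 1)"
    using mixed_second_difference[OF f s] by metis
  obtain \<sigma>' \<tau>' where 2: "0 < \<sigma>'" "\<sigma>' < s" "0 < \<tau>'" "\<tau>' < s"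
    "f (x + s *\<^sub>R axis j 1 + s *\<^sub>R axis i 1) - f (x + s *\<^sub>R axis i 1) - f (x + s *\<^sub>R axis j 1) + f x
      = s^2 * ?b (x + \<sigma>' *\<^sub>R axis j 1 + \<tau>' *\<^sub>R axis i 1)"
    using mixed_second_difference[OF f s] by metis
  have "s^2 * ?a (x + \<sigma> *\<^sub>R axis i 1 + \<tau> *\<^sub>R axis j 1) = s^2 * ?b (x + \<sigma>' *\<^sub>R axis j 1 + \<tau>' *\<^sub>R axis i 1)"
    using 1(5) 2(5) by (simp add: algebra_simps)
  then have "?a (x + \<sigma> *\<^sub>R axis i 1 + \<tau> *\<^sub>R axis j 1) = ?b (x + \<sigma>' *\<^sub>R axis j 1 + \<tau>' *\<^sub>R axis i 1)"
    using s by simp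
  moreover have "dist (?a (x + \<sigma> *\<^sub>R axis i 1 + \<tau> *\<^sub>R axis j 1)) (?a x) < e"
    "dist (?b (x + \<sigma>' *\<^sub>R axis j 1 + \<tau>' *\<^sub>R axis i 1)) (?b x) < e"
    using near 1 2 d1(2) d2(2) by auto
  ultimately show False unfolding e_def dist_real_def by (auto simp: abs_if split: if_splits)
qed

section \<open>Test functions and their integrals\<close>

lemma test_fun_smooth: "test_fun U \<phi> \<Longrightarrow> smooth_fun \<phi>"
  by (simp add: test_fun_def)

lemma test_funI:
  assumes "smooth_fun \<phi>" "compact K" "K \<subseteq> U" "\<And>x. \<phi> x \<noteq> 0 \<Longrightarrow> x \<in> K"
  shows "test_fun U \<phi>"
proof -
  have "closure {x. \<phi> x \<noteq> 0} \<subseteq> K"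
    using assms by (intro closure_minimal compact_imp_closed) auto
  moreover from this have "compact (closure {x. \<phi> x \<noteq> 0})"
    using compact_Int_closed[OF assms(2) closed_closure, of "{x. \<phi> x \<noteq> 0}"] by (simp add: Int_absorb1)
  ultimately show ?thesis using assms by (auto simp: test_fun_def)
qed

text \<open>The function vanishes on the open complement of its closed support, hence so does every
  derivative there; one compact set serves all of them.\<close>

lemma test_fun_support:
  assumes "test_fun U \<phi>"
  shows "\<exists>K. compact K \<and> K \<subseteq> U \<and> (\<forall>x. x \<notin> K \<longrightarrow> \<phi> x = 0) \<and> (\<forall>x js. x \<notin> K \<longrightarrow> iter_pd js \<phi> x = 0)"
proof -
  let ?K = "closure {x. \<phi> x \<noteq> 0}"
  have K: "compact ?K" "?K \<subseteq> U" using assms by (auto simp: test_fun_def)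
  have 0: "\<phi> x = 0" if "x \<notin> ?K" for x using that closure_subset[of "{x. \<phi> x \<noteq> 0}"] by blast
  have "iter_pd js \<phi> x = 0" if "x \<notin> ?K" for js x
    using that
  proof (induction js arbitrary: x)
    case Nil then show ?case using 0[OF Nil] by (simp only: iter_pd.simps)
  next
    case (Cons j js)
    have "((\<lambda>_. 0) has_derivative (\<lambda>_. 0)) (at x)" by simp
    then have "(iter_pd js \<phi> has_derivative (\<lambda>_. 0)) (at x)"
      by (rule has_derivative_transform_within_open[of _ _ _ _ "- ?K"]) (use Cons in auto)
    from pd_eqI[OF this, of j] show ?case by (subst iter_pd_Cons) simp
  qed
  with K 0 show ?thesis by blast
qed

lemma test_fun_iter_pd: "test_fun U \<phi> \<Longrightarrow> test_fun U (iter_pd js \<phi>)"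
proof -
  assume t: "test_fun U \<phi>"
  obtain K where "compact K \<and> K \<subseteq> U \<and> (\<forall>x. x \<notin> K \<longrightarrow> \<phi> x = 0) \<and> (\<forall>x js. x \<notin> K \<longrightarrow> iter_pd js \<phi> x = 0)"
    using test_fun_support[OF t] by (rule exE)
  then have K: "compact K" "K \<subseteq> U" "\<And>x. x \<notin> K \<Longrightarrow> \<phi> x = 0" "\<And>x js. x \<notin> K \<Longrightarrow> iter_pd js \<phi> x = 0"
    by auto
  show "test_fun U (iter_pd js \<phi>)"
    by (rule test_funI[OF smooth_iter_pd[OF test_fun_smooth[OF t]] K(1,2)]) (use K(4) in blast)
qed

lemma test_fun_mult_smooth:
  assumes "test_fun U \<phi>" "smooth_fun g" shows "test_fun U (\<lambda>x. g x * \<phi> x)"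
proof -
  obtain K where "compact K \<and> K \<subseteq> U \<and> (\<forall>x. x \<notin> K \<longrightarrow> \<phi> x = 0) \<and> (\<forall>x js. x \<notin> K \<longrightarrow> iter_pd js \<phi> x = 0)"
    using test_fun_support[OF assms(1)] by (rule exE)
  then have K: "compact K" "K \<subseteq> U" "\<And>x. x \<notin> K \<Longrightarrow> \<phi> x = 0" "\<And>x js. x \<notin> K \<Longrightarrow> iter_pd js \<phi> x = 0"
    by auto
  show ?thesis
    using K(3)
    by (intro test_funI[OF smooth_mult[OF assms(2) test_fun_smooth[OF assms(1)]] K(1,2)]) (metis mult_zero_right)
qed

lemma test_fun_scale: "test_fun U \<phi> \<Longrightarrow> test_fun U (\<lambda>x. c * \<phi> x)"
  by (rule test_fun_mult_smooth[OF _ smooth_const[of c]])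

lemma test_fun_add:
  assumes "test_fun U \<phi>" "test_fun U \<psi>" shows "test_fun U (\<lambda>x. \<phi> x + \<psi> x)"
proof -
  obtain K where "compact K \<and> K \<subseteq> U \<and> (\<forall>x. x \<notin> K \<longrightarrow> \<phi> x = 0) \<and> (\<forall>x js. x \<notin> K \<longrightarrow> iter_pd js \<phi> x = 0)"
    using test_fun_support[OF assms(1)] by (rule exE)
  then have K: "compact K" "K \<subseteq> U" "\<And>x. x \<notin> K \<Longrightarrow> \<phi> x = 0" "\<And>x js. x \<notin> K \<Longrightarrow> iter_pd js \<phi> x = 0"
    by auto
  obtain K' where "compact K' \<and> K' \<subseteq> U \<and> (\<forall>x. x \<notin> K' \<longrightarrow> \<psi> x = 0) \<and> (\<forall>x js. x \<notin> K' \<longrightarrow> iter_pd js \<psi> x = 0)"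
    using test_fun_support[OF assms(2)] by (rule exE)
  then have K': "compact K'" "K' \<subseteq> U" "\<And>x. x \<notin> K' \<Longrightarrow> \<psi> x = 0" "\<And>x js. x \<notin> K' \<Longrightarrow> iter_pd js \<psi> x = 0"
    by auto
  show ?thesis
  proof (rule test_funI[of _ "K \<union> K'"])
    show "smooth_fun (\<lambda>x. \<phi> x + \<psi> x)" by (intro smooth_add assms[THEN test_fun_smooth])
    show "x \<in> K \<union> K'" if "\<phi> x + \<psi> x \<noteq> 0" for x
      using that K(3) K'(3) by (metis UnCI add.right_neutral)
  qed (use K(1,2) K'(1,2) in auto)
qed

lemma test_fun_zero: "test_fun U (\<lambda>x. 0)"
  using test_funI[OF smooth_const, of "{}" U 0] by simp

lemma test_fun_bounded:
  assumes "test_fun U \<phi>"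
  obtains B where "B > 0" "\<And>x. \<bar>\<phi> x\<bar> \<le> B"
proof -
  obtain K where "compact K \<and> K \<subseteq> U \<and> (\<forall>x. x \<notin> K \<longrightarrow> \<phi> x = 0) \<and> (\<forall>x js. x \<notin> K \<longrightarrow> iter_pd js \<phi> x = 0)"
    using test_fun_support[OF assms] by (rule exE)
  then have K: "compact K" "K \<subseteq> U" "\<And>x. x \<notin> K \<Longrightarrow> \<phi> x = 0" "\<And>x js. x \<notin> K \<Longrightarrow> iter_pd js \<phi> x = 0"
    by auto
  have "compact (\<phi> ` K)"
    by (rule compact_continuous_image[OF smooth_continuous[OF test_fun_smooth[OF assms]] K(1)])
  then have "bounded (\<phi> ` K)" by (rule compact_imp_bounded)
  then obtain B where B: "B > 0" "\<forall>y\<in>\<phi> ` K. norm y \<le> B"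
    by (auto simp: bounded_pos)
  have "\<bar>\<phi> x\<bar> \<le> B" for x
  proof (cases "x \<in> K")
    case True then show ?thesis using B(2) by (metis imageI real_norm_def)
  next
    case False then show ?thesis using B(1) K(3)[OF False] by simp
  qed
  then show ?thesis using that[OF B(1)] by blast
qed

text \<open>Dominated convergence for difference quotients along a sequence; the mean value theorem
  turns the bound on the derivative into a bound on the quotients. It serves translations of test
  functions and averages with a moving radius.\<close>

lemma has_derivative_lebesgue_integral:
  fixes f f' :: "real \<Rightarrow> 'a \<Rightarrow> real"
  assumes t0: "t0 \<in> {a<..<b}"
    and d: "\<And>t x. t \<in> {a<..<b} \<Longrightarrow> x \<in> space M \<Longrightarrow> ((\<lambda>t. f t x) has_real_derivative f' t x) (at t)"
    and bd: "\<And>t x. t \<in> {a<..<b} \<Longrightarrow> x \<in> space M \<Longrightarrow> \<bar>f' t x\<bar> \<le> G x"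
    and G: "integrable M G"
    and f: "\<And>t. t \<in> {a<..<b} \<Longrightarrow> integrable M (f t)"
    and m: "f' t0 \<in> borel_measurable M"
  shows "((\<lambda>t. LINT x|M. f t x) has_real_derivative (LINT x|M. f' t0 x)) (at t0)"
  unfolding has_field_derivative_iff tendsto_at_iff_sequentially comp_def
proof (intro allI impI)
  fix X :: "nat \<Rightarrow> real" assume X: "\<forall>i. X i \<in> UNIV - {t0}" "X \<longlonglongrightarrow> t0"
  \<comment> \<open>The sequence may leave the interval finitely often; there the quotient is
    replaced by the derivative at \<open>t0\<close>, which obeys the same bound.\<close>
  define s where "s i x = (if X i \<in> {a<..<b} then (f (X i) x - f t0 x) / (X i - t0) else f' t0 x)" for i x
  have ev: "\<forall>\<^sub>F i in sequentially. X i \<in> {a<..<b}"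
    using X(2) t0 by (intro topological_tendstoD[OF X(2)]) auto
  have fm: "f t \<in> borel_measurable M" if "t \<in> {a<..<b}" for t using f[OF that] by auto
  have "(\<lambda>i. LINT x|M. s i x) \<longlonglongrightarrow> (LINT x|M. f' t0 x)"
  proof (rule integral_dominated_convergence[OF m _ G])
    show "s i \<in> borel_measurable M" for i
      unfolding s_def using m fm[OF t0] fm[of "X i"] by (cases "X i \<in> {a<..<b}") auto
    have "(\<lambda>i. s i x) \<longlonglongrightarrow> f' t0 x" if x: "x \<in> space M" for x
    proof -
      have "((\<lambda>t. (f t x - f t0 x) / (t - t0)) \<longlongrightarrow> f' t0 x) (at t0)"
        using d[OF t0 x] by (simp add: has_field_derivative_iff)
      then have "(\<lambda>i. (f (X i) x - f t0 x) / (X i - t0)) \<longlonglongrightarrow> f' t0 x"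
        using X unfolding tendsto_at_iff_sequentially comp_def by blast
      then show ?thesis
        by (rule Lim_transform_eventually) (rule eventually_mono[OF ev], simp add: s_def)
    qed
    then show "AE x in M. (\<lambda>i. s i x) \<longlonglongrightarrow> f' t0 x" by simp
    have "norm (s i x) \<le> G x" if x: "x \<in> space M" for i x
    proof (cases "X i \<in> {a<..<b}")
      case True
      have ne: "X i \<noteq> t0" using X(1) by auto
      have mvt: "\<exists>\<xi>. \<xi> \<in> {a<..<b} \<and> f (X i) x - f t0 x = (X i - t0) * f' \<xi> x"
      proof (cases "t0 < X i")
        case l: True
        have "\<exists>z>t0. z < X i \<and> f (X i) x - f t0 x = (X i - t0) * f' z x"
          by (rule MVT2[OF l]) (use True t0 d x in auto)
        then show ?thesis using True t0 by (metis greaterThanLessThan_iff order.strict_trans)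
      next
        case False
        then have l: "X i < t0" using ne by simp
        have "\<exists>z>X i. z < t0 \<and> f t0 x - f (X i) x = (t0 - X i) * f' z x"
          by (rule MVT2[OF l]) (use True t0 d x in auto)
        then obtain z where "z > X i" "z < t0" "f t0 x - f (X i) x = (t0 - X i) * f' z x" by blast
        then show ?thesis using True t0 by (intro exI[of _ z]) (auto simp: algebra_simps)
      qed
      then obtain \<xi> where xi: "\<xi> \<in> {a<..<b}" "f (X i) x - f t0 x = (X i - t0) * f' \<xi> x" by blast
      then have "s i x = f' \<xi> x" using True ne by (simp add: s_def)
      then show ?thesis using bd[OF xi(1) x] by simp
    next
      case False
      then have "s i x = f' t0 x" unfolding s_def by (rule if_not_P)
      then show ?thesis using bd[OF t0 x] by simp
    qed
    then show "AE x in M. norm (s i x) \<le> G x" for i by simp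
  qed
  then show "(\<lambda>i. ((LINT x|M. f (X i) x) - (LINT x|M. f t0 x)) / (X i - t0)) \<longlonglongrightarrow> (LINT x|M. f' t0 x)"
  proof (rule Lim_transform_eventually)
    show "\<forall>\<^sub>F i in sequentially. (LINT x|M. s i x) = ((LINT x|M. f (X i) x) - (LINT x|M. f t0 x)) / (X i - t0)"
      using ev
    proof eventually_elim
      case (elim i)
      then have "(LINT x|M. s i x) = (LINT x|M. (f (X i) x - f t0 x) / (X i - t0))" by (simp add: s_def)
      also have "\<dots> = ((LINT x|M. f (X i) x) - (LINT x|M. f t0 x)) / (X i - t0)"
        using f[OF elim] f[OF t0] by simp
      finally show ?case .
    qed
  qed
qed

lemma test_fun_integrable_lborel:
  fixes \<phi> :: "real^'n \<Rightarrow> real"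
  assumes "test_fun U \<phi>" shows "integrable lborel \<phi>"
proof -
  obtain K where K: "compact K \<and> K \<subseteq> U \<and> (\<forall>x. x \<notin> K \<longrightarrow> \<phi> x = 0) \<and> (\<forall>x js. x \<notin> K \<longrightarrow> iter_pd js \<phi> x = 0)"
    using test_fun_support[OF assms] by (rule exE)
  obtain B where B: "B > 0" "\<And>x. \<bar>\<phi> x\<bar> \<le> B" using test_fun_bounded[OF assms] by blast
  have [measurable]: "\<phi> \<in> borel_measurable borel" by (rule smooth_measurable[OF test_fun_smooth[OF assms]])
  have m: "emeasure lborel K < \<infinity>" using K emeasure_compact_finite by blast
  have Kb [measurable]: "K \<in> sets borel" using K by (simp add: borel_compact)
  have "integrable lborel (\<lambda>x. indicator K x * B :: real)"
    using m Kb by (intro integrable_mult_left integrable_real_indicator) auto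
  then show ?thesis
  proof (rule Bochner_Integration.integrable_bound)
    show "AE x in lborel. norm (\<phi> x) \<le> norm (indicator K x * B)"
      using B K by (auto simp: indicator_def)
  qed simp
qed

lemma LINT_lebesgue_on_supported:
  fixes f :: "real^'n \<Rightarrow> real"
  assumes "f \<in> borel_measurable borel" "\<And>x. x \<notin> U \<Longrightarrow> f x = 0" "U \<in> sets lebesgue"
  shows "(LINT x|lebesgue_on U. f x) = (LINT x|lborel. f x)"
proof -
  have "(LINT x|lebesgue_on U. f x) = (LINT x|lebesgue. indicator U x *\<^sub>R f x)"
    using assms(3) by (intro integral_restrict_space) simp
  also have "\<dots> = (LINT x|lebesgue. f x)"
    by (intro Bochner_Integration.integral_cong refl) (use assms(2) in \<open>auto simp: indicator_def\<close>)
  also have "\<dots> = (LINT x|lborel. f x)"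
    using assms(1) by (intro integral_completion) simp
  finally show ?thesis .
qed

lemma test_fun_outside: "test_fun U \<phi> \<Longrightarrow> x \<notin> U \<Longrightarrow> \<phi> x = 0"
  using test_fun_support[of U \<phi>] by blast

lemma test_fun_LINT_lborel:
  fixes \<phi> :: "real^'n \<Rightarrow> real"
  assumes "test_fun U \<phi>" "U \<in> sets lebesgue"
  shows "(LINT x|lebesgue_on U. \<phi> x) = (LINT x|lborel. \<phi> x)"
  by (rule LINT_lebesgue_on_supported[OF smooth_measurable[OF test_fun_smooth[OF assms(1)]] test_fun_outside[OF assms(1)] assms(2)])

text \<open>All translates of \<phi> along axis j have the same integral; differentiating this
  constant under the integral gives 0.\<close>

lemma test_fun_integral_pd:
  fixes \<phi> :: "real^'n \<Rightarrow> real"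
  assumes t: "test_fun U \<phi>" and U: "U \<in> sets lebesgue"
  shows "(LINT x|lebesgue_on U. iter_pd [j] \<phi> x) = 0"
proof -
  obtain K where K: "compact K \<and> K \<subseteq> U \<and> (\<forall>x. x \<notin> K \<longrightarrow> \<phi> x = 0) \<and> (\<forall>x js. x \<notin> K \<longrightarrow> iter_pd js \<phi> x = 0)"
    using test_fun_support[OF t] by (rule exE)
  then obtain R where R: "\<And>x. x \<in> K \<Longrightarrow> norm x \<le> R" using compact_imp_bounded[of K] by (auto simp: bounded_iff)
  obtain B where B: "B > 0" "\<And>x. \<bar>iter_pd [j] \<phi> x\<bar> \<le> B" using test_fun_bounded[OF test_fun_iter_pd[OF t]] by blast
  note sm = test_fun_smooth[OF t]
  note m = smooth_measurable[OF sm] smooth_measurable[OF smooth_iter_pd[OF sm]]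
  define f where "f s x = \<phi> (x + s *\<^sub>R axis j 1)" for s :: real and x
  define f' where "f' s x = iter_pd [j] \<phi> (x + s *\<^sub>R axis j 1)" for s :: real and x
  have tr: "integrable lborel (f s) \<and> (LINT x|lborel. f s x) = (LINT x|lborel. \<phi> x)" for s
  proof -
    have e: "f s = (\<lambda>x. \<phi> ((s *\<^sub>R axis j 1) + x))" by (simp add: f_def fun_eq_iff add.commute)
    have "integrable (distr lborel borel ((+) (s *\<^sub>R axis j 1))) \<phi>"
      by (simp only: lborel_distr_plus test_fun_integrable_lborel[OF t])
    moreover have "(LINT x|distr lborel borel ((+) (s *\<^sub>R axis j 1)). \<phi> x) = (LINT x|lborel. \<phi> x)"
      by (simp only: lborel_distr_plus)
    ultimately show ?thesis using m(1) by (simp add: integrable_distr_eq integral_distr e)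
  qed
  \<comment> \<open>Shifts by less than 1 keep the support inside the ball of radius R + 1, which
    gives a dominating function independent of the shift.\<close>
  have G: "integrable lborel (\<lambda>x. indicator (cball 0 (R+1)) x * B :: real)"
    by (intro integrable_mult_left integrable_real_indicator emeasure_bounded_finite) auto
  have "((\<lambda>s. LINT x|lborel. f s x) has_real_derivative (LINT x|lborel. f' 0 x)) (at 0)"
  proof (rule has_derivative_lebesgue_integral[where a="-1" and b=1, OF _ _ _ G])
    show "((\<lambda>t. f t x) has_real_derivative f' s x) (at s)" for s x
      unfolding f_def f'_def by (rule smooth_axis_deriv[OF sm])
    show "\<bar>f' s x\<bar> \<le> indicator (cball 0 (R+1)) x * B" if "s \<in> {-1<..<1}" for s x
    proof (cases "x + s *\<^sub>R axis j 1 \<in> K")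
      case True
      have "norm x \<le> norm (x + s *\<^sub>R axis j 1) + norm (s *\<^sub>R axis j (1::real))"
        using norm_triangle_ineq4[of "x + s *\<^sub>R axis j 1" "s *\<^sub>R axis j 1"] by simp
      also have "\<dots> \<le> R + 1" using R[OF True] that by (auto simp: norm_axis_1 intro!: add_mono)
      finally show ?thesis using B(2) by (simp add: f'_def)
    next
      case False
      then have "f' s x = 0" using K by (simp add: f'_def)
      then show ?thesis using B(1) by simp
    qed
    show "f' 0 \<in> borel_measurable lborel" using m(2) by (simp add: f'_def[abs_def])
  qed (use tr in auto)
  moreover have "(\<lambda>s. LINT x|lborel. f s x) = (\<lambda>s. LINT x|lborel. \<phi> x)" using tr by blast
  ultimately have "((\<lambda>s. LINT x|lborel. \<phi> x) has_real_derivative (LINT x|lborel. f' 0 x)) (at 0)" by simp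
  then have "(LINT x|lborel. f' 0 x) = 0"
    using DERIV_unique[OF _ DERIV_const] by blast
  then show ?thesis
    using test_fun_LINT_lborel[OF test_fun_iter_pd[OF t] U] by (simp add: f'_def)
qed

lemma test_fun_L2:
  assumes "test_fun U \<phi>" "U \<in> lmeasurable"
  shows "L2fun U \<phi>"
proof -
  interpret finite_measure "lebesgue_on U" by (rule finite_measure_lebesgue_on[OF assms(2)])
  obtain B where B: "B > 0" "\<And>x. \<bar>\<phi> x\<bar> \<le> B" using test_fun_bounded[OF assms(1)] by blast
  have m: "\<phi> \<in> borel_measurable (lebesgue_on U)"
    using smooth_measurable[OF test_fun_smooth[OF assms(1)]]
    by (intro measurable_restrict_space1 measurable_completion) simp
  have "L2fun U (\<lambda>x. B)" by (simp add: L2fun_def)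
  moreover have "AE x in lebesgue_on U. norm (\<phi> x) \<le> norm B" using B by auto
  ultimately show ?thesis using L2fun_mono(1) m by blast
qed

text \<open>The product of a smooth function and a test function is a test function, so its
  derivative integrates to 0.\<close>

lemma test_fun_by_parts:
  fixes \<phi> :: "real^'n \<Rightarrow> real"
  assumes t: "test_fun U \<phi>" and g: "smooth_fun g" and U: "U \<in> lmeasurable"
  shows "(LINT x|lebesgue_on U. g x * iter_pd [j] \<phi> x) = - (LINT x|lebesgue_on U. iter_pd [j] g x * \<phi> x)"
proof -
  interpret finite_measure "lebesgue_on U" by (rule finite_measure_lebesgue_on[OF U])
  have e: "iter_pd [j] (\<lambda>x. g x * \<phi> x) = (\<lambda>x. g x * iter_pd [j] \<phi> x + iter_pd [j] g x * \<phi> x)"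
    by (rule ext, rule pd_mult(1)) (simp_all add: smooth_differentiable g test_fun_smooth[OF t])
  have i: "integrable (lebesgue_on U) \<psi>" if "test_fun U \<psi>" for \<psi>
  proof -
    have "L2fun U (\<lambda>x. 1::real)" by (simp add: L2fun_def)
    from L2_real_integrable(1)[OF test_fun_L2[OF that U] this] show ?thesis by simp
  qed
  have "0 = (LINT x|lebesgue_on U. g x * iter_pd [j] \<phi> x + iter_pd [j] g x * \<phi> x)"
    using test_fun_integral_pd[OF test_fun_mult_smooth[OF t g], of j] U by (simp add: e fmeasurableD)
  also have "\<dots> = (LINT x|lebesgue_on U. g x * iter_pd [j] \<phi> x) + (LINT x|lebesgue_on U. iter_pd [j] g x * \<phi> x)"
    by (intro Bochner_Integration.integral_add i test_fun_mult_smooth test_fun_iter_pd t smooth_iter_pd g)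
  finally show ?thesis by linarith
qed

text \<open>The classical flat function exp(-c/t), with powers of 1/t in front that appear on
  differentiation. The parameter c later tends to 0, which turns the function with n = 0 into the
  indicator of t > 0.\<close>

definition expb :: "real \<Rightarrow> nat \<Rightarrow> real \<Rightarrow> real" where
  "expb c n t = (if t > 0 then (1/t)^n * exp (- c / t) else 0)"

lemma expb_tendsto_0:
  assumes "c > 0" shows "(expb c n \<longlongrightarrow> 0) (at 0)"
proof -
  have "filterlim (\<lambda>t::real. c / t) at_top (at_right 0)"
    using assms filterlim_tendsto_pos_mult_at_top[OF tendsto_const assms filterlim_inverse_at_top_right]
    by (simp add: divide_inverse)
  from filterlim_compose[OF tendsto_power_div_exp_0 this, of n]
  have "((\<lambda>t. (c/t)^n / exp (c/t)) \<longlongrightarrow> 0) (at_right 0)" .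
  from tendsto_mult_left[OF this, of "1/c^n"]
  have "((\<lambda>t. 1/c^n * ((c/t)^n / exp (c/t))) \<longlongrightarrow> 0) (at_right 0)" by simp
  moreover have "\<forall>\<^sub>F t in at_right 0. 1/c^n * ((c/t)^n / exp (c/t)) = expb c n t"
    using assms by (auto simp: eventually_at_filter expb_def power_divide exp_minus field_simps)
  ultimately have r: "(expb c n \<longlongrightarrow> 0) (at_right 0)"
    by (rule Lim_transform_eventually)
  have "\<forall>\<^sub>F t in at_left 0. 0 = expb c n t"
    by (auto simp: eventually_at_filter expb_def)
  from Lim_transform_eventually[OF tendsto_const this] have l: "(expb c n \<longlongrightarrow> 0) (at_left 0)" .
  show ?thesis using l r by (simp add: filterlim_at_split)
qed

lemma expb_deriv:
  assumes c: "c > 0"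
  shows "(expb c n has_real_derivative (c * expb c (n+2) t - real n * expb c (n+1) t)) (at t)"
proof -
  consider "t > 0" | "t < 0" | "t = 0" by linarith
  then show ?thesis
  proof cases
    case 1
    have "((\<lambda>t. (1/t)^n * exp (- c / t)) has_real_derivative
       (c * ((1/t)^(n+2) * exp (- c / t)) - real n * ((1/t)^(n+1) * exp (- c / t)))) (at t)"
    proof -
      have 1: "((\<lambda>t. 1/t) has_real_derivative - ((1/t)^2)) (at t)"
        using 1 by (auto intro!: derivative_eq_intros simp: power2_eq_square)
      have 2: "((\<lambda>t. exp (- c / t)) has_real_derivative exp (- c / t) * (c * (1/t)^2)) (at t)"
        using \<open>t > 0\<close> by (auto intro!: derivative_eq_intros simp: power2_eq_square)
      have "real n * (1/t)^(n - Suc 0) * (1/t)^2 = real n * (1/t)^(n+1)"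
        by (cases n) (simp_all add: power2_eq_square)
      then show ?thesis
        by (intro DERIV_cong[OF DERIV_mult[OF DERIV_power[OF 1, of n] 2]])
          (simp add: algebra_simps power_add power2_eq_square)
    qed
    then have "((\<lambda>t. (1/t)^n * exp (- c / t)) has_real_derivative (c * expb c (n+2) t - real n * expb c (n+1) t)) (at t)"
      using 1 by (simp only: expb_def if_True)
    then show ?thesis
      by (rule has_field_derivative_transform_within_open[of _ _ _ "{0<..}"]) (use 1 in \<open>auto simp: expb_def\<close>)
  next
    case 2
    have "((\<lambda>t. 0) has_real_derivative 0) (at t)" by simp
    then have "(expb c n has_real_derivative 0) (at t)"
      by (rule has_field_derivative_transform_within_open[of _ _ _ "{..<0}"]) (use 2 in \<open>auto simp: expb_def\<close>)
    then show ?thesis using 2 by (simp add: expb_def)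
  next
    case 3
    \<comment> \<open>At 0 the difference quotient of order n is the function of order n + 1, whose
      limit is 0.\<close>
    have "expb c (n+1) = (\<lambda>h. (expb c n h - expb c n 0) / (h - 0))"
      by (auto simp: expb_def fun_eq_iff)
    then have "(expb c n has_real_derivative 0) (at 0)"
      using expb_tendsto_0[OF c, of "n+1"] by (simp add: has_field_derivative_iff)
    then show ?thesis using 3 by (simp add: expb_def)
  qed
qed

text \<open>Linear combinations of flat functions of one affine coordinate; the derivative of a
  summand gives two summands, so the set is closed and \<open>smooth_fun_coinduct\<close>
  applies.\<close>

inductive expb_comb :: "real \<Rightarrow> real \<Rightarrow> real \<Rightarrow> 'n \<Rightarrow> (real^'n \<Rightarrow> real) \<Rightarrow> bool" for c \<sigma> \<tau> i where
  zero: "expb_comb c \<sigma> \<tau> i (\<lambda>x. 0)"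
| add: "expb_comb c \<sigma> \<tau> i f \<Longrightarrow> expb_comb c \<sigma> \<tau> i (\<lambda>x. f x + k * expb c n (\<sigma> * x $ i + \<tau>))"

lemma expb_nth_deriv:
  assumes "c > 0"
  shows "((\<lambda>x. k * expb c n (\<sigma> * x $ i + \<tau>)) has_derivative
     (\<lambda>v. k * ((c * expb c (n+2) (\<sigma> * x $ i + \<tau>) - real n * expb c (n+1) (\<sigma> * x $ i + \<tau>)) * (\<sigma> * v $ i)))) (at x)"
proof -
  have "((\<lambda>x. \<sigma> * x $ i + \<tau>) has_derivative (\<lambda>v. \<sigma> * v $ i)) (at x)"
    by (intro has_derivative_add_const has_derivative_mult_right
        bounded_linear_imp_has_derivative[OF bounded_linear_vec_nth])
  from has_derivative_compose[OF this expb_deriv[OF assms, THEN has_field_derivative_imp_has_derivative]]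
  show ?thesis by (rule has_derivative_mult_right)
qed

lemma expb_comb_closed:
  assumes c: "c > 0"
  shows "expb_comb c \<sigma> \<tau> i f \<Longrightarrow> (\<forall>x. f differentiable (at x)) \<and> (\<forall>j. expb_comb c \<sigma> \<tau> i (iter_pd [j] f))"
proof (induction rule: expb_comb.induct)
  case zero
  show ?case by (simp add: pd_const expb_comb.zero)
next
  case (add f k n)
  have d: "(\<lambda>x. k * expb c n (\<sigma> * x $ i + \<tau>)) differentiable (at x)" for x
    unfolding differentiable_def by (rule exI, rule expb_nth_deriv[OF c])
  have "iter_pd [j] (\<lambda>x. f x + k * expb c n (\<sigma> * x $ i + \<tau>)) =
     (\<lambda>x. (iter_pd [j] f x + (k * c * \<sigma> * (if i = j then 1 else 0)) * expb c (n+2) (\<sigma> * x $ i + \<tau>))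
         + (- k * real n * \<sigma> * (if i = j then 1 else 0)) * expb c (n+1) (\<sigma> * x $ i + \<tau>))" (is "?L = ?R") for j
  proof
    fix x
    have "?L x = iter_pd [j] f x + iter_pd [j] (\<lambda>x. k * expb c n (\<sigma> * x $ i + \<tau>)) x"
      by (rule pd_mult(2)[OF conjunct1[OF add.IH, rule_format] d])
    also have "\<dots> = ?R x"
      by (subst pd_eqI[OF expb_nth_deriv[OF c]]) (simp add: axis_def algebra_simps)
    finally show "?L x = ?R x" .
  qed
  moreover have "expb_comb c \<sigma> \<tau> i (\<lambda>x. (iter_pd [j] f x + (k * c * \<sigma> * (if i = j then 1 else 0)) * expb c (n+2) (\<sigma> * x $ i + \<tau>))
         + (- k * real n * \<sigma> * (if i = j then 1 else 0)) * expb c (n+1) (\<sigma> * x $ i + \<tau>))" for j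
    by (intro expb_comb.add) (simp add: add.IH)
  moreover have "(\<lambda>x. f x + k * expb c n (\<sigma> * x $ i + \<tau>)) differentiable (at x)" for x
    by (rule differentiable_add[OF conjunct1[OF add.IH, rule_format] d])
  ultimately show ?case by (intro conjI allI) (simp_all only:)
qed

lemma smooth_expb:
  assumes "c > 0" shows "smooth_fun (\<lambda>x. expb c n (\<sigma> * x $ i + \<tau>))"
proof (rule smooth_fun_coinduct[of _ "{f. expb_comb c \<sigma> \<tau> i f}"])
  show "(\<lambda>x. expb c n (\<sigma> * x $ i + \<tau>)) \<in> {f. expb_comb c \<sigma> \<tau> i f}"
    using expb_comb.add[OF expb_comb.zero, of c \<sigma> \<tau> i 1 n] by simp
qed (simp_all add: expb_comb_closed[OF assms])

text \<open>A product of flat functions of the distances to the faces of the box. The parameter c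
  exists for the limit in \<open>bump_tendsto\<close>.\<close>

definition bump :: "real \<Rightarrow> real^'n \<Rightarrow> real^'n \<Rightarrow> real^'n \<Rightarrow> real" where
  "bump c a b x = (\<Prod>i\<in>UNIV. expb c 0 (1 * x $ i + (- a $ i)) * expb c 0 ((-1) * x $ i + b $ i))"

lemma expb_range: "c > 0 \<Longrightarrow> 0 \<le> expb c 0 t \<and> expb c 0 t \<le> 1"
  by (auto simp: expb_def)

lemma bump_range: "c > 0 \<Longrightarrow> 0 \<le> bump c a b x \<and> bump c a b x \<le> 1"
  unfolding bump_def
  by (intro conjI prod_nonneg prod_le_1 ballI mult_nonneg_nonneg mult_le_one)
     (simp_all add: expb_range mult_le_one)

lemma bump_pos: "x \<in> box a b \<Longrightarrow> bump c a b x > 0"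
  unfolding bump_def by (intro prod_pos) (auto simp: expb_def mem_box_cart)

lemma bump_outside: "x \<notin> box a b \<Longrightarrow> bump c a b x = 0"
  unfolding bump_def by (auto simp: expb_def mem_box_cart)

lemma bump_test:
  assumes "c > 0" "cbox a b \<subseteq> U" shows "test_fun U (bump c a b)"
proof (rule test_funI[of _ "cbox a b"])
  show "smooth_fun (bump c a b)"
    unfolding bump_def by (intro smooth_prod smooth_mult smooth_expb assms)
  show "x \<in> cbox a b" if "bump c a b x \<noteq> 0" for x
    using that bump_outside box_subset_cbox by blast
qed (use assms in auto)

lemma bump_tendsto: "(\<lambda>m. bump (1 / real (Suc m)) a b x) \<longlonglongrightarrow> indicator (box a b) x"
proof (cases "x \<in> box a b")
  case True
  have 1: "(\<lambda>m. expb (1 / real (Suc m)) 0 t) \<longlonglongrightarrow> 1" if "t > 0" for t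
  proof -
    have "(\<lambda>m. exp (- (1 / real (Suc m)) / t)) \<longlonglongrightarrow> exp (- 0 / t)"
      using that by (intro tendsto_intros LIMSEQ_Suc[OF lim_1_over_n]) auto
    then show ?thesis using that by (simp add: expb_def)
  qed
  have "(\<lambda>m. bump (1 / real (Suc m)) a b x) \<longlonglongrightarrow> (\<Prod>i\<in>(UNIV::'a set). 1 * 1)"
    unfolding bump_def using True by (intro tendsto_prod tendsto_mult 1) (auto simp: mem_box_cart)
  then show ?thesis using True by simp
qed (simp add: bump_outside)

text \<open>Bumps are test functions with values in [0, 1], so dominated convergence carries the
  vanishing integrals over to the indicator of the box.\<close>

lemma box_integral_zero:
  fixes g :: "real^'n \<Rightarrow> real"
  assumes i: "integrable (lebesgue_on U) g" and t: "\<And>\<phi>. test_fun U \<phi> \<Longrightarrow> (LINT x|lebesgue_on U. g x * \<phi> x) = 0"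
    and s: "cbox a b \<subseteq> U" and U: "U \<in> sets lebesgue"
  shows "(LINT x|lebesgue_on U. g x * indicator (box a b) x) = 0"
proof -
  note [measurable] = borel_measurable_integrable[OF i]
  have bm: "f \<in> borel_measurable (lebesgue_on U)" if "f \<in> borel_measurable borel" for f :: "real^'n \<Rightarrow> real"
    using that by (intro measurable_restrict_space1 measurable_completion) simp
  have [measurable]: "bump (1 / real (Suc m)) a b \<in> borel_measurable (lebesgue_on U)" for m
    by (intro bm smooth_measurable test_fun_smooth[OF bump_test[OF _ s]]) simp
  have [measurable]: "(indicator (box a b) :: _ \<Rightarrow> real) \<in> borel_measurable (lebesgue_on U)"
    by (rule bm) measurable
  have "(\<lambda>m. LINT x|lebesgue_on U. g x * bump (1 / real (Suc m)) a b x) \<longlonglongrightarrow> (LINT x|lebesgue_on U. g x * indicator (box a b) x)"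
  proof (rule integral_dominated_convergence[where w="\<lambda>x. norm (g x)"])
    show "AE x in lebesgue_on U. (\<lambda>m. g x * bump (1 / real (Suc m)) a b x) \<longlonglongrightarrow> g x * indicator (box a b) x"
      by (intro always_eventually allI tendsto_intros bump_tendsto)
    show "AE x in lebesgue_on U. norm (g x * bump (1 / real (Suc m)) a b x) \<le> norm (g x)" for m
      using bump_range[of "1 / real (Suc m)" a b]
      by (intro always_eventually allI) (simp add: abs_mult mult_left_le)
    show "(\<lambda>x. g x * bump (1 / real (Suc m)) a b x) \<in> borel_measurable (lebesgue_on U)" for m
      by measurable
  qed (use i in auto)
  moreover have "(LINT x|lebesgue_on U. g x * bump (1 / real (Suc m)) a b x) = 0" for m
    by (intro t bump_test s) simp
  ultimately show ?thesis using LIMSEQ_unique[OF _ tendsto_const] by fastforce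
qed

text \<open>The integral over every closed box inside \<open>U\<close> vanishes, and Lebesgue's
  differentiation theorem recovers the value at almost every point from small cubes.\<close>

lemma fundamental_lemma:
  fixes g :: "real^'n \<Rightarrow> real"
  assumes i: "integrable (lebesgue_on U) g" and t: "\<And>\<phi>. test_fun U \<phi> \<Longrightarrow> (LINT x|lebesgue_on U. g x * \<phi> x) = 0"
    and op: "open U"
  shows "AE x in lebesgue_on U. g x = 0"
proof -
  have U: "U \<in> sets lebesgue" using op by (simp add: lmeasurable_open borel_open)
  define f where "f x = indicator U x *\<^sub>R g x" for x
  have fi: "integrable lebesgue f"
    using i U integrable_restrict_space[of U lebesgue g] by (simp add: f_def[abs_def])
  have ai: "f absolutely_integrable_on S" if "S \<in> sets lebesgue" for S
    unfolding set_integrable_def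
    by (rule integrable_mult_indicator[OF that fi])
  have zero: "integral (cbox a b) f = 0" if "cbox a b \<subseteq> U" for a b
  proof -
    have "integral (cbox a b) f = integral (box a b) f" by (rule integral_open_interval[symmetric])
    also have "\<dots> = (LINT x:box a b|lebesgue. f x)"
      using set_lebesgue_integral_eq_integral(2)[OF ai[of "box a b"]] by simp
    also have "\<dots> = (LINT x|lebesgue. indicator U x *\<^sub>R (g x * indicator (box a b) x))"
      unfolding set_lebesgue_integral_def f_def by (simp add: ac_simps)
    also have "\<dots> = (LINT x|lebesgue_on U. g x * indicator (box a b) x)"
      using U by (intro integral_restrict_space[symmetric]) simp
    also have "\<dots> = 0" by (rule box_integral_zero[OF i t that U])
    finally show ?thesis .
  qed
  obtain N where N: "negligible N" and lim: "\<And>x e. \<lbrakk>x \<notin> N; 0 < e\<rbrakk> \<Longrightarrow>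
       \<exists>d>0. \<forall>h. 0 < h \<and> h < d \<longrightarrow> norm (integral (cbox x (x + h *\<^sub>R One)) f /\<^sub>R h ^ DIM(real^'n) - f x) < e"
    using integrable_ccontinuous_explicit[of f] set_lebesgue_integral_eq_integral(1)[OF ai]
    by (metis lmeasurable_cbox fmeasurableD)
  have z: "g x = 0" if x: "x \<in> U" "x \<notin> N" for x
  proof (rule ccontr)
    assume g: "g x \<noteq> 0"
    then obtain d where d: "d > 0" "\<And>h. 0 < h \<Longrightarrow> h < d \<Longrightarrow> norm (integral (cbox x (x + h *\<^sub>R One)) f /\<^sub>R h ^ DIM(real^'n) - f x) < norm (g x)"
      using lim[OF x(2), of "norm (g x)"] by auto
    obtain e where e: "e > 0" "ball x e \<subseteq> U" using op x(1) open_contains_ball by blast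
    \<comment> \<open>The cube with corner x and side h lies within distance h D of x, so h D < e
      keeps it inside the ball; the added 1 makes D positive.\<close>
    define D where "D = norm (One :: real^'n) + 1"
    have D: "D > 0" by (simp add: D_def add_nonneg_pos)
    define h where "h = min (d/2) (e / (2 * D))"
    have h: "0 < h" "h < d" "h * D < e" using d(1) e(1) D
      by (auto simp: h_def min_def field_simps)
    have "cbox x (x + h *\<^sub>R One) \<subseteq> ball x e"
    proof
      fix y assume y: "y \<in> cbox x (x + h *\<^sub>R One)"
      have "norm (y - x) \<le> norm (h *\<^sub>R (One :: real^'n))"
        by (rule norm_le_componentwise) (use y h(1) in \<open>auto simp: mem_box inner_diff_left inner_add_left\<close>)
      also have "\<dots> \<le> h * D" using h(1) by (simp add: D_def)
      finally show "y \<in> ball x e" using h(3) by (simp add: dist_norm norm_minus_commute)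
    qed
    then have "integral (cbox x (x + h *\<^sub>R One)) f = 0" using zero e(2) by blast
    then have "norm (f x) < norm (g x)" using d(2)[OF h(1,2)] by simp
    then show False using x(1) by (simp add: f_def)
  qed
  have "N \<in> null_sets lebesgue" using N by (simp add: negligible_iff_null_sets)
  then have "AE x in lebesgue. x \<notin> N" by (rule AE_not_in)
  then have "AE x in lebesgue. x \<in> U \<longrightarrow> g x = 0" using z by auto
  then show ?thesis using U by (simp add: AE_restrict_space_iff)
qed

section \<open>Weak derivatives\<close>

locale bounded_open =
  fixes U :: "(real^'n) set"
  assumes op: "open U" and bd: "bounded U"
begin

lemma lm: "U \<in> lmeasurable" using lmeasurable_open[OF bd op] .

lemma sets_leb: "U \<in> sets lebesgue" using lm by (rule fmeasurableD)

lemma fin: "finite_measure (lebesgue_on U)" by (rule finite_measure_lebesgue_on[OF lm])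

lemma L2_const: "L2fun U (\<lambda>x. c :: real)"
proof -
  interpret finite_measure "lebesgue_on U" by (rule fin)
  show ?thesis by (simp add: L2fun_def)
qed

lemma L2_integrable: "L2fun U (f :: _ \<Rightarrow> real) \<Longrightarrow> integrable (lebesgue_on U) f"
  using L2_real_integrable(1)[OF _ L2_const[of 1], of f] by simp

lemma test_L2: "test_fun U \<phi> \<Longrightarrow> L2fun U \<phi>"
  by (rule test_fun_L2[OF _ lm])

lemma test_pd_L2: "test_fun U \<phi> \<Longrightarrow> L2fun U (iter_pd js \<phi>)"
  by (rule test_L2[OF test_fun_iter_pd])

lemma L2_fundamental:
  assumes "L2fun U g" "L2fun U (g' :: _ \<Rightarrow> real)"
    "\<And>\<phi>. test_fun U \<phi> \<Longrightarrow> (LINT x|lebesgue_on U. g x * \<phi> x) = (LINT x|lebesgue_on U. g' x * \<phi> x)"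
  shows "AE x in lebesgue_on U. g x = g' x"
proof -
  have d: "L2fun U (\<lambda>x. g x - g' x)" by (rule L2fun_diff(1)[OF assms(1,2)])
  have "(LINT x|lebesgue_on U. (g x - g' x) * \<phi> x) = 0" if t: "test_fun U \<phi>" for \<phi>
    using assms(3)[OF t] L2_real_integrable(1)[OF assms(1) test_L2[OF t]] L2_real_integrable(1)[OF assms(2) test_L2[OF t]]
    by (simp add: left_diff_distrib)
  from fundamental_lemma[OF L2_integrable[OF d] this op] show ?thesis by simp
qed

lemma weak_D_unique:
  assumes "L2fun U g" "L2fun U g'" "weak_D U js u g" "weak_D U js u g'"
  shows "AE x in lebesgue_on U. g x = g' x"
proof (rule L2_fundamental[OF assms(1,2)])
  fix \<phi> assume t: "test_fun U \<phi>"
  have "(-1)^(length js) * (LINT x|lebesgue_on U. g x * \<phi> x) = (-1)^(length js) * (LINT x|lebesgue_on U. g' x * \<phi> x)"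
    by (rule trans[OF assms(3)[unfolded weak_D_def, rule_format, OF t, symmetric] assms(4)[unfolded weak_D_def, rule_format, OF t]])
  then show "(LINT x|lebesgue_on U. g x * \<phi> x) = (LINT x|lebesgue_on U. g' x * \<phi> x)" by simp
qed

lemma sobD:
  assumes "sob U m u" "length js \<le> m"
  shows "L2fun U (wD U js u)" "weak_D U js u (wD U js u)"
proof -
  have "\<exists>g. L2fun U g \<and> weak_D U js u g" using assms unfolding sob_def by blast
  from someI_ex[OF this] show "L2fun U (wD U js u)" "weak_D U js u (wD U js u)"
    by (simp_all add: wD_def)
qed

lemma sob_L2: "sob U m u \<Longrightarrow> L2fun U u"
  by (simp add: sob_def)

lemma sob_mono: "sob U m u \<Longrightarrow> l \<le> m \<Longrightarrow> sob U l u"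
  by (auto simp: sob_def)

text \<open>\<open>wD\<close> is a choice among representatives; an explicit weak derivative can be
  identified with it only almost everywhere, and this is how values of \<open>wD\<close> are
  computed.\<close>

lemma wD_eq:
  assumes "L2fun U g" "weak_D U js u g"
  shows "L2fun U (wD U js u)" "AE x in lebesgue_on U. wD U js u x = g x"
proof -
  have "\<exists>g. L2fun U g \<and> weak_D U js u g" using assms by blast
  from someI_ex[OF this] have w: "L2fun U (wD U js u)" "weak_D U js u (wD U js u)"
    by (simp_all add: wD_def)
  show "L2fun U (wD U js u)" by (rule w(1))
  show "AE x in lebesgue_on U. wD U js u x = g x"
    by (rule weak_D_unique[OF w(1) assms(1) w(2) assms(2)])
qed

lemma L2_lin:
  assumes "L2fun U u" "L2fun U (v :: _ \<Rightarrow> real)"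
  shows "L2fun U (\<lambda>x. a * u x + b * v x)"
  using L2fun_add(1)[OF L2fun_scale(1)[OF assms(1), of a] L2fun_scale(1)[OF assms(2), of b]] by simp

lemma weak_D_lin:
  assumes "L2fun U u" "L2fun U v" "L2fun U g" "L2fun U g'" "weak_D U js u g" "weak_D U js v g'"
  shows "weak_D U js (\<lambda>x. a * u x + b * v x) (\<lambda>x. a * g x + b * g' x)"
  unfolding weak_D_def
proof (intro allI impI)
  fix \<phi> assume t: "test_fun U \<phi>"
  have lin: "(LINT x|lebesgue_on U. (a * f x + b * k x) * \<psi> x) =
      a * (LINT x|lebesgue_on U. f x * \<psi> x) + b * (LINT x|lebesgue_on U. k x * \<psi> x)"
    if "L2fun U f" "L2fun U k" "L2fun U \<psi>" for f k \<psi> :: "real^'n \<Rightarrow> real"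
  proof -
    have "(LINT x|lebesgue_on U. (a * f x + b * k x) * \<psi> x) = (LINT x|lebesgue_on U. a * (f x * \<psi> x) + b * (k x * \<psi> x))"
      by (simp add: algebra_simps)
    then show ?thesis
      using L2_real_integrable(1)[OF that(1,3)] L2_real_integrable(1)[OF that(2,3)] by simp
  qed
  have "(LINT x|lebesgue_on U. u x * iter_pd js \<phi> x) = (-1)^(length js) * (LINT x|lebesgue_on U. g x * \<phi> x)"
    "(LINT x|lebesgue_on U. v x * iter_pd js \<phi> x) = (-1)^(length js) * (LINT x|lebesgue_on U. g' x * \<phi> x)"
    using assms(5,6) t by (simp_all add: weak_D_def)
  then show "(LINT x|lebesgue_on U. (a * u x + b * v x) * iter_pd js \<phi> x)
        = (-1)^(length js) * (LINT x|lebesgue_on U. (a * g x + b * g' x) * \<phi> x)"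
    unfolding lin[OF assms(1,2) test_pd_L2[OF t]] lin[OF assms(3,4) test_L2[OF t]] by (simp add: algebra_simps)
qed

lemma wD_lin:
  assumes "sob U m u" "sob U m v" "length js \<le> m"
  shows "L2fun U (wD U js (\<lambda>x. a * u x + b * v x))"
    "AE x in lebesgue_on U. wD U js (\<lambda>x. a * u x + b * v x) x = a * wD U js u x + b * wD U js v x"
proof -
  note a = sobD[OF assms(1,3)] sobD[OF assms(2,3)] sob_L2[OF assms(1)] sob_L2[OF assms(2)]
  note e = wD_eq[OF L2_lin[OF a(1,3)] weak_D_lin[OF a(5,6,1,3,2,4)]]
  show "L2fun U (wD U js (\<lambda>x. a * u x + b * v x))" by (rule e(1))
  show "AE x in lebesgue_on U. wD U js (\<lambda>x. a * u x + b * v x) x = a * wD U js u x + b * wD U js v x"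
    by (rule e(2))
qed

lemma sob_lin:
  assumes "sob U m u" "sob U m v"
  shows "sob U m (\<lambda>x. a * u x + b * v x)"
  unfolding sob_def
proof (intro conjI allI impI)
  show "L2fun U (\<lambda>x. a * u x + b * v x)" by (intro L2_lin sob_L2; rule assms)
  fix js :: "'n list" assume l: "length js \<le> m"
  have "L2fun U (\<lambda>x. a * wD U js u x + b * wD U js v x)"
    by (intro L2_lin sobD(1)[OF _ l] assms)
  moreover have "weak_D U js (\<lambda>x. a * u x + b * v x) (\<lambda>x. a * wD U js u x + b * wD U js v x)"
    by (intro weak_D_lin sobD[OF _ l] sob_L2[of m] assms)
  ultimately show "\<exists>g. L2fun U g \<and> weak_D U js (\<lambda>x. a * u x + b * v x) g" by blast
qed

lemma wD_diff:
  assumes "sob U m u" "sob U m v" "length js \<le> m"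
  shows "L2fun U (wD U js (\<lambda>x. u x - v x))"
    "AE x in lebesgue_on U. wD U js (\<lambda>x. u x - v x) x = wD U js u x - wD U js v x"
  using wD_lin[OF assms, of 1 "-1"] by simp_all

lemma wD_Nil:
  assumes "L2fun U u" shows "AE x in lebesgue_on U. wD U [] u x = u x"
  by (rule wD_eq(2)[OF assms]) (simp add: weak_D_def)

text \<open>On the test side \<open>iter_pd (js @ ks)\<close> applies \<open>ks\<close> before
  \<open>js\<close>. Testing the definition for \<open>js\<close> with a derivative of the test
  function therefore gives the composition in this order.\<close>

lemma weak_D_append:
  assumes "sob U m u" "length js + length ks \<le> m"
  shows "weak_D U ks (wD U js u) (wD U (js @ ks) u)"
  unfolding weak_D_def
proof (intro allI impI)
  fix \<phi> assume t: "test_fun U \<phi>"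
  have "(LINT x|lebesgue_on U. u x * iter_pd js (iter_pd ks \<phi>) x) = (-1)^(length js) * (LINT x|lebesgue_on U. wD U js u x * iter_pd ks \<phi> x)"
    using sobD(2)[OF assms(1), of js] assms(2) test_fun_iter_pd[OF t] by (simp add: weak_D_def)
  moreover have "(LINT x|lebesgue_on U. u x * iter_pd (js @ ks) \<phi> x) = (-1)^(length js + length ks) * (LINT x|lebesgue_on U. wD U (js @ ks) u x * \<phi> x)"
    using sobD(2)[OF assms(1), of "js @ ks"] assms(2) t by (simp add: weak_D_def)
  ultimately have "(-1)^(length js) * (LINT x|lebesgue_on U. wD U js u x * iter_pd ks \<phi> x)
      = (-1)^(length js) * ((-1)^(length ks) * (LINT x|lebesgue_on U. wD U (js @ ks) u x * \<phi> x))"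
    by (simp only: iter_pd_append power_add mult.assoc)
  then show "(LINT x|lebesgue_on U. wD U js u x * iter_pd ks \<phi> x) = (-1)^(length ks) * (LINT x|lebesgue_on U. wD U (js @ ks) u x * \<phi> x)"
    by simp
qed

lemma sob_wD:
  assumes "sob U (length js + m) u"
  shows "sob U m (wD U js u)"
  unfolding sob_def
proof (intro conjI allI impI)
  show "L2fun U (wD U js u)" by (rule sobD(1)[OF assms]) simp
  fix ks :: "'n list" assume l: "length ks \<le> m"
  show "\<exists>g. L2fun U g \<and> weak_D U ks (wD U js u) g"
    using sobD(1)[OF assms, of "js @ ks"] weak_D_append[OF assms, of js ks] l by (intro exI[of _ "wD U (js @ ks) u"]) simp
qed

lemma wD_wD:
  assumes "sob U m u" "length js + length ks \<le> m"
  shows "AE x in lebesgue_on U. wD U ks (wD U js u) x = wD U (js @ ks) u x"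
  by (rule wD_eq(2)[OF sobD(1)[OF assms(1)] weak_D_append[OF assms]]) (use assms(2) in simp)

text \<open>Each integration by parts moves the head of the list onto \<phi> before the rest, so the
  classical derivative carries the list in reverse.\<close>

lemma weak_D_test:
  assumes "test_fun U \<phi>" shows "weak_D U js \<phi> (iter_pd (rev js) \<phi>)"
  unfolding weak_D_def
proof (intro allI impI)
  fix \<psi> assume p: "test_fun U \<psi>"
  show "(LINT x|lebesgue_on U. \<phi> x * iter_pd js \<psi> x) = (-1)^(length js) * (LINT x|lebesgue_on U. iter_pd (rev js) \<phi> x * \<psi> x)"
    using assms
  proof (induction js arbitrary: \<phi>)
    case Nil show ?case by simp
  next
    case (Cons j js)
    have "(LINT x|lebesgue_on U. \<phi> x * iter_pd (j # js) \<psi> x) = - (LINT x|lebesgue_on U. iter_pd [j] \<phi> x * iter_pd js \<psi> x)"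
      by (subst iter_pd_Cons) (rule test_fun_by_parts[OF test_fun_iter_pd[OF p] test_fun_smooth[OF Cons.prems] lm])
    also have "(LINT x|lebesgue_on U. iter_pd [j] \<phi> x * iter_pd js \<psi> x) =
       (-1)^(length js) * (LINT x|lebesgue_on U. iter_pd (rev js) (iter_pd [j] \<phi>) x * \<psi> x)"
      by (rule Cons.IH[OF test_fun_iter_pd[OF Cons.prems]])
    finally show ?case by (simp add: iter_pd_append)
  qed
qed

lemma wD_test:
  assumes "test_fun U \<phi>"
  shows "L2fun U (wD U js \<phi>)" "AE x in lebesgue_on U. wD U js \<phi> x = iter_pd (rev js) \<phi> x"
  by (rule wD_eq[OF test_pd_L2[OF assms] weak_D_test[OF assms]])+

lemma test_sob:
  assumes "test_fun U \<phi>" shows "sob U m \<phi>"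
  unfolding sob_def using test_L2[OF assms] test_pd_L2[OF assms] weak_D_test[OF assms] by blast

lemma finite_short_lists: "finite {js :: 'n list. length js \<le> m}"
  using finite_lists_length_le[of "UNIV :: 'n set" m] by simp

lemma wD_le_sob_norm:
  fixes js :: "'n list"
  assumes "length js \<le> m" shows "L2n U (wD U js u) \<le> sob_norm U m u"
proof -
  have "(L2n U (wD U js u))^2 \<le> (\<Sum>js\<in>{js::'n list. length js \<le> m}. (L2n U (wD U js u))^2)"
    using assms by (intro member_le_sum finite_short_lists) auto
  then show ?thesis unfolding sob_norm_def by (rule real_le_rsqrt)
qed

lemma sob_norm_nonneg: "0 \<le> sob_norm U m u"
  unfolding sob_norm_def by (intro real_sqrt_ge_zero sum_nonneg) simp

lemma sob0_sob: "sob0 U m u \<Longrightarrow> sob U m u"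
  by (simp add: sob0_def)

text \<open>The Sobolev norm of the difference dominates each of its weak derivatives. These agree
  with the differences of weak derivatives only almost everywhere, which is enough for equal L2
  norms.\<close>

lemma sob0_approx:
  assumes "sob0 U m u"
  obtains \<phi>s where "\<And>i. test_fun U (\<phi>s i)"
    "\<And>js :: 'n list. length js \<le> m \<Longrightarrow> (\<lambda>i. L2n U (\<lambda>x. wD U js (\<phi>s i) x - wD U js u x)) \<longlonglongrightarrow> 0"
proof -
  obtain \<phi>s where p: "\<And>i. test_fun U (\<phi>s i)" "(\<lambda>i. sob_norm U m (\<lambda>x. \<phi>s i x - u x)) \<longlonglongrightarrow> 0"
    using assms unfolding sob0_def by auto
  have "(\<lambda>i. L2n U (\<lambda>x. wD U js (\<phi>s i) x - wD U js u x)) \<longlonglongrightarrow> 0" if l: "length js \<le> m" for js :: "'n list"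
  proof (rule tendsto_sandwich[OF _ _ tendsto_const p(2)])
    have "L2n U (\<lambda>x. wD U js (\<phi>s i) x - wD U js u x) = L2n U (wD U js (\<lambda>x. \<phi>s i x - u x))" for i
    proof (rule L2n_cong_AE(2)[symmetric])
      note w = wD_diff[OF test_sob[OF p(1)] sob0_sob[OF assms] l, of i]
      show "L2fun U (wD U js (\<lambda>x. \<phi>s i x - u x))" by (rule w(1))
      show "AE x in lebesgue_on U. wD U js (\<lambda>x. \<phi>s i x - u x) x = wD U js (\<phi>s i) x - wD U js u x" by (rule w(2))
      show "(\<lambda>x. wD U js (\<phi>s i) x - wD U js u x) \<in> borel_measurable (lebesgue_on U)"
        by (intro L2fun_meas L2fun_diff(1) wD_test(1)[OF p(1)] sobD(1)[OF sob0_sob[OF assms] l])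
    qed
    then show "\<forall>\<^sub>F i in sequentially. L2n U (\<lambda>x. wD U js (\<phi>s i) x - wD U js u x) \<le> sob_norm U m (\<lambda>x. \<phi>s i x - u x)"
      using wD_le_sob_norm[OF l] by simp
  qed simp
  then show ?thesis by (intro that[of \<phi>s] p(1))
qed

text \<open>The constant sequence approximates. That \<phi> - \<phi> has norm 0 needs an argument,
  because \<open>wD\<close> of the zero function is again a choice.\<close>

lemma test_sob0:
  assumes "test_fun U \<phi>" shows "sob0 U m \<phi>"
proof -
  have "L2n U (wD U js (\<lambda>x. 0)) = 0" for js :: "'n list"
  proof -
    have "AE x in lebesgue_on U. wD U js (\<lambda>x. 0) x = 0"
      by (rule wD_eq(2)) (simp_all add: weak_D_def)
    moreover have "L2fun U (wD U js (\<lambda>x. 0))" by (rule wD_eq(1)[of "\<lambda>x. 0"]) (simp_all add: weak_D_def)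
    ultimately show ?thesis using L2n_cong_AE(2)[of U "wD U js (\<lambda>x. 0)" "\<lambda>x. 0"] by simp
  qed
  then have "sob_norm U m (\<lambda>x. \<phi> x - \<phi> x) = 0" by (simp add: sob_norm_def)
  then show ?thesis unfolding sob0_def using test_sob[OF assms] assms
    by (intro conjI exI[of _ "\<lambda>_. \<phi>"]) simp_all
qed

section \<open>Limits in L2, integration by parts and the Poincare inequality\<close>

lemma L2_tendsto_mult:
  fixes f g :: "real^'n \<Rightarrow> real"
  assumes "L2fun U g" "L2fun U f" "\<And>i. L2fun U (fs i)" "(\<lambda>i. L2n U (\<lambda>x. fs i x - f x)) \<longlonglongrightarrow> 0"
  shows "(\<lambda>i. LINT x|lebesgue_on U. g x * fs i x) \<longlonglongrightarrow> (LINT x|lebesgue_on U. g x * f x)"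
proof (rule Lim_transform)
  show "(\<lambda>i. LINT x|lebesgue_on U. g x * f x) \<longlonglongrightarrow> (LINT x|lebesgue_on U. g x * f x)" by simp
  show "(\<lambda>i. (LINT x|lebesgue_on U. g x * fs i x) - (LINT x|lebesgue_on U. g x * f x)) \<longlonglongrightarrow> 0"
  proof (rule Lim_null_comparison)
    have "norm ((LINT x|lebesgue_on U. g x * fs i x) - (LINT x|lebesgue_on U. g x * f x)) \<le> L2n U g * L2n U (\<lambda>x. fs i x - f x)" for i
    proof -
      have "(LINT x|lebesgue_on U. g x * fs i x) - (LINT x|lebesgue_on U. g x * f x) = (LINT x|lebesgue_on U. g x * (fs i x - f x))"
        using L2_real_integrable(1)[OF assms(1,2)] L2_real_integrable(1)[OF assms(1,3)]
        by (simp add: right_diff_distrib)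
      then show ?thesis using L2_real_integrable(2)[OF assms(1) L2fun_diff(1)[OF assms(3,2)], of i] by simp
    qed
    then show "\<forall>\<^sub>F i in sequentially. norm ((LINT x|lebesgue_on U. g x * fs i x) - (LINT x|lebesgue_on U. g x * f x)) \<le> L2n U g * L2n U (\<lambda>x. fs i x - f x)"
      by simp
    show "(\<lambda>i. L2n U g * L2n U (\<lambda>x. fs i x - f x)) \<longlonglongrightarrow> 0"
      using tendsto_mult_left[OF assms(4), of "L2n U g"] by simp
  qed
qed

lemma L2n_tendsto:
  fixes f :: "real^'n \<Rightarrow> 'b::euclidean_space"
  assumes "L2fun U f" "\<And>i. L2fun U (fs i)" "(\<lambda>i. L2n U (\<lambda>x. fs i x - f x)) \<longlonglongrightarrow> 0"
  shows "(\<lambda>i. L2n U (fs i)) \<longlonglongrightarrow> L2n U f"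
proof (rule Lim_transform)
  show "(\<lambda>i. L2n U f) \<longlonglongrightarrow> L2n U f" by simp
  show "(\<lambda>i. L2n U (fs i) - L2n U f) \<longlonglongrightarrow> 0"
  proof (rule Lim_null_comparison[OF _ assms(3)])
    have "norm (L2n U (fs i) - L2n U f) \<le> L2n U (\<lambda>x. fs i x - f x)" for i
    proof -
      have d: "L2fun U (\<lambda>x. fs i x - f x)" by (rule L2fun_diff(1)[OF assms(2,1)])
      have "L2n U (fs i) \<le> L2n U (\<lambda>x. fs i x - f x) + L2n U f"
        using L2fun_add(2)[OF d assms(1)] by simp
      moreover have "L2n U f \<le> L2n U (fs i) + L2n U (\<lambda>x. fs i x - f x)"
        using L2fun_diff(2)[OF assms(2)[of i] d] by simp
      ultimately show ?thesis by simp
    qed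
    then show "\<forall>\<^sub>F i in sequentially. norm (L2n U (fs i) - L2n U f) \<le> L2n U (\<lambda>x. fs i x - f x)" by simp
  qed
qed

text \<open>For test functions in place of \<open>v\<close> this is the definition of the weak
  derivative of \<xi>, after exchanging two classical derivatives; both sides are continuous in the
  L2 norms in which test functions approximate \<open>v\<close>.\<close>

lemma sob0_by_parts:
  assumes \<xi>: "sob U 1 \<xi>" and v: "sob0 U 2 v"
  shows "(LINT x|lebesgue_on U. \<xi> x * wD U [i, j] v x) = - (LINT x|lebesgue_on U. wD U [i] \<xi> x * wD U [j] v x)"
proof -
  obtain \<phi>s where p: "\<And>n. test_fun U (\<phi>s n)"
    "\<And>js :: 'n list. length js \<le> 2 \<Longrightarrow> (\<lambda>n. L2n U (\<lambda>x. wD U js (\<phi>s n) x - wD U js v x)) \<longlonglongrightarrow> 0"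
    using sob0_approx[OF v] by blast
  note \<xi>1 = sob_L2[OF \<xi>] and \<xi>2 = sobD[OF \<xi>, of "[i]", simplified]
  have eq: "(LINT x|lebesgue_on U. \<xi> x * wD U [i, j] (\<phi>s n) x) = - (LINT x|lebesgue_on U. wD U [i] \<xi> x * wD U [j] (\<phi>s n) x)" for n
  proof -
    note m = L2fun_meas[OF \<xi>1] L2fun_meas[OF \<xi>2(1)] L2fun_meas[OF wD_test(1)[OF p(1)]] L2fun_meas[OF test_pd_L2[OF p(1)]]
    have "(LINT x|lebesgue_on U. \<xi> x * wD U [i, j] (\<phi>s n) x) = (LINT x|lebesgue_on U. \<xi> x * iter_pd [j, i] (\<phi>s n) x)"
      using wD_test(2)[OF p(1), of "[i,j]" n] by (intro integral_cong_AE borel_measurable_times m) auto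
    also have "\<dots> = (LINT x|lebesgue_on U. \<xi> x * iter_pd [i] (iter_pd [j] (\<phi>s n)) x)"
      by (simp only: pd_commute[OF test_fun_smooth[OF p(1)], of j i] iter_pd_Cons[of i "[j]"])
    also have "\<dots> = - (LINT x|lebesgue_on U. wD U [i] \<xi> x * iter_pd [j] (\<phi>s n) x)"
      using \<xi>2(2) test_fun_iter_pd[OF p(1)] by (simp add: weak_D_def)
    also have "(LINT x|lebesgue_on U. wD U [i] \<xi> x * iter_pd [j] (\<phi>s n) x) = (LINT x|lebesgue_on U. wD U [i] \<xi> x * wD U [j] (\<phi>s n) x)"
      using wD_test(2)[OF p(1), of "[j]" n] by (intro integral_cong_AE borel_measurable_times m) auto
    finally show ?thesis .
  qed
  have 1: "(\<lambda>n. LINT x|lebesgue_on U. \<xi> x * wD U [i, j] (\<phi>s n) x) \<longlonglongrightarrow> (LINT x|lebesgue_on U. \<xi> x * wD U [i, j] v x)"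
    by (rule L2_tendsto_mult[OF \<xi>1 sobD(1)[OF sob0_sob[OF v]] wD_test(1)[OF p(1)] p(2)]) simp_all
  have 2: "(\<lambda>n. LINT x|lebesgue_on U. wD U [i] \<xi> x * wD U [j] (\<phi>s n) x) \<longlonglongrightarrow> (LINT x|lebesgue_on U. wD U [i] \<xi> x * wD U [j] v x)"
    by (rule L2_tendsto_mult[OF \<xi>2(1) sobD(1)[OF sob0_sob[OF v]] wD_test(1)[OF p(1)] p(2)]) simp_all
  show ?thesis
    using LIMSEQ_unique[OF 1[unfolded eq] tendsto_minus[OF 2]] .
qed

lemma coord_bound:
  obtains R where "R > 0" "\<And>x j. x \<in> U \<Longrightarrow> \<bar>x $ j\<bar> \<le> R"
proof -
  obtain R where R: "R > 0" "\<forall>x\<in>U. norm x \<le> R" using bd unfolding bounded_pos by auto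
  have "\<bar>x $ j\<bar> \<le> R" if "x \<in> U" for x j
    using order_trans[OF component_le_norm_cart] R(2) that by blast
  then show ?thesis using that[OF R(1)] by simp
qed

text \<open>The j-th derivative of x_j v^2 has integral 0, which expresses the squared norm of
  \<open>v\<close> by the product of x_j v and the derivative of \<open>v\<close>. Cauchy-Schwarz
  and one division by the norm finish.\<close>

lemma poincare_test:
  assumes R: "\<And>x j. x \<in> U \<Longrightarrow> \<bar>x $ j\<bar> \<le> R" and t: "test_fun U v"
  shows "L2n U v \<le> 2 * R * L2n U (iter_pd [j] v)"
proof -
  note sm = test_fun_smooth[OF t]
  note L = test_L2[OF t] test_pd_L2[OF t, of "[j]"]
  have e: "iter_pd [j] (\<lambda>x. (x $ j * v x) * v x) = (\<lambda>x. (x $ j * v x) * iter_pd [j] v x + (x $ j * iter_pd [j] v x + v x) * v x)"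
  proof
    fix x
    have "iter_pd [j] (\<lambda>x. (x $ j * v x) * v x) x = (x $ j * v x) * iter_pd [j] v x + iter_pd [j] (\<lambda>x. x $ j * v x) x * v x"
      by (rule pd_mult(1)) (intro smooth_differentiable smooth_mult smooth_nth sm)+
    moreover have "iter_pd [j] (\<lambda>x. x $ j * v x) x = x $ j * iter_pd [j] v x + iter_pd [j] (\<lambda>x. x $ j) x * v x"
      by (rule pd_mult(1)) (intro smooth_differentiable smooth_nth sm)+
    ultimately show "iter_pd [j] (\<lambda>x. (x $ j * v x) * v x) x = (x $ j * v x) * iter_pd [j] v x + (x $ j * iter_pd [j] v x + v x) * v x"
      by (simp add: pd_nth)
  qed
  have tt: "test_fun U (\<lambda>x. (x $ j * v x) * v x)"
    by (rule test_fun_mult_smooth[OF t]) (intro smooth_mult smooth_nth sm)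
  have L3: "L2fun U (\<lambda>x. x $ j * v x)" by (rule test_L2[OF test_fun_mult_smooth[OF t smooth_nth]])
  have i1: "integrable (lebesgue_on U) (\<lambda>x. (x $ j * v x) * iter_pd [j] v x)" by (rule L2_real_integrable(1)[OF L3 L(2)])
  have i2: "integrable (lebesgue_on U) (\<lambda>x. v x * v x)" by (rule L2_real_integrable(1)[OF L(1) L(1)])
  have "0 = (LINT x|lebesgue_on U. 2 * ((x $ j * v x) * iter_pd [j] v x) + v x * v x)"
    using test_fun_integral_pd[OF tt sets_leb, of j] unfolding e by (simp add: algebra_simps)
  also have "\<dots> = 2 * (LINT x|lebesgue_on U. (x $ j * v x) * iter_pd [j] v x) + (LINT x|lebesgue_on U. v x * v x)"
    using i1 i2 by simp
  finally have "(L2n U v)^2 = - 2 * (LINT x|lebesgue_on U. (x $ j * v x) * iter_pd [j] v x)"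
    unfolding L2n_sq by (simp add: power2_eq_square)
  also have "\<dots> \<le> 2 * (L2n U (\<lambda>x. x $ j * v x) * L2n U (iter_pd [j] v))"
    using L2_real_integrable(2)[OF L3 L(2)] by linarith
  also have "L2n U (\<lambda>x. x $ j * v x) \<le> R * L2n U v"
  proof -
    have R0: "L2n U (\<lambda>x. R *\<^sub>R v x) = \<bar>R\<bar> * L2n U v" "L2fun U (\<lambda>x. R *\<^sub>R v x)" using L2fun_scale[OF L(1)] by auto
    \<comment> \<open>The bound on the coordinates settles the sign of \<open>R\<close> only if
      there is a point; on an empty domain all norms are 0.\<close>
    have Rn: "0 \<le> R" if "x \<in> U" for x using R[OF that, of j] by linarith
    have "AE x in lebesgue_on U. norm (x $ j * v x) \<le> norm (R *\<^sub>R v x)"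
      using R Rn by (intro AE_I2) (auto simp: abs_mult intro!: mult_right_mono)
    from L2fun_mono(2)[OF R0(2) L2fun_meas[OF L3] this] show ?thesis
    proof (cases "U = {}")
      case True then show ?thesis by (simp add: L2n_def)
    next
      case False
      then have "\<bar>R\<bar> = R" using Rn by auto
      then show ?thesis using \<open>L2n U (\<lambda>x. x $ j * v x) \<le> L2n U (\<lambda>x. R *\<^sub>R v x)\<close> R0(1) by simp
    qed
  qed
  finally have "(L2n U v)^2 \<le> (2 * R * L2n U (iter_pd [j] v)) * L2n U v"
    by (simp add: mult_right_mono algebra_simps)
  then show ?thesis
  proof (cases "L2n U v = 0")
    case True
    have "0 \<le> R * L2n U (iter_pd [j] v)"
    proof (cases "U = {}")
      case True then show ?thesis by (simp add: L2n_def)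
    next
      case False
      then obtain x where "x \<in> U" by blast
      then have "0 \<le> R" using R[of x j] by linarith
      then show ?thesis by simp
    qed
    then show ?thesis using True by simp
  next
    case False
    then have "L2n U v > 0" by (simp add: order_less_le)
    then show ?thesis using \<open>(L2n U v)^2 \<le> (2 * R * L2n U (iter_pd [j] v)) * L2n U v\<close>
      by (simp add: power2_eq_square)
  qed
qed

text \<open>The inequality is applied to the first derivative of an approximating test function in
  that same direction, so only a pure second derivative appears on the right; both sides pass to the
  limit.\<close>

lemma poincare_sob0:
  obtains C where "C \<ge> 0" "\<And>v j. sob0 U 2 v \<Longrightarrow> L2n U (wD U [j] v) \<le> C * L2n U (wD U [j, j] v)"
proof -
  obtain R where R: "R > 0" "\<And>x j. x \<in> U \<Longrightarrow> \<bar>x $ j\<bar> \<le> R" using coord_bound by blast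
  have "L2n U (wD U [j] v) \<le> 2 * R * L2n U (wD U [j, j] v)" if v: "sob0 U 2 v" for v j
  proof -
    obtain \<phi>s where p: "\<And>n. test_fun U (\<phi>s n)"
      "\<And>js :: 'n list. length js \<le> 2 \<Longrightarrow> (\<lambda>n. L2n U (\<lambda>x. wD U js (\<phi>s n) x - wD U js v x)) \<longlonglongrightarrow> 0"
      using sob0_approx[OF v] by blast
    have l: "(\<lambda>n. L2n U (wD U js (\<phi>s n))) \<longlonglongrightarrow> L2n U (wD U js v)" if "length js \<le> 2" for js
      by (rule L2n_tendsto[OF sobD(1)[OF sob0_sob[OF v] that] wD_test(1)[OF p(1)] p(2)[OF that]])
    have "L2n U (wD U [j] (\<phi>s n)) \<le> 2 * R * L2n U (wD U [j, j] (\<phi>s n))" for n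
    proof -
      have "L2n U (wD U js (\<phi>s n)) = L2n U (iter_pd (rev js) (\<phi>s n))" for js
        by (rule L2n_cong_AE(2)[OF wD_test(1)[OF p(1)] L2fun_meas[OF test_pd_L2[OF p(1)]] wD_test(2)[OF p(1)]])
      from this[of "[j]"] this[of "[j,j]"] show ?thesis
        using poincare_test[OF R(2) test_fun_iter_pd[OF p(1), of "[j]" n], of j]
        by (simp add: iter_pd_Cons[of j "[j]"])
    qed
    then show ?thesis
      by (intro LIMSEQ_le[OF l tendsto_mult_left[OF l]]) auto
  qed
  then show ?thesis using that[of "2 * R"] R(1) by simp
qed

end

section \<open>Averages on a convex domain\<close>

locale convex_domain = bounded_open U for U :: "(real^'n) set" +
  assumes conv: "convex U" and ne: "U \<noteq> {}" and dim: "CARD('n) \<le> 3"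
begin

text \<open>A bump is non-negative and positive on a non-empty open box, so its integral is not 0
  and it can be normalised.\<close>

lemma eta_exists: "\<exists>\<eta>. test_fun U \<eta> \<and> (LINT x|lborel. \<eta> x) = 1"
proof -
  obtain p where "p \<in> U" using ne by blast
  then obtain a b where ab: "p \<in> box a b" "cbox a b \<subseteq> U"
    using open_contains_cbox[of U p] op by metis
  define B where "B = bump 1 a b"
  have t: "test_fun U B" unfolding B_def by (rule bump_test) (use ab in auto)
  have nn: "0 \<le> B x" for x unfolding B_def using bump_range[of 1 a b x] by simp
  have i: "integrable lborel B" by (rule test_fun_integrable_lborel[OF t])
  have "(LINT x|lborel. B x) \<noteq> 0"
  proof
    assume "(LINT x|lborel. B x) = 0"
    then have "AE x in lborel. B x = 0"
      using integral_nonneg_eq_0_iff_AE[OF i] nn by simp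
    then have "AE x in lborel. x \<notin> box a b"
      by eventually_elim (use bump_pos[of _ a b 1] in \<open>force simp: B_def\<close>)
    then have "box a b \<in> null_sets lborel"
      by (subst (asm) AE_iff_null_sets[symmetric]) simp_all
    then have "box a b \<in> null_sets lebesgue" by (rule null_sets_completionI)
    then show False using ab(1) open_not_negligible[OF open_box, of a b] by (auto simp: negligible_iff_null_sets)
  qed
  then have "(LINT x|lborel. (1 / (LINT x|lborel. B x)) * B x) = 1" by simp
  then show ?thesis using test_fun_scale[OF t] by blast
qed

definition eta :: "real^'n \<Rightarrow> real" where
  "eta = (SOME \<eta>. test_fun U \<eta> \<and> (LINT x|lborel. \<eta> x) = 1)"

lemma eta_test: "test_fun U eta" and eta_int: "(LINT x|lborel. eta x) = 1"
  using someI_ex[OF eta_exists] by (simp_all add: eta_def)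

lemma eta_smooth: "smooth_fun eta" by (rule test_fun_smooth[OF eta_test])

definition dia :: real where "dia = diameter U + 1"

lemma dia: "dia > 0" "x \<in> U \<Longrightarrow> y \<in> U \<Longrightarrow> norm (x - y) \<le> dia"
  using diameter_ge_0[OF bd] diameter_bounded_bound[OF bd, of x y] by (auto simp: dia_def dist_norm)

text \<open>The weight \<open>eta\<close> transported to the copy of the domain shrunk by \<open>r\<close> towards \<open>x\<close>; by
  convexity its support stays in the domain. The derivative of \<open>ker x r\<close> with respect to \<open>r\<close> is minus the
  divergence of the fields \<open>fld i x r\<close>.\<close>

definition ker :: "real^'n \<Rightarrow> real \<Rightarrow> real^'n \<Rightarrow> real" where
  "ker x r z = 1 / r^CARD('n) * eta (x + (1/r) *\<^sub>R (z - x))"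

definition fld :: "'n \<Rightarrow> real^'n \<Rightarrow> real \<Rightarrow> real^'n \<Rightarrow> real" where
  "fld i x r z = (1 / r^(CARD('n)+1) * eta (x + (1/r) *\<^sub>R (z - x))) * (z $ i - x $ i)"

lemma eta_affine: "smooth_fun (\<lambda>z. eta (x + (1/r) *\<^sub>R (z - x)))"
proof -
  have "(\<lambda>z. eta (x + (1/r) *\<^sub>R (z - x))) = (\<lambda>z. eta ((1/r) *\<^sub>R z + (x - (1/r) *\<^sub>R x)))"
    by (rule ext) (simp add: scaleR_diff_right algebra_simps)
  then show ?thesis using smooth_affine[OF eta_smooth, of "1/r" "x - (1/r) *\<^sub>R x"] by simp
qed

lemma ker_smooth: "smooth_fun (ker x r)"
  unfolding ker_def[abs_def] by (rule smooth_scale[OF eta_affine])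

lemma fld_smooth: "smooth_fun (fld i x r)"
  unfolding fld_def[abs_def] by (intro smooth_mult smooth_const smooth_diff smooth_nth eta_affine)

text \<open>The point y is z pushed away from x by the factor 1/r; solving for z gives a convex
  combination of x and y.\<close>

lemma convex_pull:
  assumes "x \<in> U" "0 < r" "r \<le> 1" "x + (1/r) *\<^sub>R (z - x) = y" "y \<in> U"
  shows "z = (1 - r) *\<^sub>R x + r *\<^sub>R y" "z \<in> U"
proof -
  have "r *\<^sub>R y = r *\<^sub>R x + (z - x)" using assms(2) by (simp flip: assms(4) add: scaleR_add_right)
  then show z: "z = (1 - r) *\<^sub>R x + r *\<^sub>R y" by (simp add: scaleR_diff_left)
  show "z \<in> U" unfolding z
    by (rule convexD[OF conv assms(1,5)]) (use assms(2,3) in auto)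
qed

text \<open>The support of \<psi> lies in the contraction by r of the support of \<open>eta\<close>
  towards \<open>x\<close>, which is compact and stays in \<open>U\<close> by convexity.\<close>

lemma test_of_eta_support:
  assumes "x \<in> U" "0 < r" "r \<le> 1" "smooth_fun \<psi>" "\<And>z. eta (x + (1/r) *\<^sub>R (z - x)) = 0 \<Longrightarrow> \<psi> z = 0"
  shows "test_fun U \<psi>"
proof -
  obtain K where K: "compact K \<and> K \<subseteq> U \<and> (\<forall>x. x \<notin> K \<longrightarrow> eta x = 0) \<and> (\<forall>x js. x \<notin> K \<longrightarrow> iter_pd js eta x = 0)"
    using test_fun_support[OF eta_test] by (rule exE)
  let ?K = "(\<lambda>y. (1 - r) *\<^sub>R x + r *\<^sub>R y) ` K"
  show ?thesis
  proof (rule test_funI[of _ ?K])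
    show "compact ?K" using K by (intro compact_continuous_image continuous_intros) auto
    show "?K \<subseteq> U"
    proof clarify
      fix y assume "y \<in> K"
      then show "(1 - r) *\<^sub>R x + r *\<^sub>R y \<in> U" using K assms(1-3) by (intro convexD[OF conv]) auto
    qed
    fix z assume "\<psi> z \<noteq> 0"
    then have y: "x + (1/r) *\<^sub>R (z - x) \<in> K" using assms(5) K by blast
    then have "z = (1 - r) *\<^sub>R x + r *\<^sub>R (x + (1/r) *\<^sub>R (z - x))"
      using convex_pull(1)[OF assms(1-3) refl] K by blast
    then show "z \<in> ?K" using y by blast
  qed (rule assms(4))
qed

lemma fld_test: "x \<in> U \<Longrightarrow> 0 < r \<Longrightarrow> r \<le> 1 \<Longrightarrow> test_fun U (fld i x r)"
  by (rule test_of_eta_support[OF _ _ _ fld_smooth], assumption+) (simp only: fld_def mult_zero_right mult_zero_left)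

text \<open>The derivative of \<open>ker\<close> in the radius, written out by the product rule.
  This form is easily bounded for radii away from 0, while the divergence form of
  \<open>dker_fld\<close> is the one that meets weak derivatives.\<close>

definition dker :: "real^'n \<Rightarrow> real \<Rightarrow> real^'n \<Rightarrow> real" where
  "dker x r z = - (real CARD('n) / r^(CARD('n)+1) * eta (x + (1/r) *\<^sub>R (z - x)))
     - 1 / r^(CARD('n)+2) * (\<Sum>j\<in>UNIV. (z $ j - x $ j) * iter_pd [j] eta (x + (1/r) *\<^sub>R (z - x)))"

lemma ker_deriv:
  assumes r: "r > 0"
  shows "((\<lambda>r. ker x r z) has_real_derivative dker x r z) (at r)"
proof -
  let ?w = "x + (1/r) *\<^sub>R (z - x)"
  have "((\<lambda>r. x + (1/r) *\<^sub>R (z - x)) has_derivative (\<lambda>h. (h * (- 1 / r^2)) *\<^sub>R (z - x))) (at r)"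
    using r by (auto intro!: derivative_eq_intros simp: power2_eq_square)
  from has_derivative_compose[OF this smooth_has_derivative[OF eta_smooth]]
  have 1: "((\<lambda>r. eta (x + (1/r) *\<^sub>R (z - x))) has_real_derivative
      (- 1 / r^2) * (\<Sum>j\<in>UNIV. (z $ j - x $ j) * iter_pd [j] eta ?w)) (at r)"
    by (rule has_derivative_imp_has_field_derivative) (simp add: sum_distrib_left algebra_simps)
  have dn: "real CARD('n) * r^(CARD('n) - Suc 0) * r^2 = real CARD('n) * r^(CARD('n)+1)"
    by (cases "CARD('n)") (simp_all add: power2_eq_square)
  have "real CARD('n) * r^(CARD('n) - Suc 0) / (r^CARD('n) * r^CARD('n)) = real CARD('n) / r^(CARD('n)+1)"
  proof -
    have "real CARD('n) * r^(CARD('n) - Suc 0) * r^(CARD('n)+1) = real CARD('n) * (r^CARD('n) * r^CARD('n))"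
      by (cases "CARD('n)") simp_all
    then show ?thesis using r by (simp add: field_simps)
  qed
  then have 2: "((\<lambda>r. 1 / r^CARD('n)) has_real_derivative - (real CARD('n) / r^(CARD('n)+1))) (at r)"
    using r by (auto intro!: derivative_eq_intros)
  show ?thesis unfolding ker_def[abs_def] dker_def
    by (rule DERIV_cong[OF DERIV_mult[OF 2 1]]) (simp add: power2_eq_square)
qed

text \<open>The divergence of z - x is the dimension, which matches the derivative of the factor
  1/r^d; the gradient of \<open>eta\<close> contributes the same sum on both sides.\<close>

lemma dker_fld:
  assumes r: "r > 0"
  shows "dker x r z = - (\<Sum>i\<in>UNIV. iter_pd [i] (fld i x r) z)"
proof -
  let ?w = "x + (1/r) *\<^sub>R (z - x)"
  have e: "(\<lambda>z. 1 / r^(CARD('n)+1) * eta (x + (1/r) *\<^sub>R (z - x))) = (\<lambda>z. 1 / r^(CARD('n)+1) * eta ((1/r) *\<^sub>R z + (x - (1/r) *\<^sub>R x)))"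
    by (rule ext) (simp add: scaleR_diff_right algebra_simps)
  have w: "(1/r) *\<^sub>R z + (x - (1/r) *\<^sub>R x) = ?w" by (simp add: scaleR_diff_right)
  have "iter_pd [i] (fld i x r) z = 1 / r^(CARD('n)+2) * ((z $ i - x $ i) * iter_pd [i] eta ?w) + 1 / r^(CARD('n)+1) * eta ?w" for i
  proof -
    have s1: "smooth_fun (\<lambda>z. 1 / r^(CARD('n)+1) * eta (x + (1/r) *\<^sub>R (z - x)))" by (intro smooth_scale eta_affine)
    have s2: "smooth_fun (\<lambda>z. z $ i - x $ i)" by (intro smooth_diff smooth_nth smooth_const)
    have a: "iter_pd [i] (\<lambda>z. 1 / r^(CARD('n)+1) * eta (x + (1/r) *\<^sub>R (z - x))) z = 1 / r^(CARD('n)+1) * (1/r) * iter_pd [i] eta ?w"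
      unfolding e pd_affine(1)[OF eta_smooth] w ..
    have "((\<lambda>z. z $ i - x $ i) has_derivative (\<lambda>v. v $ i)) (at z)"
      using has_derivative_diff[OF bounded_linear_imp_has_derivative[OF bounded_linear_vec_nth[of i]] has_derivative_const]
      by simp
    from pd_eqI[OF this] have b: "iter_pd [i] (\<lambda>z. z $ i - x $ i) z = 1" by simp
    have "iter_pd [i] (fld i x r) z = (1 / r^(CARD('n)+1) * eta ?w) * iter_pd [i] (\<lambda>z. z $ i - x $ i) z
       + iter_pd [i] (\<lambda>z. 1 / r^(CARD('n)+1) * eta (x + (1/r) *\<^sub>R (z - x))) z * (z $ i - x $ i)"
      unfolding fld_def[abs_def] by (rule pd_mult(1)[OF smooth_differentiable[OF s1] smooth_differentiable[OF s2]])
    then show ?thesis unfolding a b by (simp add: ac_simps)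
  qed
  then show ?thesis by (simp add: dker_def sum.distrib sum_distrib_left)
qed

text \<open>A weighted mean of \<open>u\<close> over the copy of the domain shrunk by
  \<open>r\<close> towards \<open>x\<close>. For r = 1 it does not depend on \<open>x\<close>; small
  radii recover \<open>u\<close>.\<close>

definition av :: "(real^'n \<Rightarrow> real) \<Rightarrow> real \<Rightarrow> real^'n \<Rightarrow> real" where
  "av u r x = (LINT z|lebesgue_on U. u z * ker x r z)"

definition Gm :: "(real^'n \<Rightarrow> real) \<Rightarrow> real^'n \<Rightarrow> real" where
  "Gm u z = (\<Sum>i\<in>UNIV. \<bar>wD U [i] u z\<bar>)"

lemma Gm_nonneg: "0 \<le> Gm u z" by (simp add: Gm_def sum_nonneg)

lemma Gm_L2: "sob U 1 u \<Longrightarrow> L2fun U (Gm u)"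
  unfolding Gm_def[abs_def]
  using L2fun_sum[of UNIV U "\<lambda>i z. \<bar>wD U [i] u z\<bar>"] L2fun_norm(1)[OF sobD(1)[of 1 u]] by simp

lemma meas_M: "f \<in> borel_measurable borel \<Longrightarrow> f \<in> borel_measurable (lebesgue_on U)"
  for f :: "real^'n \<Rightarrow> real"
  by (intro measurable_restrict_space1 measurable_completion) simp

lemma bounded_L2:
  fixes f :: "real^'n \<Rightarrow> real"
  assumes "f \<in> borel_measurable (lebesgue_on U)" "\<And>x. x \<in> U \<Longrightarrow> \<bar>f x\<bar> \<le> B"
  shows "L2fun U f"
  by (rule L2fun_mono(1)[OF L2_const[of B] assms(1)]) (rule AE_I2, use assms(2) in force)

lemma eta_bounds:
  obtains B where "B > 0" "\<And>x. \<bar>eta x\<bar> \<le> B" "\<And>x j. \<bar>iter_pd [j] eta x\<bar> \<le> B"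
proof -
  obtain B0 where B0: "B0 > 0" "\<And>x. \<bar>eta x\<bar> \<le> B0" using test_fun_bounded[OF eta_test] by metis
  have "\<forall>j. \<exists>B>0. \<forall>x. \<bar>iter_pd [j] eta x\<bar> \<le> B" using test_fun_bounded[OF test_fun_iter_pd[OF eta_test]] by metis
  then obtain b where b: "\<And>j. b j > 0" "\<And>j x. \<bar>iter_pd [j] eta x\<bar> \<le> b j" by metis
  have "b j \<le> (\<Sum>j\<in>UNIV. b j)" for j by (rule member_le_sum) (use b(1) in \<open>auto simp: less_imp_le\<close>)
  moreover have "0 \<le> (\<Sum>j\<in>UNIV. b j)" by (rule sum_nonneg) (use b(1) in \<open>simp add: less_imp_le\<close>)
  ultimately show ?thesis using that[of "B0 + (\<Sum>j\<in>UNIV. b j)"] B0 b(2) by (smt (verit, ccfv_threshold))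
qed

lemma dker_measurable: "r > 0 \<Longrightarrow> dker x r \<in> borel_measurable borel"
proof -
  assume r: "r > 0"
  have "dker x r = (\<lambda>z. - (\<Sum>i\<in>UNIV. iter_pd [i] (fld i x r) z))" using dker_fld[OF r] by blast
  then show ?thesis
    using borel_measurable_sum[of UNIV "\<lambda>i. iter_pd [i] (fld i x r)" borel] smooth_measurable[OF smooth_iter_pd[OF fld_smooth]]
    by simp
qed

lemma dker_bound:
  assumes x: "x \<in> U" and a: "a > 0"
  obtains K where "\<And>r z. r > a \<Longrightarrow> z \<in> U \<Longrightarrow> \<bar>dker x r z\<bar> \<le> K"
proof -
  obtain B where B: "B > 0" "\<And>x. \<bar>eta x\<bar> \<le> B" "\<And>x j. \<bar>iter_pd [j] eta x\<bar> \<le> B" using eta_bounds by metis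
  have "\<bar>dker x r z\<bar> \<le> real CARD('n) / a^(CARD('n)+1) * B + 1 / a^(CARD('n)+2) * (real CARD('n) * (dia * B))" if "r > a" "z \<in> U" for r z
  proof -
    let ?w = "x + (1/r) *\<^sub>R (z - x)"
    have "\<bar>\<Sum>j\<in>UNIV. (z $ j - x $ j) * iter_pd [j] eta ?w\<bar> \<le> (\<Sum>j\<in>(UNIV::'n set). dia * B)"
    proof (rule order_trans[OF sum_abs], rule sum_mono)
      fix j :: 'n
      have "\<bar>z $ j - x $ j\<bar> \<le> dia"
        using component_le_norm_cart[of "z - x" j] dia(2)[OF \<open>z \<in> U\<close> x] by simp
      then show "\<bar>(z $ j - x $ j) * iter_pd [j] eta ?w\<bar> \<le> dia * B"
        using B(3)[of j ?w] unfolding abs_mult by (intro mult_mono) auto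
    qed
    then have 1: "\<bar>\<Sum>j\<in>UNIV. (z $ j - x $ j) * iter_pd [j] eta ?w\<bar> \<le> real CARD('n) * (dia * B)" by simp
    have 2: "1 / r^m \<le> 1 / a^m" for m using that(1) a by (intro divide_left_mono power_mono mult_pos_pos zero_less_power) auto
    have r: "r > 0" using that a by simp
    have "\<bar>dker x r z\<bar> \<le> \<bar>real CARD('n) / r^(CARD('n)+1) * eta ?w\<bar> + \<bar>1 / r^(CARD('n)+2) * (\<Sum>j\<in>UNIV. (z $ j - x $ j) * iter_pd [j] eta ?w)\<bar>"
      unfolding dker_def by (rule order_trans[OF abs_triangle_ineq4]) simp
    also have "\<dots> \<le> real CARD('n) / a^(CARD('n)+1) * B + 1 / a^(CARD('n)+2) * (real CARD('n) * (dia * B))"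
    proof (intro add_mono)
      have "\<bar>real CARD('n) / r^(CARD('n)+1) * eta ?w\<bar> = real CARD('n) * (1 / r^(CARD('n)+1)) * \<bar>eta ?w\<bar>" using r by (simp add: abs_mult)
      also have "\<dots> \<le> real CARD('n) * (1 / a^(CARD('n)+1)) * B"
        by (intro mult_mono 2 B(2)) (use a r in auto)
      finally show "\<bar>real CARD('n) / r^(CARD('n)+1) * eta ?w\<bar> \<le> real CARD('n) / a^(CARD('n)+1) * B" by simp
      have "\<bar>1 / r^(CARD('n)+2) * (\<Sum>j\<in>UNIV. (z $ j - x $ j) * iter_pd [j] eta ?w)\<bar>
          = 1 / r^(CARD('n)+2) * \<bar>\<Sum>j\<in>UNIV. (z $ j - x $ j) * iter_pd [j] eta ?w\<bar>" using r by (simp add: abs_mult)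
      also have "\<dots> \<le> 1 / a^(CARD('n)+2) * (real CARD('n) * (dia * B))"
        by (intro mult_mono 2 1) (use a in auto)
      finally show "\<bar>1 / r^(CARD('n)+2) * (\<Sum>j\<in>UNIV. (z $ j - x $ j) * iter_pd [j] eta ?w)\<bar> \<le> 1 / a^(CARD('n)+2) * (real CARD('n) * (dia * B))" .
    qed
    finally show ?thesis .
  qed
  then show ?thesis using that by blast
qed

lemma ker_L2: "L2fun U (ker x r)"
proof -
  obtain B where B: "B > 0" "\<And>x. \<bar>eta x\<bar> \<le> B" "\<And>x j. \<bar>iter_pd [j] eta x\<bar> \<le> B" using eta_bounds by metis
  show ?thesis
  proof (rule bounded_L2[OF meas_M[OF smooth_measurable[OF ker_smooth]]])
    show "\<bar>ker x r z\<bar> \<le> \<bar>1 / r^CARD('n)\<bar> * B" for z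
      unfolding ker_def abs_mult by (rule mult_left_mono[OF B(2)]) simp
  qed
qed

lemma av_deriv:
  assumes u: "L2fun U u" and x: "x \<in> U" and r: "r > 0"
  shows "((\<lambda>r. av u r x) has_real_derivative (LINT z|lebesgue_on U. u z * dker x r z)) (at r)"
proof -
  \<comment> \<open>Radii between r/2 and 2r stay away from the singularity of the kernel at 0 and
    share one integrable bound.\<close>
  obtain K where K: "\<And>s z. s > r/2 \<Longrightarrow> z \<in> U \<Longrightarrow> \<bar>dker x s z\<bar> \<le> K" using dker_bound[OF x, of "r/2"] r by auto
  show ?thesis unfolding av_def
  proof (rule has_derivative_lebesgue_integral[where a="r/2" and b="2*r" and G="\<lambda>z. \<bar>u z\<bar> * K"])
    show "((\<lambda>t. u z * ker x t z) has_real_derivative u z * dker x t z) (at t)" if "t \<in> {r/2<..<2*r}" for t z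
      using ker_deriv[of t x z] that r by (intro DERIV_cmult) auto
    show "\<bar>u z * dker x t z\<bar> \<le> \<bar>u z\<bar> * K" if "t \<in> {r/2<..<2*r}" "z \<in> space (lebesgue_on U)" for t z
      unfolding abs_mult by (rule mult_left_mono) (use K that in auto)
    show "integrable (lebesgue_on U) (\<lambda>z. \<bar>u z\<bar> * K)"
      using L2_integrable[OF u] by (intro integrable_mult_left integrable_abs)
    show "integrable (lebesgue_on U) (\<lambda>z. u z * ker x t z)" for t
      by (rule L2_real_integrable(1)[OF u ker_L2])
    show "(\<lambda>z. u z * dker x r z) \<in> borel_measurable (lebesgue_on U)"
      by (intro borel_measurable_times L2fun_meas[OF u] meas_M dker_measurable r)
  qed (use r in auto)
qed

text \<open>Convexity makes the fields \<open>fld\<close> test functions on \<open>U\<close>, so the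
  divergence can be moved onto \<open>u\<close> as its weak gradient.\<close>

lemma av_deriv_sob:
  assumes u: "sob U 1 u" and x: "x \<in> U" and r: "r > 0" "r \<le> 1"
  shows "(LINT z|lebesgue_on U. u z * dker x r z) = (\<Sum>i\<in>UNIV. LINT z|lebesgue_on U. wD U [i] u z * fld i x r z)"
proof -
  note t = fld_test[OF x r]
  have "(LINT z|lebesgue_on U. u z * dker x r z) = (LINT z|lebesgue_on U. (\<Sum>i\<in>UNIV. - (u z * iter_pd [i] (fld i x r) z)))"
    by (simp add: dker_fld[OF r(1)] sum_distrib_left sum_negf)
  also have "\<dots> = (\<Sum>i\<in>UNIV. LINT z|lebesgue_on U. - (u z * iter_pd [i] (fld i x r) z))"
    by (intro Bochner_Integration.integral_sum Bochner_Integration.integrable_minus L2_real_integrable(1) sob_L2[OF u] test_pd_L2[OF t])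
  also have "\<dots> = (\<Sum>i\<in>UNIV. LINT z|lebesgue_on U. wD U [i] u z * fld i x r z)"
  proof (rule sum.cong[OF refl])
    fix i
    have "(LINT z|lebesgue_on U. u z * iter_pd [i] (fld i x r) z) = (-1)^length [i] * (LINT z|lebesgue_on U. wD U [i] u z * fld i x r z)"
      using sobD(2)[OF u, of "[i]"] t unfolding weak_D_def by simp
    then show "(LINT z|lebesgue_on U. - (u z * iter_pd [i] (fld i x r) z)) = (LINT z|lebesgue_on U. wD U [i] u z * fld i x r z)"
      by simp
  qed
  finally show ?thesis .
qed

text \<open>Where \<open>eta\<close> does not vanish, z - x has length at most r times
  \<open>dia\<close>; this confines the support to a ball and cancels one power of 1/r. Radii
  between s and 2s share the bound.\<close>

lemma fld_bound:
  assumes B: "\<And>x. \<bar>eta x\<bar> \<le> B" and x: "x \<in> U" and s: "0 < s" "s \<le> r" "r \<le> 2 * s"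
  shows "\<bar>fld i x r z\<bar> \<le> B * dia / s^CARD('n) * indicator (cball x (2 * s * dia)) z"
proof (cases "eta (x + (1/r) *\<^sub>R (z - x)) = 0")
  case True
  have "0 \<le> B" using B[of x] by linarith
  then show ?thesis using True dia(1) s by (simp add: fld_def)
next
  case False
  let ?w = "x + (1/r) *\<^sub>R (z - x)"
  have r: "r > 0" using s by simp
  have "?w \<in> U" using False test_fun_outside[OF eta_test] by blast
  then have "norm (?w - x) \<le> dia" using dia(2) x by blast
  then have "(1/r) * norm (z - x) \<le> dia" using r by (simp del: scaleR_diff_right add: norm_scaleR)
  then have nz: "norm (z - x) \<le> r * dia" using r by (simp add: field_simps)
  also have "\<dots> \<le> 2 * s * dia" using s dia(1) by (simp add: mult_right_mono)
  finally have "z \<in> cball x (2 * s * dia)" by (simp add: dist_norm norm_minus_commute)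
  moreover have "\<bar>fld i x r z\<bar> \<le> B * dia / s^CARD('n)"
  proof -
    have "\<bar>fld i x r z\<bar> = 1 / r^(CARD('n)+1) * \<bar>eta ?w\<bar> * \<bar>z $ i - x $ i\<bar>" using r by (simp add: fld_def abs_mult)
    also have "\<dots> \<le> 1 / r^(CARD('n)+1) * B * (r * dia)"
    proof (intro mult_mono B)
      show "\<bar>z $ i - x $ i\<bar> \<le> r * dia" using component_le_norm_cart[of "z - x" i] nz by simp
    qed (use r B[of x] in auto)
    also have "\<dots> = B * dia / r^CARD('n)" using r by simp
    also have "\<dots> \<le> B * dia / s^CARD('n)"
      using s B[of x] dia(1) by (intro divide_left_mono power_mono mult_pos_pos zero_less_power mult_nonneg_nonneg) auto
    finally show ?thesis .
  qed
  ultimately show ?thesis by simp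
qed

lemma cball_ind_L2: "L2fun U (\<lambda>z. indicator (cball x \<rho>) z :: real)"
  by (rule bounded_L2[of _ 1]) (auto intro!: meas_M simp: indicator_def)

text \<open>The mean value theorem in the radius between s and 2s, followed by the field bound at
  the intermediate radius.\<close>

lemma av_diff_bound:
  assumes B: "\<And>x. \<bar>eta x\<bar> \<le> B" and u: "sob U 1 u" and x: "x \<in> U" and s: "0 < s" "2 * s \<le> 1"
  shows "\<bar>av u (2 * s) x - av u s x\<bar> \<le> s * (B * dia / s^CARD('n) * (LINT z|lebesgue_on U. indicator (cball x (2 * s * dia)) z * Gm u z))"
proof -
  let ?I = "LINT z|lebesgue_on U. indicator (cball x (2 * s * dia)) z * Gm u z"
  have "\<exists>r>s. r < 2 * s \<and> av u (2 * s) x - av u s x = (2 * s - s) * (LINT z|lebesgue_on U. u z * dker x r z)"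
    by (rule MVT2) (use s av_deriv[OF sob_L2[OF u] x] in auto)
  then obtain r where r: "s < r" "r < 2 * s" "av u (2 * s) x - av u s x = s * (LINT z|lebesgue_on U. u z * dker x r z)"
    by auto
  have r1: "r > 0" "r \<le> 1" using r s by auto
  have g: "L2fun U (wD U [i] u)" for i by (rule sobD(1)[OF u]) simp
  have ia: "integrable (lebesgue_on U) (\<lambda>z. wD U [i] u z * fld i x r z)" for i
    by (rule L2_real_integrable(1)[OF g test_L2[OF fld_test[OF x r1]]])
  have ib: "integrable (lebesgue_on U) (\<lambda>z. indicator (cball x (2 * s * dia)) z * \<bar>wD U [i] u z\<bar>)" for i
    by (rule L2_real_integrable(1)[OF cball_ind_L2]) (use L2fun_norm(1)[OF g] in simp)
  have "\<bar>LINT z|lebesgue_on U. u z * dker x r z\<bar> \<le> (\<Sum>i\<in>UNIV. \<bar>LINT z|lebesgue_on U. wD U [i] u z * fld i x r z\<bar>)"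
    unfolding av_deriv_sob[OF u x r1] by (rule sum_abs)
  also have "\<dots> \<le> (\<Sum>i\<in>UNIV. B * dia / s^CARD('n) * (LINT z|lebesgue_on U. indicator (cball x (2 * s * dia)) z * \<bar>wD U [i] u z\<bar>))"
  proof (rule sum_mono)
    fix i
    have "\<bar>LINT z|lebesgue_on U. wD U [i] u z * fld i x r z\<bar> \<le> (LINT z|lebesgue_on U. \<bar>wD U [i] u z * fld i x r z\<bar>)"
      by (rule integral_abs_bound)
    also have "\<dots> \<le> (LINT z|lebesgue_on U. B * dia / s^CARD('n) * (indicator (cball x (2 * s * dia)) z * \<bar>wD U [i] u z\<bar>))"
    proof (rule integral_mono)
      show "\<bar>wD U [i] u z * fld i x r z\<bar> \<le> B * dia / s^CARD('n) * (indicator (cball x (2 * s * dia)) z * \<bar>wD U [i] u z\<bar>)" for z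
        using mult_left_mono[OF fld_bound[OF B x s(1), of r i z], of "\<bar>wD U [i] u z\<bar>"] r
        by (simp add: abs_mult algebra_simps)
      show "integrable (lebesgue_on U) (\<lambda>z. \<bar>wD U [i] u z * fld i x r z\<bar>)" by (rule integrable_abs[OF ia])
      show "integrable (lebesgue_on U) (\<lambda>z. B * dia / s^CARD('n) * (indicator (cball x (2 * s * dia)) z * \<bar>wD U [i] u z\<bar>))"
        by (rule integrable_mult_right[OF ib])
    qed
    finally show "\<bar>LINT z|lebesgue_on U. wD U [i] u z * fld i x r z\<bar> \<le> B * dia / s^CARD('n) * (LINT z|lebesgue_on U. indicator (cball x (2 * s * dia)) z * \<bar>wD U [i] u z\<bar>)"
      by simp
  qed
  also have "\<dots> = B * dia / s^CARD('n) * ?I"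
    unfolding Gm_def sum_distrib_left[symmetric]
    by (subst Bochner_Integration.integral_sum[OF ib, symmetric]) (simp add: sum_distrib_left)
  finally have "\<bar>LINT z|lebesgue_on U. u z * dker x r z\<bar> \<le> B * dia / s^CARD('n) * ?I" .
  from mult_left_mono[OF this less_imp_le[OF s(1)]]
  show ?thesis unfolding r(3) abs_mult abs_of_pos[OF s(1)] .
qed

end

section \<open>Dyadic differences of averages\<close>

lemma pow4_le: "0 \<le> b \<Longrightarrow> (a::real)^4 \<le> b^4 \<Longrightarrow> a \<le> b"
  using power_le_imp_le_base[of a 3 b] by (simp add: numeral_eq_Suc)

text \<open>Fatou's lemma for the fourth powers.\<close>

lemma L4_limit:
  fixes f :: "real^'n \<Rightarrow> real"
  assumes fs: "\<And>n. L4fun U (fs n)" and K: "\<And>n. L4n U (fs n) \<le> K"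
    and m: "f \<in> borel_measurable (lebesgue_on U)"
    and lim: "AE x in lebesgue_on U. (\<lambda>n. fs n x) \<longlonglongrightarrow> f x"
  shows "L4fun U f" "L4n U f \<le> K"
proof -
  note [measurable] = m L4fun_meas[OF fs]
  have K0: "0 \<le> K" using K[of 0] L4n_nonneg[of U "fs 0"] by linarith
  have i: "integrable (lebesgue_on U) (\<lambda>x. (norm (fs n x))^4)" for n using fs[of n] by (simp add: L4fun_def)
  have b: "(\<integral>\<^sup>+x. ennreal ((norm (fs n x))^4) \<partial>lebesgue_on U) \<le> ennreal (K^4)" for n
  proof -
    have "(\<integral>\<^sup>+x. ennreal ((norm (fs n x))^4) \<partial>lebesgue_on U) = ennreal ((L4n U (fs n))^4)"
      unfolding L4n_pow4 by (rule nn_integral_eq_integral[OF i]) simp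
    also have "\<dots> \<le> ennreal (K^4)" using K by (intro ennreal_leI power_mono) auto
    finally show ?thesis .
  qed
  have "(\<integral>\<^sup>+x. ennreal ((norm (f x))^4) \<partial>lebesgue_on U) = (\<integral>\<^sup>+x. liminf (\<lambda>n. ennreal ((norm (fs n x))^4)) \<partial>lebesgue_on U)"
  proof (rule nn_integral_cong_AE)
    show "AE x in lebesgue_on U. ennreal ((norm (f x))^4) = liminf (\<lambda>n. ennreal ((norm (fs n x))^4))"
      using lim
    proof eventually_elim
      case (elim x)
      have "(\<lambda>n. ennreal ((norm (fs n x))^4)) \<longlonglongrightarrow> ennreal ((norm (f x))^4)"
        by (intro tendsto_ennrealI tendsto_power tendsto_norm elim)
      then show ?case by (rule lim_imp_Liminf[OF trivial_limit_sequentially, symmetric])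
    qed
  qed
  also have "\<dots> \<le> liminf (\<lambda>n. \<integral>\<^sup>+x. ennreal ((norm (fs n x))^4) \<partial>lebesgue_on U)"
    by (rule nn_integral_liminf) simp
  also have "\<dots> \<le> ennreal (K^4)"
    by (rule order_trans[OF Liminf_le_Limsup Limsup_bounded]) (simp, intro always_eventually allI b)
  finally have n: "(\<integral>\<^sup>+x. ennreal ((norm (f x))^4) \<partial>lebesgue_on U) \<le> ennreal (K^4)" .
  have "integrable (lebesgue_on U) (\<lambda>x. (norm (f x))^4)"
    by (rule integrableI_nonneg) (use n in \<open>auto intro: le_less_trans\<close>)
  then show L: "L4fun U f" by (simp add: L4fun_def)
  have "ennreal ((L4n U f)^4) \<le> ennreal (K^4)"
    using n nn_integral_eq_integral[of "lebesgue_on U" "\<lambda>x. (norm (f x))^4"] L unfolding L4n_pow4 by (simp add: L4fun_def)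
  then have "(L4n U f)^4 \<le> K^4" using K0 by simp
  then show "L4n U f \<le> K" by (rule pow4_le[OF K0])
qed

context convex_domain
begin

abbreviation M where "M \<equiv> lebesgue_on U"

definition Bd :: real where "Bd = (SOME B. B > 0 \<and> (\<forall>x. \<bar>eta x\<bar> \<le> B))"

lemma Bd: "Bd > 0" "\<bar>eta x\<bar> \<le> Bd"
proof -
  have "\<exists>B. B > 0 \<and> (\<forall>x. \<bar>eta x\<bar> \<le> B)" using eta_bounds by metis
  from someI_ex[OF this] show "Bd > 0" "\<bar>eta x\<bar> \<le> Bd" by (simp_all add: Bd_def)
qed

text \<open>A ball of radius \<open>2 * s * dia\<close> has volume
  \<open>Vd * s^CARD('n)\<close>.\<close>

definition Vd :: real where "Vd = unit_ball_vol (real CARD('n)) * (2 * dia)^CARD('n)"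

lemma Vd_nonneg: "Vd \<ge> 0" using dia(1) by (simp add: Vd_def)

lemma fin_M: "finite_measure M" by (rule fin)

lemma pair_M: "pair_sigma_finite M M"
  using finite_measure.axioms(1)[OF fin_M] by (simp add: pair_sigma_finite_def)

lemma cball_ind_norm:
  assumes "s > 0" shows "(LINT z|M. indicat_real (cball x (2 * s * dia)) z) \<le> Vd * s^CARD('n)"
proof -
  have "(LINT z|M. indicat_real (cball x (2 * s * dia)) z) = (LINT z|lebesgue. indicator U z *\<^sub>R indicat_real (cball x (2 * s * dia)) z)"
    using sets_leb by (intro integral_restrict_space) simp
  also have "\<dots> = (LINT z|lebesgue. indicat_real (U \<inter> cball x (2 * s * dia)) z)"
    by (intro Bochner_Integration.integral_cong refl) (simp add: indicator_def)
  also have "\<dots> = measure lebesgue (U \<inter> cball x (2 * s * dia))" by simp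
  also have "\<dots> \<le> measure lebesgue (cball x (2 * s * dia))"
    by (intro measure_mono_fmeasurable) (use sets_leb in auto)
  also have "\<dots> = unit_ball_vol (real CARD('n)) * (2 * s * dia)^CARD('n)"
    using content_cball[of "2 * s * dia" x] assms dia(1) by simp
  also have "\<dots> = Vd * s^CARD('n)" by (simp add: Vd_def power_mult_distrib)
  finally show ?thesis .
qed

lemma cball_ind_L2n: "s > 0 \<Longrightarrow> (L2n U (\<lambda>z. indicator (cball x (2 * s * dia)) z :: real))^2 \<le> Vd * s^CARD('n)"
proof -
  assume s: "s > 0"
  have "(L2n U (\<lambda>z. indicator (cball x (2 * s * dia)) z :: real))^2 = (LINT z|M. indicat_real (cball x (2 * s * dia)) z)"
    unfolding L2n_sq by (intro Bochner_Integration.integral_cong refl) (simp add: indicator_def)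
  then show ?thesis using cball_ind_norm[OF s] by simp
qed

text \<open>The gradient energy in the ball that carries the fields at scale s around x.\<close>

definition Q :: "(real^'n \<Rightarrow> real) \<Rightarrow> real \<Rightarrow> real^'n \<Rightarrow> real" where
  "Q u s x = (LINT z|M. indicator (cball x (2 * s * dia)) z * (Gm u z)^2)"

lemma Gm_sq_int: "sob U 1 u \<Longrightarrow> integrable M (\<lambda>z. (Gm u z)^2)"
  using L2fun_sq[OF Gm_L2] by simp

lemma indGm_L2:
  assumes "sob U 1 u" shows "L2fun U (\<lambda>z. indicator (cball x \<rho>) z * Gm u z)"
proof (rule L2fun_mono(1)[OF Gm_L2[OF assms]])
  show "(\<lambda>z. indicator (cball x \<rho>) z * Gm u z) \<in> borel_measurable M"
    by (intro borel_measurable_times L2fun_meas[OF cball_ind_L2] L2fun_meas[OF Gm_L2[OF assms]])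
  show "AE z in M. norm (indicator (cball x \<rho>) z * Gm u z) \<le> norm (Gm u z)"
    by (rule AE_I2) (simp add: indicator_def)
qed

lemma Q_int: "sob U 1 u \<Longrightarrow> integrable M (\<lambda>z. indicator (cball x \<rho>) z * (Gm u z)^2)"
proof -
  assume u: "sob U 1 u"
  have "(\<lambda>z. (norm (indicator (cball x \<rho>) z * Gm u z))^2) = (\<lambda>z. indicator (cball x \<rho>) z * (Gm u z)^2)"
    by (rule ext) (simp add: indicator_def)
  then show ?thesis using L2fun_sq[OF indGm_L2[OF u, of x \<rho>]] by simp
qed

lemma Q_le: "sob U 1 u \<Longrightarrow> Q u s x \<le> (L2n U (Gm u))^2"
  unfolding Q_def L2n_sq
  by (intro integral_mono Q_int) (auto simp: Gm_sq_int indicator_def)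

lemma Q_nonneg: "0 \<le> Q u s x"
  unfolding Q_def by (rule Bochner_Integration.integral_nonneg) simp

text \<open>Cauchy-Schwarz against the indicator of the ball. Compared with \<open>Q_le\<close>, a
  gradient in L4 gains a power of s, which later makes dyadic differences small at every
  point.\<close>

lemma Q_le4:
  assumes u: "sob U 1 u" and g: "L4fun U (Gm u)" and s: "s > 0"
  shows "(Q u s x)^2 \<le> Vd * s^CARD('n) * (L4n U (Gm u))^4"
proof -
  have g2: "L2fun U (\<lambda>z. (Gm u z)^2)" using L4fun_L2sq[OF g] by simp
  have "Q u s x \<le> L2n U (\<lambda>z. indicator (cball x (2 * s * dia)) z :: real) * L2n U (\<lambda>z. (Gm u z)^2)"
    using L2_real_integrable(2)[OF cball_ind_L2 g2, of x "2 * s * dia"] by (simp add: Q_def)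
  then have "(Q u s x)^2 \<le> (L2n U (\<lambda>z. indicator (cball x (2 * s * dia)) z :: real) * L2n U (\<lambda>z. (Gm u z)^2))^2"
    by (intro power_mono Q_nonneg)
  also have "\<dots> = (L2n U (\<lambda>z. indicator (cball x (2 * s * dia)) z :: real))^2 * (L4n U (Gm u))^4"
  proof -
    have "(L4n U (Gm u))^4 = ((L4n U (Gm u))^2)^2" by (simp flip: power_mult)
    then show ?thesis by (simp add: power_mult_distrib L4n_sq)
  qed
  also have "\<dots> \<le> Vd * s^CARD('n) * (L4n U (Gm u))^4"
    by (intro mult_right_mono cball_ind_L2n s) simp
  finally show ?thesis .
qed

definition KK :: real where "KK = (Bd * dia)^2 * Vd"

lemma KK_nonneg: "KK \<ge> 0" using Vd_nonneg by (simp add: KK_def)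

text \<open>Cauchy-Schwarz on a ball whose volume is of order s^d improves the prefactor (s/s^d)^2
  of the squared difference to s^2/s^d.\<close>

lemma av_diff_sq:
  assumes u: "sob U 1 u" and x: "x \<in> U" and s: "0 < s" "2 * s \<le> 1"
  shows "(av u (2 * s) x - av u s x)^2 \<le> KK * (s^2 / s^CARD('n)) * Q u s x"
proof -
  let ?I = "LINT z|M. indicator (cball x (2 * s * dia)) z * Gm u z"
  let ?i = "\<lambda>z. indicator (cball x (2 * s * dia)) z :: real"
  have I0: "0 \<le> ?I" by (rule Bochner_Integration.integral_nonneg) (simp add: Gm_nonneg)
  have "?I = (LINT z|M. norm (?i z) * norm (?i z * Gm u z))"
    by (intro Bochner_Integration.integral_cong refl) (auto simp: indicator_def Gm_nonneg)
  also have "\<dots> \<le> L2n U ?i * L2n U (\<lambda>z. ?i z * Gm u z)"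
    by (rule L2_Cauchy_Schwarz[OF cball_ind_L2 indGm_L2[OF u]])
  finally have "?I^2 \<le> (L2n U ?i * L2n U (\<lambda>z. ?i z * Gm u z))^2" using I0 by (rule power_mono)
  also have "\<dots> = (L2n U ?i)^2 * Q u s x"
  proof -
    have "(L2n U (\<lambda>z. ?i z * Gm u z))^2 = Q u s x"
      unfolding L2n_sq Q_def by (intro Bochner_Integration.integral_cong refl) (auto simp: indicator_def)
    then show ?thesis by (simp add: power_mult_distrib)
  qed
  also have "\<dots> \<le> Vd * s^CARD('n) * Q u s x"
    by (intro mult_right_mono cball_ind_L2n s Q_nonneg)
  finally have I2: "?I^2 \<le> Vd * s^CARD('n) * Q u s x" .
  have "\<bar>av u (2 * s) x - av u s x\<bar> \<le> s * (Bd * dia / s^CARD('n) * ?I)"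
    by (rule av_diff_bound[OF Bd(2) u x s])
  then have "\<bar>av u (2 * s) x - av u s x\<bar>^2 \<le> (s * (Bd * dia / s^CARD('n) * ?I))^2"
    by (rule power_mono) simp
  also have "\<dots> = s^2 * (Bd * dia)^2 / (s^CARD('n))^2 * ?I^2"
    by (simp add: power_mult_distrib power_divide)
  also have "\<dots> \<le> s^2 * (Bd * dia)^2 / (s^CARD('n))^2 * (Vd * s^CARD('n) * Q u s x)"
    by (intro mult_left_mono I2) simp
  also have "\<dots> = KK * (s^2 / s^CARD('n)) * Q u s x"
    using s(1) by (simp add: KK_def power2_eq_square field_simps)
  finally show ?thesis by simp
qed

text \<open>\<open>M\<close> is a restriction of Lebesgue measure, so measurability on the product
  is transferred from the Borel sets through the identity map.\<close>

lemma pair_meas: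
  fixes g :: "(real^'n) \<times> (real^'n) \<Rightarrow> real"
  assumes "g \<in> borel_measurable borel" shows "g \<in> borel_measurable (M \<Otimes>\<^sub>M M)"
proof -
  have i: "(\<lambda>x. x) \<in> M \<rightarrow>\<^sub>M borel" by (intro measurable_restrict_space1 measurable_completion) simp
  have "(\<lambda>p. (fst p, snd p)) \<in> (M \<Otimes>\<^sub>M M) \<rightarrow>\<^sub>M (borel \<Otimes>\<^sub>M borel)"
    by (intro measurable_Pair measurable_compose[OF measurable_fst i] measurable_compose[OF measurable_snd i])
  then have "(\<lambda>p. p) \<in> (M \<Otimes>\<^sub>M M) \<rightarrow>\<^sub>M borel" by (simp add: borel_prod)
  from measurable_compose[OF this assms] show ?thesis by simp
qed

lemma pair_fst_meas: "f \<in> borel_measurable M \<Longrightarrow> (\<lambda>p. f (fst p)) \<in> borel_measurable (M \<Otimes>\<^sub>M M)"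
  and pair_snd_meas: "f \<in> borel_measurable M \<Longrightarrow> (\<lambda>p. f (snd p)) \<in> borel_measurable (M \<Otimes>\<^sub>M M)"
  for f :: "real^'n \<Rightarrow> real"
  by (rule measurable_compose[OF measurable_fst], assumption) (rule measurable_compose[OF measurable_snd], assumption)

lemma ker_pair_meas: "(\<lambda>p. ker (fst p) r (snd p)) \<in> borel_measurable (M \<Otimes>\<^sub>M M)"
proof (rule pair_meas, rule borel_measurable_continuous_onI)
  have c: "continuous_on UNIV eta" by (rule smooth_continuous[OF eta_smooth])
  show "continuous_on UNIV (\<lambda>p. ker (fst p) r (snd p))"
    unfolding ker_def
    by (intro continuous_on_mult continuous_on_const continuous_on_compose2[OF c] continuous_intros) auto
qed

lemma ind_pair_meas: "(\<lambda>p. indicator (cball (fst p) \<rho>) (snd p) :: real) \<in> borel_measurable (M \<Otimes>\<^sub>M M)"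
proof (rule pair_meas)
  have "closed {p :: (real^'n) \<times> (real^'n). dist (fst p) (snd p) \<le> \<rho>}"
    by (intro closed_Collect_le continuous_intros)
  then have "indicat_real {p :: (real^'n) \<times> (real^'n). dist (fst p) (snd p) \<le> \<rho>} \<in> borel_measurable (borel :: ((real^'n) \<times> (real^'n)) measure)"
    by (intro borel_measurable_indicator borel_closed)
  then show "(\<lambda>p :: (real^'n) \<times> (real^'n). indicator (cball (fst p) \<rho>) (snd p) :: real) \<in> borel_measurable borel"
    by (simp add: indicator_def[abs_def])
qed

lemma param_integral_meas:
  fixes f :: "real^'n \<Rightarrow> real^'n \<Rightarrow> real"
  assumes "case_prod f \<in> borel_measurable (M \<Otimes>\<^sub>M M)"
  shows "(\<lambda>x. LINT z|M. f x z) \<in> borel_measurable M"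
proof -
  interpret finite_measure M by (rule fin_M)
  show ?thesis by (rule borel_measurable_lebesgue_integral[OF assms])
qed

lemma av_meas: "L2fun U u \<Longrightarrow> av u r \<in> borel_measurable M"
proof -
  assume u: "L2fun U u"
  have "(\<lambda>p. u (snd p) * ker (fst p) r (snd p)) \<in> borel_measurable (M \<Otimes>\<^sub>M M)"
    by (intro borel_measurable_times pair_snd_meas L2fun_meas[OF u] ker_pair_meas)
  then have "(\<lambda>x. LINT z|M. u z * ker x r z) \<in> borel_measurable M"
    by (intro param_integral_meas) (simp add: case_prod_unfold)
  then show ?thesis by (simp add: av_def[abs_def])
qed

text \<open>The indicator of the ball is symmetric in centre and point, so exchanging the integrals
  gives the volume of a ball times the total gradient energy.\<close>

lemma Q_integral:
  assumes u: "sob U 1 u" and s: "s > 0"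
  shows "integrable M (Q u s)" "(LINT x|M. Q u s x) \<le> Vd * s^CARD('n) * (L2n U (Gm u))^2"
proof -
  interpret pair_sigma_finite M M by (rule pair_M)
  interpret F: finite_measure M by (rule fin_M)
  let ?f = "\<lambda>x z. indicator (cball x (2 * s * dia)) z * (Gm u z)^2"
  have mG: "(\<lambda>p. (Gm u (snd p))^2) \<in> borel_measurable (M \<Otimes>\<^sub>M M)"
    by (intro borel_measurable_power pair_snd_meas L2fun_meas[OF Gm_L2[OF u]])
  have m: "case_prod ?f \<in> borel_measurable (M \<Otimes>\<^sub>M M)"
    using borel_measurable_times[OF ind_pair_meas mG] by (simp add: case_prod_unfold)
  have mQ: "Q u s \<in> borel_measurable M"
    unfolding Q_def[abs_def] by (rule param_integral_meas[OF m])
  show iQ: "integrable M (Q u s)"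
    by (rule F.integrable_const_bound[of _ "(L2n U (Gm u))^2", OF _ mQ])
      (intro AE_I2, simp add: Q_nonneg Q_le[OF u])
  have ip: "integrable (M \<Otimes>\<^sub>M M) (case_prod ?f)"
  proof (rule Fubini_integrable[OF m])
    have "(\<lambda>x. LINT z|M. norm (case (x, z) of (x, z) \<Rightarrow> ?f x z)) = Q u s"
      by (rule ext) (simp add: Q_def abs_mult)
    then show "integrable M (\<lambda>x. LINT z|M. norm (case (x, z) of (x, z) \<Rightarrow> ?f x z))" using iQ by simp
    show "AE x in M. integrable M (\<lambda>z. case (x, z) of (x, z) \<Rightarrow> ?f x z)"
      by (intro AE_I2) (simp add: Q_int[OF u])
  qed
  have "(LINT x|M. Q u s x) = (LINT z|M. LINT x|M. ?f x z)"
    unfolding Q_def by (rule Fubini_integral[OF ip, symmetric])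
  also have "\<dots> \<le> (LINT z|M. (Vd * s^CARD('n)) * (Gm u z)^2)"
  proof (rule integral_mono)
    show "integrable M (\<lambda>z. LINT x|M. ?f x z)" by (rule integrable_snd[OF ip])
    show "integrable M (\<lambda>z. (Vd * s^CARD('n)) * (Gm u z)^2)" by (intro integrable_mult_right Gm_sq_int u)
    fix z
    have "(LINT x|M. ?f x z) = (LINT x|M. indicator (cball z (2 * s * dia)) x * (Gm u z)^2)"
      by (intro Bochner_Integration.integral_cong refl) (simp add: indicator_def dist_commute)
    also have "\<dots> = (LINT x|M. indicator (cball z (2 * s * dia)) x) * (Gm u z)^2" by simp
    also have "\<dots> \<le> (Vd * s^CARD('n)) * (Gm u z)^2"
      by (intro mult_right_mono cball_ind_norm s) simp
    finally show "(LINT x|M. ?f x z) \<le> (Vd * s^CARD('n)) * (Gm u z)^2" .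
  qed
  also have "\<dots> = Vd * s^CARD('n) * (L2n U (Gm u))^2" by (simp add: L2n_sq)
  finally show "(LINT x|M. Q u s x) \<le> Vd * s^CARD('n) * (L2n U (Gm u))^2" .
qed

text \<open>At most three dimensions leave a positive power of s here, which becomes geometric decay
  along dyadic scales.\<close>

lemma s_power: assumes "0 < s" "s \<le> (1::real)" shows "s^4 / s^CARD('n) \<le> s"
proof -
  have "s^4 \<le> s^(CARD('n) + 1)" using assms dim by (intro power_decreasing) auto
  then show ?thesis using assms(1) by (simp add: field_simps)
qed

text \<open>The fourth power of the difference is at most a multiple of the square of
  \<open>Q\<close>. One factor is replaced by the total energy, the other is integrated with
  \<open>Q_integral\<close>.\<close>

lemma av_diff_L4:
  assumes u: "sob U 1 u" and s: "0 < s" "2 * s \<le> 1"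
  shows "L4fun U (\<lambda>x. av u (2 * s) x - av u s x)"
    "(L4n U (\<lambda>x. av u (2 * s) x - av u s x))^4 \<le> KK^2 * Vd * s * (L2n U (Gm u))^4"
proof -
  interpret F: finite_measure M by (rule fin_M)
  let ?w = "\<lambda>x. av u (2 * s) x - av u s x" and ?g = "L2n U (Gm u)" and ?c = "KK * (s^2 / s^CARD('n))"
  have mw: "?w \<in> borel_measurable M" by (intro borel_measurable_diff av_meas sob_L2[OF u])
  have c0: "0 \<le> ?c" using KK_nonneg s by simp
  have b: "(norm (?w x))^4 \<le> ?c^2 * ?g^2 * Q u s x" if "x \<in> U" for x
  proof -
    have "(norm (?w x))^4 = ((?w x)^2)^2" by (simp flip: power_mult)
    also have "\<dots> \<le> (?c * Q u s x)^2" by (intro power_mono av_diff_sq u that s) simp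
    also have "\<dots> = ?c^2 * (Q u s x * Q u s x)" by (simp add: power_mult_distrib power2_eq_square)
    also have "\<dots> \<le> ?c^2 * (?g^2 * Q u s x)" by (intro mult_left_mono mult_right_mono Q_le u Q_nonneg) simp
    finally show ?thesis by (simp add: mult.assoc)
  qed
  have iQ: "integrable M (\<lambda>x. ?c^2 * ?g^2 * Q u s x)" by (intro integrable_mult_right Q_integral(1) u s)
  have i: "integrable M (\<lambda>x. (norm (?w x))^4)"
    by (rule Bochner_Integration.integrable_bound[OF iQ])
      (use mw b Q_nonneg in \<open>auto intro!: AE_I2\<close>)
  then show "L4fun U ?w" using mw by (simp add: L4fun_def)
  have "(L4n U ?w)^4 \<le> (LINT x|M. ?c^2 * ?g^2 * Q u s x)"
    unfolding L4n_pow4 by (intro integral_mono i iQ b) simp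
  also have "\<dots> = ?c^2 * ?g^2 * (LINT x|M. Q u s x)" by simp
  also have "\<dots> \<le> ?c^2 * ?g^2 * (Vd * s^CARD('n) * ?g^2)" by (intro mult_left_mono Q_integral(2) u s) simp
  also have "\<dots> = KK^2 * Vd * (s^4 / s^CARD('n)) * ?g^4"
    using s(1) by (simp add: power_mult_distrib power_divide power2_eq_square power4_eq_xxxx field_simps)
  also have "\<dots> \<le> KK^2 * Vd * s * ?g^4"
    using s_power[of s] s Vd_nonneg by (intro mult_right_mono mult_left_mono) auto
  finally show "(L4n U ?w)^4 \<le> KK^2 * Vd * s * ?g^4" .
qed

text \<open>\<open>qq\<close> is the fourth root of 1/2, and \<open>K4\<close> that of the constant
  in \<open>av_diff_L4\<close>: halving the scale multiplies the L4 bound by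
  \<open>qq\<close>.\<close>

definition qq :: real where "qq = sqrt (sqrt (1/2))"
definition K4 :: real where "K4 = sqrt (sqrt (KK^2 * Vd))"

lemma qq: "0 < qq" "qq < 1" "qq^4 = 1/2"
proof -
  show "0 < qq" by (simp add: qq_def)
  show "qq < 1" by (simp add: qq_def)
  have "qq^4 = (qq^2)^2" by (simp flip: power_mult)
  then show "qq^4 = 1/2" by (simp add: qq_def)
qed

lemma K4: "0 \<le> K4" "K4^4 = KK^2 * Vd"
proof -
  show "0 \<le> K4" using Vd_nonneg by (simp add: K4_def)
  have "K4^4 = (K4^2)^2" by (simp flip: power_mult)
  then show "K4^4 = KK^2 * Vd" using Vd_nonneg by (simp add: K4_def)
qed

definition vn :: "(real^'n \<Rightarrow> real) \<Rightarrow> nat \<Rightarrow> real^'n \<Rightarrow> real" where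
  "vn u n = av u ((1/2)^n)"

lemma half_scale: "(1/2::real)^n = 2 * (1/2)^Suc n" by simp

lemma vn_diff_L4:
  assumes u: "sob U 1 u"
  shows "L4fun U (\<lambda>x. vn u n x - vn u (Suc n) x)"
    "L4n U (\<lambda>x. vn u n x - vn u (Suc n) x) \<le> K4 * qq^n * L2n U (Gm u)"
proof -
  let ?s = "(1/2::real)^Suc n"
  have s: "0 < ?s" "2 * ?s \<le> 1" using power_le_one[of "1/2::real" n] by simp_all
  note a = av_diff_L4[OF u s]
  have e: "(\<lambda>x. vn u n x - vn u (Suc n) x) = (\<lambda>x. av u (2 * ?s) x - av u ?s x)"
    unfolding vn_def half_scale[symmetric] ..
  show "L4fun U (\<lambda>x. vn u n x - vn u (Suc n) x)" unfolding e by (rule a(1))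
  have "?s \<le> (1/2)^n" by simp
  have "(L4n U (\<lambda>x. vn u n x - vn u (Suc n) x))^4 \<le> KK^2 * Vd * ?s * (L2n U (Gm u))^4"
    unfolding e by (rule a(2))
  also have "\<dots> \<le> KK^2 * Vd * (1/2)^n * (L2n U (Gm u))^4"
    using Vd_nonneg by (intro mult_right_mono mult_left_mono) auto
  also have "\<dots> = (K4 * qq^n * L2n U (Gm u))^4"
    by (simp only: power_mult_distrib K4(2) qq(3)[symmetric] power_mult[symmetric] mult.commute[of n 4])
  finally show "L4n U (\<lambda>x. vn u n x - vn u (Suc n) x) \<le> K4 * qq^n * L2n U (Gm u)"
    by (rule pow4_le[rotated]) (use K4(1) qq(1) in auto)
qed

lemma vn_tail_L4:
  assumes u: "sob U 1 u"
  shows "L4fun U (\<lambda>x. vn u J x - vn u (J + m) x) \<and>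
    L4n U (\<lambda>x. vn u J x - vn u (J + m) x) \<le> K4 / (1 - qq) * qq^J * L2n U (Gm u)"
proof -
  have e: "vn u J x - vn u (J + m) x = (\<Sum>j<m. vn u (J + j) x - vn u (Suc (J + j)) x)" for x
    by (induction m) auto
  have "(\<Sum>j<m. L4n U (\<lambda>x. vn u (J + j) x - vn u (Suc (J + j)) x)) \<le> (\<Sum>j<m. K4 * qq^(J + j) * L2n U (Gm u))"
    by (intro sum_mono vn_diff_L4 u)
  also have "\<dots> = K4 * qq^J * L2n U (Gm u) * (\<Sum>j<m. qq^j)"
    by (simp add: power_add sum_distrib_left algebra_simps)
  also have "(\<Sum>j<m. qq^j) \<le> 1 / (1 - qq)"
  proof -
    have "(\<Sum>j<m. qq^j) \<le> (\<Sum>j. qq^j)"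
      using qq by (intro sum_le_suminf summable_geometric) auto
    then show ?thesis using suminf_geometric[of qq] qq by simp
  qed
  finally have "(\<Sum>j<m. L4n U (\<lambda>x. vn u (J + j) x - vn u (Suc (J + j)) x)) \<le> K4 / (1 - qq) * qq^J * L2n U (Gm u)"
    using K4(1) qq(1) by (simp add: mult_left_mono)
  moreover have "L4fun U (\<lambda>x. \<Sum>j<m. vn u (J + j) x - vn u (Suc (J + j)) x) \<and>
     L4n U (\<lambda>x. \<Sum>j<m. vn u (J + j) x - vn u (Suc (J + j)) x) \<le> (\<Sum>j<m. L4n U (\<lambda>x. vn u (J + j) x - vn u (Suc (J + j)) x))"
    by (rule L4fun_sum) (rule vn_diff_L4(1)[OF u])
  ultimately show ?thesis unfolding e by linarith
qed

end

section \<open>Convergence of the averages by duality\<close>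

lemma lborel_integral_affine:
  fixes F :: "real^'n \<Rightarrow> real"
  assumes "c \<noteq> 0" "F \<in> borel_measurable borel"
  shows "(LINT x|lborel. F x) = \<bar>c\<bar>^CARD('n) * (LINT y|lborel. F (t + c *\<^sub>R y))"
proof -
  have "(LINT x|lborel. F x) = (LINT x|density (distr lborel borel (\<lambda>x. t + c *\<^sub>R x)) (\<lambda>_. ennreal (\<bar>c\<bar>^DIM(real^'n))). F x)"
    using lborel_affine[OF assms(1), of t] by simp
  also have "\<dots> = (LINT x|distr lborel borel (\<lambda>x. t + c *\<^sub>R x). \<bar>c\<bar>^DIM(real^'n) *\<^sub>R F x)"
    using assms(2) by (intro integral_density) auto
  also have "\<dots> = (LINT y|lborel. \<bar>c\<bar>^DIM(real^'n) *\<^sub>R F (t + c *\<^sub>R y))"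
    using assms(2) by (intro integral_distr) auto
  finally show ?thesis by simp
qed

context convex_domain
begin

text \<open>The adjoint of averaging: the kernel is integrated in its centre. Averages are compared
  with \<open>u\<close> weakly, so that the limit of the radius falls on the smooth \<phi>.\<close>

definition adj :: "(real^'n \<Rightarrow> real) \<Rightarrow> real \<Rightarrow> real^'n \<Rightarrow> real" where
  "adj \<phi> r z = (LINT x|M. \<phi> x * ker x r z)"

lemma ker_bound: "0 < r \<Longrightarrow> \<bar>ker x r z\<bar> \<le> Bd / r^CARD('n)"
  using Bd(2) by (simp add: ker_def abs_mult divide_right_mono)

text \<open>The substitution x = (z - r y)/(1 - r), which solves z = (1 - r) x + r y, turns the
  kernel at (x, z) into a multiple of \<open>eta y\<close> and leaves a rescaled mean of \<phi>. It
  degenerates at r = 1.\<close>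

lemma adj_eq:
  assumes t: "test_fun U \<phi>" and r: "0 < r" "r < 1"
  shows "adj \<phi> r z = (1 / (1 - r))^CARD('n) * (LINT y|lborel. eta y * \<phi> ((1 / (1 - r)) *\<^sub>R (z - r *\<^sub>R y)))"
proof -
  let ?c = "- (r / (1 - r))" and ?t = "(1 / (1 - r)) *\<^sub>R z"
  have c: "continuous_on UNIV eta" by (rule smooth_continuous[OF eta_smooth])
  have ck: "continuous_on UNIV (\<lambda>x. ker x r z)"
    unfolding ker_def
    by (intro continuous_on_mult continuous_on_const continuous_on_compose2[OF c] continuous_intros) auto
  have mF: "(\<lambda>x. \<phi> x * ker x r z) \<in> borel_measurable borel"
    by (intro borel_measurable_times smooth_measurable[OF test_fun_smooth[OF t]] borel_measurable_continuous_onI[OF ck])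
  have "adj \<phi> r z = (LINT x|lborel. \<phi> x * ker x r z)"
    unfolding adj_def by (rule LINT_lebesgue_on_supported[OF mF]) (simp_all add: test_fun_outside[OF t] sets_leb)
  also have "\<dots> = \<bar>?c\<bar>^CARD('n) * (LINT y|lborel. \<phi> (?t + ?c *\<^sub>R y) * ker (?t + ?c *\<^sub>R y) r z)"
    by (rule lborel_integral_affine[OF _ mF]) (use r in simp)
  also have "\<dots> = \<bar>?c\<bar>^CARD('n) * (LINT y|lborel. 1 / r^CARD('n) * (eta y * \<phi> ((1 / (1 - r)) *\<^sub>R (z - r *\<^sub>R y))))"
  proof -
    have "\<phi> (?t + ?c *\<^sub>R y) * ker (?t + ?c *\<^sub>R y) r z = 1 / r^CARD('n) * (eta y * \<phi> ((1 / (1 - r)) *\<^sub>R (z - r *\<^sub>R y)))" for y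
    proof -
      have 1: "?t + ?c *\<^sub>R y = (1 / (1 - r)) *\<^sub>R (z - r *\<^sub>R y)" by (simp add: scaleR_diff_right)
      have 2: "(?t + ?c *\<^sub>R y) + (1/r) *\<^sub>R (z - (?t + ?c *\<^sub>R y)) = y"
      proof (subst vec_eq_iff, intro allI)
        fix i
        have "((?t + ?c *\<^sub>R y) + (1/r) *\<^sub>R (z - (?t + ?c *\<^sub>R y))) $ i
          = (z $ i / (1 - r) - r / (1 - r) * y $ i) + (1/r) * (z $ i - (z $ i / (1 - r) - r / (1 - r) * y $ i))" by simp
        also have "\<dots> = y $ i" using r by (simp add: divide_simps) (simp add: algebra_simps)
        finally show "((?t + ?c *\<^sub>R y) + (1/r) *\<^sub>R (z - (?t + ?c *\<^sub>R y))) $ i = y $ i" .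
      qed
      show ?thesis unfolding ker_def 2 unfolding 1 by simp
    qed
    then show ?thesis by simp
  qed
  also have "\<dots> = (\<bar>?c\<bar>^CARD('n) / r^CARD('n)) * (LINT y|lborel. eta y * \<phi> ((1 / (1 - r)) *\<^sub>R (z - r *\<^sub>R y)))"
    by simp
  also have "\<bar>?c\<bar>^CARD('n) / r^CARD('n) = (1 / (1 - r))^CARD('n)"
    using r by (simp add: power_divide)
  finally show ?thesis .
qed

lemma eta_abs_integrable: "integrable lborel (\<lambda>y. \<bar>eta y\<bar>)"
  by (intro integrable_abs test_fun_integrable_lborel[OF eta_test])

text \<open>The scales used for the adjoint start at 1/2 instead of 1, so that 1/(1 - r) stays
  bounded by 2.\<close>

lemma half_Suc: "0 < (1/2::real)^Suc n" "(1/2::real)^Suc n < 1" "1 / (1 - (1/2::real)^Suc n) \<le> 2"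
proof -
  have "(1/2::real)^n \<le> 1" by (rule power_le_one) auto
  then have a: "(1/2::real)^Suc n \<le> 1/2" by simp
  show "0 < (1/2::real)^Suc n" by simp
  show "(1/2::real)^Suc n < 1" using a by linarith
  have "1 - (1/2::real)^Suc n \<ge> 1/2" using a by linarith
  then show "1 / (1 - (1/2::real)^Suc n) \<le> 2" using divide_left_mono[of "1/2" "1 - (1/2::real)^Suc n" 1] by simp
qed

lemma adj_bound:
  assumes t: "test_fun U \<phi>" and B: "\<And>x. \<bar>\<phi> x\<bar> \<le> B"
  shows "\<bar>adj \<phi> ((1/2)^Suc n) z\<bar> \<le> 2^CARD('n) * (B * (LINT y|lborel. \<bar>eta y\<bar>))"
proof -
  let ?r = "(1/2::real)^Suc n"
  have B0: "0 \<le> B" using B[of z] by linarith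
  have ms: "smooth_fun (\<lambda>y. \<phi> ((1 / (1 - ?r)) *\<^sub>R (z - ?r *\<^sub>R y)))"
  proof -
    have "(\<lambda>y. \<phi> ((1 / (1 - ?r)) *\<^sub>R (z - ?r *\<^sub>R y))) = (\<lambda>y. \<phi> ((- (?r / (1 - ?r))) *\<^sub>R y + (1 / (1 - ?r)) *\<^sub>R z))"
      by (rule ext) (simp add: scaleR_diff_right)
    then show ?thesis using smooth_affine[OF test_fun_smooth[OF t], of "- (?r / (1 - ?r))" "(1 / (1 - ?r)) *\<^sub>R z"] by simp
  qed
  have i: "integrable lborel (\<lambda>y. eta y * \<phi> ((1 / (1 - ?r)) *\<^sub>R (z - ?r *\<^sub>R y)))"
  proof (rule Bochner_Integration.integrable_bound)
    show "integrable lborel (\<lambda>y. \<bar>eta y\<bar> * B)" by (rule integrable_mult_left[OF eta_abs_integrable])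
    show "(\<lambda>y. eta y * \<phi> ((1 / (1 - ?r)) *\<^sub>R (z - ?r *\<^sub>R y))) \<in> borel_measurable lborel"
      using borel_measurable_times[OF smooth_measurable[OF eta_smooth] smooth_measurable[OF ms]] by simp
    show "AE y in lborel. norm (eta y * \<phi> ((1 / (1 - ?r)) *\<^sub>R (z - ?r *\<^sub>R y))) \<le> norm (\<bar>eta y\<bar> * B)"
      by (rule AE_I2) (use B B0 in \<open>simp add: abs_mult mult_left_mono\<close>)
  qed
  have "\<bar>LINT y|lborel. eta y * \<phi> ((1 / (1 - ?r)) *\<^sub>R (z - ?r *\<^sub>R y))\<bar> \<le> (LINT y|lborel. \<bar>eta y\<bar> * B)"
  proof (rule order_trans[OF integral_abs_bound], rule integral_mono)
    show "integrable lborel (\<lambda>y. \<bar>eta y * \<phi> ((1 / (1 - ?r)) *\<^sub>R (z - ?r *\<^sub>R y))\<bar>)" by (rule integrable_abs[OF i])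
    show "integrable lborel (\<lambda>y. \<bar>eta y\<bar> * B)" by (rule integrable_mult_left[OF eta_abs_integrable])
    show "\<bar>eta y * \<phi> ((1 / (1 - ?r)) *\<^sub>R (z - ?r *\<^sub>R y))\<bar> \<le> \<bar>eta y\<bar> * B" for y
      unfolding abs_mult by (intro mult_left_mono B) simp
  qed
  then have 1: "\<bar>LINT y|lborel. eta y * \<phi> ((1 / (1 - ?r)) *\<^sub>R (z - ?r *\<^sub>R y))\<bar> \<le> B * (LINT y|lborel. \<bar>eta y\<bar>)"
    by (simp add: mult.commute)
  have 2: "(1 / (1 - ?r))^CARD('n) \<le> 2^CARD('n)" using half_Suc[of n] by (intro power_mono) auto
  have 3: "0 \<le> (1 / (1 - ?r))^CARD('n)" using half_Suc(2)[of n] by simp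
  show ?thesis unfolding adj_eq[OF t half_Suc(1,2)] abs_mult abs_of_nonneg[OF 3]
    by (intro mult_mono 1 2) auto
qed

text \<open>The argument of \<phi> tends to z for every y, and \<open>eta\<close> has integral
  1.\<close>

lemma adj_tendsto:
  assumes t: "test_fun U \<phi>"
  shows "(\<lambda>n. adj \<phi> ((1/2)^Suc n) z) \<longlonglongrightarrow> \<phi> z"
proof -
  obtain B where B: "B > 0" "\<And>x. \<bar>\<phi> x\<bar> \<le> B" using test_fun_bounded[OF t] by metis
  let ?r = "\<lambda>n. (1/2::real)^Suc n"
  have r0: "?r \<longlonglongrightarrow> 0" by (intro LIMSEQ_Suc LIMSEQ_power_zero) simp
  have cphi: "continuous_on UNIV \<phi>" by (rule smooth_continuous[OF test_fun_smooth[OF t]])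
  have A: "(\<lambda>n. LINT y|lborel. eta y * \<phi> ((1 / (1 - ?r n)) *\<^sub>R (z - ?r n *\<^sub>R y))) \<longlonglongrightarrow> (LINT y|lborel. eta y * \<phi> z)"
  proof (rule integral_dominated_convergence)
    show "(\<lambda>y. eta y * \<phi> z) \<in> borel_measurable lborel"
      using smooth_measurable[OF eta_smooth] by simp
    show "(\<lambda>y. eta y * \<phi> ((1 / (1 - ?r n)) *\<^sub>R (z - ?r n *\<^sub>R y))) \<in> borel_measurable lborel" for n
      using borel_measurable_continuous_onI[of "\<lambda>y. eta y * \<phi> ((1 / (1 - ?r n)) *\<^sub>R (z - ?r n *\<^sub>R y))"]
        continuous_on_mult[OF smooth_continuous[OF eta_smooth] continuous_on_compose2[OF cphi, of UNIV "\<lambda>y. (1 / (1 - ?r n)) *\<^sub>R (z - ?r n *\<^sub>R y)"]]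
      by (simp add: continuous_intros)
    show "integrable lborel (\<lambda>y. \<bar>eta y\<bar> * B)" by (rule integrable_mult_left[OF eta_abs_integrable])
    have "(\<lambda>n. eta y * \<phi> ((1 / (1 - ?r n)) *\<^sub>R (z - ?r n *\<^sub>R y))) \<longlonglongrightarrow> eta y * \<phi> z" for y
    proof -
      have "(\<lambda>n. (1 / (1 - ?r n)) *\<^sub>R (z - ?r n *\<^sub>R y)) \<longlonglongrightarrow> (1 / (1 - 0)) *\<^sub>R (z - 0 *\<^sub>R y)"
        by (intro tendsto_intros r0) simp
      then have "(\<lambda>n. (1 / (1 - ?r n)) *\<^sub>R (z - ?r n *\<^sub>R y)) \<longlonglongrightarrow> z" by simp
      then have "(\<lambda>n. \<phi> ((1 / (1 - ?r n)) *\<^sub>R (z - ?r n *\<^sub>R y))) \<longlonglongrightarrow> \<phi> z"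
        using continuous_on_tendsto_compose[OF cphi] by simp
      then show ?thesis by (rule tendsto_mult_left)
    qed
    then show "AE y in lborel. (\<lambda>n. eta y * \<phi> ((1 / (1 - ?r n)) *\<^sub>R (z - ?r n *\<^sub>R y))) \<longlonglongrightarrow> eta y * \<phi> z" by simp
    show "AE y in lborel. norm (eta y * \<phi> ((1 / (1 - ?r n)) *\<^sub>R (z - ?r n *\<^sub>R y))) \<le> \<bar>eta y\<bar> * B" for n
      by (rule AE_I2) (use B in \<open>simp add: abs_mult mult_left_mono\<close>)
  qed
  have C: "(\<lambda>n. (1 / (1 - ?r n))^CARD('n)) \<longlonglongrightarrow> (1 / (1 - 0))^CARD('n)"
    by (intro tendsto_intros r0) simp
  have D: "(1 / (1 - 0))^CARD('n) * (LINT y|lborel. eta y * \<phi> z) = \<phi> z" using eta_int by simp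
  have "(\<lambda>n. (1 / (1 - ?r n))^CARD('n) * (LINT y|lborel. eta y * \<phi> ((1 / (1 - ?r n)) *\<^sub>R (z - ?r n *\<^sub>R y)))) \<longlonglongrightarrow> \<phi> z"
    using tendsto_mult[OF C A] unfolding D .
  then show ?thesis by (simp only: adj_eq[OF t half_Suc(1,2)])
qed

lemma av_test_adjoint:
  assumes t: "test_fun U \<phi>" and u: "L2fun U u" and r: "r > 0"
  shows "(LINT x|M. \<phi> x * av u r x) = (LINT z|M. u z * adj \<phi> r z)"
proof -
  interpret pair_sigma_finite M M by (rule pair_M)
  interpret F: finite_measure M by (rule fin_M)
  obtain B where B: "B > 0" "\<And>x. \<bar>\<phi> x\<bar> \<le> B" using test_fun_bounded[OF t] by metis
  let ?f = "\<lambda>x z. \<phi> x * (u z * ker x r z)"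
  let ?k = "Bd / r^CARD('n)"
  have m: "case_prod ?f \<in> borel_measurable (M \<Otimes>\<^sub>M M)"
    using borel_measurable_times[OF pair_fst_meas[OF L2fun_meas[OF test_L2[OF t]]]
       borel_measurable_times[OF pair_snd_meas[OF L2fun_meas[OF u]] ker_pair_meas]]
    by (simp add: case_prod_unfold)
  have iu: "integrable M u" by (rule L2_integrable[OF u])
  have i1: "integrable M (?f x)" for x by (intro integrable_mult_right L2_real_integrable(1)[OF u ker_L2])
  have nb: "(LINT z|M. norm (?f x z)) \<le> B * ?k * (LINT z|M. \<bar>u z\<bar>)" for x
  proof -
    have "(LINT z|M. norm (?f x z)) \<le> (LINT z|M. B * ?k * \<bar>u z\<bar>)"
    proof (rule integral_mono)
      show "integrable M (\<lambda>z. norm (?f x z))" by (rule integrable_norm[OF i1])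
      show "integrable M (\<lambda>z. B * ?k * \<bar>u z\<bar>)" using iu by (intro integrable_mult_right integrable_abs)
      fix z
      have "norm (?f x z) = \<bar>\<phi> x\<bar> * (\<bar>ker x r z\<bar> * \<bar>u z\<bar>)" by (simp add: abs_mult)
      also have "\<dots> \<le> B * (?k * \<bar>u z\<bar>)"
        by (intro mult_mono B(2) ker_bound[OF r] order_refl) (use B(1) Bd(1) r in auto)
      finally show "norm (?f x z) \<le> B * ?k * \<bar>u z\<bar>" by (simp add: mult.assoc)
    qed
    then show ?thesis by simp
  qed
  have ip: "integrable (M \<Otimes>\<^sub>M M) (case_prod ?f)"
  proof (rule Fubini_integrable[OF m])
    have mm: "(\<lambda>x. LINT z|M. norm (?f x z)) \<in> borel_measurable M"
    proof (rule param_integral_meas)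
      have "(\<lambda>p. norm (case_prod ?f p)) \<in> borel_measurable (M \<Otimes>\<^sub>M M)" by (rule measurable_compose[OF m borel_measurable_norm])
      then show "(\<lambda>(x, z). norm (?f x z)) \<in> borel_measurable (M \<Otimes>\<^sub>M M)" by (simp add: case_prod_unfold)
    qed
    have "integrable M (\<lambda>x. LINT z|M. norm (?f x z))"
    proof (rule F.integrable_const_bound[OF _ mm])
      show "AE x in M. norm (LINT z|M. norm (?f x z)) \<le> B * ?k * (LINT z|M. \<bar>u z\<bar>)"
        by (rule AE_I2) (use nb in simp)
    qed
    then show "integrable M (\<lambda>x. LINT z|M. norm (case (x, z) of (x, z) \<Rightarrow> ?f x z))" by simp
    show "AE x in M. integrable M (\<lambda>z. case (x, z) of (x, z) \<Rightarrow> ?f x z)"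
      by (rule AE_I2) (simp only: prod.case i1)
  qed
  have "(LINT x|M. \<phi> x * av u r x) = (LINT x|M. LINT z|M. ?f x z)"
    unfolding av_def by simp
  also have "\<dots> = (LINT z|M. LINT x|M. ?f x z)" by (rule Fubini_integral[OF ip, symmetric])
  also have "\<dots> = (LINT z|M. u z * adj \<phi> r z)"
  proof -
    have e: "?f x z = u z * (\<phi> x * ker x r z)" for x z by simp
    show ?thesis unfolding adj_def e by simp
  qed
  finally show ?thesis .
qed

lemma vn_weak_tendsto:
  assumes t: "test_fun U \<phi>" and u: "L2fun U u"
  shows "(\<lambda>n. LINT x|M. \<phi> x * vn u n x) \<longlonglongrightarrow> (LINT x|M. u x * \<phi> x)"
proof -
  obtain B where B: "B > 0" "\<And>x. \<bar>\<phi> x\<bar> \<le> B" using test_fun_bounded[OF t] by metis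
  let ?K = "2^CARD('n) * (B * (LINT y|lborel. \<bar>eta y\<bar>))"
  have adjm: "adj \<phi> r \<in> borel_measurable M" for r
  proof -
    have "(\<lambda>p. \<phi> (snd p) * ker (snd p) r (fst p)) \<in> borel_measurable (M \<Otimes>\<^sub>M M)"
    proof (intro borel_measurable_times pair_snd_meas L2fun_meas[OF test_L2[OF t]] pair_meas borel_measurable_continuous_onI)
      show "continuous_on UNIV (\<lambda>p. ker (snd p) r (fst p))"
        unfolding ker_def
        by (intro continuous_on_mult continuous_on_const continuous_on_compose2[OF smooth_continuous[OF eta_smooth]] continuous_intros) auto
    qed
    then show ?thesis unfolding adj_def[abs_def] by (intro param_integral_meas) (simp add: case_prod_unfold)
  qed
  have "(\<lambda>n. LINT z|M. u z * adj \<phi> ((1/2)^Suc n) z) \<longlonglongrightarrow> (LINT z|M. u z * \<phi> z)"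
  proof (rule integral_dominated_convergence)
    show "(\<lambda>z. u z * \<phi> z) \<in> borel_measurable M" by (intro borel_measurable_times L2fun_meas[OF u] L2fun_meas[OF test_L2[OF t]])
    show "(\<lambda>z. u z * adj \<phi> ((1/2)^Suc n) z) \<in> borel_measurable M" for n
      by (intro borel_measurable_times L2fun_meas[OF u] adjm)
    show "integrable M (\<lambda>z. \<bar>u z\<bar> * ?K)" by (intro integrable_mult_left integrable_abs L2_integrable u)
    show "AE z in M. (\<lambda>n. u z * adj \<phi> ((1/2)^Suc n) z) \<longlonglongrightarrow> u z * \<phi> z"
      by (intro AE_I2 tendsto_mult_left adj_tendsto t)
    show "AE z in M. norm (u z * adj \<phi> ((1/2)^Suc n) z) \<le> \<bar>u z\<bar> * ?K" for n
      by (rule AE_I2) (simp only: real_norm_def abs_mult, intro mult_left_mono adj_bound t B(2) abs_ge_zero)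
  qed
  \<comment> \<open>The duality holds from scale 1/2 on; the single term at scale 1 does not affect
    the limit.\<close>
  then have "(\<lambda>n. LINT x|M. \<phi> x * vn u (Suc n) x) \<longlonglongrightarrow> (LINT x|M. u x * \<phi> x)"
    unfolding vn_def by (simp only: av_test_adjoint[OF t u half_Suc(1)])
  then show ?thesis by (rule LIMSEQ_imp_Suc)
qed

lemma L1_le_L4:
  assumes "L4fun U w" shows "(LINT x|M. \<bar>w x :: real\<bar>) \<le> sqrt (measure M U) * (sqrt (sqrt (measure M U)) * L4n U w)"
proof -
  interpret F: finite_measure M by (rule fin_M)
  note a = L4fun_imp_L2fun[OF fin_M assms]
  have one: "L2n U (\<lambda>x. 1::real) = sqrt (measure M U)" by (simp add: L2n_def)
  have "(LINT x|M. \<bar>w x\<bar>) = (LINT x|M. norm (1::real) * norm (w x))" by simp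
  also have "\<dots> \<le> L2n U (\<lambda>x. 1::real) * L2n U w" by (rule L2_Cauchy_Schwarz[OF L2_const a(1)])
  also have "\<dots> \<le> sqrt (measure M U) * (sqrt (sqrt (measure M U)) * L4n U w)"
    unfolding one by (intro mult_left_mono a(2)) simp
  finally show ?thesis .
qed

text \<open>On a bounded domain geometric decay in L4 implies geometric decay in L1, so the sum of
  the absolute differences has a finite integral and is finite almost everywhere.\<close>

lemma vn_convergent:
  assumes u: "sob U 1 u" shows "AE x in M. convergent (\<lambda>n. vn u n x)"
proof -
  let ?w = "\<lambda>n x. vn u n x - vn u (Suc n) x"
  let ?c = "sqrt (measure M U) * (sqrt (sqrt (measure M U)) * (K4 * L2n U (Gm u)))"
  note L = vn_diff_L4[OF u]
  have i: "integrable M (\<lambda>x. \<bar>?w n x\<bar>)" for n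
    by (intro integrable_abs L2_integrable L4fun_imp_L2fun(1)[OF fin_M] L(1))
  have b: "(LINT x|M. \<bar>?w n x\<bar>) \<le> ?c * qq^n" for n
  proof -
    have "(LINT x|M. \<bar>?w n x\<bar>) \<le> sqrt (measure M U) * (sqrt (sqrt (measure M U)) * L4n U (?w n))"
      by (rule L1_le_L4[OF L(1)])
    also have "\<dots> \<le> sqrt (measure M U) * (sqrt (sqrt (measure M U)) * (K4 * qq^n * L2n U (Gm u)))"
      by (intro mult_left_mono L(2)) auto
    finally show ?thesis by (simp add: ac_simps)
  qed
  have c0: "0 \<le> ?c" using K4(1) by simp
  have sq: "summable (\<lambda>n. ?c * qq^n)" using qq by (intro summable_mult summable_geometric) simp
  have m: "(\<lambda>x. ennreal \<bar>?w n x\<bar>) \<in> borel_measurable M" for n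
    using borel_measurable_integrable[OF i] by simp
  have "(\<integral>\<^sup>+x. (\<Sum>n. ennreal \<bar>?w n x\<bar>) \<partial>M) = (\<Sum>n. \<integral>\<^sup>+x. ennreal \<bar>?w n x\<bar> \<partial>M)"
    by (rule nn_integral_suminf[OF m])
  also have "\<dots> = (\<Sum>n. ennreal (LINT x|M. \<bar>?w n x\<bar>))"
    by (intro suminf_cong nn_integral_eq_integral[OF i]) simp
  also have "\<dots> \<le> (\<Sum>n. ennreal (?c * qq^n))"
    by (intro suminf_le ennreal_leI b summableI)
  also have "\<dots> = ennreal (\<Sum>n. ?c * qq^n)"
    by (intro suminf_ennreal2 sq) (use c0 qq(1) in simp)
  also have "\<dots> < \<infinity>" by simp
  finally have "AE x in M. (\<Sum>n. ennreal \<bar>?w n x\<bar>) \<noteq> \<infinity>"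
    by (intro nn_integral_PInf_AE) (use m in auto)
  then show ?thesis
  proof eventually_elim
    case (elim x)
    have "summable (\<lambda>n. \<bar>?w n x\<bar>)"
      by (rule summable_suminf_not_top) (use elim in auto)
    then have "summable (\<lambda>n. ?w n x)" by (rule summable_rabs_cancel)
    then have "convergent (\<lambda>n. \<Sum>i<n. ?w i x)" by (simp add: summable_iff_convergent)
    then have "convergent (\<lambda>n. vn u 0 x - (\<Sum>i<n. ?w i x))" by (intro convergent_diff convergent_const)
    moreover have "vn u 0 x - (\<Sum>i<n. ?w i x) = vn u n x" for n by (induction n) auto
    ultimately show ?case by simp
  qed
qed

text \<open>The averages converge almost everywhere to some v, and by \<open>L4_limit\<close> also
  in L2; tested with smooth functions they converge to \<open>u\<close>. The fundamental lemma
  identifies the two limits.\<close>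

lemma vn_tendsto:
  assumes u: "sob U 1 u"
  shows "AE x in M. (\<lambda>n. vn u n x) \<longlonglongrightarrow> u x"
proof -
  define v where "v x = lim (\<lambda>n. vn u n x)" for x
  have mvn: "vn u n \<in> borel_measurable M" for n unfolding vn_def by (rule av_meas[OF sob_L2[OF u]])
  have mv: "v \<in> borel_measurable M" unfolding v_def[abs_def] by (rule borel_measurable_lim_metric[OF mvn])
  have cv: "AE x in M. (\<lambda>n. vn u n x) \<longlonglongrightarrow> v x"
    using vn_convergent[OF u] by eventually_elim (simp add: v_def convergent_LIMSEQ_iff)
  have tail: "L4fun U (\<lambda>x. vn u J x - v x)" "L4n U (\<lambda>x. vn u J x - v x) \<le> K4 / (1 - qq) * qq^J * L2n U (Gm u)" for J
  proof -
    have "AE x in M. (\<lambda>m. vn u J x - vn u (J + m) x) \<longlonglongrightarrow> vn u J x - v x"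
      using cv
    proof eventually_elim
      case (elim x)
      have "(\<lambda>m. vn u (m + J) x) \<longlonglongrightarrow> v x" by (rule LIMSEQ_ignore_initial_segment[OF elim])
      then show ?case by (intro tendsto_diff tendsto_const) (simp add: add.commute)
    qed
    note a = L4_limit[OF conjunct1[OF vn_tail_L4[OF u]] conjunct2[OF vn_tail_L4[OF u]] borel_measurable_diff[OF mvn mv] this]
    show "L4fun U (\<lambda>x. vn u J x - v x)" by (rule a(1))
    show "L4n U (\<lambda>x. vn u J x - v x) \<le> K4 / (1 - qq) * qq^J * L2n U (Gm u)" by (rule a(2))
  qed
  have L2d: "L2fun U (\<lambda>x. vn u n x - v x)" for n by (rule L4fun_imp_L2fun(1)[OF fin_M tail(1)])
  have L2vn: "L2fun U (vn u n)" for n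
  proof (rule bounded_L2[OF mvn])
    let ?r = "(1/2::real)^n"
    show "\<bar>vn u n x\<bar> \<le> Bd / ?r^CARD('n) * (LINT z|M. \<bar>u z\<bar>)" for x
    proof -
      have "\<bar>vn u n x\<bar> \<le> (LINT z|M. \<bar>u z * ker x ?r z\<bar>)" unfolding vn_def av_def by (rule integral_abs_bound)
      also have "\<dots> \<le> (LINT z|M. Bd / ?r^CARD('n) * \<bar>u z\<bar>)"
      proof (rule integral_mono)
        show "integrable M (\<lambda>z. \<bar>u z * ker x ?r z\<bar>)" by (intro integrable_abs L2_real_integrable(1) ker_L2 sob_L2[OF u])
        show "integrable M (\<lambda>z. Bd / ?r^CARD('n) * \<bar>u z\<bar>)" by (intro integrable_mult_right integrable_abs L2_integrable sob_L2[OF u])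
        show "\<bar>u z * ker x ?r z\<bar> \<le> Bd / ?r^CARD('n) * \<bar>u z\<bar>" for z
          using mult_left_mono[OF ker_bound[of ?r x z] abs_ge_zero[of "u z"]] by (simp add: abs_mult mult.commute)
      qed
      finally show ?thesis by simp
    qed
  qed
  have L2v: "L2fun U v" using L2fun_diff(1)[OF L2vn[of 0] L2d[of 0]] by simp
  have lim0: "(\<lambda>n. L2n U (\<lambda>x. vn u n x - v x)) \<longlonglongrightarrow> 0"
  proof (rule tendsto_sandwich[OF _ _ tendsto_const])
    show "\<forall>\<^sub>F n in sequentially. L2n U (\<lambda>x. vn u n x - v x) \<le> sqrt (sqrt (measure M U)) * (K4 / (1 - qq) * qq^n * L2n U (Gm u))"
      by (intro always_eventually allI order_trans[OF L4fun_imp_L2fun(2)[OF fin_M tail(1)]] mult_left_mono tail(2)) simp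
    have "(\<lambda>n. sqrt (sqrt (measure M U)) * (K4 / (1 - qq) * qq^n * L2n U (Gm u))) \<longlonglongrightarrow> sqrt (sqrt (measure M U)) * (K4 / (1 - qq) * 0 * L2n U (Gm u))"
      using qq by (intro tendsto_intros LIMSEQ_power_zero) simp
    then show "(\<lambda>n. sqrt (sqrt (measure M U)) * (K4 / (1 - qq) * qq^n * L2n U (Gm u))) \<longlonglongrightarrow> 0" by simp
  qed simp
  have "AE x in M. v x = u x"
  proof (rule L2_fundamental[OF L2v sob_L2[OF u]])
    fix \<phi> assume t: "test_fun U \<phi>"
    have "(\<lambda>n. LINT x|M. \<phi> x * vn u n x) \<longlonglongrightarrow> (LINT x|M. \<phi> x * v x)"
      by (rule L2_tendsto_mult[OF test_L2[OF t] L2v L2vn lim0])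
    from LIMSEQ_unique[OF this vn_weak_tendsto[OF t sob_L2[OF u]]]
    show "(LINT x|M. v x * \<phi> x) = (LINT x|M. u x * \<phi> x)" by (simp add: mult.commute)
  qed
  with cv show ?thesis by eventually_elim simp
qed

lemma vn_approx_L4:
  assumes u: "sob U 1 u"
  shows "L4fun U (\<lambda>x. vn u J x - u x)" "L4n U (\<lambda>x. vn u J x - u x) \<le> K4 / (1 - qq) * qq^J * L2n U (Gm u)"
proof -
  have mvn: "vn u n \<in> borel_measurable M" for n unfolding vn_def by (rule av_meas[OF sob_L2[OF u]])
  have "AE x in M. (\<lambda>m. vn u J x - vn u (J + m) x) \<longlonglongrightarrow> vn u J x - u x"
    using vn_tendsto[OF u]
  proof eventually_elim
    case (elim x)
    have "(\<lambda>m. vn u (m + J) x) \<longlonglongrightarrow> u x" by (rule LIMSEQ_ignore_initial_segment[OF elim])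
    then show ?case by (intro tendsto_diff tendsto_const) (simp add: add.commute)
  qed
  note a = L4_limit[OF conjunct1[OF vn_tail_L4[OF u]] conjunct2[OF vn_tail_L4[OF u]] borel_measurable_diff[OF mvn L2fun_meas[OF sob_L2[OF u]]] this]
  show "L4fun U (\<lambda>x. vn u J x - u x)" by (rule a(1))
  show "L4n U (\<lambda>x. vn u J x - u x) \<le> K4 / (1 - qq) * qq^J * L2n U (Gm u)" by (rule a(2))
qed

end

section \<open>Sobolev inequalities\<close>

lemma abs_pow4: "\<bar>a::real\<bar>^4 = (a^2)^2"
  by (simp add: power4_eq_xxxx power2_eq_square)

lemma cancel_square: "(p::real) \<noteq> 0 \<Longrightarrow> (k * (s^2 / p))^2 * (V * p * g) = k^2 * V * (s^4 / p) * g"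
  by (simp add: power2_eq_square power4_eq_xxxx field_simps)

lemma pow4_prod: "(k * g * q^n)^4 = (k::real)^4 * (q^4)^n * g^4"
proof -
  have "(q^n)^4 = (q^4)^n" unfolding power_mult[symmetric] by (simp only: mult.commute)
  then show ?thesis unfolding power_mult_distrib by simp
qed

lemma times_divide_cancel: "(a::real) \<noteq> 0 \<Longrightarrow> a * (b / a) = b"
  by simp

context convex_domain
begin

lemma abs_int_le: "L2fun U u \<Longrightarrow> (LINT z|M. \<bar>u z :: real\<bar>) \<le> sqrt (measure M U) * L2n U u"
proof -
  assume u: "L2fun U u"
  have one: "L2n U (\<lambda>x. 1::real) = sqrt (measure M U)"
  proof -
    interpret F: finite_measure M by (rule fin_M)
    show ?thesis by (simp add: L2n_def)
  qed
  have "(LINT x|M. \<bar>u x\<bar>) = (LINT x|M. norm (1::real) * norm (u x))" by simp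
  also have "\<dots> \<le> L2n U (\<lambda>x. 1::real) * L2n U u" by (rule L2_Cauchy_Schwarz[OF L2_const u])
  finally show ?thesis by (simp only: one)
qed

lemma bounded_L4:
  fixes f :: "real^'n \<Rightarrow> real"
  assumes "f \<in> borel_measurable M" "\<And>x. x \<in> U \<Longrightarrow> \<bar>f x\<bar> \<le> B"
  shows "L4fun U f" "L4n U f \<le> \<bar>B\<bar> * L4n U (\<lambda>x. 1::real)"
proof -
  interpret F: finite_measure M by (rule fin_M)
  have one: "L4fun U (\<lambda>x. 1::real)" by (simp add: L4fun_def)
  note sc = L4fun_scale[OF one, of B, simplified]
  have "AE x in M. norm (f x) \<le> norm B" by (rule AE_I2) (use assms(2) in force)
  note m = L4fun_mono[OF sc(1) assms(1) this]
  show "L4fun U f" by (rule m(1))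
  show "L4n U f \<le> \<bar>B\<bar> * L4n U (\<lambda>x. 1::real)" using m(2) sc(2) by simp
qed

lemma av_bound:
  assumes u: "L2fun U u" and r: "0 < r"
  shows "\<bar>av u r x\<bar> \<le> Bd / r^CARD('n) * (LINT z|M. \<bar>u z\<bar>)"
proof -
  have "\<bar>av u r x\<bar> \<le> (LINT z|M. \<bar>u z * ker x r z\<bar>)" unfolding av_def by (rule integral_abs_bound)
  also have "\<dots> \<le> (LINT z|M. Bd / r^CARD('n) * \<bar>u z\<bar>)"
  proof (rule integral_mono)
    show "integrable M (\<lambda>z. \<bar>u z * ker x r z\<bar>)" by (intro integrable_abs L2_real_integrable(1) ker_L2 u)
    show "integrable M (\<lambda>z. Bd / r^CARD('n) * \<bar>u z\<bar>)" by (intro integrable_mult_right integrable_abs L2_integrable u)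
    show "\<bar>u z * ker x r z\<bar> \<le> Bd / r^CARD('n) * \<bar>u z\<bar>" for z
      using mult_left_mono[OF ker_bound[OF r, of x z] abs_ge_zero[of "u z"]] by (simp add: abs_mult mult.commute)
  qed
  finally show ?thesis by simp
qed

text \<open>\<open>u\<close> is its average at scale 1, which is bounded, minus a remainder in
  L4.\<close>

lemma sob_L4: assumes u: "sob U 1 u" shows "L4fun U u"
proof -
  have "L4fun U (vn u 0)"
    unfolding vn_def by (rule bounded_L4[OF av_meas[OF sob_L2[OF u]] av_bound[OF sob_L2[OF u]]]) simp
  from L4fun_diff(1)[OF this vn_approx_L4(1)[OF u, of 0]] show ?thesis by simp
qed

lemma eta_lipschitz:
  obtains Le where "Le \<ge> 0" "\<And>a b. \<bar>eta a - eta b\<bar> \<le> Le * norm (a - b)"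
proof -
  obtain B where B: "B > 0" "\<And>x. \<bar>eta x\<bar> \<le> B" "\<And>x j. \<bar>iter_pd [j] eta x\<bar> \<le> B" using eta_bounds by metis
  have "\<bar>eta a - eta b\<bar> \<le> (real CARD('n) * B) * norm (a - b)" for a b
  proof -
    have "\<exists>z>0. z < 1 \<and> eta (b + 1 *\<^sub>R (a - b)) - eta (b + 0 *\<^sub>R (a - b)) = (1 - 0) * (\<Sum>j\<in>UNIV. (a - b) $ j * iter_pd [j] eta (b + z *\<^sub>R (a - b)))"
      by (rule MVT2[of 0 1 "\<lambda>t. eta (b + t *\<^sub>R (a - b))"]) (simp, rule smooth_line_deriv[OF eta_smooth])
    then obtain z where z: "eta a - eta b = (\<Sum>j\<in>UNIV. (a - b) $ j * iter_pd [j] eta (b + z *\<^sub>R (a - b)))" by auto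
    have "\<bar>eta a - eta b\<bar> \<le> (\<Sum>j\<in>(UNIV::'n set). norm (a - b) * B)"
      unfolding z
    proof (rule order_trans[OF sum_abs], rule sum_mono)
      fix j :: 'n
      show "\<bar>(a - b) $ j * iter_pd [j] eta (b + z *\<^sub>R (a - b))\<bar> \<le> norm (a - b) * B"
        unfolding abs_mult by (intro mult_mono component_le_norm_cart B(3)) auto
    qed
    then show ?thesis by (simp add: ac_simps)
  qed
  then show ?thesis using that[of "real CARD('n) * B"] B(1) by simp
qed

text \<open>At a fixed scale the averages are equicontinuous on bounded sets of L2, which is what
  lets a finite net suffice in \<open>ehrling\<close>. The factor 1 - 1/r, by which the argument of
  \<open>eta\<close> moves, is at most 1/r in absolute value.\<close>

lemma av_lipschitz:
  assumes r: "0 < r" "r \<le> 1"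
  obtains L where "L \<ge> 0" "\<And>u x y. L2fun U u \<Longrightarrow> \<bar>av u r x - av u r y\<bar> \<le> L * norm (x - y) * L2n U u"
proof -
  obtain Le where Le: "Le \<ge> 0" "\<And>a b. \<bar>eta a - eta b\<bar> \<le> Le * norm (a - b)" using eta_lipschitz by metis
  let ?k = "1 / r^CARD('n) * (Le * (1/r))"
  have k0: "0 \<le> ?k" using Le(1) r(1) by simp
  have kb: "\<bar>ker x r z - ker y r z\<bar> \<le> ?k * norm (x - y)" for x y z
  proof -
    have e: "(x + (1/r) *\<^sub>R (z - x)) - (y + (1/r) *\<^sub>R (z - y)) = (1 - 1/r) *\<^sub>R (x - y)"
      by (simp add: algebra_simps)
    have "\<bar>ker x r z - ker y r z\<bar> = 1 / r^CARD('n) * \<bar>eta (x + (1/r) *\<^sub>R (z - x)) - eta (y + (1/r) *\<^sub>R (z - y))\<bar>"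
      using r by (simp add: ker_def abs_mult flip: diff_divide_distrib)
    also have "\<dots> \<le> 1 / r^CARD('n) * (Le * norm ((1 - 1/r) *\<^sub>R (x - y)))"
      using Le(2)[of "x + (1/r) *\<^sub>R (z - x)" "y + (1/r) *\<^sub>R (z - y)"] r unfolding e by (intro mult_left_mono) auto
    also have "\<dots> \<le> 1 / r^CARD('n) * (Le * ((1/r) * norm (x - y)))"
    proof (intro mult_left_mono)
      have "\<bar>1 - 1/r\<bar> \<le> 1/r" using r by (simp add: abs_if)
      then show "norm ((1 - 1/r) *\<^sub>R (x - y)) \<le> (1/r) * norm (x - y)" unfolding norm_scaleR by (intro mult_right_mono) auto
    qed (use Le(1) r in auto)
    finally show ?thesis by (simp add: ac_simps)
  qed
  have "\<bar>av u r x - av u r y\<bar> \<le> (?k * sqrt (measure M U)) * norm (x - y) * L2n U u" if u: "L2fun U u" for u x y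
  proof -
    have i: "integrable M (\<lambda>z. u z * ker x r z)" for x by (rule L2_real_integrable(1)[OF u ker_L2])
    have "\<bar>av u r x - av u r y\<bar> = \<bar>LINT z|M. u z * ker x r z - u z * ker y r z\<bar>"
      unfolding av_def by (simp only: Bochner_Integration.integral_diff[OF i i])
    also have "\<dots> \<le> (LINT z|M. \<bar>u z * ker x r z - u z * ker y r z\<bar>)" by (rule integral_abs_bound)
    also have "\<dots> \<le> (LINT z|M. (?k * norm (x - y)) * \<bar>u z\<bar>)"
    proof (rule integral_mono)
      show "integrable M (\<lambda>z. \<bar>u z * ker x r z - u z * ker y r z\<bar>)"
        by (intro integrable_abs Bochner_Integration.integrable_diff i)
      show "integrable M (\<lambda>z. (?k * norm (x - y)) * \<bar>u z\<bar>)"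
        by (intro integrable_mult_right integrable_abs L2_integrable u)
      show "\<bar>u z * ker x r z - u z * ker y r z\<bar> \<le> (?k * norm (x - y)) * \<bar>u z\<bar>" for z
      proof -
        have "u z * ker x r z - u z * ker y r z = (ker x r z - ker y r z) * u z" by (simp add: algebra_simps)
        then show ?thesis using mult_right_mono[OF kb[of x z y] abs_ge_zero[of "u z"]] by (simp only: abs_mult)
      qed
    qed
    also have "\<dots> = (?k * norm (x - y)) * (LINT z|M. \<bar>u z\<bar>)" by simp
    also have "\<dots> \<le> (?k * norm (x - y)) * (sqrt (measure M U) * L2n U u)"
      by (intro mult_left_mono abs_int_le u mult_nonneg_nonneg k0) simp
    finally show ?thesis by (simp only: ac_simps)
  qed
  moreover have "0 \<le> ?k * sqrt (measure M U)" by (rule mult_nonneg_nonneg[OF k0]) simp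
  ultimately show ?thesis by (intro that)
qed

lemma finite_net:
  assumes "\<delta> > 0" obtains P where "finite P" "\<And>x. x \<in> U \<Longrightarrow> \<exists>p\<in>P. norm (x - p) < \<delta>"
proof -
  have 1: "compact (closure U)" using bd by (simp add: compact_closure)
  have 2: "\<And>B. B \<in> (\<lambda>p. ball p \<delta>) ` closure U \<Longrightarrow> open B" by auto
  have 3: "closure U \<subseteq> \<Union> ((\<lambda>p. ball p \<delta>) ` closure U)" using assms by auto
  obtain \<C> where C: "\<C> \<subseteq> (\<lambda>p. ball p \<delta>) ` closure U" "finite \<C>" "closure U \<subseteq> \<Union>\<C>"
    using compactE[OF 1 3 2] by auto
  obtain P where P: "finite P" "\<C> = (\<lambda>p. ball p \<delta>) ` P"
    using finite_subset_image[OF C(2,1)] by blast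
  have "\<exists>p\<in>P. norm (x - p) < \<delta>" if "x \<in> U" for x
  proof -
    have "x \<in> closure U" using that closure_subset by blast
    then obtain p where "p \<in> P" "x \<in> ball p \<delta>" using C(3) P(2) by blast
    then show ?thesis by (auto simp: dist_norm norm_minus_commute)
  qed
  then show ?thesis using that P(1) by blast
qed

text \<open>At a fine enough scale the remainder is below \<epsilon> times the gradient. The average
  at that scale is Lipschitz, hence known up to \<epsilon> times the L2 norm from its values on a
  finite net; these values are pairings of \<open>u\<close> with kernels, which make up F.\<close>

lemma ehrling:
  assumes e: "\<epsilon> > 0"
  shows "\<exists>F C. finite F \<and> (\<forall>\<psi>\<in>F. L2fun U \<psi>) \<and> C \<ge> 0 \<and>
    (\<forall>u. sob U 1 u \<longrightarrow> L4n U u \<le> \<epsilon> * (L2n U u + L2n U (Gm u)) + C * (\<Sum>\<psi>\<in>F. \<bar>LINT x|M. u x * \<psi> x\<bar>))"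
proof -
  have K0: "0 \<le> K4 / (1 - qq)" using K4(1) qq(2) by simp
  have "(\<lambda>J. K4 / (1 - qq) * qq^J) \<longlonglongrightarrow> K4 / (1 - qq) * 0"
    using qq by (intro tendsto_intros LIMSEQ_power_zero) simp
  then have "\<forall>\<^sub>F J in sequentially. K4 / (1 - qq) * qq^J < \<epsilon>"
    using e by (intro order_tendstoD) auto
  then obtain J where J: "K4 / (1 - qq) * qq^J < \<epsilon>" using eventually_happens'[OF sequentially_bot] by blast
  let ?r = "(1/2::real)^J"
  have r: "0 < ?r" "?r \<le> 1" by (simp_all add: power_le_one)
  obtain L where L: "L \<ge> 0" "\<And>u x y. L2fun U u \<Longrightarrow> \<bar>av u ?r x - av u ?r y\<bar> \<le> L * norm (x - y) * L2n U u"
    using av_lipschitz[OF r] by metis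
  let ?c = "L4n U (\<lambda>x. 1::real)"
  \<comment> \<open>The mesh is chosen so that the Lipschitz error, measured in L4, is at most
    \<epsilon>; the added ones keep the denominator positive.\<close>
  define \<delta> where "\<delta> = \<epsilon> / ((L + 1) * (?c + 1))"
  have c0: "0 \<le> ?c" by simp
  have d: "\<delta> > 0" using e L(1) c0 by (simp add: \<delta>_def add_nonneg_pos)
  have dd: "L * \<delta> * ?c \<le> \<epsilon>"
  proof -
    have "L * ?c \<le> (L + 1) * (?c + 1)" using L(1) c0 by (intro mult_mono) auto
    then have "L * ?c * \<delta> \<le> (L + 1) * (?c + 1) * \<delta>" using d by (intro mult_right_mono) auto
    also have "\<dots> = \<epsilon>"
    proof -
      have "(L + 1) * (?c + 1) \<noteq> 0" using L(1) c0 by (intro less_imp_neq[symmetric] mult_pos_pos) linarith+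
      then show ?thesis unfolding \<delta>_def by (rule times_divide_cancel)
    qed
    finally show ?thesis by (simp add: ac_simps)
  qed
  obtain P where P: "finite P" "\<And>x. x \<in> U \<Longrightarrow> \<exists>p\<in>P. norm (x - p) < \<delta>" using finite_net[OF d] by metis
  let ?F = "(\<lambda>p. ker p ?r) ` P"
  have fF: "finite ?F" using P(1) by simp
  have main: "L4n U u \<le> \<epsilon> * (L2n U u + L2n U (Gm u)) + ?c * (\<Sum>\<psi>\<in>?F. \<bar>LINT x|M. u x * \<psi> x\<bar>)" if u: "sob U 1 u" for u
  proof -
    let ?S = "\<Sum>\<psi>\<in>?F. \<bar>LINT x|M. u x * \<psi> x\<bar>"
    have S0: "0 \<le> ?S" by (intro sum_nonneg) simp
    have u2: "L2fun U u" by (rule sob_L2[OF u])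
    have b: "\<bar>vn u J x\<bar> \<le> L * \<delta> * L2n U u + ?S" if x: "x \<in> U" for x
    proof -
      obtain p where p: "p \<in> P" "norm (x - p) < \<delta>" using P(2)[OF x] by blast
      have "\<bar>av u ?r p\<bar> \<le> ?S"
        unfolding av_def using p(1) by (intro member_le_sum[of "ker p ?r" ?F "\<lambda>\<psi>. \<bar>LINT x|M. u x * \<psi> x\<bar>"] fF) auto
      moreover have "\<bar>av u ?r x - av u ?r p\<bar> \<le> L * \<delta> * L2n U u"
        using L(2)[OF u2, of x p] p(2) L(1)
        by (meson L2n_nonneg less_imp_le mult_left_mono mult_right_mono order_trans)
      ultimately show ?thesis unfolding vn_def by linarith
    qed
    have "L4n U (vn u J) \<le> \<bar>L * \<delta> * L2n U u + ?S\<bar> * ?c"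
      by (rule bounded_L4(2)[OF _ b]) (simp_all add: vn_def av_meas[OF u2])
    also have "\<dots> = L * \<delta> * ?c * L2n U u + ?c * ?S"
      using L(1) d S0 by (simp add: abs_of_nonneg algebra_simps)
    also have "\<dots> \<le> \<epsilon> * L2n U u + ?c * ?S" using dd by (intro add_right_mono mult_right_mono) auto
    finally have 1: "L4n U (vn u J) \<le> \<epsilon> * L2n U u + ?c * ?S" .
    have "L4fun U (vn u J)" by (rule bounded_L4(1)[OF _ b]) (simp_all add: vn_def av_meas[OF u2])
    from L4fun_diff(2)[OF this vn_approx_L4(1)[OF u, of J]]
    have "L4n U u \<le> L4n U (vn u J) + L4n U (\<lambda>x. vn u J x - u x)" by simp
    also have "L4n U (\<lambda>x. vn u J x - u x) \<le> \<epsilon> * L2n U (Gm u)"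
      by (rule order_trans[OF vn_approx_L4(2)[OF u]]) (intro mult_right_mono less_imp_le[OF J] L2n_nonneg)
    finally show ?thesis using 1 by (simp add: algebra_simps)
  qed
  have "\<forall>\<psi>\<in>?F. L2fun U \<psi>" by (simp add: ker_L2)
  then show ?thesis using fF c0 main by (intro exI[of _ ?F] exI[of _ ?c]) simp
qed

lemma sob_L4_bound:
  "\<exists>C\<ge>0. \<forall>u. sob U 1 u \<longrightarrow> L4n U u \<le> C * (L2n U u + L2n U (Gm u))"
proof -
  obtain F C where F': "finite F \<and> (\<forall>\<psi>\<in>F. L2fun U \<psi>) \<and> C \<ge> 0 \<and>
    (\<forall>u. sob U 1 u \<longrightarrow> L4n U u \<le> 1 * (L2n U u + L2n U (Gm u)) + C * (\<Sum>\<psi>\<in>F. \<bar>LINT x|M. u x * \<psi> x\<bar>))"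
    using ehrling[OF zero_less_one] by (elim exE) (rule that)
  then have F: "finite F" "\<And>\<psi>. \<psi> \<in> F \<Longrightarrow> L2fun U \<psi>" "C \<ge> 0"
    "\<And>u. sob U 1 u \<Longrightarrow> L4n U u \<le> 1 * (L2n U u + L2n U (Gm u)) + C * (\<Sum>\<psi>\<in>F. \<bar>LINT x|M. u x * \<psi> x\<bar>)"
    by simp_all
  let ?K = "\<Sum>\<psi>\<in>F. L2n U \<psi>"
  have K0: "0 \<le> ?K" by (intro sum_nonneg) simp
  have "L4n U u \<le> (1 + C * ?K) * (L2n U u + L2n U (Gm u))" if u: "sob U 1 u" for u
  proof -
    have "(\<Sum>\<psi>\<in>F. \<bar>LINT x|M. u x * \<psi> x\<bar>) \<le> (\<Sum>\<psi>\<in>F. L2n U u * L2n U \<psi>)"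
      by (intro sum_mono L2_real_integrable(2) sob_L2[OF u] F(2))
    also have "\<dots> = ?K * L2n U u" by (simp add: sum_distrib_left mult.commute)
    also have "\<dots> \<le> ?K * (L2n U u + L2n U (Gm u))" by (intro mult_left_mono K0) simp
    finally have "C * (\<Sum>\<psi>\<in>F. \<bar>LINT x|M. u x * \<psi> x\<bar>) \<le> C * (?K * (L2n U u + L2n U (Gm u)))"
      by (rule mult_left_mono[OF _ F(3)])
    then show ?thesis using F(4)[OF u] by (simp add: algebra_simps)
  qed
  then show ?thesis using F(3) K0 by (intro exI[of _ "1 + C * ?K"]) simp
qed

text \<open>With the gradient in L4 a dyadic difference is small at every point without integration
  in x, so the telescoping sum is bounded uniformly. The average at scale 1 supplies the bounded
  first term.\<close>

lemma sob_W14_bounded: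
  assumes u: "sob U 1 u" and g: "L4fun U (Gm u)"
  obtains K where "K \<ge> 0" "AE x in M. \<bar>u x\<bar> \<le> K"
proof -
  let ?G = "L4n U (Gm u)"
  have w: "\<bar>vn u n x - vn u (Suc n) x\<bar> \<le> K4 * ?G * qq^n" if x: "x \<in> U" for n x
  proof (rule pow4_le)
    show "0 \<le> K4 * ?G * qq^n" using K4(1) qq(1) by simp
    let ?s = "(1/2::real)^Suc n"
    have s: "0 < ?s" "2 * ?s \<le> 1" "?s \<le> 1" using power_le_one[of "1/2::real" n] power_le_one[of "1/2::real" "Suc n"] by simp_all
    let ?c = "KK * (?s^2 / ?s^CARD('n))"
    have c0: "0 \<le> ?c" using KK_nonneg by simp
    have e: "vn u n x - vn u (Suc n) x = av u (2 * ?s) x - av u ?s x"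
      unfolding vn_def half_scale[symmetric] ..
    have "\<bar>vn u n x - vn u (Suc n) x\<bar>^4 = ((av u (2 * ?s) x - av u ?s x)^2)^2"
      unfolding e by (rule abs_pow4)
    also have "\<dots> \<le> (?c * Q u ?s x)^2" by (intro power_mono av_diff_sq u x s) simp
    also have "\<dots> = ?c^2 * (Q u ?s x)^2" by (rule power_mult_distrib)
    also have "\<dots> \<le> ?c^2 * (Vd * ?s^CARD('n) * ?G^4)" by (intro mult_left_mono Q_le4 u g s) simp
    also have "\<dots> = KK^2 * Vd * (?s^4 / ?s^CARD('n)) * ?G^4"
      by (rule cancel_square) (use s(1) in simp)
    also have "\<dots> \<le> KK^2 * Vd * (1/2)^n * ?G^4"
    proof (intro mult_right_mono mult_left_mono)
      have "?s \<le> (1/2)^n" by simp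
      then show "?s^4 / ?s^CARD('n) \<le> (1/2)^n" using s_power[OF s(1,3)] by linarith
    qed (use Vd_nonneg in auto)
    also have "\<dots> = (K4 * ?G * qq^n)^4"
      unfolding pow4_prod K4(2) qq(3) ..
    finally show "\<bar>vn u n x - vn u (Suc n) x\<bar>^4 \<le> (K4 * ?G * qq^n)^4" .
  qed
  let ?K = "K4 * ?G * (1 / (1 - qq))"
  have tail: "\<bar>vn u 0 x - vn u m x\<bar> \<le> ?K" if x: "x \<in> U" for m x
  proof -
    have "vn u 0 x - vn u m x = (\<Sum>j<m. vn u j x - vn u (Suc j) x)" by (induction m) auto
    then have "\<bar>vn u 0 x - vn u m x\<bar> \<le> (\<Sum>j<m. K4 * ?G * qq^j)"
      using order_trans[OF sum_abs sum_mono[OF w[OF x]]] by simp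
    also have "\<dots> = K4 * ?G * (\<Sum>j<m. qq^j)" by (simp add: sum_distrib_left)
    also have "\<dots> \<le> K4 * ?G * (\<Sum>j. qq^j)"
      using qq K4(1) by (intro mult_left_mono sum_le_suminf summable_geometric) auto
    also have "(\<Sum>j. qq^j) = 1 / (1 - qq)" using suminf_geometric[of qq] qq by simp
    finally show ?thesis .
  qed
  let ?B = "Bd / 1^CARD('n) * (LINT z|M. \<bar>u z\<bar>)"
  have b: "\<bar>vn u m x\<bar> \<le> ?K + ?B" if "x \<in> U" for m x
    using tail[OF that, of m] av_bound[OF sob_L2[OF u] zero_less_one, of x] by (simp add: vn_def)
  have "AE x in M. \<bar>u x\<bar> \<le> ?K + ?B"
    using vn_tendsto[OF u] AE_space
  proof eventually_elim
    case (elim x)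
    show ?case
      by (rule tendsto_upperbound[OF tendsto_rabs[OF elim(1)]]) (use b elim(2) in auto)
  qed
  moreover have "0 \<le> ?K + ?B" using K4(1) qq Bd(1) by (intro add_nonneg_nonneg mult_nonneg_nonneg) auto
  ultimately show ?thesis using that by blast
qed

end

section \<open>Finite-rank approximation and finite-dimensional fixed points\<close>

text \<open>Tuples of functions, coefficient vectors and tuples of these are all function types; a
  pointwise structure makes \<open>subspace\<close> and \<open>span\<close> available for each of
  them.\<close>

instantiation "fun" :: (type, real_vector) real_vector
begin
definition scaleR_fun :: "real \<Rightarrow> ('a \<Rightarrow> 'b) \<Rightarrow> 'a \<Rightarrow> 'b" where
  "scaleR_fun c f = (\<lambda>x. c *\<^sub>R f x)"
instance
  by standard (simp_all add: scaleR_fun_def fun_eq_iff plus_fun_def zero_fun_def scaleR_add_right scaleR_add_left)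
end

lemma sum_fun_apply: "(\<Sum>i\<in>I. f i) x = (\<Sum>i\<in>I. f i x)"
  by (induction I rule: infinite_finite_induct) (simp_all add: plus_fun_def zero_fun_def)

text \<open>The images of the unit vectors under an injective square system are independent and as
  numerous as the unit vectors; a right-hand side outside their span would give one independent
  vector too many.\<close>

lemma finite_matrix_solve:
  fixes A :: "'b \<Rightarrow> 'b \<Rightarrow> real"
  assumes fB: "finite B"
    and inj: "\<And>c. (\<And>b'. b' \<in> B \<Longrightarrow> (\<Sum>b\<in>B. c b * A b b') = 0) \<Longrightarrow> \<forall>b\<in>B. c b = 0"
  shows "\<exists>c. \<forall>b'\<in>B. (\<Sum>b\<in>B. c b * A b b') = g b'"
proof -
  define T :: "('b \<Rightarrow> real) \<Rightarrow> 'b \<Rightarrow> real" where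
    "T c b' = (if b' \<in> B then (\<Sum>b\<in>B. c b * A b b') else 0)" for c b'
  define \<delta> :: "'b \<Rightarrow> 'b \<Rightarrow> real" where "\<delta> b = (\<lambda>b'. if b' = b then 1 else 0)" for b
  have lin: "linear T"
    by (rule linearI)
      (auto simp: T_def fun_eq_iff scaleR_fun_def plus_fun_def algebra_simps sum.distrib sum_distrib_left)
  have rep: "g = (\<Sum>b\<in>B. g b *\<^sub>R \<delta> b)" if "\<And>b. b \<notin> B \<Longrightarrow> g b = 0" for g
  proof
    fix y
    have "(\<Sum>b\<in>B. g b *\<^sub>R \<delta> b) y = (\<Sum>b\<in>B. if b = y then g b else 0)"
      by (simp add: sum_fun_apply scaleR_fun_def \<delta>_def) (intro sum.cong, auto)
    also have "\<dots> = g y" using fB that by (simp add: sum.delta)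
    finally show "g y = (\<Sum>b\<in>B. g b *\<^sub>R \<delta> b) y" by simp
  qed
  have insp: "g \<in> span (\<delta> ` B)" if "\<And>b. b \<notin> B \<Longrightarrow> g b = 0" for g
    by (subst rep[OF that], assumption) (intro span_sum span_scale span_base imageI)
  have supp: "g b = 0" if "g \<in> span (\<delta> ` B)" "b \<notin> B" for g b
  proof -
    have "subspace {g :: 'b \<Rightarrow> real. \<forall>b. b \<notin> B \<longrightarrow> g b = 0}"
      by (rule subspaceI) (simp_all add: zero_fun_def plus_fun_def scaleR_fun_def)
    moreover have "\<delta> ` B \<subseteq> {g. \<forall>b. b \<notin> B \<longrightarrow> g b = 0}" by (auto simp: \<delta>_def)
    ultimately have "span (\<delta> ` B) \<subseteq> {g. \<forall>b. b \<notin> B \<longrightarrow> g b = 0}" by (intro span_minimal)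
    then show ?thesis using that by blast
  qed
  have zero_c: "c = 0" if c: "c \<in> span (\<delta> ` B)" and T0: "T c = 0" for c
  proof
    fix b
    have "(\<Sum>b\<in>B. c b * A b b') = 0" if "b' \<in> B" for b'
      using fun_cong[OF T0, of b'] that by (simp add: T_def zero_fun_def)
    then have "\<forall>b\<in>B. c b = 0" by (rule inj)
    then show "c b = (0 :: 'b \<Rightarrow> real) b" using supp[OF c, of b] by (cases "b \<in> B") (simp_all add: zero_fun_def)
  qed
  have injT: "inj_on T (span (\<delta> ` B))"
    using linear_inj_on_iff_eq_0[OF lin subspace_span[of "\<delta> ` B"]] zero_c by blast
  have inj\<delta>: "inj_on \<delta> B"
  proof (rule inj_onI)
    fix a b assume "\<delta> a = \<delta> b"
    from fun_cong[OF this, of a] show "a = b" by (simp add: \<delta>_def split: if_splits)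
  qed
  have ind\<delta>: "independent (\<delta> ` B)"
  proof (rule independent_if_scalars_zero)
    show "finite (\<delta> ` B)" using fB by simp
    fix f x assume s: "(\<Sum>y\<in>\<delta> ` B. f y *\<^sub>R y) = 0" and x: "x \<in> \<delta> ` B"
    then obtain b where b: "b \<in> B" "x = \<delta> b" by blast
    have "0 = (\<Sum>y\<in>\<delta> ` B. f y *\<^sub>R y) b" using s by (simp add: zero_fun_def)
    also have "\<dots> = (\<Sum>a\<in>B. (f (\<delta> a) *\<^sub>R \<delta> a) b)" by (simp add: sum.reindex[OF inj\<delta>] sum_fun_apply)
    also have "\<dots> = (\<Sum>a\<in>B. if a = b then f (\<delta> a) else 0)"
      by (intro sum.cong) (auto simp: scaleR_fun_def \<delta>_def)
    also have "\<dots> = f x" using b fB by (simp add: sum.delta)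
    finally show "f x = 0" by simp
  qed
  have indT: "independent (T ` \<delta> ` B)"
    by (rule linear_independent_injective_image[OF lin ind\<delta> injT])
  have cardT: "card (T ` \<delta> ` B) = card B"
    by (metis card_image inj\<delta> inj_on_subset injT span_superset)
  have Tsp: "T ` \<delta> ` B \<subseteq> span (\<delta> ` B)"
    by (auto intro!: insp simp: T_def)
  define g' where "g' b = (if b \<in> B then g b else 0)" for b
  have g': "g' \<in> span (\<delta> ` B)" by (rule insp) (simp add: g'_def)
  have "g' \<in> span (T ` \<delta> ` B)"
  proof (rule ccontr)
    assume n: "g' \<notin> span (T ` \<delta> ` B)"
    have 1: "independent (insert g' (T ` \<delta> ` B))"
      using independent_insertI[OF n indT] .
    have 2: "insert g' (T ` \<delta> ` B) \<subseteq> span (\<delta> ` B)" using Tsp g' by (rule insert_subsetI[rotated])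
    have 3: "card (insert g' (T ` \<delta> ` B)) \<le> card (\<delta> ` B)"
      by (rule conjunct2[OF independent_span_bound[OF finite_imageI[OF fB] 1 2]])
    have 4: "g' \<notin> T ` \<delta> ` B"
    proof
      assume "g' \<in> T ` \<delta> ` B"
      from span_base[OF this] n show False by (rule notE[rotated])
    qed
    have "card (insert g' (T ` \<delta> ` B)) = Suc (card B)"
      using 4 fB cardT by (simp add: card_insert_disjoint)
    then show False using 3 card_image[OF inj\<delta>] by simp
  qed
  then have "g' \<in> T ` span (\<delta> ` B)" using linear_span_image[OF lin, of "\<delta> ` B"] by (simp only:)
  then obtain c where c: "g' = T c" by (rule imageE)
  have "(\<Sum>b\<in>B. c b * A b b') = g b'" if "b' \<in> B" for b'
    using fun_cong[OF c, of b'] that by (simp add: T_def g'_def)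
  then show ?thesis by blast
qed

text \<open>Integrals are additive only on integrable functions, so linearity is required on a
  subspace and not on the whole function type.\<close>

definition lin_on :: "'a::real_vector set \<Rightarrow> ('a \<Rightarrow> real) \<Rightarrow> bool" where
  "lin_on S f \<longleftrightarrow> (\<forall>u\<in>S. \<forall>v\<in>S. \<forall>a b. f (a *\<^sub>R u + b *\<^sub>R v) = a * f u + b * f v)"

lemma lin_onD: "lin_on S f \<Longrightarrow> u \<in> S \<Longrightarrow> v \<in> S \<Longrightarrow> f (a *\<^sub>R u + b *\<^sub>R v) = a * f u + b * f v"
  by (simp add: lin_on_def)

lemma lin_on_simps:
  assumes "lin_on S f" "subspace S"
  shows "f 0 = 0" "u \<in> S \<Longrightarrow> v \<in> S \<Longrightarrow> f (u + v) = f u + f v" "u \<in> S \<Longrightarrow> f (c *\<^sub>R u) = c * f u"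
    "u \<in> S \<Longrightarrow> v \<in> S \<Longrightarrow> f (u - v) = f u - f v"
proof -
  have z: "0 \<in> S" using assms(2) by (rule subspace_0)
  show 0: "f 0 = 0" using lin_onD[OF assms(1) z z, of 0 0] by simp
  show "u \<in> S \<Longrightarrow> v \<in> S \<Longrightarrow> f (u + v) = f u + f v" using lin_onD[OF assms(1), of u v 1 1] by simp
  show "u \<in> S \<Longrightarrow> f (c *\<^sub>R u) = c * f u" using lin_onD[OF assms(1) _ z, of u c 0] 0 by simp
  show "u \<in> S \<Longrightarrow> v \<in> S \<Longrightarrow> f (u - v) = f u - f v" using lin_onD[OF assms(1), of u v 1 "-1"] by simp
qed

lemma lin_on_sum:
  assumes "lin_on S f" "subspace S" "\<And>i. i \<in> I \<Longrightarrow> e i \<in> S"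
  shows "f (\<Sum>i\<in>I. c i *\<^sub>R e i) = (\<Sum>i\<in>I. c i * f (e i))"
  using assms(3)
proof (induction I rule: infinite_finite_induct)
  case (insert i I)
  have "(\<Sum>i\<in>I. c i *\<^sub>R e i) \<in> S" by (intro subspace_sum subspace_scale assms(2)) (use insert.prems in auto)
  then have "f (c i *\<^sub>R e i + (\<Sum>i\<in>I. c i *\<^sub>R e i)) = c i * f (e i) + f (\<Sum>i\<in>I. c i *\<^sub>R e i)"
    using lin_on_simps(2,3)[OF assms(1,2)] insert.prems subspace_scale[OF assms(2)] by simp
  then show ?case using insert by simp
qed (simp_all add: lin_on_simps(1)[OF assms(1,2)])

section \<open>Semi-inner products and finite-rank approximation\<close>

locale semi_ip =
  fixes S :: "'a::real_vector set" and ip :: "'a \<Rightarrow> 'a \<Rightarrow> real"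
  assumes sub: "subspace S"
    and lin: "\<And>w. w \<in> S \<Longrightarrow> lin_on S (ip w)"
    and sym: "\<And>u v. u \<in> S \<Longrightarrow> v \<in> S \<Longrightarrow> ip u v = ip v u"
    and nonneg: "\<And>u. u \<in> S \<Longrightarrow> 0 \<le> ip u u"
begin

definition nrm :: "'a \<Rightarrow> real" where "nrm u = sqrt (ip u u)"

lemma nrm_nonneg: "u \<in> S \<Longrightarrow> 0 \<le> nrm u" by (simp add: nrm_def nonneg)
lemma nrm_sq: "u \<in> S \<Longrightarrow> (nrm u)^2 = ip u u" by (simp add: nrm_def nonneg)

lemma comb_in: "(\<And>m. m < n \<Longrightarrow> e m \<in> S) \<Longrightarrow> (\<Sum>m<n. c m *\<^sub>R e m) \<in> S" for n :: nat
  by (intro subspace_sum subspace_scale sub) auto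

lemma ip_comb:
  assumes "\<And>m. m < n \<Longrightarrow> e m \<in> S" "u \<in> S"
  shows "ip (\<Sum>m<n. c m *\<^sub>R e m) u = (\<Sum>m<(n::nat). c m * ip (e m) u)"
proof -
  have "ip (\<Sum>m<n. c m *\<^sub>R e m) u = ip u (\<Sum>m<n. c m *\<^sub>R e m)" by (rule sym[OF comb_in assms(2)]) (rule assms(1))
  also have "\<dots> = (\<Sum>m<n. c m * ip u (e m))" by (rule lin_on_sum[OF lin[OF assms(2)] sub]) (use assms(1) in simp)
  also have "\<dots> = (\<Sum>m<n. c m * ip (e m) u)" by (intro sum.cong refl) (use assms sym in simp)
  finally show ?thesis .
qed

definition orthonormal :: "nat \<Rightarrow> (nat \<Rightarrow> 'a) \<Rightarrow> bool" where
  "orthonormal n e \<longleftrightarrow> (\<forall>m<n. e m \<in> S) \<and> (\<forall>m<n. \<forall>k<n. ip (e m) (e k) = (if m = k then 1 else 0))"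

lemma orthonormal_comb:
  assumes "orthonormal n e"
  shows "k < n \<Longrightarrow> ip (e k) (\<Sum>m<n. c m *\<^sub>R e m) = c k"
    "ip (\<Sum>m<n. c m *\<^sub>R e m) (\<Sum>m<n. d m *\<^sub>R e m) = (\<Sum>m<n. c m * d m)"
proof -
  have e: "\<And>m. m < n \<Longrightarrow> e m \<in> S" and o: "\<And>m k. m < n \<Longrightarrow> k < n \<Longrightarrow> ip (e m) (e k) = (if m = k then 1 else 0)"
    using assms by (auto simp: orthonormal_def)
  have 1: "ip (e k) (\<Sum>m<n. c m *\<^sub>R e m) = c k" if k: "k < n" for k c
  proof -
    have "ip (e k) (\<Sum>m<n. c m *\<^sub>R e m) = (\<Sum>m<n. c m * ip (e k) (e m))"
      by (rule lin_on_sum[OF lin[OF e[OF k]] sub]) (use e in simp)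
    also have "\<dots> = (\<Sum>m<n. if m = k then c m else 0)" by (intro sum.cong refl) (use o k in auto)
    finally show ?thesis using k by simp
  qed
  show "k < n \<Longrightarrow> ip (e k) (\<Sum>m<n. c m *\<^sub>R e m) = c k" by (rule 1)
  show "ip (\<Sum>m<n. c m *\<^sub>R e m) (\<Sum>m<n. d m *\<^sub>R e m) = (\<Sum>m<n. c m * d m)"
    by (subst ip_comb[OF e comb_in[OF e]]) (simp_all add: 1)
qed

text \<open>Each functional is tested with the sum of the system carrying its signs, a vector of
  norm at most the root of n; so the sum of its absolute values grows at most like that root. The
  lower bound \<epsilon> on each member makes it grow like n, and n is bounded.\<close>

lemma orthonormal_size_bound:
  assumes o: "orthonormal n e" and fI: "finite I" and l: "\<And>i. i \<in> I \<Longrightarrow> lin_on S (l i)"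
    and lb: "\<And>i u. i \<in> I \<Longrightarrow> u \<in> S \<Longrightarrow> \<bar>l i u\<bar> \<le> cc i * nrm u"
    and q: "\<And>m. m < n \<Longrightarrow> \<epsilon> \<le> C * (\<Sum>i\<in>I. \<bar>l i (e m)\<bar>)" and e0: "\<epsilon> > 0" and C: "C \<ge> 0"
  shows "real n \<le> (C * (\<Sum>i\<in>I. cc i) / \<epsilon>)^2"
proof -
  have e: "\<And>m. m < n \<Longrightarrow> e m \<in> S" using o by (auto simp: orthonormal_def)
  have s: "(\<Sum>m<n. \<bar>l i (e m)\<bar>) \<le> cc i * sqrt (real n)" if i: "i \<in> I" for i
  proof -
    let ?v = "\<Sum>m<n. sgn (l i (e m)) *\<^sub>R e m"
    have cc: "0 \<le> cc i * nrm u" if "u \<in> S" for u using lb[OF i that] by linarith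
    have v: "?v \<in> S" by (rule comb_in[OF e])
    have "l i ?v = (\<Sum>m<n. sgn (l i (e m)) * l i (e m))" by (rule lin_on_sum[OF l[OF i] sub]) (use e in simp)
    also have "\<dots> = (\<Sum>m<n. \<bar>l i (e m)\<bar>)" by (intro sum.cong refl) (simp add: abs_sgn mult.commute)
    finally have 1: "(\<Sum>m<n. \<bar>l i (e m)\<bar>) \<le> cc i * nrm ?v" using lb[OF i v] by linarith
    have "ip ?v ?v = (\<Sum>m<n. sgn (l i (e m)) * sgn (l i (e m)))" by (rule orthonormal_comb(2)[OF o])
    also have "\<dots> \<le> (\<Sum>m<n. 1)" by (intro sum_mono) (simp add: sgn_if)
    finally have 2: "nrm ?v \<le> sqrt (real n)" by (simp add: nrm_def)
    show ?thesis
    proof (cases "n = 0")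
      case False
      then have "e 0 \<in> S" "nrm (e 0) = 1" using o by (auto simp: orthonormal_def nrm_def)
      then have "0 \<le> cc i" using cc[of "e 0"] by simp
      then show ?thesis using 1 2 by (meson mult_left_mono order_trans)
    qed simp
  qed
  let ?K = "\<Sum>i\<in>I. cc i"
  have "real n * \<epsilon> = (\<Sum>m<n. \<epsilon>)" by simp
  also have "\<dots> \<le> (\<Sum>m<n. C * (\<Sum>i\<in>I. \<bar>l i (e m)\<bar>))" by (intro sum_mono q) simp
  also have "\<dots> = C * (\<Sum>i\<in>I. \<Sum>m<n. \<bar>l i (e m)\<bar>)" by (simp add: sum_distrib_left sum.swap[of _ I])
  also have "\<dots> \<le> C * (\<Sum>i\<in>I. cc i * sqrt (real n))" by (intro mult_left_mono sum_mono s C)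
  also have "\<dots> = C * ?K * sqrt (real n)" by (simp add: sum_distrib_right)
  finally have m: "real n * \<epsilon> \<le> C * ?K * sqrt (real n)" .
  have "sqrt (real n) \<le> C * ?K / \<epsilon> \<or> n = 0"
  proof (cases "n = 0")
    case False
    then have p: "sqrt (real n) > 0" by simp
    have "sqrt (real n) * (sqrt (real n) * \<epsilon>) \<le> sqrt (real n) * (C * ?K)"
      using m by (simp only: mult.assoc[symmetric] real_sqrt_mult_self abs_of_nat) (simp only: ac_simps)
    then have "sqrt (real n) * \<epsilon> \<le> C * ?K" using p by simp
    then show ?thesis using e0 by (simp add: field_simps)
  qed simp
  then show ?thesis
  proof
    assume "sqrt (real n) \<le> C * ?K / \<epsilon>"
    then have "(sqrt (real n))^2 \<le> (C * ?K / \<epsilon>)^2" by (intro power_mono) auto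
    then show ?thesis by simp
  qed simp
qed

text \<open>An orthonormal system whose members all have q at least \<epsilon> has bounded length,
  so a longest one exists. An orthogonal vector with q above \<epsilon> times its norm could be
  normalised and appended.\<close>

lemma finite_rank_splitting:
  assumes hom: "\<And>c u. u \<in> S \<Longrightarrow> q (c *\<^sub>R u) = \<bar>c\<bar> * q u" and qb: "\<And>u. u \<in> S \<Longrightarrow> q u \<le> C0 * nrm u"
    and fI: "finite I" and l: "\<And>i. i \<in> I \<Longrightarrow> lin_on S (l i)"
    and lb: "\<And>i u. i \<in> I \<Longrightarrow> u \<in> S \<Longrightarrow> \<bar>l i u\<bar> \<le> cc i * nrm u"
    and q: "\<And>u. u \<in> S \<Longrightarrow> q u \<le> \<epsilon> / 2 * nrm u + C * (\<Sum>i\<in>I. \<bar>l i u\<bar>)" and e0: "\<epsilon> > 0" and C: "C \<ge> 0"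
  shows "\<exists>n e. orthonormal n e \<and> (\<forall>u\<in>S. (\<forall>m<n. ip (e m) u = 0) \<longrightarrow> q u \<le> \<epsilon> * nrm u)"
proof -
  define P where "P n \<longleftrightarrow> (\<exists>e. orthonormal n e \<and> (\<forall>m<n. \<epsilon> \<le> q (e m)))" for n
  have "P 0" by (simp add: P_def orthonormal_def)
  have bnd: "n \<le> nat \<lceil>(C * (\<Sum>i\<in>I. cc i) / (\<epsilon>/2))^2\<rceil>" if "P n" for n
  proof -
    obtain e where o: "orthonormal n e" and qe: "\<forall>m<n. \<epsilon> \<le> q (e m)" using \<open>P n\<close> unfolding P_def by (elim exE conjE) (rule that)
    \<comment> \<open>On a unit vector the norm term of the hypothesis takes up \<epsilon>/2, so the
      functionals account for the other half.\<close>
    have "\<epsilon>/2 \<le> C * (\<Sum>i\<in>I. \<bar>l i (e m)\<bar>)" if m: "m < n" for m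
    proof -
      have "e m \<in> S" "nrm (e m) = 1" using o m by (auto simp: orthonormal_def nrm_def)
      then show ?thesis using q[of "e m"] qe m by fastforce
    qed
    from orthonormal_size_bound[OF o fI l lb this _ C] e0
    have "real n \<le> (C * (\<Sum>i\<in>I. cc i) / (\<epsilon>/2))^2" by simp
    then show ?thesis by linarith
  qed
  obtain n where n: "P n" "\<And>k. P k \<Longrightarrow> k \<le> n"
    using GreatestI_nat[of P 0, OF \<open>P 0\<close> bnd] Greatest_le_nat[of P _, OF _ bnd] by metis
  obtain e where o: "orthonormal n e" and qe: "\<forall>m<n. \<epsilon> \<le> q (e m)" using n(1) unfolding P_def by (elim exE conjE) (rule that)
  have "q u \<le> \<epsilon> * nrm u" if u: "u \<in> S" and ort: "\<forall>m<n. ip (e m) u = 0" for u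
  proof (rule ccontr)
    assume c: "\<not> q u \<le> \<epsilon> * nrm u"
    have "nrm u \<noteq> 0" using c qb[OF u] by auto
    then have p: "nrm u > 0" using nrm_nonneg[OF u] by simp
    define w where "w = (1 / nrm u) *\<^sub>R u"
    have w: "w \<in> S" unfolding w_def by (rule subspace_scale[OF sub u])
    have ww: "ip w w = 1"
    proof -
      have "ip w w = (1 / nrm u) * ip w u" unfolding w_def[of ] by (rule lin_on_simps(3)[OF lin[OF w[unfolded w_def]] sub u])
      also have "ip w u = ip u w" by (rule sym[OF w u])
      also have "ip u w = (1 / nrm u) * ip u u" unfolding w_def by (rule lin_on_simps(3)[OF lin[OF u] sub u])
      finally show ?thesis unfolding nrm_sq[OF u, symmetric] using p by (simp add: power2_eq_square)
    qed
    have we: "ip (e m) w = 0" if "m < n" for m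
    proof -
      have "e m \<in> S" using o that by (simp add: orthonormal_def)
      from lin_on_simps(3)[OF lin[OF this] sub u, of "1 / nrm u"] show ?thesis using ort that by (simp add: w_def)
    qed
    have qw: "\<epsilon> \<le> q w"
      unfolding w_def hom[OF u] using c p by (simp add: field_simps)
    define e' where "e' m = (if m = n then w else e m)" for m
    have "orthonormal (Suc n) e'"
      unfolding orthonormal_def
    proof (intro conjI allI impI)
      show "e' m \<in> S" if "m < Suc n" for m using that o w by (auto simp: e'_def orthonormal_def)
      show "ip (e' m) (e' k) = (if m = k then 1 else 0)" if mk: "m < Suc n" "k < Suc n" for m k
      proof -
        have es: "e m \<in> S" if "m < n" for m using o that by (simp add: orthonormal_def)
        consider "m = n" "k = n" | "m < n" "k = n" | "m = n" "k < n" | "m < n" "k < n" using mk by linarith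
        then show ?thesis
        proof cases
          case 3
          then show ?thesis using sym[OF w es[OF 3(2)]] we[OF 3(2)] by (simp add: e'_def)
        qed (use o ww we in \<open>auto simp: e'_def orthonormal_def\<close>)
      qed
    qed
    moreover have "\<forall>m<Suc n. \<epsilon> \<le> q (e' m)" using qe qw by (auto simp: e'_def less_Suc_eq)
    ultimately have "P (Suc n)" unfolding P_def by (intro exI conjI)
    then show False using n(2) by fastforce
  qed
  then show ?thesis using o by (intro exI[of _ n] exI[of _ e]) simp
qed

text \<open>\<xi> represents \<kappa> on the span of the system. For general u the error is \<kappa>
  of the part orthogonal to that span, where \<open>q\<close> is small and the norm is at most that
  of u.\<close>

lemma riesz_approx:
  assumes o: "orthonormal n e" and split: "\<And>u. u \<in> S \<Longrightarrow> (\<forall>m<n. ip (e m) u = 0) \<Longrightarrow> q u \<le> \<epsilon> * nrm u"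
    and k: "lin_on S \<kappa>" and kb: "\<And>u. u \<in> S \<Longrightarrow> \<bar>\<kappa> u\<bar> \<le> t * q u" and t: "0 \<le> t" and e0: "0 \<le> \<epsilon>"
  defines "\<xi> \<equiv> (\<Sum>m<n. \<kappa> (e m) *\<^sub>R e m)"
  shows "\<xi> \<in> S" "\<And>u. u \<in> S \<Longrightarrow> \<bar>\<kappa> u - ip \<xi> u\<bar> \<le> t * \<epsilon> * nrm u" "\<kappa> \<xi> = ip \<xi> \<xi>"
proof -
  have e: "\<And>m. m < n \<Longrightarrow> e m \<in> S" using o by (auto simp: orthonormal_def)
  show x: "\<xi> \<in> S" unfolding \<xi>_def by (rule comb_in[OF e])
  show "\<kappa> \<xi> = ip \<xi> \<xi>"
  proof -
    have "\<kappa> \<xi> = (\<Sum>m<n. \<kappa> (e m) * \<kappa> (e m))" unfolding \<xi>_def by (rule lin_on_sum[OF k sub]) (use e in simp)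
    then show ?thesis unfolding \<xi>_def orthonormal_comb(2)[OF o] .
  qed
  fix u assume u: "u \<in> S"
  let ?p = "\<Sum>m<n. ip (e m) u *\<^sub>R e m"
  have p: "?p \<in> S" by (rule comb_in[OF e])
  let ?w = "u - ?p"
  have w: "?w \<in> S" by (rule subspace_diff[OF sub u p])
  have ort: "\<forall>m<n. ip (e m) ?w = 0"
    by (intro allI impI) (simp add: lin_on_simps(4)[OF lin[OF e] sub u p] orthonormal_comb(1)[OF o])
  have "ip \<xi> u = (\<Sum>m<n. \<kappa> (e m) * ip (e m) u)" unfolding \<xi>_def by (rule ip_comb[OF e u])
  also have "\<dots> = (\<Sum>m<n. ip (e m) u * \<kappa> (e m))" by (simp only: mult.commute)
  also have "\<dots> = \<kappa> ?p" by (rule lin_on_sum[OF k sub, symmetric]) (use e in simp)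
  finally have "\<kappa> u - ip \<xi> u = \<kappa> ?w" by (simp add: lin_on_simps(4)[OF k sub u p])
  then have "\<bar>\<kappa> u - ip \<xi> u\<bar> \<le> t * q ?w" using kb[OF w] by simp
  also have "\<dots> \<le> t * (\<epsilon> * nrm ?w)" by (intro mult_left_mono split w ort t)
  also have "\<dots> \<le> t * (\<epsilon> * nrm u)"
  proof (intro mult_left_mono t e0)
    have pw: "ip ?p ?w = 0" by (subst ip_comb[OF e w]) (use ort in simp_all)
    have "ip ?w u = ip u ?w" by (rule sym[OF w u])
    also have "u = ?w + ?p" by simp
    finally have "ip u u = ip ?w ?w + ip ?w ?p + ip u ?p"
      using lin_on_simps(2)[OF lin[OF w] sub w p] lin_on_simps(2)[OF lin[OF u] sub w p] sym[OF w u] by simp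
    also have "ip ?w ?p = 0" using pw sym[OF w p] by simp
    also have "ip u ?p = (\<Sum>m<n. ip (e m) u * ip u (e m))" by (rule lin_on_sum[OF lin[OF u] sub]) (use e in simp)
    also have "\<dots> = (\<Sum>m<n. (ip (e m) u)^2)" by (intro sum.cong refl) (use sym[OF u e] in \<open>simp add: power2_eq_square\<close>)
    finally have "ip u u = ip ?w ?w + (\<Sum>m<n. (ip (e m) u)^2)" by simp
    moreover have "0 \<le> (\<Sum>m<n. (ip (e m) u)^2)" by (intro sum_nonneg) simp
    ultimately show "nrm ?w \<le> nrm u" unfolding nrm_def by simp
  qed
  finally show "\<bar>\<kappa> u - ip \<xi> u\<bar> \<le> t * \<epsilon> * nrm u" by (simp add: mult.assoc)
qed

end

text \<open>A basis with its coordinate functionals, so that the discrete space and its k-fold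
  product are handled alike.\<close>

locale fin_space =
  fixes V :: "'a::real_vector set" and B :: "'b set" and e :: "'b \<Rightarrow> 'a" and x :: "'b \<Rightarrow> 'a \<Rightarrow> real"
  assumes subV: "subspace V" and finB: "finite B" and eV: "\<And>b. b \<in> B \<Longrightarrow> e b \<in> V"
    and xlin: "\<And>b. b \<in> B \<Longrightarrow> lin_on V (x b)"
    and expand: "\<And>v. v \<in> V \<Longrightarrow> v = (\<Sum>b\<in>B. x b v *\<^sub>R e b)"
    and xe: "\<And>b b'. b \<in> B \<Longrightarrow> b' \<in> B \<Longrightarrow> x b (e b') = (if b = b' then 1 else 0)"
begin

lemma comb_V: "(\<Sum>b\<in>B. c b *\<^sub>R e b) \<in> V"
  by (intro subspace_sum subspace_scale subV eV)

text \<open>A combination in the kernel of the system matrix pairs to 0 with the basis, hence with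
  all of V, and vanishes by \<open>nd\<close>; the coordinate functionals then annul its
  coefficients.\<close>

lemma solve:
  assumes a1: "\<And>\<Phi>. \<Phi> \<in> V \<Longrightarrow> lin_on V (\<lambda>\<Theta>. a \<Theta> \<Phi>)" and a2: "\<And>\<Theta>. \<Theta> \<in> V \<Longrightarrow> lin_on V (a \<Theta>)"
    and nd: "\<And>\<Theta>. \<Theta> \<in> V \<Longrightarrow> (\<And>\<Phi>. \<Phi> \<in> V \<Longrightarrow> a \<Theta> \<Phi> = 0) \<Longrightarrow> \<Theta> = 0"
    and f: "lin_on V f"
  shows "\<exists>\<Theta>\<in>V. \<forall>\<Phi>\<in>V. a \<Theta> \<Phi> = f \<Phi>"
proof -
  have ex: "\<exists>c. \<forall>b'\<in>B. (\<Sum>b\<in>B. c b * a (e b) (e b')) = f (e b')"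
  proof (rule finite_matrix_solve[OF finB])
    fix c assume c: "\<And>b'. b' \<in> B \<Longrightarrow> (\<Sum>b\<in>B. c b * a (e b) (e b')) = 0"
    let ?T = "\<Sum>b\<in>B. c b *\<^sub>R e b"
    have T: "?T \<in> V" by (rule comb_V)
    have "a ?T \<Phi> = 0" if P: "\<Phi> \<in> V" for \<Phi>
    proof -
      have "a ?T (e b') = 0" if "b' \<in> B" for b'
        using lin_on_sum[OF a1[OF eV[OF that]] subV, of B e c] eV c[OF that] by simp
      then show ?thesis
        by (subst expand[OF P], subst lin_on_sum[OF a2[OF T] subV]) (simp_all add: eV)
    qed
    from nd[OF T this] have T0: "?T = 0" .
    show "\<forall>b\<in>B. c b = 0"
    proof
      fix b assume b: "b \<in> B"
      have "0 = x b ?T" using T0 lin_on_simps(1)[OF xlin[OF b] subV] by simp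
      also have "\<dots> = (\<Sum>b'\<in>B. c b' * x b (e b'))" by (rule lin_on_sum[OF xlin[OF b] subV]) (rule eV)
      also have "\<dots> = (\<Sum>b'\<in>B. if b' = b then c b' else 0)" by (intro sum.cong refl) (use xe b in auto)
      also have "\<dots> = c b" using finB b by simp
      finally show "c b = 0" by simp
    qed
  qed
  then obtain c where c: "\<forall>b'\<in>B. (\<Sum>b\<in>B. c b * a (e b) (e b')) = f (e b')" by (elim exE) (rule that)
  let ?T = "\<Sum>b\<in>B. c b *\<^sub>R e b"
  have T: "?T \<in> V" by (rule comb_V)
  have "a ?T \<Phi> = f \<Phi>" if P: "\<Phi> \<in> V" for \<Phi>
  proof -
    have ee: "a ?T (e b') = f (e b')" if "b' \<in> B" for b'
      using lin_on_sum[OF a1[OF eV[OF that]] subV, of B e c] eV c that by simp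
    have "a ?T \<Phi> = (\<Sum>b\<in>B. x b \<Phi> * a ?T (e b))"
      by (subst expand[OF P], subst lin_on_sum[OF a2[OF T] subV]) (simp_all add: eV)
    also have "\<dots> = (\<Sum>b\<in>B. x b \<Phi> * f (e b))" by (intro sum.cong refl) (simp add: ee)
    also have "\<dots> = f \<Phi>"
      by (subst (2) expand[OF P], subst lin_on_sum[OF f subV]) (simp_all add: eV)
    finally show ?thesis .
  qed
  then show ?thesis using T by blast
qed

text \<open>The iteration starts at 0 and solves the linear problem with the quadratic term taken
  from the previous iterate. It stays in the ball of radius 2r/\<beta> and contracts there by 1/2;
  convergence is read off in coordinates, which the norm controls.\<close>

lemma quadratic_fixed_point:
  fixes nm :: "'a \<Rightarrow> real"
  assumes nn: "\<And>u. u \<in> V \<Longrightarrow> 0 \<le> nm u"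
    and tri: "\<And>u v. u \<in> V \<Longrightarrow> v \<in> V \<Longrightarrow> nm (u + v) \<le> nm u + nm v"
    and hom: "\<And>c u. u \<in> V \<Longrightarrow> nm (c *\<^sub>R u) = \<bar>c\<bar> * nm u"
    and def: "\<And>u. u \<in> V \<Longrightarrow> nm u = 0 \<Longrightarrow> u = 0"
    and xb: "\<And>b u. b \<in> B \<Longrightarrow> u \<in> V \<Longrightarrow> \<bar>x b u\<bar> \<le> Cx * nm u"
    and a1: "\<And>\<Phi>. \<Phi> \<in> V \<Longrightarrow> lin_on V (\<lambda>\<Theta>. a \<Theta> \<Phi>)" and a2: "\<And>\<Theta>. \<Theta> \<in> V \<Longrightarrow> lin_on V (a \<Theta>)"
    and ab: "\<And>\<Theta> \<Phi>. \<Theta> \<in> V \<Longrightarrow> \<Phi> \<in> V \<Longrightarrow> \<bar>a \<Theta> \<Phi>\<bar> \<le> Ca * nm \<Theta> * nm \<Phi>"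
    and infsup: "\<And>\<Theta> c. \<Theta> \<in> V \<Longrightarrow> 0 \<le> c \<Longrightarrow> (\<And>\<Phi>. \<Phi> \<in> V \<Longrightarrow> \<bar>a \<Theta> \<Phi>\<bar> \<le> c * nm \<Phi>) \<Longrightarrow> \<beta> * nm \<Theta> \<le> c"
    and beta: "\<beta> > 0"
    and R: "lin_on V R" and Rb: "\<And>\<Phi>. \<Phi> \<in> V \<Longrightarrow> \<bar>R \<Phi>\<bar> \<le> r * nm \<Phi>" and r0: "0 \<le> r"
    and b1: "\<And>\<Theta>' \<Phi>. \<Theta>' \<in> V \<Longrightarrow> \<Phi> \<in> V \<Longrightarrow> lin_on V (\<lambda>\<Theta>. bb \<Theta> \<Theta>' \<Phi>)"
    and b2: "\<And>\<Theta> \<Phi>. \<Theta> \<in> V \<Longrightarrow> \<Phi> \<in> V \<Longrightarrow> lin_on V (\<lambda>\<Theta>'. bb \<Theta> \<Theta>' \<Phi>)"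
    and b3: "\<And>\<Theta> \<Theta>'. \<Theta> \<in> V \<Longrightarrow> \<Theta>' \<in> V \<Longrightarrow> lin_on V (bb \<Theta> \<Theta>')"
    and bbd: "\<And>\<Theta> \<Theta>' \<Phi>. \<Theta> \<in> V \<Longrightarrow> \<Theta>' \<in> V \<Longrightarrow> \<Phi> \<in> V \<Longrightarrow> \<bar>bb \<Theta> \<Theta>' \<Phi>\<bar> \<le> m * nm \<Theta> * nm \<Theta>' * nm \<Phi>" and m0: "0 \<le> m"
    and small: "8 * m * r \<le> \<beta>^2"
  shows "\<exists>\<Theta>\<in>V. nm \<Theta> \<le> 2 * r / \<beta> \<and> (\<forall>\<Phi>\<in>V. a \<Theta> \<Phi> + R \<Phi> + bb \<Theta> \<Theta> \<Phi> = 0)"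
proof -
  have nd: "\<Theta> = 0" if "\<Theta> \<in> V" "\<And>\<Phi>. \<Phi> \<in> V \<Longrightarrow> a \<Theta> \<Phi> = 0" for \<Theta>
  proof -
    have "\<beta> * nm \<Theta> \<le> 0" by (rule infsup[OF that(1)]) (use that(2) in simp_all)
    then have "nm \<Theta> \<le> 0" using beta by (simp add: mult_le_0_iff)
    then show ?thesis using def[OF that(1)] nn[OF that(1)] by simp
  qed
  have step: "\<exists>\<Theta>'\<in>V. \<forall>\<Phi>\<in>V. a \<Theta>' \<Phi> = - R \<Phi> - bb \<Theta> \<Theta> \<Phi>" if t: "\<Theta> \<in> V" for \<Theta>
  proof (rule solve[OF a1 a2 nd])
    show "lin_on V (\<lambda>\<Phi>. - R \<Phi> - bb \<Theta> \<Theta> \<Phi>)"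
      using R b3[OF t t] unfolding lin_on_def by (simp add: algebra_simps)
  qed
  define F where "F \<Theta> = (SOME \<Theta>'. \<Theta>' \<in> V \<and> (\<forall>\<Phi>\<in>V. a \<Theta>' \<Phi> = - R \<Phi> - bb \<Theta> \<Theta> \<Phi>))" for \<Theta>
  have F: "F \<Theta> \<in> V" "\<And>\<Phi>. \<Phi> \<in> V \<Longrightarrow> a (F \<Theta>) \<Phi> = - R \<Phi> - bb \<Theta> \<Theta> \<Phi>" if "\<Theta> \<in> V" for \<Theta>
  proof -
    have "\<exists>\<Theta>'. \<Theta>' \<in> V \<and> (\<forall>\<Phi>\<in>V. a \<Theta>' \<Phi> = - R \<Phi> - bb \<Theta> \<Theta> \<Phi>)" using step[OF that] by blast
    from someI_ex[OF this] show "F \<Theta> \<in> V" "\<And>\<Phi>. \<Phi> \<in> V \<Longrightarrow> a (F \<Theta>) \<Phi> = - R \<Phi> - bb \<Theta> \<Theta> \<Phi>" by (simp_all add: F_def)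
  qed
  define th where "th n = (F ^^ n) 0" for n
  have th_Suc: "th (Suc n) = F (th n)" for n by (simp add: th_def)
  have thV: "th n \<in> V" for n by (induction n) (simp_all add: th_Suc F(1), simp add: th_def subspace_0[OF subV])
  let ?\<rho> = "2 * r / \<beta>"
  have rho0: "0 \<le> ?\<rho>" using r0 beta by simp
  \<comment> \<open>The smallness condition rewritten for the radius 2r/\<beta>. The 8 is made for
    this quarter, which doubles to the contraction factor 1/2.\<close>
  have mr: "m * ?\<rho> \<le> \<beta> / 4" using small beta by (simp add: field_simps power2_eq_square)
  have nm0: "nm 0 = 0" using hom[OF subspace_0[OF subV], of 0] by simp
  have thb: "nm (th n) \<le> ?\<rho>" for n
  proof (induction n)
    case 0 show ?case using rho0 nm0 by (simp add: th_def)
  next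
    case (Suc n)
    have "\<beta> * nm (th (Suc n)) \<le> r + m * ?\<rho> * ?\<rho>"
    proof (rule infsup[OF thV])
      show "0 \<le> r + m * ?\<rho> * ?\<rho>" using r0 m0 beta by simp
      fix \<Phi> assume P: "\<Phi> \<in> V"
      have "\<bar>bb (th n) (th n) \<Phi>\<bar> \<le> m * nm (th n) * nm (th n) * nm \<Phi>" by (rule bbd[OF thV thV P])
      also have "\<dots> \<le> m * ?\<rho> * ?\<rho> * nm \<Phi>"
        by (intro mult_right_mono mult_mono Suc m0 nn[OF P] order_refl mult_nonneg_nonneg nn[OF thV] rho0)
      finally show "\<bar>a (th (Suc n)) \<Phi>\<bar> \<le> (r + m * ?\<rho> * ?\<rho>) * nm \<Phi>"
        using Rb[OF P] by (simp add: th_Suc F(2)[OF thV P] distrib_right)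
    qed
    also have "m * ?\<rho> * ?\<rho> \<le> \<beta> / 4 * ?\<rho>" by (rule mult_right_mono[OF mr rho0])
    \<comment> \<open>Here r is half of \<beta> times the radius, so a further quarter still
      fits.\<close>
    also have "r + \<beta> / 4 * ?\<rho> \<le> \<beta> * ?\<rho>" using beta r0 by (simp add: field_simps)
    finally show ?case using beta by (simp add: field_simps)
  qed
  have dV: "th (Suc n) - th n \<in> V" for n by (rule subspace_diff[OF subV thV thV])
  have contr: "nm (th (Suc (Suc n)) - th (Suc n)) \<le> 1/2 * nm (th (Suc n) - th n)" for n
  proof -
    let ?D = "th (Suc n) - th n"
    have "\<beta> * nm (th (Suc (Suc n)) - th (Suc n)) \<le> 2 * (m * ?\<rho>) * nm ?D"
    proof (rule infsup[OF dV])
      show "0 \<le> 2 * (m * ?\<rho>) * nm ?D" by (intro mult_nonneg_nonneg m0 rho0 nn[OF dV]) simp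
      fix \<Phi> assume P: "\<Phi> \<in> V"
      have "a (th (Suc (Suc n)) - th (Suc n)) \<Phi> = a (th (Suc (Suc n))) \<Phi> - a (th (Suc n)) \<Phi>"
        by (rule lin_on_simps(4)[OF a1[OF P] subV thV thV])
      also have "\<dots> = bb (th n) (th n) \<Phi> - bb (th (Suc n)) (th (Suc n)) \<Phi>"
        by (simp only: th_Suc[of "Suc n"] th_Suc[of n] F(2)[OF thV P] F(2)[OF F(1)[OF thV] P])
      \<comment> \<open>A difference of quadratic terms splits into two terms, each linear in the
        increment.\<close>
      also have "\<dots> = - (bb ?D (th (Suc n)) \<Phi> + bb (th n) ?D \<Phi>)"
        using lin_on_simps(4)[OF b1[OF thV P] subV thV thV] lin_on_simps(4)[OF b2[OF thV P] subV thV thV] by simp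
      finally have "\<bar>a (th (Suc (Suc n)) - th (Suc n)) \<Phi>\<bar> \<le> \<bar>bb ?D (th (Suc n)) \<Phi>\<bar> + \<bar>bb (th n) ?D \<Phi>\<bar>" by linarith
      also have "\<bar>bb ?D (th (Suc n)) \<Phi>\<bar> \<le> m * nm ?D * ?\<rho> * nm \<Phi>"
        by (rule order_trans[OF bbd[OF dV thV P]])
          (intro mult_right_mono mult_left_mono thb nn[OF P] mult_nonneg_nonneg m0 nn[OF dV])
      also have "\<bar>bb (th n) ?D \<Phi>\<bar> \<le> m * ?\<rho> * nm ?D * nm \<Phi>"
        by (rule order_trans[OF bbd[OF thV dV P]])
          (intro mult_right_mono mult_left_mono thb nn[OF P] m0 nn[OF dV])
      finally show "\<bar>a (th (Suc (Suc n)) - th (Suc n)) \<Phi>\<bar> \<le> 2 * (m * ?\<rho>) * nm ?D * nm \<Phi>" by (simp add: algebra_simps)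
    qed
    also have "2 * (m * ?\<rho>) * nm ?D \<le> 2 * (\<beta> / 4) * nm ?D" by (intro mult_right_mono mult_left_mono mr nn[OF dV]) simp
    finally show ?thesis using beta by simp
  qed
  have geo: "nm (th (Suc n) - th n) \<le> (1/2)^n * nm (th (Suc 0) - th 0)" for n
  proof (induction n)
    case (Suc n)
    have "nm (th (Suc (Suc n)) - th (Suc n)) \<le> 1/2 * nm (th (Suc n) - th n)" by (rule contr)
    also have "\<dots> \<le> 1/2 * ((1/2)^n * nm (th (Suc 0) - th 0))" by (intro mult_left_mono Suc) simp
    finally show ?case by simp
  qed simp
  have conv: "convergent (\<lambda>n. x b (th n))" if b: "b \<in> B" for b
  proof -
    have Cx: "0 \<le> Cx * nm (th (Suc 0) - th 0)" using xb[OF b dV[of 0]] by linarith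
    have "\<bar>x b (th (Suc n)) - x b (th n)\<bar> \<le> \<bar>Cx\<bar> * nm (th (Suc 0) - th 0) * (1/2)^n" for n
    proof -
      have "x b (th (Suc n)) - x b (th n) = x b (th (Suc n) - th n)"
        by (rule lin_on_simps(4)[OF xlin[OF b] subV thV thV, symmetric])
      then have "\<bar>x b (th (Suc n)) - x b (th n)\<bar> \<le> Cx * nm (th (Suc n) - th n)" using xb[OF b dV] by simp
      also have "\<dots> \<le> \<bar>Cx\<bar> * nm (th (Suc n) - th n)" by (intro mult_right_mono nn[OF dV]) simp
      also have "\<dots> \<le> \<bar>Cx\<bar> * ((1/2)^n * nm (th (Suc 0) - th 0))" by (intro mult_left_mono geo) simp
      finally show ?thesis by (simp add: ac_simps)
    qed
    then have bnd: "\<And>n. norm (x b (th (Suc n)) - x b (th n)) \<le> \<bar>Cx\<bar> * nm (th (Suc 0) - th 0) * (1/2)^n"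
      by (simp only: real_norm_def)
    have "summable (\<lambda>n. (1/2::real)^n)" by (rule summable_geometric) simp
    then have "summable (\<lambda>n. \<bar>Cx\<bar> * nm (th (Suc 0) - th 0) * (1/2)^n)" by (rule summable_mult)
    then have "summable (\<lambda>n. x b (th (Suc n)) - x b (th n))"
      by (rule summable_comparison_test'[where N=0]) (rule bnd)
    then have "convergent (\<lambda>n. \<Sum>k<n. x b (th (Suc k)) - x b (th k))" by (simp only: summable_iff_convergent)
    then have "convergent (\<lambda>n. x b (th n) - x b (th 0))" by (simp only: sum_lessThan_telescope[of "\<lambda>n. x b (th n)"])
    then have "convergent (\<lambda>n. (x b (th n) - x b (th 0)) + x b (th 0))" by (rule convergent_add[OF _ convergent_const])
    then show ?thesis by simp
  qed
  define L where "L b = lim (\<lambda>n. x b (th n))" for b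
  have L: "(\<lambda>n. x b (th n)) \<longlonglongrightarrow> L b" if "b \<in> B" for b
    using conv[OF that] by (simp add: L_def convergent_LIMSEQ_iff)
  define T where "T = (\<Sum>b\<in>B. L b *\<^sub>R e b)"
  have T: "T \<in> V" unfolding T_def by (rule comb_V)
  have nsum: "nm (\<Sum>b\<in>I. c b *\<^sub>R e b) \<le> (\<Sum>b\<in>I. \<bar>c b\<bar> * nm (e b))" if "I \<subseteq> B" for c I
    using finite_subset[OF that finB] that
  proof (induction I rule: finite_induct)
    case (insert b I)
    have "(\<Sum>b\<in>I. c b *\<^sub>R e b) \<in> V" by (intro subspace_sum subspace_scale subV eV) (use insert.prems in auto)
    then show ?case
      using tri[OF subspace_scale[OF subV eV], of b "\<Sum>b\<in>I. c b *\<^sub>R e b" "c b"] insert hom[OF eV, of b "c b"] by simp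
  qed (simp add: nm0)
  have lim0: "(\<lambda>n. nm (th n - T)) \<longlonglongrightarrow> 0"
  proof (rule tendsto_sandwich[OF _ _ tendsto_const])
    show "\<forall>\<^sub>F n in sequentially. 0 \<le> nm (th n - T)" using nn[OF subspace_diff[OF subV thV T]] by simp
    have "nm (th n - T) \<le> (\<Sum>b\<in>B. \<bar>x b (th n) - L b\<bar> * nm (e b))" for n
    proof -
      have "th n - T = (\<Sum>b\<in>B. (x b (th n) - L b) *\<^sub>R e b)"
        unfolding T_def by (subst expand[OF thV[of n]]) (simp add: scaleR_diff_left sum_subtractf)
      then show ?thesis using nsum[OF order_refl, of "\<lambda>b. x b (th n) - L b"] by simp
    qed
    then show "\<forall>\<^sub>F n in sequentially. nm (th n - T) \<le> (\<Sum>b\<in>B. \<bar>x b (th n) - L b\<bar> * nm (e b))" by simp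
    have "(\<lambda>n. \<Sum>b\<in>B. \<bar>x b (th n) - L b\<bar> * nm (e b)) \<longlonglongrightarrow> (\<Sum>b\<in>B. \<bar>L b - L b\<bar> * nm (e b))"
      by (intro tendsto_intros L)
    then show "(\<lambda>n. \<Sum>b\<in>B. \<bar>x b (th n) - L b\<bar> * nm (e b)) \<longlonglongrightarrow> 0" by simp
  qed
  have nmT: "nm T \<le> ?\<rho>"
  proof (rule LIMSEQ_le_const)
    have "(\<lambda>n. ?\<rho> + nm (th n - T)) \<longlonglongrightarrow> ?\<rho> + 0" by (intro tendsto_intros lim0)
    then show "(\<lambda>n. ?\<rho> + nm (th n - T)) \<longlonglongrightarrow> ?\<rho>" by simp
    have "nm T \<le> ?\<rho> + nm (th n - T)" for n
    proof -
      have dn: "th n - T \<in> V" by (rule subspace_diff[OF subV thV T])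
      have "nm (th n + (-1) *\<^sub>R (th n - T)) \<le> nm (th n) + nm ((-1) *\<^sub>R (th n - T))"
        by (rule tri[OF thV subspace_scale[OF subV dn]])
      then show ?thesis using hom[OF dn, of "-1"] thb[of n] by simp
    qed
    then show "\<exists>N. \<forall>n\<ge>N. nm T \<le> ?\<rho> + nm (th n - T)" by blast
  qed
  have "a T \<Phi> + R \<Phi> + bb T T \<Phi> = 0" if P: "\<Phi> \<in> V" for \<Phi>
  proof -
    have dn: "th n - T \<in> V" for n by (rule subspace_diff[OF subV thV T])
    \<comment> \<open>The defect of the limit is compared with the equation that links two
      consecutive iterates; each term of the difference carries a distance to the limit.\<close>
    have bd: "\<bar>a T \<Phi> + R \<Phi> + bb T T \<Phi>\<bar> \<le> Ca * nm (th (Suc n) - T) * nm \<Phi> + 2 * (m * ?\<rho>) * nm \<Phi> * nm (th n - T)" for n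
    proof -
      have "a (th (Suc n)) \<Phi> + R \<Phi> + bb (th n) (th n) \<Phi> = 0" by (simp add: th_Suc F(2)[OF thV P])
      moreover have "a (th (Suc n) - T) \<Phi> = a (th (Suc n)) \<Phi> - a T \<Phi>" by (rule lin_on_simps(4)[OF a1[OF P] subV thV T])
      moreover have "bb (th n - T) (th n) \<Phi> = bb (th n) (th n) \<Phi> - bb T (th n) \<Phi>" by (rule lin_on_simps(4)[OF b1[OF thV P] subV thV T])
      moreover have "bb T (th n - T) \<Phi> = bb T (th n) \<Phi> - bb T T \<Phi>" by (rule lin_on_simps(4)[OF b2[OF T P] subV thV T])
      ultimately have "\<bar>a T \<Phi> + R \<Phi> + bb T T \<Phi>\<bar> \<le> \<bar>a (th (Suc n) - T) \<Phi>\<bar> + (\<bar>bb (th n - T) (th n) \<Phi>\<bar> + \<bar>bb T (th n - T) \<Phi>\<bar>)" by linarith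
      also have "\<bar>a (th (Suc n) - T) \<Phi>\<bar> \<le> Ca * nm (th (Suc n) - T) * nm \<Phi>" by (rule ab[OF dn P])
      also have "\<bar>bb (th n - T) (th n) \<Phi>\<bar> \<le> m * nm (th n - T) * ?\<rho> * nm \<Phi>"
        by (rule order_trans[OF bbd[OF dn thV P]]) (intro mult_right_mono mult_left_mono thb nn[OF P] mult_nonneg_nonneg m0 nn[OF dn])
      also have "\<bar>bb T (th n - T) \<Phi>\<bar> \<le> m * ?\<rho> * nm (th n - T) * nm \<Phi>"
        by (rule order_trans[OF bbd[OF T dn P]]) (intro mult_right_mono mult_left_mono nmT nn[OF P] m0 nn[OF dn])
      finally show ?thesis by (simp add: algebra_simps)
    qed
    have "(\<lambda>n. Ca * nm (th (Suc n) - T) * nm \<Phi> + 2 * (m * ?\<rho>) * nm \<Phi> * nm (th n - T)) \<longlonglongrightarrow> Ca * 0 * nm \<Phi> + 2 * (m * ?\<rho>) * nm \<Phi> * 0"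
      by (intro tendsto_intros lim0 LIMSEQ_Suc[OF lim0])
    then have "\<bar>a T \<Phi> + R \<Phi> + bb T T \<Phi>\<bar> \<le> Ca * 0 * nm \<Phi> + 2 * (m * ?\<rho>) * nm \<Phi> * 0"
      by (rule LIMSEQ_le_const) (use bd in blast)
    then show ?thesis by simp
  qed
  then show ?thesis using T nmT by blast
qed

end

section \<open>The continuous forms\<close>

lemma tup_nth [simp]: "tup F x $ i = F i x"
  by (simp add: tup_def)

lemma L2_tup:
  fixes F :: "'k::finite \<Rightarrow> real^'n \<Rightarrow> 'b::euclidean_space"
  assumes "\<And>i. L2fun U (F i)"
  shows "L2fun U (tup F)" "L2n U (tup F) \<le> (\<Sum>i\<in>UNIV. L2n U (F i))" "L2n U (F i) \<le> L2n U (tup F)"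
proof -
  have a: "\<And>i. L2fun U (\<lambda>x. tup F x $ i)" using assms by simp
  show t: "L2fun U (tup F)" by (rule L2fun_vec(1)[OF a])
  show "L2n U (tup F) \<le> (\<Sum>i\<in>UNIV. L2n U (F i))" using L2fun_vec(2)[OF a] by simp
  show "L2n U (F i) \<le> L2n U (tup F)" using L2fun_nth(2)[OF t, of i] by simp
qed

lemma L4_tup:
  fixes F :: "'k::finite \<Rightarrow> real^'n \<Rightarrow> 'b::euclidean_space"
  assumes "\<And>i. L4fun U (F i)"
  shows "L4fun U (tup F)" "L4n U (tup F) \<le> (\<Sum>i\<in>UNIV. L4n U (F i))" "L4n U (F i) \<le> L4n U (tup F)"
proof -
  have a: "\<And>i. L4fun U (\<lambda>x. tup F x $ i)" using assms by simp
  show t: "L4fun U (tup F)" by (rule L4fun_vec(1)[OF a])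
  show "L4n U (tup F) \<le> (\<Sum>i\<in>UNIV. L4n U (F i))" using L4fun_vec(2)[OF a] by simp
  show "L4n U (F i) \<le> L4n U (tup F)" using L4fun_nth(2)[OF t, of i] by simp
qed

lemma bilinear_norm_bound:
  fixes h :: "'a::euclidean_space \<Rightarrow> 'b::euclidean_space \<Rightarrow> 'c::real_normed_vector"
  assumes "bilinear h" shows "\<exists>K\<ge>0. \<forall>a b. norm (h a b) \<le> K * (norm a * norm b)"
  using bilinear_bounded_pos[OF assms] by (auto simp: mult.assoc intro: less_imp_le)

context
  fixes h :: "'p::euclidean_space \<Rightarrow> 'q::euclidean_space \<Rightarrow> 'r::euclidean_space"
  assumes hb: "bilinear h"
begin

lemma trilinear_measurable:
  assumes "\<Xi> \<in> borel_measurable M" "\<Theta> \<in> borel_measurable M" "\<Phi> \<in> borel_measurable M"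
  shows "(\<lambda>x. inner (\<Xi> x) (h (\<Theta> x) (\<Phi> x))) \<in> borel_measurable M"
proof -
  have "bounded_bilinear h" using hb bilinear_conv_bounded_bilinear by blast
  then have "continuous_on UNIV (\<lambda>x. h (fst x) (snd x))"
    by (rule bounded_bilinear.continuous_on[OF _ continuous_on_fst[OF continuous_on_id] continuous_on_snd[OF continuous_on_id]])
  from borel_measurable_continuous_Pair[OF assms(2,3) this]
  have "(\<lambda>x. h (\<Theta> x) (\<Phi> x)) \<in> borel_measurable M" .
  with assms(1) show ?thesis by (rule borel_measurable_inner)
qed

text \<open>One estimate for all distributions of exponents: the product of the three norms has to
  be dominated by a product of two L2 functions.\<close>

lemma trilinear_bound:
  fixes \<Xi> :: "real^'n \<Rightarrow> 'r" and F G :: "real^'n \<Rightarrow> real"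
  assumes K: "K \<ge> 0" "\<And>a b. norm (h a b) \<le> K * (norm a * norm b)"
    and m: "\<Xi> \<in> borel_measurable (lebesgue_on U)" "\<Theta> \<in> borel_measurable (lebesgue_on U)" "\<Phi> \<in> borel_measurable (lebesgue_on U)"
    and FG: "L2fun U F" "L2fun U G"
    and le: "AE x in lebesgue_on U. norm (\<Xi> x) * (norm (\<Theta> x) * norm (\<Phi> x)) \<le> norm (F x) * norm (G x)"
  shows "integrable (lebesgue_on U) (\<lambda>x. inner (\<Xi> x) (h (\<Theta> x) (\<Phi> x)))"
    "\<bar>LINT x|lebesgue_on U. inner (\<Xi> x) (h (\<Theta> x) (\<Phi> x))\<bar> \<le> K * (L2n U F * L2n U G)"
proof -
  let ?I = "\<lambda>x. inner (\<Xi> x) (h (\<Theta> x) (\<Phi> x))"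
  have i: "integrable (lebesgue_on U) (\<lambda>x. K * (norm (F x) * norm (G x)))"
    by (rule integrable_mult_right[OF L2_mult_integrable[OF FG]])
  have ae: "AE x in lebesgue_on U. \<bar>?I x\<bar> \<le> K * (norm (F x) * norm (G x))"
    using le
  proof eventually_elim
    case (elim x)
    have "\<bar>?I x\<bar> \<le> norm (\<Xi> x) * norm (h (\<Theta> x) (\<Phi> x))" by (rule Cauchy_Schwarz_ineq2)
    also have "\<dots> \<le> norm (\<Xi> x) * (K * (norm (\<Theta> x) * norm (\<Phi> x)))" by (intro mult_left_mono K(2)) simp
    also have "\<dots> = K * (norm (\<Xi> x) * (norm (\<Theta> x) * norm (\<Phi> x)))" by simp
    also have "\<dots> \<le> K * (norm (F x) * norm (G x))" by (intro mult_left_mono elim K(1))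
    finally show ?case .
  qed
  show ii: "integrable (lebesgue_on U) ?I"
  proof (rule Bochner_Integration.integrable_bound[OF i trilinear_measurable[OF m]])
    show "AE x in lebesgue_on U. norm (?I x) \<le> norm (K * (norm (F x) * norm (G x)))"
      using ae
    proof eventually_elim
      case (elim x)
      then show ?case using abs_ge_self[of "K * (norm (F x) * norm (G x))"] by simp
    qed
  qed
  have "\<bar>LINT x|lebesgue_on U. ?I x\<bar> \<le> (LINT x|lebesgue_on U. \<bar>?I x\<bar>)" by (rule integral_abs_bound)
  also have "\<dots> \<le> (LINT x|lebesgue_on U. K * (norm (F x) * norm (G x)))"
    by (rule integral_mono_AE[OF integrable_abs[OF ii] i ae])
  also have "\<dots> = K * (LINT x|lebesgue_on U. norm (F x) * norm (G x))" by simp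
  also have "\<dots> \<le> K * (L2n U F * L2n U G)" by (intro mult_left_mono L2_Cauchy_Schwarz FG K(1))
  finally show "\<bar>LINT x|lebesgue_on U. ?I x\<bar> \<le> K * (L2n U F * L2n U G)" .
qed

end

context convex_domain
begin

lemma whess_L2:
  assumes "sob U 2 u"
  shows "L2fun U (whess U u)" "L2n U (wD U [i, j] u) \<le> L2n U (whess U u)"
    "L2n U (whess U u) \<le> (\<Sum>i\<in>UNIV. \<Sum>j\<in>UNIV. L2n U (wD U [i, j] u))"
proof -
  have w: "L2fun U (wD U [i, j] u)" for i j by (rule sobD(1)[OF assms]) simp
  have e: "(\<lambda>x. whess U u x $ i $ j) = wD U [i, j] u" for i j by (simp add: whess_def)
  have r: "L2fun U (\<lambda>x. whess U u x $ i)" for i by (rule L2fun_vec(1)) (simp only: e w)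
  show t: "L2fun U (whess U u)" by (rule L2fun_vec(1)[OF r])
  show "L2n U (wD U [i, j] u) \<le> L2n U (whess U u)"
    using order_trans[OF L2fun_nth(2)[OF r, of i j] L2fun_nth(2)[OF t, of i]] by (simp only: e)
  have "L2n U (\<lambda>x. whess U u x $ i) \<le> (\<Sum>j\<in>UNIV. L2n U (wD U [i, j] u))" for i
    using L2fun_vec(2)[of U "\<lambda>x. whess U u x $ i"] by (simp only: e w)
  then show "L2n U (whess U u) \<le> (\<Sum>i\<in>UNIV. \<Sum>j\<in>UNIV. L2n U (wD U [i, j] u))"
    by (intro order_trans[OF L2fun_vec(2)[OF r]] sum_mono)
qed

lemma sob_wD1: "sob U 2 u \<Longrightarrow> sob U 1 (wD U [j] u)"
  using sob_wD[of "[j]" 1 u] by (simp add: numeral_2_eq_2)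

lemma Gm_wD:
  assumes u: "sob U 2 u"
  shows "L2n U (Gm (wD U [j] u)) \<le> (\<Sum>i\<in>UNIV. L2n U (wD U [j, i] u))"
proof -
  have a: "L2fun U (wD U [i] (wD U [j] u))" for i by (rule sobD(1)[OF sob_wD1[OF u]]) simp
  have "L2n U (Gm (wD U [j] u)) \<le> (\<Sum>i\<in>UNIV. L2n U (\<lambda>z. \<bar>wD U [i] (wD U [j] u) z\<bar>))"
    unfolding Gm_def[abs_def] by (rule conjunct2[OF L2fun_sum]) (use L2fun_norm(1)[OF a] in simp)
  also have "\<dots> = (\<Sum>i\<in>UNIV. L2n U (wD U [j, i] u))"
  proof (rule sum.cong[OF refl])
    fix i
    have "L2n U (\<lambda>z. \<bar>wD U [i] (wD U [j] u) z\<bar>) = L2n U (wD U [i] (wD U [j] u))" using L2fun_norm(2)[OF a] by simp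
    also have "\<dots> = L2n U (wD U [j, i] u)"
    proof (rule L2n_cong_AE(2)[OF a])
      show "wD U [j, i] u \<in> borel_measurable M" by (rule L2fun_meas[OF sobD(1)[OF u]]) simp
      show "AE x in M. wD U [i] (wD U [j] u) x = wD U [j, i] u x" using wD_wD[OF u, of "[j]" "[i]"] by simp
    qed
    finally show "L2n U (\<lambda>z. \<bar>wD U [i] (wD U [j] u) z\<bar>) = L2n U (wD U [j, i] u)" .
  qed
  finally show ?thesis .
qed

lemma wgrad_L4:
  assumes "sob U 2 u"
  shows "L4fun U (wgrad U u)" "L4n U (wgrad U u) \<le> (\<Sum>j\<in>UNIV. L4n U (wD U [j] u))"
proof -
  have e: "(\<lambda>x. wgrad U u x $ j) = wD U [j] u" for j by (simp add: wgrad_def)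
  have w: "L4fun U (wD U [j] u)" for j by (rule sob_L4[OF sob_wD1[OF assms]])
  show "L4fun U (wgrad U u)" by (rule L4fun_vec(1)) (simp only: e w)
  show "L4n U (wgrad U u) \<le> (\<Sum>j\<in>UNIV. L4n U (wD U [j] u))"
    using L4fun_vec(2)[of U "wgrad U u"] by (simp only: e w)
qed

text \<open>Poincare bounds the partial derivative; its own gradient consists of entries of the
  Hessian.\<close>

lemma sob0_grad_L2:
  "\<exists>C\<ge>0. \<forall>v j. sob0 U 2 v \<longrightarrow> L2n U (wD U [j] v) + L2n U (Gm (wD U [j] v)) \<le> C * L2n U (whess U v)"
proof -
  obtain C where C: "C \<ge> 0" "\<And>v j. sob0 U 2 v \<Longrightarrow> L2n U (wD U [j] v) \<le> C * L2n U (wD U [j, j] v)" using poincare_sob0 by metis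
  have "L2n U (wD U [j] v) + L2n U (Gm (wD U [j] v)) \<le> (C + real CARD('n)) * L2n U (whess U v)" if v: "sob0 U 2 v" for v j
  proof -
    note s = sob0_sob[OF v]
    have "L2n U (wD U [j] v) \<le> C * L2n U (whess U v)"
      by (rule order_trans[OF C(2)[OF v]]) (intro mult_left_mono whess_L2(2) s C(1))
    moreover have "L2n U (Gm (wD U [j] v)) \<le> (\<Sum>i\<in>(UNIV::'n set). L2n U (whess U v))"
      by (rule order_trans[OF Gm_wD[OF s]]) (intro sum_mono whess_L2(2) s)
    ultimately show ?thesis by (simp add: distrib_right)
  qed
  then show ?thesis using C(1) by (intro exI[of _ "C + real CARD('n)"]) simp
qed

lemma sob0_grad_L4:
  "\<exists>C\<ge>0. \<forall>v. sob0 U 2 v \<longrightarrow> L4n U (wgrad U v) \<le> C * L2n U (whess U v)"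
proof -
  obtain C1 where C1: "C1 \<ge> 0" "\<forall>v j. sob0 U 2 v \<longrightarrow> L2n U (wD U [j] v) + L2n U (Gm (wD U [j] v)) \<le> C1 * L2n U (whess U v)"
    using sob0_grad_L2 by (elim exE conjE) (rule that)
  obtain C2 where C2: "C2 \<ge> 0" "\<forall>u. sob U 1 u \<longrightarrow> L4n U u \<le> C2 * (L2n U u + L2n U (Gm u))"
    using sob_L4_bound by (elim exE conjE) (rule that)
  have "L4n U (wgrad U v) \<le> (real CARD('n) * (C2 * C1)) * L2n U (whess U v)" if v: "sob0 U 2 v" for v
  proof -
    note s = sob0_sob[OF v]
    have "L4n U (wgrad U v) \<le> (\<Sum>j\<in>(UNIV::'n set). C2 * (C1 * L2n U (whess U v)))"
    proof (rule order_trans[OF wgrad_L4(2)[OF s]], rule sum_mono)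
      fix j
      have "L4n U (wD U [j] v) \<le> C2 * (L2n U (wD U [j] v) + L2n U (Gm (wD U [j] v)))"
        using C2(2) sob_wD1[OF s] by simp
      also have "\<dots> \<le> C2 * (C1 * L2n U (whess U v))" using C1(2) v by (intro mult_left_mono C2(1)) simp
      finally show "L4n U (wD U [j] v) \<le> C2 * (C1 * L2n U (whess U v))" .
    qed
    then show ?thesis by (simp add: mult.assoc)
  qed
  then show ?thesis using C1(1) C2(1) by (intro exI[of _ "real CARD('n) * (C2 * C1)"]) simp
qed

end

locale trilinear_form = convex_domain U for U :: "(real^'n) set" +
  fixes h :: "real^'n^'k \<Rightarrow> real^'n^'k \<Rightarrow> real^'n^'n^'k"
  assumes h_bil: "bilinear h"
begin

definition Mh :: real where "Mh = (SOME K. K \<ge> 0 \<and> (\<forall>a b. norm (h a b) \<le> K * (norm a * norm b)))"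

lemma Mh: "Mh \<ge> 0" "norm (h a b) \<le> Mh * (norm a * norm b)"
proof -
  have "\<exists>K. K \<ge> 0 \<and> (\<forall>a b. norm (h a b) \<le> K * (norm a * norm b))" using bilinear_norm_bound[OF h_bil] by simp
  from someI_ex[OF this] show "Mh \<ge> 0" "norm (h a b) \<le> Mh * (norm a * norm b)" by (simp_all add: Mh_def)
qed

abbreviation BB where "BB \<equiv> Bform U h"
abbreviation AA where "AA \<equiv> Aform U"

text \<open>Additivity of \<open>Bform\<close> asks for integrable integrands, while integrability
  comes from different exponents in different places; the predicate separates the two.\<close>

definition BI :: "(real^'n \<Rightarrow> real^'n^'n^'k) \<Rightarrow> (real^'n \<Rightarrow> real^'n^'k) \<Rightarrow> (real^'n \<Rightarrow> real^'n^'k) \<Rightarrow> bool" where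
  "BI \<Xi> \<Theta> \<Phi> \<longleftrightarrow> integrable M (\<lambda>x. inner (\<Xi> x) (h (\<Theta> x) (\<Phi> x)))"

lemma B_244:
  assumes "L2fun U \<Xi>" "L4fun U \<Theta>" "L4fun U \<Phi>"
  shows "BI \<Xi> \<Theta> \<Phi>" "\<bar>BB \<Xi> \<Theta> \<Phi>\<bar> \<le> Mh * (L2n U \<Xi> * (L4n U \<Theta> * L4n U \<Phi>))"
proof -
  note m = L2fun_meas[OF assms(1)] L4fun_meas[OF assms(2)] L4fun_meas[OF assms(3)]
  note f = L4_mult[OF assms(2,3)]
  have "AE x in M. norm (\<Xi> x) * (norm (\<Theta> x) * norm (\<Phi> x)) \<le> norm (norm (\<Xi> x)) * norm (norm (\<Theta> x) * norm (\<Phi> x))" by simp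
  note t = trilinear_bound[OF h_bil Mh m L2fun_norm(1)[OF assms(1)] f(1) this]
  show "BI \<Xi> \<Theta> \<Phi>" using t(1) by (simp add: BI_def)
  have "\<bar>BB \<Xi> \<Theta> \<Phi>\<bar> \<le> Mh * (L2n U \<Xi> * L2n U (\<lambda>x. norm (\<Theta> x) * norm (\<Phi> x)))"
    using t(2) L2fun_norm(2)[OF assms(1)] by (simp add: Bform_def)
  also have "\<dots> \<le> Mh * (L2n U \<Xi> * (L4n U \<Theta> * L4n U \<Phi>))" by (intro mult_left_mono f(2) Mh(1) L2n_nonneg)
  finally show "\<bar>BB \<Xi> \<Theta> \<Phi>\<bar> \<le> Mh * (L2n U \<Xi> * (L4n U \<Theta> * L4n U \<Phi>))" .
qed

text \<open>The third argument is placed in L2 for the gradient error of the companion, which is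
  small in that norm only; the Hessian of \<Psi> fills the first slot in L4.\<close>

lemma B_442:
  assumes "L4fun U \<Xi>" "L4fun U \<Theta>" "L2fun U \<Phi>"
  shows "BI \<Xi> \<Theta> \<Phi>" "\<bar>BB \<Xi> \<Theta> \<Phi>\<bar> \<le> Mh * (L4n U \<Xi> * L4n U \<Theta> * L2n U \<Phi>)"
proof -
  note m = L4fun_meas[OF assms(1)] L4fun_meas[OF assms(2)] L2fun_meas[OF assms(3)]
  note f = L4_mult[OF assms(1,2)]
  have "AE x in M. norm (\<Xi> x) * (norm (\<Theta> x) * norm (\<Phi> x)) \<le> norm (norm (\<Xi> x) * norm (\<Theta> x)) * norm (norm (\<Phi> x))" by (simp add: mult.assoc)
  note t = trilinear_bound[OF h_bil Mh m f(1) L2fun_norm(1)[OF assms(3)] this]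
  show "BI \<Xi> \<Theta> \<Phi>" using t(1) by (simp add: BI_def)
  have "\<bar>BB \<Xi> \<Theta> \<Phi>\<bar> \<le> Mh * (L2n U (\<lambda>x. norm (\<Xi> x) * norm (\<Theta> x)) * L2n U \<Phi>)"
    using t(2) L2fun_norm(2)[OF assms(3)] by (simp add: Bform_def)
  also have "\<dots> \<le> Mh * (L4n U \<Xi> * L4n U \<Theta> * L2n U \<Phi>)" by (intro mult_left_mono mult_right_mono f(2) Mh(1) L2n_nonneg)
  finally show "\<bar>BB \<Xi> \<Theta> \<Phi>\<bar> \<le> Mh * (L4n U \<Xi> * L4n U \<Theta> * L2n U \<Phi>)" .
qed

text \<open>The counterpart of \<open>B_442\<close> when the first slot holds a discrete Hessian,
  known in L2 only: the gradient of \<Psi> in the second slot then has to be bounded.\<close>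

lemma B_2inf2:
  assumes "L2fun U \<Xi>" "\<Theta> \<in> borel_measurable M" "AE x in M. norm (\<Theta> x) \<le> K" "0 \<le> K" "L2fun U \<Phi>"
  shows "BI \<Xi> \<Theta> \<Phi>" "\<bar>BB \<Xi> \<Theta> \<Phi>\<bar> \<le> Mh * (L2n U \<Xi> * (K * L2n U \<Phi>))"
proof -
  note m = L2fun_meas[OF assms(1)] assms(2) L2fun_meas[OF assms(5)]
  note f = L2fun_scale[OF L2fun_norm(1)[OF assms(5)], of K]
  have "AE x in M. norm (\<Xi> x) * (norm (\<Theta> x) * norm (\<Phi> x)) \<le> norm (norm (\<Xi> x)) * norm (K *\<^sub>R norm (\<Phi> x))"
    using assms(3)
  proof eventually_elim
    case (elim x)
    then show ?case using assms(4) by (simp add: abs_mult mult_left_mono mult_right_mono)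
  qed
  note t = trilinear_bound[OF h_bil Mh m L2fun_norm(1)[OF assms(1)] f(1) this]
  show "BI \<Xi> \<Theta> \<Phi>" using t(1) by (simp add: BI_def)
  show "\<bar>BB \<Xi> \<Theta> \<Phi>\<bar> \<le> Mh * (L2n U \<Xi> * (K * L2n U \<Phi>))"
    using t(2) f(2) L2fun_norm(2)[OF assms(1)] L2fun_norm(2)[OF assms(5)] assms(4) by (simp add: Bform_def)
qed

lemma h_lin:
  "h (a *\<^sub>R u + b *\<^sub>R v) w = a *\<^sub>R h u w + b *\<^sub>R h v w" "h w (a *\<^sub>R u + b *\<^sub>R v) = a *\<^sub>R h w u + b *\<^sub>R h w v"
  by (simp_all add: bilinear_ladd[OF h_bil] bilinear_radd[OF h_bil] bilinear_lmul[OF h_bil] bilinear_rmul[OF h_bil])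

lemma B_lin1: "BI \<Xi> \<Theta> \<Phi> \<Longrightarrow> BI \<Xi>' \<Theta> \<Phi> \<Longrightarrow> BB (\<lambda>x. a *\<^sub>R \<Xi> x + b *\<^sub>R \<Xi>' x) \<Theta> \<Phi> = a * BB \<Xi> \<Theta> \<Phi> + b * BB \<Xi>' \<Theta> \<Phi>"
  by (simp add: BI_def Bform_def inner_add_left)

lemma B_lin2: "BI \<Xi> \<Theta> \<Phi> \<Longrightarrow> BI \<Xi> \<Theta>' \<Phi> \<Longrightarrow> BB \<Xi> (\<lambda>x. a *\<^sub>R \<Theta> x + b *\<^sub>R \<Theta>' x) \<Phi> = a * BB \<Xi> \<Theta> \<Phi> + b * BB \<Xi> \<Theta>' \<Phi>"
  by (simp add: BI_def Bform_def inner_add_right h_lin)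

lemma B_lin3: "BI \<Xi> \<Theta> \<Phi> \<Longrightarrow> BI \<Xi> \<Theta> \<Phi>' \<Longrightarrow> BB \<Xi> \<Theta> (\<lambda>x. a *\<^sub>R \<Phi> x + b *\<^sub>R \<Phi>' x) = a * BB \<Xi> \<Theta> \<Phi> + b * BB \<Xi> \<Theta> \<Phi>'"
  by (simp add: BI_def Bform_def inner_add_right h_lin)

lemma B_diff:
  "BI \<Xi> \<Theta> \<Phi> \<Longrightarrow> BI \<Xi>' \<Theta> \<Phi> \<Longrightarrow> BB (\<lambda>x. \<Xi> x - \<Xi>' x) \<Theta> \<Phi> = BB \<Xi> \<Theta> \<Phi> - BB \<Xi>' \<Theta> \<Phi>"
  "BI \<Xi> \<Theta> \<Phi> \<Longrightarrow> BI \<Xi> \<Theta>' \<Phi> \<Longrightarrow> BB \<Xi> (\<lambda>x. \<Theta> x - \<Theta>' x) \<Phi> = BB \<Xi> \<Theta> \<Phi> - BB \<Xi> \<Theta>' \<Phi>"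
  "BI \<Xi> \<Theta> \<Phi> \<Longrightarrow> BI \<Xi> \<Theta> \<Phi>' \<Longrightarrow> BB \<Xi> \<Theta> (\<lambda>x. \<Phi> x - \<Phi>' x) = BB \<Xi> \<Theta> \<Phi> - BB \<Xi> \<Theta> \<Phi>'"
  using B_lin1[of \<Xi> \<Theta> \<Phi> \<Xi>' 1 "-1"] B_lin2[of \<Xi> \<Theta> \<Phi> \<Theta>' 1 "-1"] B_lin3[of \<Xi> \<Theta> \<Phi> \<Phi>' 1 "-1"] by simp_all

lemma B_add:
  "BI \<Xi> \<Theta> \<Phi> \<Longrightarrow> BI \<Xi>' \<Theta> \<Phi> \<Longrightarrow> BB (\<lambda>x. \<Xi> x + \<Xi>' x) \<Theta> \<Phi> = BB \<Xi> \<Theta> \<Phi> + BB \<Xi>' \<Theta> \<Phi>"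
  "BI \<Xi> \<Theta> \<Phi> \<Longrightarrow> BI \<Xi> \<Theta>' \<Phi> \<Longrightarrow> BB \<Xi> (\<lambda>x. \<Theta> x + \<Theta>' x) \<Phi> = BB \<Xi> \<Theta> \<Phi> + BB \<Xi> \<Theta>' \<Phi>"
  "BI \<Xi> \<Theta> \<Phi> \<Longrightarrow> BI \<Xi> \<Theta> \<Phi>' \<Longrightarrow> BB \<Xi> \<Theta> (\<lambda>x. \<Phi> x + \<Phi>' x) = BB \<Xi> \<Theta> \<Phi> + BB \<Xi> \<Theta> \<Phi>'"
  using B_lin1[of \<Xi> \<Theta> \<Phi> \<Xi>' 1 1] B_lin2[of \<Xi> \<Theta> \<Phi> \<Theta>' 1 1] B_lin3[of \<Xi> \<Theta> \<Phi> \<Phi>' 1 1] by simp_all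

lemma B_cong_AE:
  assumes "\<Xi> \<in> borel_measurable M" "\<Theta> \<in> borel_measurable M" "\<Phi> \<in> borel_measurable M"
    "\<Xi>' \<in> borel_measurable M" "\<Theta>' \<in> borel_measurable M" "\<Phi>' \<in> borel_measurable M"
    "AE x in M. \<Xi> x = \<Xi>' x" "AE x in M. \<Theta> x = \<Theta>' x" "AE x in M. \<Phi> x = \<Phi>' x"
  shows "BB \<Xi> \<Theta> \<Phi> = BB \<Xi>' \<Theta>' \<Phi>'"
  unfolding Bform_def
proof (rule integral_cong_AE)
  show "AE x in M. inner (\<Xi> x) (h (\<Theta> x) (\<Phi> x)) = inner (\<Xi>' x) (h (\<Theta>' x) (\<Phi>' x))"
    using assms(7,8,9) by eventually_elim simp
qed (intro trilinear_measurable[OF h_bil] assms)+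

lemma A_lin2: "L2fun U Z \<Longrightarrow> L2fun U H \<Longrightarrow> L2fun U H' \<Longrightarrow> AA Z (\<lambda>x. a *\<^sub>R H x + b *\<^sub>R H' x) = a * AA Z H + b * AA Z H'"
  using L2_inner_integrable[of U Z H] L2_inner_integrable[of U Z H'] by (simp add: Aform_def inner_add_right)

lemma A_sym: "AA Z H = AA H Z" by (simp add: Aform_def inner_commute)

lemma A_bound: "L2fun U Z \<Longrightarrow> L2fun U H \<Longrightarrow> \<bar>AA Z H\<bar> \<le> L2n U Z * L2n U H"
  unfolding Aform_def by (rule L2_inner_bound)

lemma A_diff2: "L2fun U Z \<Longrightarrow> L2fun U H \<Longrightarrow> L2fun U H' \<Longrightarrow> AA Z (\<lambda>x. H x - H' x) = AA Z H - AA Z H'"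
  and A_add2: "L2fun U Z \<Longrightarrow> L2fun U H \<Longrightarrow> L2fun U H' \<Longrightarrow> AA Z (\<lambda>x. H x + H' x) = AA Z H + AA Z H'"
  using A_lin2[of Z H H' 1 "-1"] A_lin2[of Z H H' 1 1] by simp_all

lemma A_diff1: "L2fun U Z \<Longrightarrow> L2fun U H \<Longrightarrow> L2fun U H' \<Longrightarrow> AA (\<lambda>x. H x - H' x) Z = AA H Z - AA H' Z"
  and A_add1: "L2fun U Z \<Longrightarrow> L2fun U H \<Longrightarrow> L2fun U H' \<Longrightarrow> AA (\<lambda>x. H x + H' x) Z = AA H Z + AA H' Z"
  using A_diff2[of Z H H'] A_add2[of Z H H'] by (simp_all add: A_sym[of _ Z])

lemma A_self: "AA Z Z = (L2n U Z)^2"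
  by (simp add: Aform_def L2n_sq power2_norm_eq_inner)

lemma A_cong_AE:
  assumes "Z \<in> borel_measurable M" "H \<in> borel_measurable M" "Z' \<in> borel_measurable M" "H' \<in> borel_measurable M"
    "AE x in M. Z x = Z' x" "AE x in M. H x = H' x"
  shows "AA Z H = AA Z' H'"
  unfolding Aform_def
proof (rule integral_cong_AE)
  show "AE x in M. inner (Z x) (H x) = inner (Z' x) (H' x)" using assms(5,6) by eventually_elim simp
qed (intro borel_measurable_inner assms)+

lemma HT_L2: "(\<And>i. sob U 2 (\<Phi> i)) \<Longrightarrow> L2fun U (HT U (\<Phi> :: 'k \<Rightarrow> _))"
  unfolding HT_def by (intro L2_tup(1) whess_L2)

lemma GradT_L4: "(\<And>i. sob U 2 (\<Phi> i)) \<Longrightarrow> L4fun U (GradT U (\<Phi> :: 'k \<Rightarrow> _))"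
  unfolding GradT_def by (intro L4_tup(1) wgrad_L4)

lemma Xsp_sob: "Xsp U \<Phi> \<Longrightarrow> sob U 2 (\<Phi> i)"
  by (simp add: Xsp_def sob0_sob)

lemma Xsp_grad_L4:
  "\<exists>C\<ge>0. \<forall>\<Phi> :: 'k \<Rightarrow> _. Xsp U \<Phi> \<longrightarrow> L4n U (GradT U \<Phi>) \<le> C * L2n U (HT U \<Phi>)"
proof -
  obtain C where C: "C \<ge> 0" "\<forall>v. sob0 U 2 v \<longrightarrow> L4n U (wgrad U v) \<le> C * L2n U (whess U v)"
    using sob0_grad_L4 by (elim exE conjE) (rule that)
  have "L4n U (GradT U \<Phi>) \<le> (real CARD('k) * C) * L2n U (HT U \<Phi>)" if X: "Xsp U \<Phi>" for \<Phi> :: "'k \<Rightarrow> real^'n \<Rightarrow> real"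
  proof -
    note s = Xsp_sob[OF X]
    have "L4n U (GradT U \<Phi>) \<le> (\<Sum>i\<in>UNIV. L4n U (wgrad U (\<Phi> i)))"
      unfolding GradT_def by (intro L4_tup(2) wgrad_L4 s)
    also have "\<dots> \<le> (\<Sum>i\<in>(UNIV::'k set). C * L2n U (HT U \<Phi>))"
    proof (rule sum_mono)
      fix i
      have "L4n U (wgrad U (\<Phi> i)) \<le> C * L2n U (whess U (\<Phi> i))" using C(2) X by (simp add: Xsp_def)
      also have "\<dots> \<le> C * L2n U (HT U \<Phi>)"
        unfolding HT_def by (intro mult_left_mono C(1) L2_tup(3) whess_L2 s)
      finally show "L4n U (wgrad U (\<Phi> i)) \<le> C * L2n U (HT U \<Phi>)" .
    qed
    also have "\<dots> = (real CARD('k) * C) * L2n U (HT U \<Phi>)" by simp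
    finally show ?thesis .
  qed
  then show ?thesis using C(1) by (intro exI[of _ "real CARD('k) * C"]) simp
qed

end

section \<open>Test tuples, density and the continuous inf-sup condition\<close>

lemma iter_pd_lin:
  assumes "smooth_fun f" "smooth_fun g"
  shows "iter_pd js (\<lambda>x. a * f x + b * g x) = (\<lambda>x. a * iter_pd js f x + b * iter_pd js g x)"
proof (induction js)
  case (Cons j js)
  let ?F = "iter_pd js f" and ?G = "iter_pd js g"
  have s: "smooth_fun ?F" "smooth_fun ?G" by (intro smooth_iter_pd assms)+
  have c: "iter_pd [j] (\<lambda>x. k * F x) x = k * iter_pd [j] F x" if "smooth_fun F" for k F x
  proof -
    have "iter_pd [j] (\<lambda>x. k * F x) x = k * iter_pd [j] F x + iter_pd [j] (\<lambda>x. k) x * F x"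
      by (rule pd_mult(1)[OF smooth_differentiable[OF smooth_const] smooth_differentiable[OF that]])
    then show ?thesis by (simp add: pd_const)
  qed
  have "iter_pd [j] (\<lambda>x. a * ?F x + b * ?G x) x = a * iter_pd [j] ?F x + b * iter_pd [j] ?G x" for x
  proof -
    have "iter_pd [j] (\<lambda>x. a * ?F x + b * ?G x) x = iter_pd [j] (\<lambda>x. a * ?F x) x + iter_pd [j] (\<lambda>x. b * ?G x) x"
      by (rule pd_mult(2)[OF smooth_differentiable[OF smooth_scale[OF s(1)]] smooth_differentiable[OF smooth_scale[OF s(2)]]])
    then show ?thesis by (simp add: c s)
  qed
  then show ?case
    unfolding iter_pd_Cons[of j js "\<lambda>x. a * f x + b * g x"] iter_pd_Cons[of j js f] iter_pd_Cons[of j js g] Cons.IH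
    by (rule ext)
qed simp

lemma lin_fun_apply: "(a *\<^sub>R \<phi> + b *\<^sub>R \<psi>) i = (\<lambda>x. a * \<phi> i x + b * (\<psi> i x :: real))"
  by (simp add: plus_fun_def scaleR_fun_def)

context trilinear_form
begin

definition TS :: "('k \<Rightarrow> real^'n \<Rightarrow> real) set" where "TS = {\<phi>. \<forall>i. test_fun U (\<phi> i)}"

text \<open>Classical derivatives of test tuples: unlike \<open>HT\<close> and \<open>GradT\<close>,
  they depend linearly on the tuple at every point. The order \<open>[b, a]\<close> is the reversal
  found in \<open>wD_test\<close>.\<close>

definition Hc :: "('k \<Rightarrow> real^'n \<Rightarrow> real) \<Rightarrow> real^'n \<Rightarrow> real^'n^'n^'k" where
  "Hc \<phi> x = (\<chi> i a b. iter_pd [b, a] (\<phi> i) x)"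

definition Gc :: "('k \<Rightarrow> real^'n \<Rightarrow> real) \<Rightarrow> real^'n \<Rightarrow> real^'n^'k" where
  "Gc \<phi> x = (\<chi> i j. iter_pd [j] (\<phi> i) x)"

lemma TS_test: "\<phi> \<in> TS \<Longrightarrow> test_fun U (\<phi> i)" by (simp add: TS_def)

lemma TS_Xsp: "\<phi> \<in> TS \<Longrightarrow> Xsp U \<phi>" by (simp add: Xsp_def TS_def test_sob0)

lemma TS_sob: "\<phi> \<in> TS \<Longrightarrow> sob U m (\<phi> i)" by (rule test_sob[OF TS_test])

lemma TS_subspace: "subspace TS"
proof (rule subspaceI)
  show "0 \<in> TS" using test_fun_zero[of U] by (simp add: TS_def zero_fun_def)
  show "\<phi> + \<psi> \<in> TS" if "\<phi> \<in> TS" "\<psi> \<in> TS" for \<phi> \<psi>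
    using that test_fun_add[OF TS_test TS_test, of \<phi> \<psi>] by (simp add: TS_def plus_fun_def)
  show "c *\<^sub>R \<phi> \<in> TS" if "\<phi> \<in> TS" for c \<phi>
    using that test_fun_scale[OF TS_test, of \<phi> c] by (simp add: TS_def scaleR_fun_def)
qed

lemma Hc_lin: "\<phi> \<in> TS \<Longrightarrow> \<psi> \<in> TS \<Longrightarrow> Hc (a *\<^sub>R \<phi> + b *\<^sub>R \<psi>) = (\<lambda>x. a *\<^sub>R Hc \<phi> x + b *\<^sub>R Hc \<psi> x)"
  unfolding Hc_def[abs_def] lin_fun_apply
  by (simp add: iter_pd_lin[OF test_fun_smooth[OF TS_test] test_fun_smooth[OF TS_test]] vec_eq_iff fun_eq_iff)

lemma Gc_lin: "\<phi> \<in> TS \<Longrightarrow> \<psi> \<in> TS \<Longrightarrow> Gc (a *\<^sub>R \<phi> + b *\<^sub>R \<psi>) = (\<lambda>x. a *\<^sub>R Gc \<phi> x + b *\<^sub>R Gc \<psi> x)"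
  unfolding Gc_def[abs_def] lin_fun_apply
  by (simp add: iter_pd_lin[OF test_fun_smooth[OF TS_test] test_fun_smooth[OF TS_test]] vec_eq_iff fun_eq_iff)

lemma HT_Hc: "\<phi> \<in> TS \<Longrightarrow> AE x in M. HT U \<phi> x = Hc \<phi> x"
proof -
  assume t: "\<phi> \<in> TS"
  have "AE x in M. \<forall>i. \<forall>a. \<forall>b. wD U [a, b] (\<phi> i) x = iter_pd [b, a] (\<phi> i) x"
    by (intro eventually_all_finite) (use wD_test(2)[OF TS_test[OF t], of "[_, _]"] in simp)
  then show ?thesis by eventually_elim (simp add: HT_def whess_def Hc_def vec_eq_iff)
qed

lemma GradT_Gc: "\<phi> \<in> TS \<Longrightarrow> AE x in M. GradT U \<phi> x = Gc \<phi> x"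
proof -
  assume t: "\<phi> \<in> TS"
  have "AE x in M. \<forall>i. \<forall>a. wD U [a] (\<phi> i) x = iter_pd [a] (\<phi> i) x"
    by (intro eventually_all_finite) (use wD_test(2)[OF TS_test[OF t], of "[_]"] in simp)
  then show ?thesis by eventually_elim (simp add: GradT_def wgrad_def Gc_def vec_eq_iff)
qed

lemma pd_meas_M: "test_fun U f \<Longrightarrow> iter_pd js f \<in> borel_measurable M"
  by (rule L2fun_meas[OF test_pd_L2])

lemma Hc_meas: "\<phi> \<in> TS \<Longrightarrow> Hc \<phi> \<in> borel_measurable M"
  unfolding Hc_def[abs_def]
  by (subst vec_measurable_iff, intro allI, subst vec_measurable_iff, intro allI, subst vec_measurable_iff)
    (simp add: pd_meas_M[OF TS_test])

lemma Gc_meas: "\<phi> \<in> TS \<Longrightarrow> Gc \<phi> \<in> borel_measurable M"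
  unfolding Gc_def[abs_def]
  by (subst vec_measurable_iff, intro allI, subst vec_measurable_iff) (simp add: pd_meas_M[OF TS_test])

lemma Hc_L2: assumes "\<phi> \<in> TS" shows "L2fun U (Hc \<phi>)" "L2n U (HT U \<phi>) = L2n U (Hc \<phi>)"
  using L2n_cong_AE[OF HT_L2[OF TS_sob[OF assms]] Hc_meas[OF assms] HT_Hc[OF assms]] by auto

lemma Gc_L4: assumes "\<phi> \<in> TS" shows "L4fun U (Gc \<phi>)" "L4n U (GradT U \<phi>) = L4n U (Gc \<phi>)"
  using L4n_cong_AE[OF GradT_L4[OF TS_sob[OF assms]] Gc_meas[OF assms] GradT_Gc[OF assms]] by auto

definition ip :: "('k \<Rightarrow> real^'n \<Rightarrow> real) \<Rightarrow> ('k \<Rightarrow> real^'n \<Rightarrow> real) \<Rightarrow> real" where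
  "ip \<phi> \<psi> = AA (Hc \<phi>) (Hc \<psi>)"

sublocale sip: semi_ip TS ip
proof
  show "subspace TS" by (rule TS_subspace)
  show "lin_on TS (ip w)" if w: "w \<in> TS" for w
    unfolding lin_on_def ip_def
  proof (intro ballI allI)
    fix u v a b assume "u \<in> TS" "v \<in> TS"
    then show "AA (Hc w) (Hc (a *\<^sub>R u + b *\<^sub>R v)) = a * AA (Hc w) (Hc u) + b * AA (Hc w) (Hc v)"
      by (subst Hc_lin) (simp_all add: A_lin2 Hc_L2(1) w)
  qed
  show "ip u v = ip v u" for u v unfolding ip_def by (rule A_sym)
  show "0 \<le> ip u u" for u by (simp add: ip_def A_self)
qed

lemma nrm_eq: "sip.nrm \<phi> = L2n U (Hc \<phi>)"
  by (simp add: sip.nrm_def ip_def A_self)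

lemma Gc_bound: "\<exists>C\<ge>0. \<forall>\<phi>\<in>TS. L4n U (Gc \<phi>) \<le> C * L2n U (Hc \<phi>)"
proof -
  obtain C where C: "C \<ge> 0" "\<forall>\<Phi> :: 'k \<Rightarrow> _. Xsp U \<Phi> \<longrightarrow> L4n U (GradT U \<Phi>) \<le> C * L2n U (HT U \<Phi>)"
    using Xsp_grad_L4 by (elim exE conjE) (rule that)
  have "L4n U (Gc \<phi>) \<le> C * L2n U (Hc \<phi>)" if "\<phi> \<in> TS" for \<phi>
    using C(2)[rule_format, OF TS_Xsp[OF that]] by (simp only: Gc_L4(2)[OF that] Hc_L2(2)[OF that])
  then show ?thesis using C(1) by (intro exI[of _ C]) simp
qed

lemma pd_wD:
  assumes t: "test_fun U f" and p: "L2fun U \<psi>"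
  shows "(LINT x|M. wD U [j] f x * \<psi> x) = (LINT x|M. iter_pd [j] f x * \<psi> x)"
proof (rule integral_cong_AE)
  show "AE x in M. wD U [j] f x * \<psi> x = iter_pd [j] f x * \<psi> x"
    using wD_test(2)[OF t, of "[j]"] by eventually_elim simp
qed (intro borel_measurable_times L2fun_meas[OF p] L2fun_meas[OF wD_test(1)[OF t]] pd_meas_M[OF t])+

text \<open>The abstract splitting applies with the L4 norm of the gradient as q: Ehrling's
  inequality for the first derivatives bounds it by a small multiple of the Hessian norm plus
  pairings with finitely many functions.\<close>

lemma splitting:
  assumes e: "\<epsilon> > 0"
  shows "\<exists>n e. sip.orthonormal n e \<and> (\<forall>u\<in>TS. (\<forall>m<n. ip (e m) u = 0) \<longrightarrow> L4n U (Gc u) \<le> \<epsilon> * sip.nrm u)"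
proof -
  obtain C0 where C0: "C0 \<ge> 0" "\<forall>\<phi>\<in>TS. L4n U (Gc \<phi>) \<le> C0 * L2n U (Hc \<phi>)"
    using Gc_bound by (elim exE conjE) (rule that)
  obtain C1 where C1: "C1 \<ge> 0" "\<forall>v j. sob0 U 2 v \<longrightarrow> L2n U (wD U [j] v) + L2n U (Gm (wD U [j] v)) \<le> C1 * L2n U (whess U v)"
    using sob0_grad_L2 by (elim exE conjE) (rule that)
  define N where "N = real CARD('k) * real CARD('n)"
  have N: "N > 0" by (simp add: N_def)
  \<comment> \<open>There are N first derivatives in all, each contributing \<epsilon>' C1 times the
    norm; together they use at most \<epsilon>/2.\<close>
  define \<epsilon>' where "\<epsilon>' = \<epsilon> / 2 / (N * (C1 + 1))"
  have e': "\<epsilon>' > 0" using e N C1(1) by (simp add: \<epsilon>'_def add_nonneg_pos)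
  have Ne: "N * (\<epsilon>' * C1) \<le> \<epsilon> / 2"
  proof -
    have p: "N * (C1 + 1) \<noteq> 0" using N C1(1) by auto
    have "N * (\<epsilon>' * C1) \<le> (N * (C1 + 1)) * \<epsilon>'" using N e' by (simp add: algebra_simps)
    also have "\<dots> = \<epsilon> / 2" unfolding \<epsilon>'_def by (rule times_divide_cancel[OF p])
    finally show ?thesis .
  qed
  obtain F C where F': "finite F \<and> (\<forall>\<psi>\<in>F. L2fun U \<psi>) \<and> C \<ge> 0 \<and>
    (\<forall>u. sob U 1 u \<longrightarrow> L4n U u \<le> \<epsilon>' * (L2n U u + L2n U (Gm u)) + C * (\<Sum>\<psi>\<in>F. \<bar>LINT x|M. u x * \<psi> x\<bar>))"
    using ehrling[OF e'] by (elim exE) (rule that)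
  then have F: "finite F" "\<And>\<psi>. \<psi> \<in> F \<Longrightarrow> L2fun U \<psi>" "C \<ge> 0"
    "\<And>u. sob U 1 u \<Longrightarrow> L4n U u \<le> \<epsilon>' * (L2n U u + L2n U (Gm u)) + C * (\<Sum>\<psi>\<in>F. \<bar>LINT x|M. u x * \<psi> x\<bar>)"
    by simp_all
  define I where "I = (UNIV :: 'k set) \<times> ((UNIV :: 'n set) \<times> F)"
  define l where "l p \<phi> = (LINT x|M. iter_pd [fst (snd p)] (\<phi> (fst p)) x * snd (snd p) x)" for p :: "'k \<times> 'n \<times> (real^'n \<Rightarrow> real)" and \<phi> :: "'k \<Rightarrow> real^'n \<Rightarrow> real"
  define cc where "cc p = C1 * L2n U (snd (snd p))" for p :: "'k \<times> 'n \<times> (real^'n \<Rightarrow> real)"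
  have hess: "L2n U (whess U (u i)) \<le> sip.nrm u" if "u \<in> TS" for u i
  proof -
    have "L2n U (whess U (u i)) \<le> L2n U (HT U u)" unfolding HT_def by (intro L2_tup(3) whess_L2 TS_sob[OF that])
    then show ?thesis by (simp only: nrm_eq Hc_L2(2)[OF that])
  qed
  show ?thesis
  proof (rule sip.finite_rank_splitting[where q="\<lambda>u. L4n U (Gc u)" and I=I and l=l and cc=cc and C=C])
    show "L4n U (Gc (c *\<^sub>R u)) = \<bar>c\<bar> * L4n U (Gc u)" if "u \<in> TS" for c u
    proof -
      have "Gc (c *\<^sub>R u) = (\<lambda>x. c *\<^sub>R Gc u x)" using Gc_lin[OF that that, of c 0] by simp
      then show ?thesis using L4fun_scale(2)[OF Gc_L4(1)[OF that]] by simp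
    qed
    show "L4n U (Gc u) \<le> C0 * sip.nrm u" if "u \<in> TS" for u using C0(2) that by (simp only: nrm_eq)
    show "finite I" using F(1) by (simp add: I_def)
    show "lin_on TS (l p)" if "p \<in> I" for p
      unfolding lin_on_def
    proof (intro ballI allI)
      fix u v :: "'k \<Rightarrow> real^'n \<Rightarrow> real" and a b assume uv: "u \<in> TS" "v \<in> TS"
      obtain i j \<psi> where p: "p = (i, j, \<psi>)" by (cases p) auto
      have ps: "L2fun U \<psi>" using that F(2) by (simp add: I_def p)
      have "l p (a *\<^sub>R u + b *\<^sub>R v) = (LINT x|M. a * (iter_pd [j] (u i) x * \<psi> x) + b * (iter_pd [j] (v i) x * \<psi> x))"
        unfolding l_def p fst_conv snd_conv lin_fun_apply
          iter_pd_lin[OF test_fun_smooth[OF TS_test[OF uv(1)]] test_fun_smooth[OF TS_test[OF uv(2)]]]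
        by (simp only: distrib_right mult.assoc)
      also have "\<dots> = a * l p u + b * l p v"
        unfolding l_def p fst_conv snd_conv
        using L2_real_integrable(1)[OF test_pd_L2[OF TS_test[OF uv(1)]] ps, of "[j]" i] L2_real_integrable(1)[OF test_pd_L2[OF TS_test[OF uv(2)]] ps, of "[j]" i] by simp
      finally show "l p (a *\<^sub>R u + b *\<^sub>R v) = a * l p u + b * l p v" .
    qed
    show "\<bar>l p u\<bar> \<le> cc p * sip.nrm u" if pI: "p \<in> I" and u: "u \<in> TS" for p u
    proof -
      obtain i j \<psi> where p: "p = (i, j, \<psi>)" by (cases p) auto
      have ps: "L2fun U \<psi>" using pI F(2) by (simp add: I_def p)
      have "l p u = (LINT x|M. wD U [j] (u i) x * \<psi> x)" unfolding l_def p by (simp add: pd_wD[OF TS_test[OF u] ps])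
      then have "\<bar>l p u\<bar> \<le> L2n U (wD U [j] (u i)) * L2n U \<psi>"
        using L2_real_integrable(2)[OF wD_test(1)[OF TS_test[OF u]] ps] by simp
      also have "\<dots> \<le> (C1 * sip.nrm u) * L2n U \<psi>"
      proof (intro mult_right_mono)
        have "L2n U (wD U [j] (u i)) + L2n U (Gm (wD U [j] (u i))) \<le> C1 * L2n U (whess U (u i))"
          using C1(2) test_sob0[OF TS_test[OF u]] by simp
        also have "\<dots> \<le> C1 * sip.nrm u" by (intro mult_left_mono hess u C1(1))
        finally show "L2n U (wD U [j] (u i)) \<le> C1 * sip.nrm u"
          using L2n_nonneg[of U "Gm (wD U [j] (u i))"] by linarith
      qed simp
      finally show ?thesis by (simp add: cc_def p ac_simps)
    qed
    show "L4n U (Gc u) \<le> \<epsilon> / 2 * sip.nrm u + C * (\<Sum>p\<in>I. \<bar>l p u\<bar>)" if u: "u \<in> TS" for u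
    proof -
      have comp: "L4n U (wD U [j] (u i)) \<le> \<epsilon>' * C1 * sip.nrm u + C * (\<Sum>\<psi>\<in>F. \<bar>l (i, j, \<psi>) u\<bar>)" for i j
      proof -
        have "L4n U (wD U [j] (u i)) \<le> \<epsilon>' * (L2n U (wD U [j] (u i)) + L2n U (Gm (wD U [j] (u i)))) + C * (\<Sum>\<psi>\<in>F. \<bar>LINT x|M. wD U [j] (u i) x * \<psi> x\<bar>)"
          by (rule F(4)[OF sob_wD1[OF TS_sob[OF u]]])
        also have "(\<Sum>\<psi>\<in>F. \<bar>LINT x|M. wD U [j] (u i) x * \<psi> x\<bar>) = (\<Sum>\<psi>\<in>F. \<bar>l (i, j, \<psi>) u\<bar>)"
          by (intro sum.cong refl) (simp add: l_def pd_wD[OF TS_test[OF u] F(2)])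
        also have "\<epsilon>' * (L2n U (wD U [j] (u i)) + L2n U (Gm (wD U [j] (u i)))) \<le> \<epsilon>' * (C1 * sip.nrm u)"
        proof (rule mult_left_mono[OF _ less_imp_le[OF e']])
          have "L2n U (wD U [j] (u i)) + L2n U (Gm (wD U [j] (u i))) \<le> C1 * L2n U (whess U (u i))"
            using C1(2) test_sob0[OF TS_test[OF u]] by simp
          also have "\<dots> \<le> C1 * sip.nrm u" by (intro mult_left_mono hess u C1(1))
          finally show "L2n U (wD U [j] (u i)) + L2n U (Gm (wD U [j] (u i))) \<le> C1 * sip.nrm u" .
        qed
        finally show ?thesis by (simp add: mult.assoc)
      qed
      have "L4n U (Gc u) = L4n U (GradT U u)" by (rule Gc_L4(2)[OF u, symmetric])
      also have "\<dots> \<le> (\<Sum>i\<in>UNIV. L4n U (wgrad U (u i)))"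
        unfolding GradT_def by (intro L4_tup(2) wgrad_L4 TS_sob[OF u])
      also have "\<dots> \<le> (\<Sum>i\<in>UNIV. \<Sum>j\<in>UNIV. L4n U (wD U [j] (u i)))"
        by (intro sum_mono wgrad_L4(2) TS_sob[OF u])
      also have "\<dots> \<le> (\<Sum>i\<in>(UNIV::'k set). \<Sum>j\<in>(UNIV::'n set). \<epsilon>' * C1 * sip.nrm u + C * (\<Sum>\<psi>\<in>F. \<bar>l (i, j, \<psi>) u\<bar>))"
        by (intro sum_mono comp)
      also have "\<dots> = N * (\<epsilon>' * C1) * sip.nrm u + C * (\<Sum>p\<in>I. \<bar>l p u\<bar>)"
      proof -
        have "(\<Sum>p\<in>I. \<bar>l p u\<bar>) = (\<Sum>i\<in>UNIV. \<Sum>j\<in>UNIV. \<Sum>\<psi>\<in>F. \<bar>l (i, j, \<psi>) u\<bar>)"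
          unfolding I_def by (simp add: sum.cartesian_product case_prod_unfold)
        then show ?thesis unfolding sum.distrib sum_distrib_left[symmetric] by (simp add: N_def mult.assoc)
      qed
      also have "\<dots> \<le> \<epsilon> / 2 * sip.nrm u + C * (\<Sum>p\<in>I. \<bar>l p u\<bar>)"
        by (intro add_right_mono mult_right_mono Ne) (simp add: nrm_eq)
      finally show ?thesis .
    qed
  qed (use e F(3) in auto)
qed

text \<open>Convergence of the Hessians is part of membership in X. For the gradients the L4
  embedding is applied to differences of first derivatives, whose own gradients are differences of
  second derivatives.\<close>

lemma Xsp_approx:
  assumes X: "Xsp U (\<Phi> :: 'k \<Rightarrow> real^'n \<Rightarrow> real)"
  shows "\<exists>\<phi>s. (\<forall>n. \<phi>s n \<in> TS) \<and> (\<lambda>n. L2n U (\<lambda>x. HT U (\<phi>s n) x - HT U \<Phi> x)) \<longlonglongrightarrow> 0 \<and>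
     (\<lambda>n. L4n U (\<lambda>x. GradT U (\<phi>s n) x - GradT U \<Phi> x)) \<longlonglongrightarrow> 0"
proof -
  have "\<forall>i. \<exists>\<psi>. (\<forall>n. test_fun U (\<psi> n)) \<and> (\<forall>js :: 'n list. length js \<le> 2 \<longrightarrow> (\<lambda>n. L2n U (\<lambda>x. wD U js (\<psi> n) x - wD U js (\<Phi> i) x)) \<longlonglongrightarrow> 0)"
  proof
    fix i
    have "sob0 U 2 (\<Phi> i)" using X by (simp add: Xsp_def)
    then show "\<exists>\<psi>. (\<forall>n. test_fun U (\<psi> n)) \<and> (\<forall>js :: 'n list. length js \<le> 2 \<longrightarrow> (\<lambda>n. L2n U (\<lambda>x. wD U js (\<psi> n) x - wD U js (\<Phi> i) x)) \<longlonglongrightarrow> 0)"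
      by (rule sob0_approx) (intro exI conjI allI impI, assumption+)
  qed
  from choice[OF this] obtain p where p': "\<forall>i. (\<forall>n. test_fun U (p i n)) \<and> (\<forall>js :: 'n list. length js \<le> 2 \<longrightarrow> (\<lambda>n. L2n U (\<lambda>x. wD U js (p i n) x - wD U js (\<Phi> i) x)) \<longlonglongrightarrow> 0)"
    by (elim exE) (rule that)
  have p: "test_fun U (p i n)" "length js \<le> 2 \<Longrightarrow> (\<lambda>n. L2n U (\<lambda>x. wD U js (p i n) x - wD U js (\<Phi> i) x)) \<longlonglongrightarrow> 0" for i n and js :: "'n list"
    using p' by simp_all
  define \<phi> where "\<phi> n i = p i n" for n i
  have T: "\<phi> n \<in> TS" for n by (simp add: TS_def \<phi>_def p(1))
  have s: "sob U 2 (\<Phi> i)" "sob U 2 (p i n)" for i n by (rule Xsp_sob[OF X]) (rule test_sob[OF p(1)])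
  have w: "L2fun U (\<lambda>x. wD U js (p i n) x - wD U js (\<Phi> i) x)" if "length js \<le> 2" for i n and js :: "'n list"
    by (intro L2fun_diff(1) sobD(1)[OF s(1) that] sobD(1)[OF s(2) that])
  have H: "(\<lambda>n. L2n U (\<lambda>x. HT U (\<phi> n) x - HT U \<Phi> x)) \<longlonglongrightarrow> 0"
  proof (rule tendsto_sandwich[OF _ _ tendsto_const])
    let ?f = "\<lambda>n i a b x. wD U [a, b] (p i n) x - wD U [a, b] (\<Phi> i) x"
    have "L2n U (\<lambda>x. HT U (\<phi> n) x - HT U \<Phi> x) \<le> (\<Sum>i\<in>UNIV. \<Sum>a\<in>UNIV. \<Sum>b\<in>UNIV. L2n U (?f n i a b))" for n
    proof -
      have e: "(\<lambda>x. (HT U (\<phi> n) x - HT U \<Phi> x) $ i $ a $ b) = ?f n i a b" for i a b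
        by (simp add: HT_def whess_def \<phi>_def)
      have 1: "L2fun U (\<lambda>x. (HT U (\<phi> n) x - HT U \<Phi> x) $ i $ a $ b)" for i a b unfolding e by (rule w) simp
      note 2 = L2fun_vec[OF 1]
      note 3 = L2fun_vec[OF 2(1)]
      note 4 = L2fun_vec[OF 3(1)]
      show ?thesis
        by (rule order_trans[OF 4(2)], rule sum_mono, rule order_trans[OF 3(2)], rule sum_mono, rule order_trans[OF 2(2)]) (simp only: e order_refl)
    qed
    then show "\<forall>\<^sub>F n in sequentially. L2n U (\<lambda>x. HT U (\<phi> n) x - HT U \<Phi> x) \<le> (\<Sum>i\<in>UNIV. \<Sum>a\<in>UNIV. \<Sum>b\<in>UNIV. L2n U (?f n i a b))" by simp
    have "(\<lambda>n. \<Sum>i\<in>UNIV. \<Sum>a\<in>UNIV. \<Sum>b\<in>UNIV. L2n U (?f n i a b)) \<longlonglongrightarrow> (\<Sum>i\<in>(UNIV::'k set). \<Sum>a\<in>(UNIV::'n set). \<Sum>b\<in>(UNIV::'n set). 0)"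
      by (intro tendsto_sum p(2)) simp
    then show "(\<lambda>n. \<Sum>i\<in>UNIV. \<Sum>a\<in>UNIV. \<Sum>b\<in>UNIV. L2n U (?f n i a b)) \<longlonglongrightarrow> 0" by simp
  qed simp
  obtain C2 where C2: "C2 \<ge> 0" "\<forall>u. sob U 1 u \<longrightarrow> L4n U u \<le> C2 * (L2n U u + L2n U (Gm u))"
    using sob_L4_bound by (elim exE conjE) (rule that)
  have G: "(\<lambda>n. L4n U (\<lambda>x. GradT U (\<phi> n) x - GradT U \<Phi> x)) \<longlonglongrightarrow> 0"
  proof (rule tendsto_sandwich[OF _ _ tendsto_const])
    let ?u = "\<lambda>n i j x. wD U [j] (p i n) x - wD U [j] (\<Phi> i) x"
    let ?g = "\<lambda>n i j l x. wD U [j, l] (p i n) x - wD U [j, l] (\<Phi> i) x"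
    let ?b = "\<lambda>n. \<Sum>i\<in>UNIV. \<Sum>j\<in>UNIV. C2 * (L2n U (?u n i j) + (\<Sum>l\<in>UNIV. L2n U (?g n i j l)))"
    have su: "sob U 1 (?u n i j)" for n i j
    proof -
      have "sob U 1 (\<lambda>x. 1 * wD U [j] (p i n) x + (-1) * wD U [j] (\<Phi> i) x)"
        by (rule sob_lin[OF sob_wD1[OF s(2)] sob_wD1[OF s(1)]])
      then show ?thesis by simp
    qed
    have bu: "L4n U (?u n i j) \<le> C2 * (L2n U (?u n i j) + (\<Sum>l\<in>UNIV. L2n U (?g n i j l)))" for n i j
    proof -
      have a: "L2fun U (wD U [l] (?u n i j))" for l by (rule sobD(1)[OF su]) simp
      have "L2n U (Gm (?u n i j)) \<le> (\<Sum>l\<in>UNIV. L2n U (\<lambda>z. \<bar>wD U [l] (?u n i j) z\<bar>))"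
        unfolding Gm_def[abs_def] by (rule conjunct2[OF L2fun_sum]) (use L2fun_norm(1)[OF a] in simp)
      also have "\<dots> = (\<Sum>l\<in>UNIV. L2n U (?g n i j l))"
      proof (rule sum.cong[OF refl])
        fix l
        have "L2n U (\<lambda>z. \<bar>wD U [l] (?u n i j) z\<bar>) = L2n U (wD U [l] (?u n i j))" using L2fun_norm(2)[OF a] by simp
        also have "\<dots> = L2n U (?g n i j l)"
        proof (rule L2n_cong_AE(2)[OF a L2fun_meas[OF w]])
          have "AE x in M. wD U [l] (?u n i j) x = wD U [l] (wD U [j] (p i n)) x - wD U [l] (wD U [j] (\<Phi> i)) x"
            by (rule wD_diff(2)[OF sob_wD1[OF s(2)] sob_wD1[OF s(1)]]) simp
          moreover have "AE x in M. wD U [l] (wD U [j] (p i n)) x = wD U [j, l] (p i n) x" using wD_wD[OF s(2), of "[j]" "[l]"] by simp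
          moreover have "AE x in M. wD U [l] (wD U [j] (\<Phi> i)) x = wD U [j, l] (\<Phi> i) x" using wD_wD[OF s(1), of "[j]" "[l]"] by simp
          ultimately show "AE x in M. wD U [l] (?u n i j) x = ?g n i j l x" by eventually_elim simp
        qed simp
        finally show "L2n U (\<lambda>z. \<bar>wD U [l] (?u n i j) z\<bar>) = L2n U (?g n i j l)" .
      qed
      finally have "L2n U (Gm (?u n i j)) \<le> (\<Sum>l\<in>UNIV. L2n U (?g n i j l))" .
      then have "C2 * (L2n U (?u n i j) + L2n U (Gm (?u n i j))) \<le> C2 * (L2n U (?u n i j) + (\<Sum>l\<in>UNIV. L2n U (?g n i j l)))"
        by (intro mult_left_mono add_left_mono C2(1))
      moreover have "L4n U (?u n i j) \<le> C2 * (L2n U (?u n i j) + L2n U (Gm (?u n i j)))" by (rule C2(2)[rule_format, OF su])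
      ultimately show ?thesis by linarith
    qed
    have "L4n U (\<lambda>x. GradT U (\<phi> n) x - GradT U \<Phi> x) \<le> ?b n" for n
    proof -
      have e: "(\<lambda>x. (GradT U (\<phi> n) x - GradT U \<Phi> x) $ i $ j) = ?u n i j" for i j
        by (simp add: GradT_def wgrad_def \<phi>_def)
      have 1: "L4fun U (\<lambda>x. (GradT U (\<phi> n) x - GradT U \<Phi> x) $ i $ j)" for i j unfolding e by (rule sob_L4[OF su])
      note 2 = L4fun_vec[OF 1]
      note 3 = L4fun_vec[OF 2(1)]
      show ?thesis
        by (rule order_trans[OF 3(2)], rule sum_mono, rule order_trans[OF 2(2)], rule sum_mono) (simp only: e bu)
    qed
    then show "\<forall>\<^sub>F n in sequentially. L4n U (\<lambda>x. GradT U (\<phi> n) x - GradT U \<Phi> x) \<le> ?b n" by simp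
    have "?b \<longlonglongrightarrow> (\<Sum>i\<in>(UNIV::'k set). \<Sum>j\<in>(UNIV::'n set). C2 * (0 + (\<Sum>l\<in>(UNIV::'n set). 0)))"
      by (intro tendsto_sum tendsto_mult_left tendsto_add p(2)) simp_all
    then show "?b \<longlonglongrightarrow> 0" by simp
  qed simp
  show ?thesis using T H G by (intro exI[of _ \<phi>]) simp
qed

text \<open>Every term is continuous in the Hessian norm and the L4 norm of the gradient, and test
  tuples approximate \<Phi> in both. Two trilinear terms are carried because the linearised form has
  two.\<close>

lemma density_bound:
  assumes X: "Xsp U (\<Phi> :: 'k \<Rightarrow> real^'n \<Rightarrow> real)" and Z: "L2fun U Z" and 1: "L2fun U \<Xi>1" "L4fun U \<Theta>1" and 2: "L2fun U \<Xi>2" "L4fun U \<Theta>2"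
    and b: "\<And>\<phi>. \<phi> \<in> TS \<Longrightarrow> \<bar>AA Z (Hc \<phi>) + BB \<Xi>1 \<Theta>1 (Gc \<phi>) + BB \<Xi>2 \<Theta>2 (Gc \<phi>)\<bar> \<le> c * L2n U (Hc \<phi>)"
  shows "\<bar>AA Z (HT U \<Phi>) + BB \<Xi>1 \<Theta>1 (GradT U \<Phi>) + BB \<Xi>2 \<Theta>2 (GradT U \<Phi>)\<bar> \<le> c * L2n U (HT U \<Phi>)"
proof -
  obtain \<phi>s where ps: "(\<forall>n. \<phi>s n \<in> TS) \<and> (\<lambda>n. L2n U (\<lambda>x. HT U (\<phi>s n) x - HT U \<Phi> x)) \<longlonglongrightarrow> 0 \<and>
     (\<lambda>n. L4n U (\<lambda>x. GradT U (\<phi>s n) x - GradT U \<Phi> x)) \<longlonglongrightarrow> 0"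
    using Xsp_approx[OF X] by (elim exE) (rule that)
  have T: "\<phi>s n \<in> TS" for n using ps by simp
  note hl = HT_L2[OF Xsp_sob[OF X]] and gl = GradT_L4[OF Xsp_sob[OF X]]
  note hn = HT_L2[OF TS_sob[OF T]] and gn = GradT_L4[OF TS_sob[OF T]]
  let ?f = "\<lambda>H G. AA Z H + BB \<Xi>1 \<Theta>1 G + BB \<Xi>2 \<Theta>2 G"
  let ?dH = "\<lambda>n x. HT U (\<phi>s n) x - HT U \<Phi> x" and ?dG = "\<lambda>n x. GradT U (\<phi>s n) x - GradT U \<Phi> x"
  let ?K = "Mh * (L2n U \<Xi>1 * L4n U \<Theta>1) + Mh * (L2n U \<Xi>2 * L4n U \<Theta>2)"
  have bn: "\<bar>?f (HT U (\<phi>s n)) (GradT U (\<phi>s n))\<bar> \<le> c * L2n U (HT U (\<phi>s n))" for n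
  proof -
    have "AA Z (HT U (\<phi>s n)) = AA Z (Hc (\<phi>s n))"
      by (rule A_cong_AE) (use HT_Hc[OF T] in \<open>simp_all add: L2fun_meas[OF Z] L2fun_meas[OF hn] Hc_meas[OF T]\<close>)
    moreover have "BB \<Xi> \<Theta> (GradT U (\<phi>s n)) = BB \<Xi> \<Theta> (Gc (\<phi>s n))" if "L2fun U \<Xi>" "L4fun U \<Theta>" for \<Xi> \<Theta>
      by (rule B_cong_AE) (use GradT_Gc[OF T] that in \<open>simp_all add: L2fun_meas L4fun_meas L4fun_meas[OF gn] Gc_meas[OF T]\<close>)
    ultimately show ?thesis using b[OF T, of n] 1 2 by (simp only: Hc_L2(2)[OF T])
  qed
  have fn: "\<bar>?f (HT U \<Phi>) (GradT U \<Phi>)\<bar> \<le> c * L2n U (HT U (\<phi>s n)) + (L2n U Z * L2n U (?dH n) + ?K * L4n U (?dG n))" for n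
  proof -
    have dH: "L2fun U (?dH n)" and dG: "L4fun U (?dG n)" by (intro L2fun_diff(1) hn hl) (intro L4fun_diff(1) gn gl)
    have "AA Z (?dH n) = AA Z (HT U (\<phi>s n)) - AA Z (HT U \<Phi>)" by (rule A_diff2[OF Z hn hl])
    moreover have "BB \<Xi>1 \<Theta>1 (?dG n) = BB \<Xi>1 \<Theta>1 (GradT U (\<phi>s n)) - BB \<Xi>1 \<Theta>1 (GradT U \<Phi>)"
      by (rule B_diff(3)[OF B_244(1)[OF 1 gn] B_244(1)[OF 1 gl]])
    moreover have "BB \<Xi>2 \<Theta>2 (?dG n) = BB \<Xi>2 \<Theta>2 (GradT U (\<phi>s n)) - BB \<Xi>2 \<Theta>2 (GradT U \<Phi>)"
      by (rule B_diff(3)[OF B_244(1)[OF 2 gn] B_244(1)[OF 2 gl]])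
    moreover have "\<bar>AA Z (?dH n)\<bar> \<le> L2n U Z * L2n U (?dH n)" by (rule A_bound[OF Z dH])
    moreover have "\<bar>BB \<Xi>1 \<Theta>1 (?dG n)\<bar> \<le> Mh * (L2n U \<Xi>1 * L4n U \<Theta>1) * L4n U (?dG n)" using B_244(2)[OF 1 dG] by (simp add: mult.assoc)
    moreover have "\<bar>BB \<Xi>2 \<Theta>2 (?dG n)\<bar> \<le> Mh * (L2n U \<Xi>2 * L4n U \<Theta>2) * L4n U (?dG n)" using B_244(2)[OF 2 dG] by (simp add: mult.assoc)
    ultimately show ?thesis using bn[of n] unfolding distrib_right by linarith
  qed
  have "(\<lambda>n. c * L2n U (HT U (\<phi>s n)) + (L2n U Z * L2n U (?dH n) + ?K * L4n U (?dG n))) \<longlonglongrightarrow> c * L2n U (HT U \<Phi>) + (L2n U Z * 0 + ?K * 0)"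
    using ps by (intro tendsto_add tendsto_mult_left L2n_tendsto[OF hl hn]) simp_all
  then have "(\<lambda>n. c * L2n U (HT U (\<phi>s n)) + (L2n U Z * L2n U (?dH n) + ?K * L4n U (?dG n))) \<longlonglongrightarrow> c * L2n U (HT U \<Phi>)" by simp
  then show ?thesis by (rule LIMSEQ_le_const) (use fn in simp)
qed

text \<open>The inf-sup condition as an implication: a bound c on test tuples extends by density to
  X, so c is an upper bound of the quotients and hence of their supremum.\<close>

lemma inf_sup_test:
  assumes reg: "regular_sol U h L \<Psi>"
  shows "\<exists>\<beta>>0. \<forall>\<xi>\<in>TS. \<forall>c\<ge>0. (\<forall>\<phi>\<in>TS. \<bar>AA (Hc \<xi>) (Hc \<phi>) + BB (HT U \<Psi>) (Gc \<xi>) (Gc \<phi>) + BB (Hc \<xi>) (GradT U \<Psi>) (Gc \<phi>)\<bar> \<le> c * L2n U (Hc \<phi>))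
     \<longrightarrow> \<beta> * L2n U (Hc \<xi>) \<le> c"
proof -
  obtain \<beta> where b: "\<beta> > 0" "\<forall>\<Theta>. Xsp U \<Theta> \<longrightarrow> \<beta> * L2n U (HT U \<Theta>) \<le>
          Sup {linA U h \<Psi> \<Theta> \<Phi> / L2n U (HT U \<Phi>) | \<Phi>. Xsp U \<Phi> \<and> L2n U (HT U \<Phi>) \<noteq> 0}"
    and X: "Xsp U \<Psi>"
    using reg unfolding regular_sol_def cont_sol_def by (elim exE conjE) (rule that)
  note hl = HT_L2[OF Xsp_sob[OF X]] and gl = GradT_L4[OF Xsp_sob[OF X]]
  have "\<beta> * L2n U (Hc \<xi>) \<le> c" if xi: "\<xi> \<in> TS" and c: "c \<ge> 0" and
    bd: "\<forall>\<phi>\<in>TS. \<bar>AA (Hc \<xi>) (Hc \<phi>) + BB (HT U \<Psi>) (Gc \<xi>) (Gc \<phi>) + BB (Hc \<xi>) (GradT U \<Psi>) (Gc \<phi>)\<bar> \<le> c * L2n U (Hc \<phi>)" for \<xi> c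
  proof (cases "L2n U (Hc \<xi>) = 0")
    case False
    let ?S = "{linA U h \<Psi> \<xi> \<Phi> / L2n U (HT U \<Phi>) | \<Phi>. Xsp U \<Phi> \<and> L2n U (HT U \<Phi>) \<noteq> 0}"
    have up: "s \<le> c" if s: "s \<in> ?S" for s
    proof -
      obtain \<Phi> where P: "s = linA U h \<Psi> \<xi> \<Phi> / L2n U (HT U \<Phi>)" "Xsp U \<Phi>" "L2n U (HT U \<Phi>) \<noteq> 0" using s by auto
      note hP = HT_L2[OF Xsp_sob[OF P(2)]] and gP = GradT_L4[OF Xsp_sob[OF P(2)]]
      note hx = HT_L2[OF TS_sob[OF xi]] and gx = GradT_L4[OF TS_sob[OF xi]]
      have "linA U h \<Psi> \<xi> \<Phi> = AA (Hc \<xi>) (HT U \<Phi>) + BB (HT U \<Psi>) (Gc \<xi>) (GradT U \<Phi>) + BB (Hc \<xi>) (GradT U \<Psi>) (GradT U \<Phi>)"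
      proof -
        have "AA (HT U \<xi>) (HT U \<Phi>) = AA (Hc \<xi>) (HT U \<Phi>)"
          by (rule A_cong_AE) (use HT_Hc[OF xi] in \<open>simp_all add: L2fun_meas[OF hP] L2fun_meas[OF hx] Hc_meas[OF xi]\<close>)
        moreover have "BB (HT U \<Psi>) (GradT U \<xi>) (GradT U \<Phi>) = BB (HT U \<Psi>) (Gc \<xi>) (GradT U \<Phi>)"
          by (rule B_cong_AE) (use GradT_Gc[OF xi] in \<open>simp_all add: L2fun_meas[OF hl] L4fun_meas[OF gP] L4fun_meas[OF gx] Gc_meas[OF xi]\<close>)
        moreover have "BB (HT U \<xi>) (GradT U \<Psi>) (GradT U \<Phi>) = BB (Hc \<xi>) (GradT U \<Psi>) (GradT U \<Phi>)"
          by (rule B_cong_AE) (use HT_Hc[OF xi] in \<open>simp_all add: L2fun_meas[OF hx] L4fun_meas[OF gP] L4fun_meas[OF gl] Hc_meas[OF xi]\<close>)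
        ultimately show ?thesis by (simp only: linA_def)
      qed
      moreover have "\<bar>AA (Hc \<xi>) (HT U \<Phi>) + BB (HT U \<Psi>) (Gc \<xi>) (GradT U \<Phi>) + BB (Hc \<xi>) (GradT U \<Psi>) (GradT U \<Phi>)\<bar> \<le> c * L2n U (HT U \<Phi>)"
        by (rule density_bound[OF P(2) Hc_L2(1)[OF xi] hl Gc_L4(1)[OF xi] Hc_L2(1)[OF xi] gl]) (use bd in blast)
      ultimately have "linA U h \<Psi> \<xi> \<Phi> \<le> c * L2n U (HT U \<Phi>)" by linarith
      moreover have "L2n U (HT U \<Phi>) > 0" using P(3) L2n_nonneg[of U "HT U \<Phi>"] by linarith
      ultimately show ?thesis unfolding P(1) by (simp add: divide_le_eq)
    qed
    \<comment> \<open>\<xi> itself supplies a quotient, since a supremum over the empty set would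
      say nothing.\<close>
    have "linA U h \<Psi> \<xi> \<xi> / L2n U (HT U \<xi>) \<in> ?S"
      by (intro CollectI exI[of _ \<xi>] conjI refl TS_Xsp[OF xi]) (simp only: Hc_L2(2)[OF xi], rule False)
    then have "?S \<noteq> {}" by blast
    then have "Sup ?S \<le> c" by (rule cSup_least) (rule up)
    moreover have "\<beta> * L2n U (HT U \<xi>) \<le> Sup ?S" by (rule b(2)[rule_format, OF TS_Xsp[OF xi]])
    ultimately show ?thesis by (simp only: Hc_L2(2)[OF xi])
  qed (use c in simp)
  then show ?thesis using b(1) by (intro exI[of _ \<beta>]) simp
qed

end

section \<open>Hessian discretisations\<close>

lemma lin_mapD:
  assumes "lin_map V F" "v \<in> V" "w \<in> V"
  shows "F (a *\<^sub>R v + b *\<^sub>R w) = (\<lambda>x. a *\<^sub>R F v x + b *\<^sub>R F w x)"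
proof -
  have "a *\<^sub>R v + b *\<^sub>R w = (\<lambda>i. a * v i + b * w i)" by (simp add: plus_fun_def scaleR_fun_def)
  then show ?thesis using assms unfolding lin_map_def by simp
qed

lemma Vsp_subspace: "subspace (Vsp N)"
  by (rule subspaceI) (simp_all add: Vsp_def zero_fun_def plus_fun_def scaleR_fun_def)

lemma lin_map_zero:
  assumes "lin_map (Vsp N) F" shows "F 0 = (\<lambda>x. 0)"
  using lin_mapD[OF assms subspace_0[OF Vsp_subspace] subspace_0[OF Vsp_subspace], of 0 0] by simp

lemma fin_space_Vsp: "fin_space (Vsp N) {..<N} (\<lambda>b i. if i = b then 1 else 0) (\<lambda>b v. v b)"
proof
  show "subspace (Vsp N)" by (rule Vsp_subspace)
  show "v = (\<Sum>b<N. v b *\<^sub>R (\<lambda>i. if i = b then 1 else 0))" if "v \<in> Vsp N" for v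
  proof
    fix i
    have "(\<Sum>b<N. v b *\<^sub>R (\<lambda>i. if i = b then 1 else 0)) i = (\<Sum>b<N. if i = b then v b else 0)"
      unfolding sum_fun_apply by (intro sum.cong refl) (simp add: scaleR_fun_def)
    also have "\<dots> = v i" using that by (simp add: Vsp_def)
    finally show "v i = (\<Sum>b<N. v b *\<^sub>R (\<lambda>i. if i = b then 1 else 0)) i" by simp
  qed
qed (auto simp: Vsp_def lin_on_def plus_fun_def scaleR_fun_def)

text \<open>Tychonoff's theorem; coefficient sequences carry the product topology.\<close>

lemma box_compact: "compact {w :: nat \<Rightarrow> real. \<forall>i. w i \<in> S i}" if "\<And>i. compact (S i)" for S
proof -
  have "compactin (product_topology (\<lambda>i. euclidean) UNIV) (PiE UNIV S)"
    by (subst compactin_PiE) (simp add: that)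
  then show ?thesis by (simp add: euclidean_product_topology PiE_UNIV_domain Pi_def)
qed

locale hess_scheme = convex_domain U for U :: "(real^'n) set" +
  fixes N :: nat and PiD :: "(nat \<Rightarrow> real) \<Rightarrow> real^'n \<Rightarrow> real"
    and Gr :: "(nat \<Rightarrow> real) \<Rightarrow> real^'n \<Rightarrow> real^'n" and Hs :: "(nat \<Rightarrow> real) \<Rightarrow> real^'n \<Rightarrow> real^'n^'n"
    and E :: "(nat \<Rightarrow> real) \<Rightarrow> real^'n \<Rightarrow> real" and \<rho> \<Gamma> :: real
  assumes hd: "hess_disc U N PiD Gr Hs" and cp: "companion U N E"
    and CDb: "CD U N PiD Gr Hs \<le> \<Gamma>" and GEb: "GammaE U N Hs E \<le> \<Gamma>" and oEb: "omegaE U N Gr Hs E \<le> \<rho>"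
    and aDb: "alphaD U N PiD Gr Hs \<le> \<rho>" and gDb: "gammaD U N Gr Hs \<le> \<rho>" and rho: "\<rho> > 0" and Gam: "\<Gamma> \<ge> 0"
begin

abbreviation V where "V \<equiv> Vsp N"

lemma disc:
  "lin_map V PiD" "lin_map V Gr" "lin_map V Hs" "w \<in> V \<Longrightarrow> L2fun U (PiD w)" "w \<in> V \<Longrightarrow> L4fun U (Gr w)"
  "w \<in> V \<Longrightarrow> L2fun U (Hs w)" "w \<in> V \<Longrightarrow> L2n U (Hs w) = 0 \<Longrightarrow> w = 0"
  using hd unfolding hess_disc_def by (simp_all add: zero_fun_def)

lemma comp: "lin_map V E" "w \<in> V \<Longrightarrow> sob0 U 2 (E w)"
  using cp unfolding companion_def by simp_all

definition nH :: "(nat \<Rightarrow> real) \<Rightarrow> real" where "nH w = L2n U (Hs w)"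

lemma nH_nonneg [simp]: "0 \<le> nH w" by (simp add: nH_def)

lemma nH_pos:
  assumes "w \<in> V" "w \<noteq> (\<lambda>_. 0)" shows "nH w > 0"
proof -
  have "L2n U (Hs w) \<noteq> 0" using disc(7)[OF assms(1)] assms(2) by (simp only: zero_fun_def) blast
  then show ?thesis using L2n_nonneg[of U "Hs w"] unfolding nH_def by linarith
qed

interpretation fs: fin_space V "{..<N}" "\<lambda>b i. if i = b then 1 else 0" "\<lambda>b v. v b"
  by (rule fin_space_Vsp)

text \<open>The Hessian inner product is definite on the finite-dimensional space, so it represents
  the coordinate functional, and Cauchy-Schwarz bounds it. This stands in for the equivalence of
  norms.\<close>

lemma coord_bound_each:
  assumes "j < N" shows "\<exists>C\<ge>0. \<forall>v\<in>V. \<bar>v j\<bar> \<le> C * nH v"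
proof -
  have "\<exists>w\<in>V. \<forall>v\<in>V. (LINT x|M. inner (Hs w x) (Hs v x)) = v j"
  proof (rule fs.solve)
    show "lin_on V (\<lambda>w. LINT x|M. inner (Hs w x) (Hs v x))" if "v \<in> V" for v
      unfolding lin_on_def
      using L2_inner_integrable[OF disc(6) disc(6)[OF that]] by (simp add: lin_mapD[OF disc(3)] inner_add_left)
    show "lin_on V (\<lambda>v. LINT x|M. inner (Hs w x) (Hs v x))" if "w \<in> V" for w
      unfolding lin_on_def
      using L2_inner_integrable[OF disc(6)[OF that] disc(6)] by (simp add: lin_mapD[OF disc(3)] inner_add_right)
    show "w = 0" if "w \<in> V" "\<And>v. v \<in> V \<Longrightarrow> (LINT x|M. inner (Hs w x) (Hs v x)) = 0" for w
    proof (rule disc(7)[OF that(1)])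
      have "(L2n U (Hs w))^2 = 0" using that(2)[OF that(1)] by (simp add: L2n_sq power2_norm_eq_inner)
      then show "L2n U (Hs w) = 0" by simp
    qed
    show "lin_on V (\<lambda>v. v j)" using fs.xlin assms by simp
  qed
  then obtain w where w: "w \<in> V" "\<forall>v\<in>V. (LINT x|M. inner (Hs w x) (Hs v x)) = v j" by (elim bexE) (rule that)
  have "\<bar>v j\<bar> \<le> nH w * nH v" if "v \<in> V" for v
    using L2_inner_bound[OF disc(6)[OF w(1)] disc(6)[OF that]] w(2) that by (simp add: nH_def)
  then show ?thesis by (intro exI[of _ "nH w"]) simp
qed

lemma coord_bound_all: "\<exists>C\<ge>0. \<forall>j<N. \<forall>v\<in>V. \<bar>v j\<bar> \<le> C * nH v"
proof -
  have "\<forall>j. \<exists>C. j < N \<longrightarrow> 0 \<le> C \<and> (\<forall>v\<in>V. \<bar>v j\<bar> \<le> C * nH v)" using coord_bound_each by meson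
  from choice[OF this] obtain c where c: "\<forall>j. j < N \<longrightarrow> 0 \<le> c j \<and> (\<forall>v\<in>V. \<bar>v j\<bar> \<le> c j * nH v)" by (elim exE) (rule that)
  have "\<bar>v j\<bar> \<le> (\<Sum>j<N. c j) * nH v" if "j < N" "v \<in> V" for j v
  proof -
    have "c j \<le> (\<Sum>j<N. c j)" by (rule member_le_sum) (use c that in auto)
    then have "c j * nH v \<le> (\<Sum>j<N. c j) * nH v" by (intro mult_right_mono) auto
    then show ?thesis using c that by fastforce
  qed
  then show ?thesis using c by (intro exI[of _ "\<Sum>j<N. c j"]) (auto intro: sum_nonneg)
qed

text \<open>The property shared by the numerators of the ratios behind the constants of a
  discretisation; in finite dimension it is enough for a bound by \<open>nH\<close>.\<close>

definition sublin :: "((nat \<Rightarrow> real) \<Rightarrow> real) \<Rightarrow> bool" where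
  "sublin s \<longleftrightarrow> (\<forall>v\<in>V. \<forall>w\<in>V. \<forall>a b. s (a *\<^sub>R v + b *\<^sub>R w) \<le> \<bar>a\<bar> * s v + \<bar>b\<bar> * s w)"

lemma sublinD: "sublin s \<Longrightarrow> v \<in> V \<Longrightarrow> w \<in> V \<Longrightarrow> s (a *\<^sub>R v + b *\<^sub>R w) \<le> \<bar>a\<bar> * s v + \<bar>b\<bar> * s w"
  by (simp add: sublin_def)

lemma sublin_zero: "sublin s \<Longrightarrow> s 0 \<le> 0"
  using sublinD[of s 0 0 0 0] subspace_0[OF Vsp_subspace] by simp

lemma sublin_sum:
  assumes s: "sublin s" and "\<And>b. b \<in> I \<Longrightarrow> e b \<in> V"
  shows "s (\<Sum>b\<in>I. c b *\<^sub>R e b) \<le> (\<Sum>b\<in>I. \<bar>c b\<bar> * s (e b))"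
  using assms(2)
proof (induction I rule: infinite_finite_induct)
  case (insert b I)
  have "(\<Sum>b\<in>I. c b *\<^sub>R e b) \<in> V" by (intro subspace_sum subspace_scale Vsp_subspace) (use insert.prems in auto)
  then have "s (c b *\<^sub>R e b + 1 *\<^sub>R (\<Sum>b\<in>I. c b *\<^sub>R e b)) \<le> \<bar>c b\<bar> * s (e b) + \<bar>1\<bar> * s (\<Sum>b\<in>I. c b *\<^sub>R e b)"
    by (intro sublinD[OF s]) (use insert.prems in simp)
  moreover have "s (\<Sum>b\<in>I. c b *\<^sub>R e b) \<le> (\<Sum>b\<in>I. \<bar>c b\<bar> * s (e b))" using insert by blast
  ultimately show ?case by (simp only: sum.insert[OF insert(1,2)] scaleR_one abs_one mult_1_left)
qed (use sublin_zero[OF s] in simp_all)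

lemma sublin_bounded:
  assumes s: "sublin s" shows "\<exists>K\<ge>0. \<forall>v\<in>V. s v \<le> K * nH v"
proof -
  obtain C where C: "C \<ge> 0" "\<forall>j<N. \<forall>v\<in>V. \<bar>v j\<bar> \<le> C * nH v" using coord_bound_all by (elim exE conjE) (rule that)
  define e :: "nat \<Rightarrow> nat \<Rightarrow> real" where "e b = (\<lambda>i. if i = b then 1 else 0)" for b
  let ?K = "\<Sum>b<N. C * \<bar>s (e b)\<bar>"
  have "s v \<le> ?K * nH v" if v: "v \<in> V" for v
  proof -
    have "s v = s (\<Sum>b<N. v b *\<^sub>R e b)" using fs.expand[OF v] by (simp add: e_def)
    also have "\<dots> \<le> (\<Sum>b<N. \<bar>v b\<bar> * s (e b))" by (rule sublin_sum[OF s]) (use fs.eV in \<open>simp add: e_def\<close>)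
    also have "\<dots> \<le> (\<Sum>b<N. (C * nH v) * \<bar>s (e b)\<bar>)"
    proof (rule sum_mono)
      fix b assume b: "b \<in> {..<N}"
      have "\<bar>v b\<bar> * s (e b) \<le> \<bar>v b\<bar> * \<bar>s (e b)\<bar>" by (intro mult_left_mono) auto
      also have "\<dots> \<le> (C * nH v) * \<bar>s (e b)\<bar>" by (intro mult_right_mono) (use C(2) b v in auto)
      finally show "\<bar>v b\<bar> * s (e b) \<le> (C * nH v) * \<bar>s (e b)\<bar>" .
    qed
    also have "\<dots> = ?K * nH v" by (simp add: sum_distrib_left sum_distrib_right ac_simps)
    finally show ?thesis .
  qed
  then show ?thesis using C(1) by (intro exI[of _ ?K]) (auto intro: sum_nonneg)
qed

text \<open>The supremum bounds its members only because \<open>sublin_bounded\<close> makes the set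
  bounded above. At w = 0, which the set leaves out, sublinearity gives a non-positive left-hand
  side.\<close>

lemma sup_ratio:
  assumes s: "sublin s" and c: "Sup (insert 0 {s w / nH w | w. w \<in> V \<and> w \<noteq> (\<lambda>_. 0)}) \<le> c" and w: "w \<in> V"
  shows "s w \<le> c * nH w"
proof (cases "w = (\<lambda>_. 0)")
  case True
  then have "w = 0" by (simp add: zero_fun_def)
  moreover have "nH 0 = 0" using lin_map_zero[OF disc(3)] by (simp add: nH_def)
  ultimately show ?thesis using sublin_zero[OF s] by simp
next
  case False
  obtain K where K: "K \<ge> 0" "\<forall>v\<in>V. s v \<le> K * nH v" using sublin_bounded[OF s] by (elim exE conjE) (rule that)
  have "bdd_above (insert 0 {s w / nH w | w. w \<in> V \<and> w \<noteq> (\<lambda>_. 0)})"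
  proof (rule bdd_aboveI[of _ K])
    fix y assume "y \<in> insert 0 {s w / nH w | w. w \<in> V \<and> w \<noteq> (\<lambda>_. 0)}"
    then consider "y = 0" | w where "y = s w / nH w" "w \<in> V" "w \<noteq> (\<lambda>_. 0)" by blast
    then show "y \<le> K"
    proof cases
      case 2
      then show ?thesis using K(2) nH_pos[OF 2(2,3)] by (simp add: divide_le_eq)
    qed (use K(1) in simp)
  qed
  then have "s w / nH w \<le> Sup (insert 0 {s w / nH w | w. w \<in> V \<and> w \<noteq> (\<lambda>_. 0)})"
    by (intro cSup_upper) (use w False in auto)
  then have "s w / nH w \<le> c" using c by linarith
  then show ?thesis using nH_pos[OF w False] by (simp add: divide_le_eq)
qed

lemma L2_lincomb_bound:
  fixes f g :: "real^'n \<Rightarrow> 'b::euclidean_space"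
  assumes "L2fun U f" "L2fun U g"
  shows "L2n U (\<lambda>x. a *\<^sub>R f x + b *\<^sub>R g x) \<le> \<bar>a\<bar> * L2n U f + \<bar>b\<bar> * L2n U g"
  using L2fun_add(2)[OF L2fun_scale(1)[OF assms(1), of a] L2fun_scale(1)[OF assms(2), of b]]
  by (simp add: L2fun_scale(2)[OF assms(1)] L2fun_scale(2)[OF assms(2)])

lemma L4_lincomb_bound:
  fixes f g :: "real^'n \<Rightarrow> 'b::euclidean_space"
  assumes "L4fun U f" "L4fun U g"
  shows "L4n U (\<lambda>x. a *\<^sub>R f x + b *\<^sub>R g x) \<le> \<bar>a\<bar> * L4n U f + \<bar>b\<bar> * L4n U g"
  using L4fun_add(2)[OF L4fun_scale(1)[OF assms(1), of a] L4fun_scale(1)[OF assms(2), of b]]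
  by (simp add: L4fun_scale(2)[OF assms(1)] L4fun_scale(2)[OF assms(2)])

lemma nH_sublin: "sublin nH"
  unfolding sublin_def nH_def using L2_lincomb_bound[OF disc(6) disc(6)] by (simp add: lin_mapD[OF disc(3)])

lemma Pi_sublin: "sublin (\<lambda>w. L2n U (PiD w))"
  unfolding sublin_def using L2_lincomb_bound[OF disc(4) disc(4)] by (simp add: lin_mapD[OF disc(1)])

lemma Gr_sublin: "sublin (\<lambda>w. L4n U (Gr w))"
  unfolding sublin_def using L4_lincomb_bound[OF disc(5) disc(5)] by (simp add: lin_mapD[OF disc(2)])

lemma CD_bound:
  assumes w: "w \<in> V" shows "L2n U (PiD w) \<le> \<Gamma> * nH w" "L4n U (Gr w) \<le> \<Gamma> * nH w"
proof -
  have "sublin (\<lambda>w. max (L2n U (PiD w)) (L4n U (Gr w)))"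
    unfolding sublin_def
  proof (intro ballI allI)
    fix v w a b assume vw: "v \<in> V" "w \<in> V"
    have "\<bar>a\<bar> * L2n U (PiD v) + \<bar>b\<bar> * L2n U (PiD w) \<le> \<bar>a\<bar> * max (L2n U (PiD v)) (L4n U (Gr v)) + \<bar>b\<bar> * max (L2n U (PiD w)) (L4n U (Gr w))"
      "\<bar>a\<bar> * L4n U (Gr v) + \<bar>b\<bar> * L4n U (Gr w) \<le> \<bar>a\<bar> * max (L2n U (PiD v)) (L4n U (Gr v)) + \<bar>b\<bar> * max (L2n U (PiD w)) (L4n U (Gr w))"
      by (intro add_mono mult_left_mono; simp)+
    then show "max (L2n U (PiD (a *\<^sub>R v + b *\<^sub>R w))) (L4n U (Gr (a *\<^sub>R v + b *\<^sub>R w))) \<le> \<bar>a\<bar> * max (L2n U (PiD v)) (L4n U (Gr v)) + \<bar>b\<bar> * max (L2n U (PiD w)) (L4n U (Gr w))"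
      using sublinD[OF Pi_sublin vw, of a b] sublinD[OF Gr_sublin vw, of a b] by linarith
  qed
  from sup_ratio[OF this _ w, of \<Gamma>] have "max (L2n U (PiD w)) (L4n U (Gr w)) \<le> \<Gamma> * nH w"
    using CDb by (simp add: CD_def nH_def)
  then show "L2n U (PiD w) \<le> \<Gamma> * nH w" "L4n U (Gr w) \<le> \<Gamma> * nH w" by simp_all
qed

lemma E_lin: "v \<in> V \<Longrightarrow> w \<in> V \<Longrightarrow> E (a *\<^sub>R v + b *\<^sub>R w) = (\<lambda>x. a * E v x + b * E w x)"
  by (simp add: lin_mapD[OF comp(1)])

lemma E_sob: "w \<in> V \<Longrightarrow> sob U 2 (E w)" by (rule sob0_sob[OF comp(2)])

lemma V_comb: "v \<in> V \<Longrightarrow> w \<in> V \<Longrightarrow> a *\<^sub>R v + b *\<^sub>R w \<in> V"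
  by (intro subspace_add subspace_scale Vsp_subspace)

lemma whess_E_lin:
  assumes "v \<in> V" "w \<in> V"
  shows "AE x in M. whess U (E (a *\<^sub>R v + b *\<^sub>R w)) x = a *\<^sub>R whess U (E v) x + b *\<^sub>R whess U (E w) x"
proof -
  have "AE x in M. \<forall>i. \<forall>j. wD U [i, j] (\<lambda>x. a * E v x + b * E w x) x = a * wD U [i, j] (E v) x + b * wD U [i, j] (E w) x"
    by (intro eventually_all_finite wD_lin(2)[OF E_sob E_sob] assms) simp
  then show ?thesis unfolding E_lin[OF assms] by eventually_elim (simp add: whess_def vec_eq_iff)
qed

lemma wgrad_E_lin:
  assumes "v \<in> V" "w \<in> V"
  shows "AE x in M. wgrad U (E (a *\<^sub>R v + b *\<^sub>R w)) x = a *\<^sub>R wgrad U (E v) x + b *\<^sub>R wgrad U (E w) x"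
proof -
  have "AE x in M. \<forall>i. wD U [i] (\<lambda>x. a * E v x + b * E w x) x = a * wD U [i] (E v) x + b * wD U [i] (E w) x"
    by (intro eventually_all_finite wD_lin(2)[OF E_sob E_sob] assms) simp
  then show ?thesis unfolding E_lin[OF assms] by eventually_elim (simp add: wgrad_def vec_eq_iff)
qed

lemma wgrad_L2: "sob U 2 u \<Longrightarrow> L2fun U (wgrad U u)"
proof -
  assume u: "sob U 2 u"
  have e: "(\<lambda>x. wgrad U u x $ j) = wD U [j] u" for j by (simp add: wgrad_def)
  have "L2fun U (wD U [j] u)" for j by (rule sobD(1)[OF u]) simp
  then show ?thesis by (intro L2fun_vec(1)) (simp only: e)
qed

lemma GE_bound:
  assumes w: "w \<in> V" shows "L2n U (whess U (E w)) \<le> \<Gamma> * nH w"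
proof (rule sup_ratio[OF _ _ w])
  show "Sup (insert 0 {L2n U (whess U (E w)) / nH w |w. w \<in> V \<and> w \<noteq> (\<lambda>_. 0)}) \<le> \<Gamma>"
    using GEb by (simp add: GammaE_def nH_def)
  show "sublin (\<lambda>w. L2n U (whess U (E w)))"
    unfolding sublin_def
  proof (intro ballI allI)
    fix v w a b assume vw: "v \<in> V" "w \<in> V"
    have "L2n U (whess U (E (a *\<^sub>R v + b *\<^sub>R w))) = L2n U (\<lambda>x. a *\<^sub>R whess U (E v) x + b *\<^sub>R whess U (E w) x)"
      by (rule L2n_cong_AE(2)[OF whess_L2(1)[OF E_sob[OF V_comb[OF vw]]] _ whess_E_lin[OF vw]])
        (intro L2fun_meas L2fun_add(1) L2fun_scale(1) whess_L2(1) E_sob vw)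
    then show "L2n U (whess U (E (a *\<^sub>R v + b *\<^sub>R w))) \<le> \<bar>a\<bar> * L2n U (whess U (E v)) + \<bar>b\<bar> * L2n U (whess U (E w))"
      using L2_lincomb_bound[OF whess_L2(1)[OF E_sob[OF vw(1)]] whess_L2(1)[OF E_sob[OF vw(2)]], of a b] by simp
  qed
qed

lemma Gr_L2: "w \<in> V \<Longrightarrow> L2fun U (Gr w)"
  by (rule L4fun_imp_L2fun(1)[OF fin_M disc(5)])

lemma omega_bound:
  assumes w: "w \<in> V" shows "L2n U (\<lambda>x. Gr w x - wgrad U (E w) x) \<le> \<rho> * nH w"
proof (rule sup_ratio[OF _ _ w])
  show "Sup (insert 0 {L2n U (\<lambda>x. Gr w x - wgrad U (E w) x) / nH w |w. w \<in> V \<and> w \<noteq> (\<lambda>_. 0)}) \<le> \<rho>"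
    using oEb by (simp add: omegaE_def nH_def)
  show "sublin (\<lambda>w. L2n U (\<lambda>x. Gr w x - wgrad U (E w) x))"
    unfolding sublin_def
  proof (intro ballI allI)
    fix v w a b assume vw: "v \<in> V" "w \<in> V"
    let ?d = "\<lambda>w x. Gr w x - wgrad U (E w) x"
    have d: "L2fun U (?d w)" if "w \<in> V" for w by (intro L2fun_diff(1) Gr_L2 wgrad_L2 E_sob that)
    have "L2n U (?d (a *\<^sub>R v + b *\<^sub>R w)) = L2n U (\<lambda>x. a *\<^sub>R ?d v x + b *\<^sub>R ?d w x)"
    proof (rule L2n_cong_AE(2)[OF d[OF V_comb[OF vw]]])
      show "(\<lambda>x. a *\<^sub>R ?d v x + b *\<^sub>R ?d w x) \<in> borel_measurable M"
        by (intro L2fun_meas L2fun_add(1) L2fun_scale(1) d vw)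
      show "AE x in M. ?d (a *\<^sub>R v + b *\<^sub>R w) x = a *\<^sub>R ?d v x + b *\<^sub>R ?d w x"
        using wgrad_E_lin[OF vw, of a b] unfolding lin_mapD[OF disc(2) vw]
        by eventually_elim (simp add: scaleR_diff_right)
    qed
    then show "L2n U (?d (a *\<^sub>R v + b *\<^sub>R w)) \<le> \<bar>a\<bar> * L2n U (?d v) + \<bar>b\<bar> * L2n U (?d w)"
      using L2_lincomb_bound[OF d[OF vw(1)] d[OF vw(2)], of a b] by simp
  qed
qed

text \<open>The factor d^2 is crude: every entry, and every weak derivative in the divergence, is
  bounded by the whole norm.\<close>

lemma entry_L2: "sobM1 U \<xi> \<Longrightarrow> L2fun U \<xi> \<and> L2n U \<xi> \<le> (real CARD('n) * real CARD('n)) * sobM1_norm U \<xi>"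
  and wdiv_L2: "sobM1 U \<xi> \<Longrightarrow> L2fun U (wdiv U \<xi>) \<and> L2n U (wdiv U \<xi>) \<le> (real CARD('n) * real CARD('n)) * sobM1_norm U \<xi>"
proof -
  assume x: "sobM1 U \<xi>"
  have s: "sob U 1 (\<lambda>x. \<xi> x $ i $ j)" for i j using x by (simp add: sobM1_def)
  have le: "sob_norm U 1 (\<lambda>x. \<xi> x $ i $ j) \<le> sobM1_norm U \<xi>" for i j
    unfolding sobM1_norm_def
  proof (rule real_le_rsqrt)
    have "(sob_norm U 1 (\<lambda>x. \<xi> x $ i $ j))^2 \<le> (\<Sum>j\<in>UNIV. (sob_norm U 1 (\<lambda>x. \<xi> x $ i $ j))^2)"
      by (rule member_le_sum[of j UNIV "\<lambda>j. (sob_norm U 1 (\<lambda>x. \<xi> x $ i $ j))^2"]) auto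
    also have "\<dots> \<le> (\<Sum>i\<in>UNIV. \<Sum>j\<in>UNIV. (sob_norm U 1 (\<lambda>x. \<xi> x $ i $ j))^2)"
      by (rule member_le_sum[of i UNIV "\<lambda>i. \<Sum>j\<in>UNIV. (sob_norm U 1 (\<lambda>x. \<xi> x $ i $ j))^2"]) (auto intro: sum_nonneg)
    finally show "(sob_norm U 1 (\<lambda>x. \<xi> x $ i $ j))^2 \<le> (\<Sum>i\<in>UNIV. \<Sum>j\<in>UNIV. (sob_norm U 1 (\<lambda>x. \<xi> x $ i $ j))^2)" .
  qed
  have l0: "L2n U (\<lambda>x. \<xi> x $ i $ j) \<le> sobM1_norm U \<xi>" for i j
  proof -
    have "L2n U (\<lambda>x. \<xi> x $ i $ j) = L2n U (wD U [] (\<lambda>x. \<xi> x $ i $ j))"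
      by (rule L2n_cong_AE(2)[symmetric, OF sobD(1)[OF s] L2fun_meas[OF sob_L2[OF s]] wD_Nil[OF sob_L2[OF s]]]) simp
    also have "\<dots> \<le> sob_norm U 1 (\<lambda>x. \<xi> x $ i $ j)" by (rule wD_le_sob_norm) simp
    finally show ?thesis using le[of i j] by linarith
  qed
  note r1 = L2fun_vec[OF sob_L2[OF s]]
  note r2 = L2fun_vec[OF r1(1)]
  have "L2n U \<xi> \<le> (\<Sum>i\<in>(UNIV::'n set). \<Sum>j\<in>(UNIV::'n set). sobM1_norm U \<xi>)"
    by (rule order_trans[OF r2(2)], rule sum_mono, rule order_trans[OF r1(2)], rule sum_mono, rule l0)
  then show "L2fun U \<xi> \<and> L2n U \<xi> \<le> (real CARD('n) * real CARD('n)) * sobM1_norm U \<xi>" using r2(1) by (simp add: mult.assoc)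
  have g: "L2fun U (wD U [i] (\<lambda>y. \<xi> y $ i $ j))" for i j by (rule sobD(1)[OF s]) simp
  have gl: "L2n U (wD U [i] (\<lambda>y. \<xi> y $ i $ j)) \<le> sobM1_norm U \<xi>" for i j
    by (rule order_trans[OF wD_le_sob_norm le]) simp
  have e: "(\<lambda>x. wdiv U \<xi> x $ j) = (\<lambda>x. \<Sum>i\<in>UNIV. wD U [i] (\<lambda>y. \<xi> y $ i $ j) x)" for j by (simp add: wdiv_def)
  have q: "L2fun U (\<lambda>x. wdiv U \<xi> x $ j) \<and> L2n U (\<lambda>x. wdiv U \<xi> x $ j) \<le> (\<Sum>i\<in>UNIV. L2n U (wD U [i] (\<lambda>y. \<xi> y $ i $ j)))" for j
    unfolding e by (rule L2fun_sum) (rule g)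
  note v = L2fun_vec[OF conjunct1[OF q]]
  have "L2n U (wdiv U \<xi>) \<le> (\<Sum>j\<in>(UNIV::'n set). \<Sum>i\<in>(UNIV::'n set). sobM1_norm U \<xi>)"
    by (rule order_trans[OF v(2)], rule sum_mono, rule order_trans[OF conjunct2[OF q]], rule sum_mono, rule gl)
  then show "L2fun U (wdiv U \<xi>) \<and> L2n U (wdiv U \<xi>) \<le> (real CARD('n) * real CARD('n)) * sobM1_norm U \<xi>" using v(1) by (simp add: mult.assoc)
qed

text \<open>The signed defect of discrete integration by parts, whose normalised supremum is
  \<open>WD\<close>; before taking absolute values it is linear in w.\<close>

definition WI :: "(real^'n \<Rightarrow> real^'n^'n) \<Rightarrow> (nat \<Rightarrow> real) \<Rightarrow> real" where
  "WI \<xi> w = (LINT x|M. inner (\<xi> x) (Hs w x) + inner (wdiv U \<xi> x) (Gr w x))"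

lemma WI_eq:
  assumes "sobM1 U \<xi>" "w \<in> V"
  shows "WI \<xi> w = (LINT x|M. inner (\<xi> x) (Hs w x)) + (LINT x|M. inner (wdiv U \<xi> x) (Gr w x))"
  unfolding WI_def using entry_L2[OF assms(1)] wdiv_L2[OF assms(1)]
  by (intro Bochner_Integration.integral_add L2_inner_integrable disc(6) Gr_L2 assms) simp_all

lemma WI_lin:
  assumes x: "sobM1 U \<xi>" and vw: "v \<in> V" "w \<in> V"
  shows "WI \<xi> (a *\<^sub>R v + b *\<^sub>R w) = a * WI \<xi> v + b * WI \<xi> w"
proof -
  note i = L2_inner_integrable[OF conjunct1[OF entry_L2[OF x]] disc(6)] L2_inner_integrable[OF conjunct1[OF wdiv_L2[OF x]] Gr_L2]
  show ?thesis
    unfolding WI_eq[OF x V_comb[OF vw]] WI_eq[OF x vw(1)] WI_eq[OF x vw(2)] lin_mapD[OF disc(3) vw] lin_mapD[OF disc(2) vw]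
    using i[OF vw(1)] i[OF vw(2)] by (simp add: inner_add_right algebra_simps)
qed

lemma WI_sublin: "sobM1 U \<xi> \<Longrightarrow> sublin (\<lambda>w. \<bar>WI \<xi> w\<bar>)"
  unfolding sublin_def by (auto simp: WI_lin abs_mult[symmetric] intro: abs_triangle_ineq)

lemma WD_eq: "WD U N Gr Hs \<xi> = Sup (insert 0 {\<bar>WI \<xi> w\<bar> / nH w | w. w \<in> V \<and> w \<noteq> (\<lambda>_. 0)})"
  by (simp add: WD_def WI_def nH_def)

text \<open>\<open>gammaD\<close> is a supremum of suprema, and both sets have to be bounded above.
  The rough estimate \<open>WK\<close>, which rests on \<Gamma>, achieves this for the outer one;
  only then does the bound by \<rho> reach a single field.\<close>

lemma gamma_bound:
  assumes x: "sobM1 U \<xi>" and w: "w \<in> V"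
  shows "\<bar>WI \<xi> w\<bar> \<le> \<rho> * sobM1_norm U \<xi> * nH w"
proof -
  let ?D = "real CARD('n) * real CARD('n)" and ?m = "sqrt (sqrt (measure M U))"
  let ?K = "?D * (1 + ?m * \<Gamma>)"
  have K0: "0 \<le> ?K" using Gam by simp
  have WK: "WD U N Gr Hs \<xi> \<le> ?K * sobM1_norm U \<xi>" if x: "sobM1 U \<xi>" for \<xi>
    unfolding WD_eq
  proof (rule cSup_least)
    have n0: "0 \<le> sobM1_norm U \<xi>" unfolding sobM1_norm_def by (intro real_sqrt_ge_zero sum_nonneg) simp
    fix y assume "y \<in> insert 0 {\<bar>WI \<xi> w\<bar> / nH w | w. w \<in> V \<and> w \<noteq> (\<lambda>_. 0)}"
    then consider "y = 0" | w where "y = \<bar>WI \<xi> w\<bar> / nH w" "w \<in> V" "w \<noteq> (\<lambda>_. 0)" by blast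
    then show "y \<le> ?K * sobM1_norm U \<xi>"
    proof cases
      case 1 then show ?thesis using K0 n0 by (simp only: mult_nonneg_nonneg)
    next
      case 2
      have "\<bar>WI \<xi> w\<bar> \<le> L2n U \<xi> * nH w + L2n U (wdiv U \<xi>) * L2n U (Gr w)"
        unfolding WI_eq[OF x 2(2)] nH_def
        using L2_inner_bound[OF conjunct1[OF entry_L2[OF x]] disc(6)[OF 2(2)]] L2_inner_bound[OF conjunct1[OF wdiv_L2[OF x]] Gr_L2[OF 2(2)]] by linarith
      also have "\<dots> \<le> (?D * sobM1_norm U \<xi>) * nH w + (?D * sobM1_norm U \<xi>) * (?m * (\<Gamma> * nH w))"
      proof (intro add_mono mult_mono)
        have "L2n U (Gr w) \<le> ?m * L4n U (Gr w)" by (rule L4fun_imp_L2fun(2)[OF fin_M disc(5)[OF 2(2)]])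
        also have "\<dots> \<le> ?m * (\<Gamma> * nH w)" by (intro mult_left_mono CD_bound 2(2)) simp
        finally show "L2n U (Gr w) \<le> ?m * (\<Gamma> * nH w)" .
      qed (use entry_L2[OF x] wdiv_L2[OF x] n0 in auto)
      also have "\<dots> = ?K * sobM1_norm U \<xi> * nH w" by (simp add: algebra_simps)
      finally show ?thesis unfolding 2(1) using nH_pos[OF 2(2,3)] by (simp only: divide_le_eq if_True)
    qed
  qed simp
  have "WD U N Gr Hs \<xi> \<le> \<rho> * sobM1_norm U \<xi>"
  proof (cases "sobM1_norm U \<xi> = 0")
    \<comment> \<open>Fields of norm 0 are left out of \<open>gammaD\<close>; the rough estimate
      covers them.\<close>
    case True then show ?thesis using WK[OF x] by simp
  next
    case False
    then have p: "sobM1_norm U \<xi> > 0" unfolding sobM1_norm_def by (simp add: order_less_le sum_nonneg)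
    have "WD U N Gr Hs \<xi> / sobM1_norm U \<xi> \<le> gammaD U N Gr Hs"
      unfolding gammaD_def
    proof (rule cSup_upper)
      show "WD U N Gr Hs \<xi> / sobM1_norm U \<xi> \<in> insert 0 {WD U N Gr Hs \<xi> / sobM1_norm U \<xi> |\<xi>. sobM1 U \<xi> \<and> sobM1_norm U \<xi> \<noteq> 0}"
        using x False by blast
      show "bdd_above (insert 0 {WD U N Gr Hs \<xi> / sobM1_norm U \<xi> |\<xi>. sobM1 U \<xi> \<and> sobM1_norm U \<xi> \<noteq> 0})"
      proof (rule bdd_aboveI[of _ ?K])
        fix y assume "y \<in> insert 0 {WD U N Gr Hs \<xi> / sobM1_norm U \<xi> |\<xi>. sobM1 U \<xi> \<and> sobM1_norm U \<xi> \<noteq> 0}"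
        then consider "y = 0" | \<xi> where "y = WD U N Gr Hs \<xi> / sobM1_norm U \<xi>" "sobM1 U \<xi>" "sobM1_norm U \<xi> \<noteq> 0" by blast
        then show "y \<le> ?K"
        proof cases
          case 1 then show ?thesis using K0 by simp
        next
          case 2
          have "sobM1_norm U \<xi> > 0" using 2(3) unfolding sobM1_norm_def by (simp add: order_less_le sum_nonneg)
          then show ?thesis unfolding 2(1) using WK[OF 2(2)] by (simp only: divide_le_eq if_True)
        qed
      qed
    qed
    then have "WD U N Gr Hs \<xi> / sobM1_norm U \<xi> \<le> \<rho>" using gDb by linarith
    then show ?thesis using p by (simp add: divide_le_eq)
  qed
  then show ?thesis using sup_ratio[OF WI_sublin[OF x] _ w, of "\<rho> * sobM1_norm U \<xi>"] by (simp add: WD_eq)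
qed

section \<open>Interpolation in the discrete space\<close>

abbreviation sv where "sv \<equiv> SD_val U PiD Gr Hs"

lemma sv_fun:
  assumes p: "sob U 2 \<phi>" and w: "w \<in> V"
  shows "L2fun U (\<lambda>x. PiD w x - \<phi> x)" "L4fun U (\<lambda>x. Gr w x - wgrad U \<phi> x)" "L2fun U (\<lambda>x. Hs w x - whess U \<phi> x)"
  using L2fun_diff(1)[OF disc(4)[OF w] sob_L2[OF p]] L4fun_diff(1)[OF disc(5)[OF w] wgrad_L4(1)[OF p]]
    L2fun_diff(1)[OF disc(6)[OF w] whess_L2(1)[OF p]] by simp_all

lemma sv_nonneg: "0 \<le> sv \<phi> w"
  by (simp add: SD_val_def)

lemma sv_le:
  assumes p: "sob U 2 \<phi>" and w: "w \<in> V" "w' \<in> V"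
  shows "sv \<phi> w \<le> sv \<phi> w' + (2 * \<Gamma> + 1) * nH (w - w')"
proof -
  have d: "w - w' \<in> V" by (rule subspace_diff[OF Vsp_subspace w])
  have e: "w = 1 *\<^sub>R w' + 1 *\<^sub>R (w - w')" by simp
  have eP: "PiD w = (\<lambda>x. PiD w' x + PiD (w - w') x)" and eG: "Gr w = (\<lambda>x. Gr w' x + Gr (w - w') x)" and eH: "Hs w = (\<lambda>x. Hs w' x + Hs (w - w') x)"
    using lin_mapD[OF disc(1) w(2) d, of 1 1] lin_mapD[OF disc(2) w(2) d, of 1 1] lin_mapD[OF disc(3) w(2) d, of 1 1] by simp_all
  note f = sv_fun[OF p w(2)]
  have "L2n U (\<lambda>x. PiD w x - \<phi> x) \<le> L2n U (\<lambda>x. PiD w' x - \<phi> x) + L2n U (PiD (w - w'))"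
    using L2fun_add(2)[OF f(1) disc(4)[OF d]] unfolding eP by (simp add: algebra_simps)
  moreover have "L4n U (\<lambda>x. Gr w x - wgrad U \<phi> x) \<le> L4n U (\<lambda>x. Gr w' x - wgrad U \<phi> x) + L4n U (Gr (w - w'))"
    using L4fun_add(2)[OF f(2) disc(5)[OF d]] unfolding eG by (simp add: algebra_simps)
  moreover have "L2n U (\<lambda>x. Hs w x - whess U \<phi> x) \<le> L2n U (\<lambda>x. Hs w' x - whess U \<phi> x) + nH (w - w')"
    using L2fun_add(2)[OF f(3) disc(6)[OF d]] unfolding eH nH_def by (simp add: algebra_simps)
  ultimately show ?thesis using CD_bound[OF d] unfolding SD_val_def by (simp add: algebra_simps)
qed

lemma nH_coord:
  assumes v: "v \<in> V" shows "nH v \<le> (\<Sum>b<N. \<bar>v b\<bar> * nH (\<lambda>i. if i = b then 1 else 0))"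
proof -
  have "nH v = nH (\<Sum>b<N. v b *\<^sub>R (\<lambda>i. if i = b then 1 else 0))" by (rule arg_cong[OF fs.expand[OF v]])
  also have "\<dots> \<le> (\<Sum>b<N. \<bar>v b\<bar> * nH (\<lambda>i. if i = b then 1 else 0))"
    by (rule sublin_sum[OF nH_sublin fs.eV])
  finally show ?thesis .
qed

lemma sv_continuous:
  assumes p: "sob U 2 \<phi>" and S: "S \<subseteq> V"
  shows "continuous_on S (sv \<phi>)"
  unfolding continuous_on_def
proof
  fix x assume x: "x \<in> S"
  let ?c = "\<lambda>b. nH (\<lambda>i. if i = b then 1 else 0)"
  let ?g = "\<lambda>w. (2 * \<Gamma> + 1) * (\<Sum>b<N. \<bar>w b - x b\<bar> * ?c b)"
  have bd: "\<bar>sv \<phi> w - sv \<phi> x\<bar> \<le> ?g w" if w: "w \<in> S" for w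
  proof -
    have V: "w \<in> V" "x \<in> V" using w x S by auto
    have n: "(2 * \<Gamma> + 1) * nH (u - v) \<le> (2 * \<Gamma> + 1) * (\<Sum>b<N. \<bar>u b - v b\<bar> * ?c b)" if "u \<in> V" "v \<in> V" for u v
      using nH_coord[OF subspace_diff[OF Vsp_subspace that]] Gam by (intro mult_left_mono) simp_all
    have "(\<Sum>b<N. \<bar>x b - w b\<bar> * ?c b) = (\<Sum>b<N. \<bar>w b - x b\<bar> * ?c b)" by (simp only: abs_minus_commute)
    then show ?thesis using sv_le[OF p V] sv_le[OF p V(2,1)] n[OF V] n[OF V(2,1)] by (simp only: abs_le_iff) linarith
  qed
  have "((\<lambda>w. sv \<phi> w - sv \<phi> x) \<longlongrightarrow> 0) (at x within S)"
  proof (rule Lim_null_comparison)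
    show "\<forall>\<^sub>F w in at x within S. norm (sv \<phi> w - sv \<phi> x) \<le> ?g w"
      using bd by (auto simp: eventually_at_filter)
    have co: "((\<lambda>w. w b) \<longlongrightarrow> x b) (at x within S)" for b
    proof -
      have "continuous_on S (\<lambda>w :: nat \<Rightarrow> real. w b)" by (rule continuous_on_subset[OF continuous_on_product_coordinates]) simp
      then show ?thesis using x unfolding continuous_on_def by blast
    qed
    have "(?g \<longlongrightarrow> (2 * \<Gamma> + 1) * (\<Sum>b<N. \<bar>x b - x b\<bar> * ?c b)) (at x within S)" by (intro tendsto_intros co)
    then show "(?g \<longlongrightarrow> 0) (at x within S)" by simp
  qed
  then show "(sv \<phi> \<longlongrightarrow> sv \<phi> x) (at x within S)" by (rule LIM_zero_cancel)
qed

text \<open>A vector that does better than 0 has a Hessian norm bounded in terms of \<phi>, hence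
  coordinates in [-R, R]; on this compact box the continuous functional attains its minimum. The
  choice in \<open>PD\<close> rests on the existence of a minimiser.\<close>

lemma sv_minimum:
  assumes p: "sob U 2 \<phi>" shows "\<exists>w\<in>V. \<forall>v\<in>V. sv \<phi> w \<le> sv \<phi> v"
proof -
  obtain C where C: "C \<ge> 0" "\<forall>j<N. \<forall>v\<in>V. \<bar>v j\<bar> \<le> C * nH v" using coord_bound_all by (elim exE conjE) (rule that)
  define R where "R = C * (sv \<phi> 0 + L2n U (whess U \<phi>))"
  define S where "S = {w. \<forall>i. w i \<in> (if i < N then {-R..R} else {0::real})}"
  have R0: "R \<ge> 0" unfolding R_def using C(1) sv_nonneg by simp
  have S0: "0 \<in> S" using R0 by (simp add: S_def zero_fun_def)
  have SV: "S \<subseteq> V"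
  proof
    fix w assume "w \<in> S"
    then have "w i \<in> (if i < N then {-R..R} else {0})" for i by (simp add: S_def)
    then have "w i = 0" if "N \<le> i" for i using that by (metis leD singletonD)
    then show "w \<in> V" by (simp add: Vsp_def)
  qed
  have "compact S" unfolding S_def by (rule box_compact) simp
  from continuous_attains_inf[OF this _ sv_continuous[OF p SV]] S0
  obtain w where w: "w \<in> S" "\<forall>v\<in>S. sv \<phi> w \<le> sv \<phi> v" by blast
  have "sv \<phi> w \<le> sv \<phi> v" if v: "v \<in> V" for v
  proof (cases "sv \<phi> v < sv \<phi> 0")
    case True
    have "nH v \<le> L2n U (\<lambda>x. Hs v x - whess U \<phi> x) + L2n U (whess U \<phi>)"
      using L2fun_add(2)[OF sv_fun(3)[OF p v] whess_L2(1)[OF p]] by (simp add: nH_def)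
    also have "L2n U (\<lambda>x. Hs v x - whess U \<phi> x) \<le> sv \<phi> v" by (simp add: SD_val_def)
    finally have n: "nH v \<le> sv \<phi> 0 + L2n U (whess U \<phi>)" using True by linarith
    have "\<bar>v j\<bar> \<le> R" if "j < N" for j
    proof -
      have "\<bar>v j\<bar> \<le> C * nH v" using C(2) that v by blast
      also have "\<dots> \<le> R" unfolding R_def by (rule mult_left_mono[OF n C(1)])
      finally show ?thesis .
    qed
    moreover have "v j = 0" if "\<not> j < N" for j using v that by (simp add: Vsp_def)
    ultimately have "v j \<in> (if j < N then {-R..R} else {0})" for j by (cases "j < N") (simp_all add: abs_le_iff minus_le_iff)
    then have "v \<in> S" by (simp add: S_def)
    then show ?thesis using w(2) by blast
  next
    case False
    have "sv \<phi> w \<le> sv \<phi> 0" using w(2) S0 by (rule bspec)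
    then show ?thesis using False by linarith
  qed
  then show ?thesis using w(1) SV by blast
qed

lemma SD_PD:
  assumes p: "sob U 2 \<phi>"
  shows "PD U N PiD Gr Hs \<phi> \<in> V" "sv \<phi> (PD U N PiD Gr Hs \<phi>) = SD U N PiD Gr Hs \<phi>"
    "v \<in> V \<Longrightarrow> SD U N PiD Gr Hs \<phi> \<le> sv \<phi> v"
proof -
  obtain w where w: "w \<in> V" "\<forall>v\<in>V. sv \<phi> w \<le> sv \<phi> v" using sv_minimum[OF p] by (elim bexE) (rule that)
  have e: "SD U N PiD Gr Hs \<phi> = sv \<phi> w" unfolding SD_def by (rule cInf_eq_minimum) (use w in auto)
  then have "\<exists>w. w \<in> V \<and> sv \<phi> w = SD U N PiD Gr Hs \<phi>" using w(1) by auto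
  from someI_ex[OF this] show "PD U N PiD Gr Hs \<phi> \<in> V" "sv \<phi> (PD U N PiD Gr Hs \<phi>) = SD U N PiD Gr Hs \<phi>" by (simp_all add: PD_def)
  show "v \<in> V \<Longrightarrow> SD U N PiD Gr Hs \<phi> \<le> sv \<phi> v" using w(2) e by simp
qed

text \<open>The zero vector is a competitor, so the distance is at most a sum of norms of \<phi>.
  The purpose is to make the set in \<open>alphaD\<close> bounded above.\<close>

lemma SD_bound: "\<exists>K\<ge>0. \<forall>\<phi>. sob U 3 \<phi> \<longrightarrow> sob0 U 2 \<phi> \<longrightarrow> SD U N PiD Gr Hs \<phi> \<le> K * sob_norm U 3 \<phi>"
proof -
  obtain C where C: "C \<ge> 0" "\<forall>v. sob0 U 2 v \<longrightarrow> L4n U (wgrad U v) \<le> C * L2n U (whess U v)"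
    using sob0_grad_L4 by (elim exE conjE) (rule that)
  let ?D = "real CARD('n) * real CARD('n)"
  have "SD U N PiD Gr Hs \<phi> \<le> (1 + (C + 1) * ?D) * sob_norm U 3 \<phi>" if p: "sob U 3 \<phi>" "sob0 U 2 \<phi>" for \<phi>
  proof -
    note s = sob0_sob[OF p(2)]
    have z: "0 \<in> V" by (rule subspace_0[OF Vsp_subspace])
    have z0: "PiD 0 = (\<lambda>x. 0)" "Gr 0 = (\<lambda>x. 0)" "Hs 0 = (\<lambda>x. 0)" by (rule lin_map_zero[OF disc(1)] lin_map_zero[OF disc(2)] lin_map_zero[OF disc(3)])+
    have "SD U N PiD Gr Hs \<phi> \<le> sv \<phi> 0" by (rule SD_PD(3)[OF s z])
    also have "sv \<phi> 0 = L2n U \<phi> + L4n U (wgrad U \<phi>) + L2n U (whess U \<phi>)"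
      unfolding SD_val_def z0 using L2fun_minus(2)[OF sob_L2[OF s]] L4fun_minus(2)[OF wgrad_L4(1)[OF s]] L2fun_minus(2)[OF whess_L2(1)[OF s]] by simp
    also have "L2n U \<phi> = L2n U (wD U [] \<phi>)"
      by (rule L2n_cong_AE(2)[symmetric, OF sobD(1)[OF s] L2fun_meas[OF sob_L2[OF s]] wD_Nil[OF sob_L2[OF s]]]) simp
    also have "\<dots> \<le> sob_norm U 3 \<phi>" by (rule wD_le_sob_norm) simp
    finally have 1: "SD U N PiD Gr Hs \<phi> \<le> sob_norm U 3 \<phi> + L4n U (wgrad U \<phi>) + L2n U (whess U \<phi>)" by simp
    have "L2n U (whess U \<phi>) \<le> (\<Sum>i\<in>(UNIV::'n set). \<Sum>j\<in>(UNIV::'n set). sob_norm U 3 \<phi>)"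
      by (rule order_trans[OF whess_L2(3)[OF s]]) (intro sum_mono wD_le_sob_norm, simp)
    then have h: "L2n U (whess U \<phi>) \<le> ?D * sob_norm U 3 \<phi>" by (simp add: mult.assoc)
    have "L4n U (wgrad U \<phi>) \<le> C * L2n U (whess U \<phi>)" using C(2) p(2) by blast
    also have "\<dots> \<le> C * (?D * sob_norm U 3 \<phi>)" by (rule mult_left_mono[OF h C(1)])
    finally show ?thesis using 1 h by (simp add: distrib_right mult.assoc)
  qed
  then show ?thesis using C(1) by (intro exI[of _ "1 + (C + 1) * ?D"]) simp
qed

lemma alpha_bound:
  assumes p: "sob U 3 \<phi>" "sob0 U 2 \<phi>"
  shows "SD U N PiD Gr Hs \<phi> \<le> \<rho> * sob_norm U 3 \<phi>"
proof -
  obtain K where K: "K \<ge> 0" "\<forall>\<phi>. sob U 3 \<phi> \<longrightarrow> sob0 U 2 \<phi> \<longrightarrow> SD U N PiD Gr Hs \<phi> \<le> K * sob_norm U 3 \<phi>"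
    using SD_bound by (elim exE conjE) (rule that)
  show ?thesis
  proof (cases "sob_norm U 3 \<phi> = 0")
    case True
    then show ?thesis using K(2) p by force
  next
    case False
    then have pos: "sob_norm U 3 \<phi> > 0" using sob_norm_nonneg[of 3 \<phi>] by linarith
    let ?S = "insert 0 {SD U N PiD Gr Hs \<phi> / sob_norm U 3 \<phi> | \<phi>. sob U 3 \<phi> \<and> sob0 U 2 \<phi> \<and> sob_norm U 3 \<phi> \<noteq> 0}"
    have "SD U N PiD Gr Hs \<phi> / sob_norm U 3 \<phi> \<le> alphaD U N PiD Gr Hs"
      unfolding alphaD_def
    proof (rule cSup_upper)
      show "SD U N PiD Gr Hs \<phi> / sob_norm U 3 \<phi> \<in> ?S" using p False by blast
      show "bdd_above ?S"
      proof (rule bdd_aboveI[of _ K])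
        fix y assume "y \<in> ?S"
        then consider "y = 0" | \<phi> where "y = SD U N PiD Gr Hs \<phi> / sob_norm U 3 \<phi>" "sob U 3 \<phi>" "sob0 U 2 \<phi>" "sob_norm U 3 \<phi> \<noteq> 0" by blast
        then show "y \<le> K"
        proof cases
          case 1 then show ?thesis using K(1) by simp
        next
          case 2
          have "sob_norm U 3 \<phi> > 0" using 2(4) sob_norm_nonneg[of 3 \<phi>] by linarith
          then show ?thesis unfolding 2(1) using K(2) 2(2,3) by (simp only: divide_le_eq if_True)
        qed
      qed
    qed
    then have "SD U N PiD Gr Hs \<phi> / sob_norm U 3 \<phi> \<le> \<rho>" using aDb by linarith
    then show ?thesis using pos by (simp add: divide_le_eq)
  qed
qed

lemma PD_bound:
  assumes p: "sob U 3 \<phi>" "sob0 U 2 \<phi>"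
  shows "PD U N PiD Gr Hs \<phi> \<in> V"
    "L2n U (\<lambda>x. PiD (PD U N PiD Gr Hs \<phi>) x - \<phi> x) \<le> \<rho> * sob_norm U 3 \<phi>"
    "L4n U (\<lambda>x. Gr (PD U N PiD Gr Hs \<phi>) x - wgrad U \<phi> x) \<le> \<rho> * sob_norm U 3 \<phi>"
    "L2n U (\<lambda>x. Hs (PD U N PiD Gr Hs \<phi>) x - whess U \<phi> x) \<le> \<rho> * sob_norm U 3 \<phi>"
proof -
  note s = sob0_sob[OF p(2)]
  let ?P = "PD U N PiD Gr Hs \<phi>"
  show "?P \<in> V" by (rule SD_PD(1)[OF s])
  have "L2n U (\<lambda>x. PiD ?P x - \<phi> x) + L4n U (\<lambda>x. Gr ?P x - wgrad U \<phi> x) + L2n U (\<lambda>x. Hs ?P x - whess U \<phi> x) \<le> \<rho> * sob_norm U 3 \<phi>"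
    using alpha_bound[OF p] SD_PD(2)[OF s] by (simp add: SD_val_def)
  moreover note L2n_nonneg[of U "\<lambda>x. PiD ?P x - \<phi> x"] L4n_nonneg[of U "\<lambda>x. Gr ?P x - wgrad U \<phi> x"] L2n_nonneg[of U "\<lambda>x. Hs ?P x - whess U \<phi> x"]
  ultimately show "L2n U (\<lambda>x. PiD ?P x - \<phi> x) \<le> \<rho> * sob_norm U 3 \<phi>"
    "L4n U (\<lambda>x. Gr ?P x - wgrad U \<phi> x) \<le> \<rho> * sob_norm U 3 \<phi>"
    "L2n U (\<lambda>x. Hs ?P x - whess U \<phi> x) \<le> \<rho> * sob_norm U 3 \<phi>" by linarith+
qed

end

section \<open>Consistency and regularity of the exact solution\<close>

context convex_domain
begin

text \<open>The factor of \<rho> in the consistency estimate: the H1 norm of the Hessian pays for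
  the limit-conformity defect, its divergence for the gradient error of the companion.\<close>

definition cH :: "(real^'n \<Rightarrow> real) \<Rightarrow> real" where
  "cH u = sobM1_norm U (whess U u) + L2n U (wdiv U (whess U u))"

lemma whess_sobM1:
  assumes "sob U 3 u" shows "sobM1 U (whess U u)"
proof -
  have "sob U 1 (wD U [i, j] u)" for i j using sob_wD[of "[i, j]" 1 u] assms by (simp add: numeral_3_eq_3)
  then show ?thesis by (simp add: sobM1_def whess_def)
qed

lemma div_by_parts:
  assumes x: "sobM1 U \<xi>" and v: "sob0 U 2 v"
  shows "(LINT x|M. inner (\<xi> x) (whess U v x)) = - (LINT x|M. inner (wdiv U \<xi> x) (wgrad U v x))"
proof -
  have s: "sob U 1 (\<lambda>x. \<xi> x $ i $ j)" for i j using x by (simp add: sobM1_def)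
  have a: "L2fun U (wD U [i, j] v)" "L2fun U (wD U [j] v)" for i j by (rule sobD(1)[OF sob0_sob[OF v]], simp)+
  have b: "L2fun U (\<lambda>x. \<xi> x $ i $ j)" "L2fun U (wD U [i] (\<lambda>x. \<xi> x $ i $ j))" for i j
    by (rule sob_L2[OF s]) (rule sobD(1)[OF s], simp)
  have "(LINT x|M. inner (\<xi> x) (whess U v x)) = (\<Sum>i\<in>UNIV. \<Sum>j\<in>UNIV. LINT x|M. \<xi> x $ i $ j * wD U [i, j] v x)"
    using L2_real_integrable(1)[OF b(1) a(1)] by (simp add: inner_vec_def whess_def)
  also have "\<dots> = (\<Sum>i\<in>UNIV. \<Sum>j\<in>UNIV. - (LINT x|M. wD U [i] (\<lambda>x. \<xi> x $ i $ j) x * wD U [j] v x))"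
    by (simp only: sob0_by_parts[OF s v])
  also have "\<dots> = - (\<Sum>j\<in>UNIV. \<Sum>i\<in>UNIV. LINT x|M. wD U [i] (\<lambda>x. \<xi> x $ i $ j) x * wD U [j] v x)"
    by (subst sum.swap) (simp add: sum_negf)
  also have "(\<Sum>j\<in>UNIV. \<Sum>i\<in>UNIV. LINT x|M. wD U [i] (\<lambda>x. \<xi> x $ i $ j) x * wD U [j] v x) = (LINT x|M. inner (wdiv U \<xi> x) (wgrad U v x))"
    using L2_real_integrable(1)[OF b(2) a(2)] by (simp add: inner_vec_def wdiv_def wgrad_def sum_distrib_right)
  finally show ?thesis .
qed

end

context hess_scheme
begin

text \<open>Integrating by parts on the conforming side turns the consistency error into the limit-conformity
  defect minus the gradient error of the companion.\<close>
lemma hess_consistency: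
  assumes u: "sob U 3 u" and w: "w \<in> V"
  shows "\<bar>(LINT x|M. inner (whess U u x) (Hs w x)) - (LINT x|M. inner (whess U u x) (whess U (E w) x))\<bar> \<le> \<rho> * cH u * nH w"
proof -
  let ?\<xi> = "whess U u"
  note x = whess_sobM1[OF u]
  note dv = conjunct1[OF wdiv_L2[OF x]]
  have gE: "L2fun U (wgrad U (E w))" by (rule wgrad_L2[OF E_sob[OF w]])
  have d: "(LINT x|M. inner (wdiv U ?\<xi> x) (Gr w x - wgrad U (E w) x)) = (LINT x|M. inner (wdiv U ?\<xi> x) (Gr w x)) - (LINT x|M. inner (wdiv U ?\<xi> x) (wgrad U (E w) x))"
    using L2_inner_integrable[OF dv Gr_L2[OF w]] L2_inner_integrable[OF dv gE] by (simp add: inner_diff_right)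
  have "\<bar>LINT x|M. inner (wdiv U ?\<xi> x) (Gr w x - wgrad U (E w) x)\<bar> \<le> L2n U (wdiv U ?\<xi>) * L2n U (\<lambda>x. Gr w x - wgrad U (E w) x)"
    by (rule L2_inner_bound[OF dv L2fun_diff(1)[OF Gr_L2[OF w] gE]])
  also have "\<dots> \<le> L2n U (wdiv U ?\<xi>) * (\<rho> * nH w)" by (intro mult_left_mono omega_bound w) simp
  finally have "\<bar>LINT x|M. inner (wdiv U ?\<xi> x) (Gr w x - wgrad U (E w) x)\<bar> \<le> L2n U (wdiv U ?\<xi>) * (\<rho> * nH w)" .
  moreover have "\<bar>WI ?\<xi> w\<bar> \<le> \<rho> * sobM1_norm U ?\<xi> * nH w" by (rule gamma_bound[OF x w])
  moreover have "(LINT x|M. inner (?\<xi> x) (Hs w x)) - (LINT x|M. inner (?\<xi> x) (whess U (E w) x)) = WI ?\<xi> w - (LINT x|M. inner (wdiv U ?\<xi> x) (Gr w x - wgrad U (E w) x))"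
    unfolding WI_eq[OF x w] d div_by_parts[OF x comp(2)[OF w]] by simp
  moreover have "\<rho> * cH u * nH w = \<rho> * sobM1_norm U ?\<xi> * nH w + L2n U (wdiv U ?\<xi>) * (\<rho> * nH w)" by (simp add: cH_def algebra_simps)
  ultimately show ?thesis by linarith
qed

end

context trilinear_form
begin

lemma HT_L4:
  assumes s: "\<And>i. sob U 3 (\<Psi> i)" shows "L4fun U (HT U (\<Psi> :: 'k \<Rightarrow> real^'n \<Rightarrow> real))"
proof -
  have "L4fun U (wD U [i, j] (\<Psi> l))" for i j l
    using sob_L4[OF sob_wD[of "[i, j]" 1 "\<Psi> l"]] s[of l] by (simp add: numeral_3_eq_3)
  then show ?thesis unfolding HT_def whess_def by (intro L4_tup(1) L4fun_vec(1)) simp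
qed

text \<open>Second derivatives of an H3 function are in H1, hence in L4; so the first derivatives
  have a gradient in L4 and \<open>sob_W14_bounded\<close> applies.\<close>

lemma wD_AE_bounded:
  assumes u: "sob U 3 u" shows "\<exists>K\<ge>0. AE x in M. \<bar>wD U [j] u x\<bar> \<le> K"
proof -
  have s: "sob U 2 (wD U [j] u)" using sob_wD[of "[j]" 2 u] u by (simp add: numeral_3_eq_3 numeral_2_eq_2)
  have "L4fun U (wD U [l] (wD U [j] u))" for l by (rule sob_L4[OF sob_wD1[OF s]])
  then have "L4fun U (\<lambda>z. \<bar>wD U [l] (wD U [j] u) z\<bar>)" for l using L4fun_norm(1)[of U "wD U [l] (wD U [j] u)"] by simp
  then have g: "L4fun U (Gm (wD U [j] u))" unfolding Gm_def[abs_def] by (intro conjunct1[OF L4fun_sum])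
  show ?thesis by (rule sob_W14_bounded[OF sob_mono[OF s] g]) auto
qed

lemma GradT_AE_bounded:
  assumes s: "\<And>i. sob U 3 (\<Psi> i)" shows "\<exists>K\<ge>0. AE x in M. norm (GradT U (\<Psi> :: 'k \<Rightarrow> real^'n \<Rightarrow> real) x) \<le> K"
proof -
  have "\<forall>i. \<forall>j. \<exists>K. 0 \<le> K \<and> (AE x in M. \<bar>wD U [j] (\<Psi> i) x\<bar> \<le> K)" using wD_AE_bounded[OF s] by simp
  then have "\<exists>K. \<forall>i j. 0 \<le> K i j \<and> (AE x in M. \<bar>wD U [j] (\<Psi> i) x\<bar> \<le> K i j)" by (simp only: choice_iff)
  then obtain K where K: "\<forall>i j. 0 \<le> K i j \<and> (AE x in M. \<bar>wD U [j] (\<Psi> i) x\<bar> \<le> K i j)" by (rule exE)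
  have "AE x in M. \<forall>i. \<forall>j. \<bar>wD U [j] (\<Psi> i) x\<bar> \<le> K i j" using K by (intro eventually_all_finite) simp
  then have "AE x in M. norm (GradT U \<Psi> x) \<le> (\<Sum>i\<in>UNIV. \<Sum>j\<in>UNIV. K i j)"
  proof eventually_elim
    case (elim x)
    have "norm (GradT U \<Psi> x) \<le> (\<Sum>i\<in>UNIV. norm (GradT U \<Psi> x $ i))" unfolding norm_vec_def by (rule L2_set_le_sum) simp
    also have "\<dots> \<le> (\<Sum>i\<in>UNIV. \<Sum>j\<in>UNIV. K i j)"
    proof (rule sum_mono)
      fix i
      have "norm (GradT U \<Psi> x $ i) \<le> (\<Sum>j\<in>UNIV. \<bar>GradT U \<Psi> x $ i $ j\<bar>)" by (rule norm_le_l1_cart)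
      also have "\<dots> \<le> (\<Sum>j\<in>UNIV. K i j)" by (intro sum_mono) (use elim in \<open>simp add: GradT_def wgrad_def\<close>)
      finally show "norm (GradT U \<Psi> x $ i) \<le> (\<Sum>j\<in>UNIV. K i j)" .
    qed
    finally show ?case .
  qed
  then show ?thesis using K by (intro exI[of _ "\<Sum>i\<in>UNIV. \<Sum>j\<in>UNIV. K i j"]) (simp add: sum_nonneg)
qed

end

context bounded_open
begin

text \<open>The companion maps into the space of order 2, whereas \<open>Hminus1\<close> gives
  linearity of \<open>L\<close> on the space of order 1.\<close>

lemma sob0_mono:
  assumes u: "sob0 U m u" and l: "l \<le> m" shows "sob0 U l u"
proof -
  obtain p where p: "\<forall>i. test_fun U (p i)" "(\<lambda>i. sob_norm U m (\<lambda>x. p i x - u x)) \<longlonglongrightarrow> 0"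
    using u unfolding sob0_def by (elim conjE exE) (rule that)
  have le: "sob_norm U l v \<le> sob_norm U m v" for v
    unfolding sob_norm_def by (intro real_sqrt_le_mono sum_mono2 finite_short_lists) (use l in auto)
  have "(\<lambda>i. sob_norm U l (\<lambda>x. p i x - u x)) \<longlonglongrightarrow> 0"
    by (rule tendsto_sandwich[OF _ _ tendsto_const p(2)]) (simp_all add: le sob_norm_nonneg)
  then show ?thesis using p(1) sob_mono[OF sob0_sob[OF u] l] unfolding sob0_def by blast
qed

end

section \<open>Tuples of discrete functions\<close>

lemma zero_fun_apply: "0 i = 0"
  by (simp add: zero_fun_def)

locale hess_system = trilinear_form U h + hess_scheme U N PiD Gr Hs E \<rho> \<Gamma>
  for U :: "(real^'n) set" and h :: "real^'n^'k \<Rightarrow> real^'n^'k \<Rightarrow> real^'n^'n^'k"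
    and N PiD Gr Hs E \<rho> \<Gamma>
begin

text \<open>The k-fold discrete space; \<open>HD\<close>, \<open>GD\<close>, \<open>FD\<close>,
  \<open>ET\<close>, \<open>QD\<close> and \<open>nD\<close> are the componentwise versions of
  \<open>Hs\<close>, \<open>Gr\<close>, \<open>PiD\<close>, \<open>E\<close>, \<open>PD\<close> and
  of the norm \<open>nH\<close>.\<close>

definition VT :: "('k \<Rightarrow> nat \<Rightarrow> real) set" where "VT = {v. \<forall>i. v i \<in> V}"
definition HD :: "('k \<Rightarrow> nat \<Rightarrow> real) \<Rightarrow> real^'n \<Rightarrow> real^'n^'n^'k" where "HD v = tup (\<lambda>i. Hs (v i))"
definition GD :: "('k \<Rightarrow> nat \<Rightarrow> real) \<Rightarrow> real^'n \<Rightarrow> real^'n^'k" where "GD v = tup (\<lambda>i. Gr (v i))"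
definition FD :: "('k \<Rightarrow> nat \<Rightarrow> real) \<Rightarrow> real^'n \<Rightarrow> real^'k" where "FD v = tup (\<lambda>i. PiD (v i))"
definition ET :: "('k \<Rightarrow> nat \<Rightarrow> real) \<Rightarrow> 'k \<Rightarrow> real^'n \<Rightarrow> real" where "ET v = (\<lambda>i. E (v i))"
definition QD :: "('k \<Rightarrow> real^'n \<Rightarrow> real) \<Rightarrow> 'k \<Rightarrow> nat \<Rightarrow> real" where "QD W = (\<lambda>i. PD U N PiD Gr Hs (W i))"
definition nD :: "('k \<Rightarrow> nat \<Rightarrow> real) \<Rightarrow> real" where "nD v = L2n U (HD v)"

lemma VT_nth: "v \<in> VT \<Longrightarrow> v i \<in> V" by (simp add: VT_def)

lemma VT_subspace: "subspace VT"
  using Vsp_subspace[of N] by (simp add: subspace_def VT_def plus_fun_def[of "_ :: 'k \<Rightarrow> _"] zero_fun_def[where 'a='k] scaleR_fun_def[of _ "_ :: 'k \<Rightarrow> _"])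

lemma VT_comb: "u \<in> VT \<Longrightarrow> v \<in> VT \<Longrightarrow> a *\<^sub>R u + b *\<^sub>R v \<in> VT"
  by (intro subspace_add subspace_scale VT_subspace)

lemma comb_nth: "(a *\<^sub>R u + b *\<^sub>R v) i = a *\<^sub>R u i + b *\<^sub>R (v i :: nat \<Rightarrow> real)"
  by (simp add: plus_fun_def scaleR_fun_def)

lemma HD_L2: "v \<in> VT \<Longrightarrow> L2fun U (HD v)" unfolding HD_def by (intro L2_tup(1) disc(6) VT_nth)
lemma GD_L4: "v \<in> VT \<Longrightarrow> L4fun U (GD v)" unfolding GD_def by (intro L4_tup(1) disc(5) VT_nth)
lemma FD_L2: "v \<in> VT \<Longrightarrow> L2fun U (FD v)" unfolding FD_def by (intro L2_tup(1) disc(4) VT_nth)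
lemma GD_L2: "v \<in> VT \<Longrightarrow> L2fun U (GD v)" by (rule L4fun_imp_L2fun(1)[OF fin_M GD_L4])

lemma HD_lin: "u \<in> VT \<Longrightarrow> v \<in> VT \<Longrightarrow> HD (a *\<^sub>R u + b *\<^sub>R v) = (\<lambda>x. a *\<^sub>R HD u x + b *\<^sub>R HD v x)"
  unfolding HD_def comb_nth by (simp add: fun_eq_iff vec_eq_iff lin_mapD[OF disc(3)] VT_nth)

lemma GD_lin: "u \<in> VT \<Longrightarrow> v \<in> VT \<Longrightarrow> GD (a *\<^sub>R u + b *\<^sub>R v) = (\<lambda>x. a *\<^sub>R GD u x + b *\<^sub>R GD v x)"
  unfolding GD_def comb_nth by (simp add: fun_eq_iff vec_eq_iff lin_mapD[OF disc(2)] VT_nth)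

lemma FD_lin: "u \<in> VT \<Longrightarrow> v \<in> VT \<Longrightarrow> FD (a *\<^sub>R u + b *\<^sub>R v) = (\<lambda>x. a *\<^sub>R FD u x + b *\<^sub>R FD v x)"
  unfolding FD_def comb_nth by (simp add: fun_eq_iff vec_eq_iff lin_mapD[OF disc(1)] VT_nth)

lemma nD_nonneg [simp]: "0 \<le> nD v" by (simp add: nD_def)

lemma nH_le_nD: "v \<in> VT \<Longrightarrow> nH (v i) \<le> nD v"
  unfolding nH_def nD_def HD_def by (intro L2_tup(3)[of U "\<lambda>i. Hs (v i)"] disc(6) VT_nth)

lemma nD_def_pos: "v \<in> VT \<Longrightarrow> nD v = 0 \<Longrightarrow> v = 0"
proof
  fix i assume v: "v \<in> VT" "nD v = 0"
  have "nH (v i) = 0" using nH_le_nD[OF v(1), of i] v(2) nH_nonneg[of "v i"] by linarith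
  then have "v i = 0" using disc(7)[OF VT_nth[OF v(1)], of i] unfolding nH_def by blast
  then show "v i = 0 i" by (simp only: zero_fun_apply)
qed

lemma sum_nD_bound:
  assumes v: "v \<in> VT" and c: "0 \<le> c" and b: "\<And>i. f i \<le> c * nH (v i)"
  shows "(\<Sum>i\<in>(UNIV :: 'k set). f i) \<le> (real CARD('k) * c) * nD v"
proof -
  have "(\<Sum>i\<in>(UNIV :: 'k set). f i) \<le> (\<Sum>i\<in>(UNIV :: 'k set). c * nD v)"
    by (intro sum_mono order_trans[OF b] mult_left_mono nH_le_nD v c)
  then show ?thesis by simp
qed

lemma GD_bound: "v \<in> VT \<Longrightarrow> L4n U (GD v) \<le> (real CARD('k) * \<Gamma>) * nD v"
  unfolding GD_def by (rule order_trans[OF L4_tup(2)]) (auto intro!: sum_nD_bound disc(5) CD_bound VT_nth Gam)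

lemma FD_bound: "v \<in> VT \<Longrightarrow> L2n U (FD v) \<le> (real CARD('k) * \<Gamma>) * nD v"
  unfolding FD_def by (rule order_trans[OF L2_tup(2)]) (auto intro!: sum_nD_bound disc(4) CD_bound VT_nth Gam)

lemma ET_Xsp: "v \<in> VT \<Longrightarrow> Xsp U (ET v)"
  by (simp add: Xsp_def ET_def comp(2) VT_nth)

lemma HE_L2: "v \<in> VT \<Longrightarrow> L2fun U (HT U (ET v))" by (intro HT_L2 Xsp_sob ET_Xsp)
lemma GE_L4: "v \<in> VT \<Longrightarrow> L4fun U (GradT U (ET v))" by (intro GradT_L4 Xsp_sob ET_Xsp)
lemma GE_L2: "v \<in> VT \<Longrightarrow> L2fun U (GradT U (ET v))" by (rule L4fun_imp_L2fun(1)[OF fin_M GE_L4])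

lemma HE_bound: "v \<in> VT \<Longrightarrow> L2n U (HT U (ET v)) \<le> (real CARD('k) * \<Gamma>) * nD v"
  unfolding HT_def ET_def by (rule order_trans[OF L2_tup(2)]) (auto intro!: sum_nD_bound whess_L2(1) E_sob GE_bound VT_nth Gam)

lemma GE_err:
  assumes v: "v \<in> VT"
  shows "L2n U (\<lambda>x. GD v x - GradT U (ET v) x) \<le> (real CARD('k) * \<rho>) * nD v"
proof -
  have e: "(\<lambda>x. GD v x - GradT U (ET v) x) = tup (\<lambda>i x. Gr (v i) x - wgrad U (E (v i)) x)"
    by (simp add: fun_eq_iff vec_eq_iff GD_def GradT_def ET_def)
  show ?thesis unfolding e
  proof (rule order_trans[OF L2_tup(2)])
    show "L2fun U (\<lambda>x. Gr (v i) x - wgrad U (E (v i)) x)" for i by (intro L2fun_diff(1) Gr_L2 wgrad_L2 E_sob VT_nth v)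
    show "(\<Sum>i\<in>UNIV. L2n U (\<lambda>x. Gr (v i) x - wgrad U (E (v i)) x)) \<le> (real CARD('k) * \<rho>) * nD v"
      by (rule sum_nD_bound[OF v]) (use rho omega_bound[OF VT_nth[OF v]] in auto)
  qed
qed

lemma A_tup:
  assumes "\<And>i. L2fun U (F i)" "\<And>i. L2fun U (G i)"
  shows "AA (tup F) (tup G) = (\<Sum>i\<in>UNIV. LINT x|M. inner (F i x) (G i x))"
proof -
  have e: "inner (tup F x) (tup G x) = (\<Sum>i\<in>UNIV. inner (F i x) (G i x))" for x
    by (simp only: inner_vec_def[of "tup F x"] tup_nth)
  show ?thesis unfolding Aform_def e by (rule Bochner_Integration.integral_sum) (rule L2_inner_integrable[OF assms])
qed

lemma HT_consistency:
  assumes W: "\<And>i. sob U 3 (W i)" and v: "v \<in> VT"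
  shows "\<bar>AA (HT U W) (HD v) - AA (HT U W) (HT U (ET v))\<bar> \<le> \<rho> * (\<Sum>i\<in>UNIV. cH (W i)) * nD v"
proof -
  have s: "sob U 2 (W i)" for i by (rule sob_mono[OF W]) simp
  note u2 = whess_L2(1)[OF s]
  have "AA (HT U W) (HD v) - AA (HT U W) (HT U (ET v)) =
    (\<Sum>i\<in>UNIV. (LINT x|M. inner (whess U (W i) x) (Hs (v i) x)) - (LINT x|M. inner (whess U (W i) x) (whess U (E (v i)) x)))"
    unfolding HT_def HD_def ET_def
    by (subst A_tup[OF u2 disc(6)[OF VT_nth[OF v]]], subst A_tup[OF u2 whess_L2(1)[OF E_sob[OF VT_nth[OF v]]]]) (simp add: sum_subtractf)
  also have "\<bar>\<dots>\<bar> \<le> (\<Sum>i\<in>UNIV. \<bar>(LINT x|M. inner (whess U (W i) x) (Hs (v i) x)) - (LINT x|M. inner (whess U (W i) x) (whess U (E (v i)) x))\<bar>)"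
    by (rule sum_abs)
  also have "\<dots> \<le> (\<Sum>i\<in>UNIV. \<rho> * cH (W i) * nD v)"
  proof (rule sum_mono)
    fix i
    have c: "0 \<le> cH (W i)" unfolding cH_def sobM1_norm_def by (intro add_nonneg_nonneg real_sqrt_ge_zero sum_nonneg) simp_all
    have "\<rho> * cH (W i) * nH (v i) \<le> \<rho> * cH (W i) * nD v" using rho c by (intro mult_left_mono nH_le_nD v) simp
    then show "\<bar>(LINT x|M. inner (whess U (W i) x) (Hs (v i) x)) - (LINT x|M. inner (whess U (W i) x) (whess U (E (v i)) x))\<bar> \<le> \<rho> * cH (W i) * nD v"
      using hess_consistency[OF W[of i] VT_nth[OF v, of i]] by linarith
  qed
  also have "\<dots> = \<rho> * (\<Sum>i\<in>UNIV. cH (W i)) * nD v" by (simp add: sum_distrib_left sum_distrib_right)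
  finally show ?thesis .
qed

lemma QD_bound:
  fixes W :: "'k \<Rightarrow> real^'n \<Rightarrow> real"
  assumes W: "\<And>i. sob U 3 (W i)" "Xsp U W"
  shows "QD W \<in> VT"
    "L2n U (\<lambda>x. FD (QD W) x - tup W x) \<le> \<rho> * (\<Sum>i\<in>UNIV. sob_norm U 3 (W i))"
    "L4n U (\<lambda>x. GD (QD W) x - GradT U W x) \<le> \<rho> * (\<Sum>i\<in>UNIV. sob_norm U 3 (W i))"
    "L2n U (\<lambda>x. HD (QD W) x - HT U W x) \<le> \<rho> * (\<Sum>i\<in>UNIV. sob_norm U 3 (W i))"
proof -
  have X: "sob0 U 2 (W i)" for i using W(2) by (simp add: Xsp_def)
  note P = PD_bound[OF W(1) X] and f = sv_fun[OF sob0_sob[OF X] PD_bound(1)[OF W(1) X]]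
  show "QD W \<in> VT" by (simp add: VT_def QD_def P(1))
  have e1: "(\<lambda>x. FD (QD W) x - tup W x) = tup (\<lambda>i x. PiD (PD U N PiD Gr Hs (W i)) x - W i x)"
    and e2: "(\<lambda>x. GD (QD W) x - GradT U W x) = tup (\<lambda>i x. Gr (PD U N PiD Gr Hs (W i)) x - wgrad U (W i) x)"
    and e3: "(\<lambda>x. HD (QD W) x - HT U W x) = tup (\<lambda>i x. Hs (PD U N PiD Gr Hs (W i)) x - whess U (W i) x)"
    by (simp_all add: fun_eq_iff vec_eq_iff FD_def GD_def HD_def QD_def GradT_def HT_def)
  show "L2n U (\<lambda>x. FD (QD W) x - tup W x) \<le> \<rho> * (\<Sum>i\<in>UNIV. sob_norm U 3 (W i))"
    unfolding e1 sum_distrib_left by (rule order_trans[OF L2_tup(2)[OF f(1)]]) (intro sum_mono P(2))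
  show "L4n U (\<lambda>x. GD (QD W) x - GradT U W x) \<le> \<rho> * (\<Sum>i\<in>UNIV. sob_norm U 3 (W i))"
    unfolding e2 sum_distrib_left by (rule order_trans[OF L4_tup(2)[OF f(2)]]) (intro sum_mono P(3))
  show "L2n U (\<lambda>x. HD (QD W) x - HT U W x) \<le> \<rho> * (\<Sum>i\<in>UNIV. sob_norm U 3 (W i))"
    unfolding e3 sum_distrib_left by (rule order_trans[OF L2_tup(2)[OF f(3)]]) (intro sum_mono P(4))
qed

lemma fin_space_VT:
  "fin_space VT ((UNIV :: 'k set) \<times> {..<N}) (\<lambda>b i j. if (i, j) = b then 1 else 0) (\<lambda>b v. v (fst b) (snd b))"
proof
  show "subspace VT" by (rule VT_subspace)
  show "v = (\<Sum>b\<in>UNIV \<times> {..<N}. v (fst b) (snd b) *\<^sub>R (\<lambda>i j. if (i, j) = b then 1 else 0))" if v: "v \<in> VT" for v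
  proof (intro ext)
    fix i j
    have "(\<Sum>b\<in>UNIV \<times> {..<N}. v (fst b) (snd b) *\<^sub>R (\<lambda>i j. if (i, j) = b then 1 else 0)) i j
      = (\<Sum>b\<in>(UNIV :: 'k set) \<times> {..<N}. if (i, j) = b then v (fst b) (snd b) else 0)"
      unfolding sum_fun_apply by (intro sum.cong refl) (simp add: scaleR_fun_def)
    also have "\<dots> = v i j" using VT_nth[OF v, of i] by (subst sum.delta') (auto simp: Vsp_def)
    finally show "v i j = (\<Sum>b\<in>UNIV \<times> {..<N}. v (fst b) (snd b) *\<^sub>R (\<lambda>i j. if (i, j) = b then 1 else 0)) i j" by simp
  qed
qed (auto simp: VT_def Vsp_def lin_on_def plus_fun_def scaleR_fun_def)

lemma VT_coord: "\<exists>C. \<forall>b\<in>(UNIV :: 'k set) \<times> {..<N}. \<forall>v\<in>VT. \<bar>v (fst b) (snd b)\<bar> \<le> C * nD v"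
proof -
  obtain C where C: "C \<ge> 0" "\<forall>j<N. \<forall>v\<in>V. \<bar>v j\<bar> \<le> C * nH v" using coord_bound_all by (elim exE conjE) (rule that)
  have "\<bar>v i j\<bar> \<le> C * nD v" if "j < N" "v \<in> VT" for v i j
  proof -
    have "\<bar>v i j\<bar> \<le> C * nH (v i)" using C(2) that(1) VT_nth[OF that(2)] by blast
    also have "\<dots> \<le> C * nD v" by (rule mult_left_mono[OF nH_le_nD[OF that(2)] C(1)])
    finally show ?thesis .
  qed
  then show ?thesis by (intro exI[of _ C]) auto
qed

end

section \<open>The discrete inf-sup condition\<close>

lemma fun_lin_sum:
  fixes F :: "'a::real_vector \<Rightarrow> 'c \<Rightarrow> 'b::real_vector"
  assumes S: "subspace S" and F: "\<And>u v a b. u \<in> S \<Longrightarrow> v \<in> S \<Longrightarrow> F (a *\<^sub>R u + b *\<^sub>R v) = (\<lambda>x. a *\<^sub>R F u x + b *\<^sub>R F v x)"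
    and v: "\<And>m. m \<in> I \<Longrightarrow> v m \<in> S"
  shows "F (\<Sum>m\<in>I. c m *\<^sub>R v m) = (\<lambda>x. \<Sum>m\<in>I. c m *\<^sub>R F (v m) x)"
proof -
  have z: "F 0 = (\<lambda>x. 0)" using F[OF subspace_0[OF S] subspace_0[OF S], of 0 0] by simp
  show ?thesis
    using v
  proof (induction I rule: infinite_finite_induct)
    case (insert m I)
    have s: "(\<Sum>m\<in>I. c m *\<^sub>R v m) \<in> S" by (intro subspace_sum subspace_scale S) (use insert.prems in auto)
    have "F (c m *\<^sub>R v m + 1 *\<^sub>R (\<Sum>m\<in>I. c m *\<^sub>R v m)) = (\<lambda>x. c m *\<^sub>R F (v m) x + 1 *\<^sub>R F (\<Sum>m\<in>I. c m *\<^sub>R v m) x)"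
      by (rule F[OF insert.prems s]) simp
    then show ?case using insert by (simp add: scaleR_one)
  qed (simp_all add: z)
qed

text \<open>This locale is kept apart from \<open>regular_data\<close> because \<epsilon> is chosen
  from the constants defined in it, and the family \<open>e\<close> only after \<epsilon>.\<close>

locale regular_base = trilinear_form U h for U :: "(real^'n) set" and h :: "real^'n^'k \<Rightarrow> real^'n^'k \<Rightarrow> real^'n^'n^'k" +
  fixes \<Psi> :: "'k \<Rightarrow> real^'n \<Rightarrow> real" and K \<beta> C0 \<Gamma> :: real
  assumes XP: "Xsp U \<Psi>" and P3: "\<And>i. sob U 3 (\<Psi> i)"
    and K0: "0 \<le> K" and Kb: "AE x in lebesgue_on U. norm (GradT U \<Psi> x) \<le> K"
    and beta: "\<beta> > 0"
    and infsup: "\<And>\<xi> c. \<xi> \<in> TS \<Longrightarrow> 0 \<le> c \<Longrightarrow> (\<And>\<phi>. \<phi> \<in> TS \<Longrightarrow> \<bar>AA (Hc \<xi>) (Hc \<phi>) + BB (HT U \<Psi>) (Gc \<xi>) (Gc \<phi>) + BB (Hc \<xi>) (GradT U \<Psi>) (Gc \<phi>)\<bar> \<le> c * L2n U (Hc \<phi>))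
      \<Longrightarrow> \<beta> * L2n U (Hc \<xi>) \<le> c"
    and C0: "C0 \<ge> 0" and Gc0: "\<And>\<phi>. \<phi> \<in> TS \<Longrightarrow> L4n U (Gc \<phi>) \<le> C0 * L2n U (Hc \<phi>)"
    and Gam0: "\<Gamma> \<ge> 0"
begin

text \<open>\<open>G0\<close> bounds the discrete gradient by the discrete Hessian,
  \<open>C1\<close> the lower-order part as a functional of an L4 field, \<open>C2\<close> the
  Hessian norm of \<open>xi\<close>; \<open>b1\<close> is the stability constant left after two
  quarters of \<beta> are absorbed.\<close>

definition "h2 = L2n U (HT U \<Psi>)"
definition "h4 = L4n U (HT U \<Psi>)"
definition "g4 = L4n U (GradT U \<Psi>)"
definition "G0 = real CARD('k) * \<Gamma>"
definition "C1 = Mh * (h2 * G0 + g4)"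
definition "C2 = C1 * C0"
definition "b1 = \<beta> / (2 * (\<beta> + C2))"

lemma base_nonneg: "0 \<le> h2" "0 \<le> h4" "0 \<le> g4" "0 \<le> G0" "0 \<le> C1" "0 \<le> C2" "0 < b1"
proof -
  show 1: "0 \<le> h2" "0 \<le> h4" "0 \<le> g4" "0 \<le> G0" using Gam0 by (simp_all add: h2_def h4_def g4_def G0_def)
  then show c: "0 \<le> C1" using Mh(1) by (simp add: C1_def)
  then show "0 \<le> C2" using C0 by (simp add: C2_def)
  then show "0 < b1" using beta by (simp add: b1_def add_pos_nonneg)
qed

lemma P_L2: "L2fun U (HT U \<Psi>)" and P_L4: "L4fun U (HT U \<Psi>)" and P_G4: "L4fun U (GradT U \<Psi>)"
  by (intro HT_L2 Xsp_sob XP) (intro HT_L4 P3, intro GradT_L4 Xsp_sob XP)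

end

text \<open>\<open>eps1\<close> is spent in \<open>stability\<close> and \<open>eps2\<close> in
  \<open>coercivity\<close>; the last two assumptions are the outcome of
  \<open>splitting\<close>.\<close>

locale regular_data = regular_base U h \<Psi> K \<beta> C0 \<Gamma>
  for U :: "(real^'n) set" and h :: "real^'n^'k \<Rightarrow> real^'n^'k \<Rightarrow> real^'n^'n^'k" and \<Psi> K \<beta> C0 \<Gamma> +
  fixes \<epsilon> :: real and n :: nat and e :: "nat \<Rightarrow> 'k \<Rightarrow> real^'n \<Rightarrow> real"
  assumes eps0: "0 \<le> \<epsilon>" and eps1: "C1 * \<epsilon> \<le> \<beta> / 4" and eps2: "C1 * \<epsilon> * G0 \<le> b1^2 / 4"
    and orth: "sip.orthonormal n e"
    and split: "\<And>u. u \<in> TS \<Longrightarrow> (\<forall>m<n. ip (e m) u = 0) \<Longrightarrow> L4n U (Gc u) \<le> \<epsilon> * sip.nrm u"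
begin

text \<open>\<open>Se\<close> and \<open>SP\<close> are interpolation costs, \<open>He\<close> and
  \<open>CP\<close> consistency costs, of the finite family and of \<Psi>. As factors of \<rho>,
  \<open>C3\<close> measures the interpolation of \<open>xi\<close>, \<open>C5\<close> and
  \<open>C6\<close> the losses in stability and coercivity, \<open>C8\<close> the change from \<Psi>
  to its interpolant, \<open>C9\<close> the residual. \<open>C7\<close> bounds the test function and
  \<open>bh\<close> is the discrete inf-sup constant.\<close>

definition "Se m = (\<Sum>i\<in>UNIV. sob_norm U 3 (e m i))"
definition "He m = (\<Sum>i\<in>UNIV. cH (e m i))"
definition "C3 = C2 * (\<Sum>m<n. Se m)"
definition "C5 = Mh * h2 * C0 * (G0 + 1) * C3"
definition "C6 = C3 + C1 * C3 + Mh * (h4 * G0 + K) * real CARD('k) + C2 * (\<Sum>m<n. He m)"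
definition "C7 = 1 + C2 + C3"
definition "bh = b1^2 / (2 * C7)"
definition "SP = (\<Sum>i\<in>UNIV. sob_norm U 3 (\<Psi> i))"
definition "CP = (\<Sum>i\<in>UNIV. cH (\<Psi> i))"
definition "C8 = Mh * SP * (G0 * G0 + G0)"
definition "C9 = SP + CP + Mh * SP * (g4 + SP) * G0 + Mh * h2 * SP * G0 + Mh * h4 * g4 * real CARD('k)"

lemma cH_nonneg: "0 \<le> cH u"
  unfolding cH_def sobM1_norm_def by (intro add_nonneg_nonneg real_sqrt_ge_zero sum_nonneg) simp_all

lemma data_nonneg: "0 \<le> Se m" "0 \<le> He m" "0 \<le> C3" "0 \<le> C5" "0 \<le> C6" "0 < C7" "0 < bh" "0 \<le> SP" "0 \<le> CP" "0 \<le> C8" "0 \<le> C9"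
proof -
  show S: "0 \<le> Se m" for m unfolding Se_def by (intro sum_nonneg sob_norm_nonneg)
  show H: "0 \<le> He m" for m unfolding He_def by (intro sum_nonneg cH_nonneg)
  show C3: "0 \<le> C3" unfolding C3_def by (intro mult_nonneg_nonneg sum_nonneg S base_nonneg)
  show "0 \<le> C5" unfolding C5_def by (intro mult_nonneg_nonneg add_nonneg_nonneg C3 base_nonneg Mh(1) C0) simp
  show "0 \<le> C6" unfolding C6_def by (intro add_nonneg_nonneg mult_nonneg_nonneg sum_nonneg C3 H base_nonneg Mh(1) K0) simp
  show C7: "0 < C7" unfolding C7_def using C3 base_nonneg(6) by linarith
  show "0 < bh" unfolding bh_def using C7 base_nonneg(7) by simp
  show SP: "0 \<le> SP" unfolding SP_def by (intro sum_nonneg sob_norm_nonneg)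
  show CP: "0 \<le> CP" unfolding CP_def by (intro sum_nonneg cH_nonneg)
  show "0 \<le> C8" unfolding C8_def by (intro add_nonneg_nonneg mult_nonneg_nonneg SP base_nonneg Mh(1))
  show "0 \<le> C9" unfolding C9_def by (intro add_nonneg_nonneg mult_nonneg_nonneg SP CP base_nonneg Mh(1)) simp
qed

lemma e_TS: "m < n \<Longrightarrow> e m \<in> TS" using orth by (simp add: sip.orthonormal_def)

lemma e_nrm: "m < n \<Longrightarrow> L2n U (Hc (e m)) = 1"
  using orth unfolding nrm_eq[symmetric] by (simp add: sip.orthonormal_def sip.nrm_def)

end

text \<open>Beyond \<rho> \<le> 1 there is one threshold for each loss of order \<rho> that is
  absorbed: in stability, in coercivity, in the passage from \<Psi> to its interpolant, and in the
  fixed point.\<close>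

locale hess_regular = regular_data U h \<Psi> K \<beta> C0 \<Gamma> \<epsilon> n e + hess_system U h N PiD Gr Hs E \<rho> \<Gamma>
  for U :: "(real^'n) set" and h :: "real^'n^'k \<Rightarrow> real^'n^'k \<Rightarrow> real^'n^'n^'k" and \<Psi> K \<beta> C0 \<Gamma> \<epsilon> n e N PiD Gr Hs E \<rho> +
  assumes r1: "\<rho> \<le> 1" and r5: "C5 * \<rho> \<le> \<beta> / 4" and r6: "C6 * \<rho> \<le> b1^2 / 4" and r8: "C8 * \<rho> \<le> bh / 2"
    and r9: "(8 * (Mh * G0 * G0) * C9) * \<rho> \<le> (bh / 2)^2"
begin

lemma GD_G0: "v \<in> VT \<Longrightarrow> L4n U (GD v) \<le> G0 * nD v"
  unfolding G0_def by (rule GD_bound)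

text \<open>The lower-order part of the linearised form at \<Theta>, as a functional of an arbitrary
  field: it is evaluated at discrete gradients, at gradients of companions and at those of test
  tuples.\<close>

definition kap :: "('k \<Rightarrow> nat \<Rightarrow> real) \<Rightarrow> (real^'n \<Rightarrow> real^'n^'k) \<Rightarrow> real" where
  "kap \<Theta> Y = BB (HT U \<Psi>) (GD \<Theta>) Y + BB (HD \<Theta>) (GradT U \<Psi>) Y"

lemma kap_BI: "\<Theta> \<in> VT \<Longrightarrow> L4fun U Y \<Longrightarrow> BI (HT U \<Psi>) (GD \<Theta>) Y \<and> BI (HD \<Theta>) (GradT U \<Psi>) Y"
  by (intro conjI B_244(1) P_L2 P_G4 GD_L4 HD_L2)

lemma kap_lin:
  "\<Theta> \<in> VT \<Longrightarrow> L4fun U Y \<Longrightarrow> L4fun U Y' \<Longrightarrow> kap \<Theta> (\<lambda>x. a *\<^sub>R Y x + b *\<^sub>R Y' x) = a * kap \<Theta> Y + b * kap \<Theta> Y'"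
  using kap_BI[of \<Theta> Y] kap_BI[of \<Theta> Y'] unfolding kap_def by (simp add: B_lin3 distrib_left)

lemma kap_add:
  "\<Theta> \<in> VT \<Longrightarrow> L4fun U Y \<Longrightarrow> L4fun U Y' \<Longrightarrow> kap \<Theta> (\<lambda>x. Y x + Y' x) = kap \<Theta> Y + kap \<Theta> Y'"
  using kap_lin[of \<Theta> Y Y' 1 1] by simp

lemma kap_bound:
  assumes T: "\<Theta> \<in> VT" and Y: "L4fun U Y"
  shows "\<bar>kap \<Theta> Y\<bar> \<le> (C1 * nD \<Theta>) * L4n U Y"
proof -
  have "\<bar>kap \<Theta> Y\<bar> \<le> Mh * (h2 * (L4n U (GD \<Theta>) * L4n U Y)) + Mh * (nD \<Theta> * (g4 * L4n U Y))"
    unfolding kap_def h2_def g4_def nD_def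
    by (rule order_trans[OF abs_triangle_ineq]) (intro add_mono B_244(2) P_L2 P_G4 GD_L4 HD_L2 T Y)
  also have "\<dots> \<le> Mh * (h2 * ((G0 * nD \<Theta>) * L4n U Y)) + Mh * (nD \<Theta> * (g4 * L4n U Y))"
    by (intro add_right_mono mult_left_mono mult_right_mono GD_G0 T Mh(1) base_nonneg L4n_nonneg)
  also have "\<dots> = (C1 * nD \<Theta>) * L4n U Y" by (simp add: C1_def algebra_simps)
  finally show ?thesis .
qed

text \<open>L2 control of the field suffices because the Hessian of \<Psi> is in L4 and its gradient
  is bounded.\<close>

lemma kap_bound2:
  assumes T: "\<Theta> \<in> VT" and Y: "L2fun U Y"
  shows "\<bar>kap \<Theta> Y\<bar> \<le> (Mh * (h4 * G0 + K) * nD \<Theta>) * L2n U Y"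
proof -
  have "\<bar>BB (HT U \<Psi>) (GD \<Theta>) Y\<bar> \<le> Mh * (h4 * L4n U (GD \<Theta>) * L2n U Y)"
    unfolding h4_def by (rule B_442(2)[OF P_L4 GD_L4[OF T] Y])
  also have "\<dots> \<le> Mh * (h4 * (G0 * nD \<Theta>) * L2n U Y)"
    by (intro mult_left_mono mult_right_mono GD_G0 T Mh(1) base_nonneg L2n_nonneg)
  finally have 1: "\<bar>BB (HT U \<Psi>) (GD \<Theta>) Y\<bar> \<le> Mh * (h4 * (G0 * nD \<Theta>) * L2n U Y)" .
  have 2: "\<bar>BB (HD \<Theta>) (GradT U \<Psi>) Y\<bar> \<le> Mh * (nD \<Theta> * (K * L2n U Y))"
    unfolding nD_def by (rule B_2inf2(2)[OF HD_L2[OF T] L4fun_meas[OF P_G4] Kb K0 Y])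
  show ?thesis using 1 2 unfolding kap_def by (simp add: algebra_simps abs_le_iff) 
qed

text \<open>\<open>xi \<Theta>\<close> represents the lower-order part \<open>kap \<Theta>\<close> up to \<open>\<epsilon>\<close>, and \<open>Ixi \<Theta>\<close> is its
  discrete interpolant.\<close>

definition xi where "xi \<Theta> = (\<Sum>m<n. kap \<Theta> (Gc (e m)) *\<^sub>R e m)"
definition Ixi where "Ixi \<Theta> = (\<Sum>m<n. kap \<Theta> (Gc (e m)) *\<^sub>R QD (e m))"

lemma xi:
  assumes T: "\<Theta> \<in> VT"
  shows "xi \<Theta> \<in> TS" "\<And>u. u \<in> TS \<Longrightarrow> \<bar>kap \<Theta> (Gc u) - ip (xi \<Theta>) u\<bar> \<le> C1 * nD \<Theta> * \<epsilon> * L2n U (Hc u)" "kap \<Theta> (Gc (xi \<Theta>)) = ip (xi \<Theta>) (xi \<Theta>)"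
proof -
  have l: "lin_on TS (\<lambda>u. kap \<Theta> (Gc u))" unfolding lin_on_def by (simp add: Gc_lin kap_lin T Gc_L4(1))
  have b: "\<bar>kap \<Theta> (Gc u)\<bar> \<le> (C1 * nD \<Theta>) * L4n U (Gc u)" if "u \<in> TS" for u by (rule kap_bound[OF T Gc_L4(1)[OF that]])
  have t: "0 \<le> C1 * nD \<Theta>" using base_nonneg(5) by simp
  note r = sip.riesz_approx[OF orth split l b t eps0]
  show "xi \<Theta> \<in> TS" "kap \<Theta> (Gc (xi \<Theta>)) = ip (xi \<Theta>) (xi \<Theta>)" unfolding xi_def by (rule r, assumption+)+
  show "\<bar>kap \<Theta> (Gc u) - ip (xi \<Theta>) u\<bar> \<le> C1 * nD \<Theta> * \<epsilon> * L2n U (Hc u)" if "u \<in> TS" for u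
    unfolding nrm_eq[symmetric] xi_def by (rule r(2), assumption+, rule that)
qed

lemma kap_e: "\<Theta> \<in> VT \<Longrightarrow> m < n \<Longrightarrow> \<bar>kap \<Theta> (Gc (e m))\<bar> \<le> C2 * nD \<Theta>"
proof -
  assume T: "\<Theta> \<in> VT" and m: "m < n"
  have "\<bar>kap \<Theta> (Gc (e m))\<bar> \<le> (C1 * nD \<Theta>) * L4n U (Gc (e m))" by (rule kap_bound[OF T Gc_L4(1)[OF e_TS[OF m]]])
  also have "\<dots> \<le> (C1 * nD \<Theta>) * (C0 * 1)"
    using Gc0[OF e_TS[OF m]] base_nonneg(5) by (intro mult_left_mono) (simp_all add: e_nrm[OF m])
  finally show ?thesis by (simp add: C2_def ac_simps)
qed

text \<open>The functional evaluated at \<open>xi\<close> is the squared norm of \<open>xi\<close>,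
  and one factor cancels.\<close>

lemma xi_norm: "\<Theta> \<in> VT \<Longrightarrow> L2n U (Hc (xi \<Theta>)) \<le> C2 * nD \<Theta>"
proof -
  assume T: "\<Theta> \<in> VT"
  let ?x = "L2n U (Hc (xi \<Theta>))"
  have "?x * ?x = kap \<Theta> (Gc (xi \<Theta>))" by (simp add: xi(3)[OF T] ip_def A_self power2_eq_square)
  also have "\<dots> \<le> (C1 * nD \<Theta>) * L4n U (Gc (xi \<Theta>))" using kap_bound[OF T Gc_L4(1)[OF xi(1)[OF T]]] by linarith
  also have "\<dots> \<le> (C1 * nD \<Theta>) * (C0 * ?x)" by (intro mult_left_mono Gc0 xi(1) T mult_nonneg_nonneg base_nonneg nD_nonneg)
  finally have "?x * ?x \<le> (C2 * nD \<Theta>) * ?x" by (simp add: C2_def ac_simps)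
  then show ?thesis
    using mult_le_cancel_right[of ?x ?x "C2 * nD \<Theta>"] L2n_nonneg[of U "Hc (xi \<Theta>)"] base_nonneg(6) nD_nonneg[of \<Theta>]
    by (metis mult_nonneg_nonneg order_le_less)
qed

lemma QD_e:
  assumes m: "m < n"
  shows "QD (e m) \<in> VT" "L4n U (\<lambda>x. GD (QD (e m)) x - Gc (e m) x) \<le> \<rho> * Se m" "L2n U (\<lambda>x. HD (QD (e m)) x - Hc (e m) x) \<le> \<rho> * Se m"
proof -
  note t = e_TS[OF m] and Q = QD_bound[OF TS_sob[OF e_TS[OF m]] TS_Xsp[OF e_TS[OF m]]]
  show q: "QD (e m) \<in> VT" by (rule Q(1))
  have "L4n U (\<lambda>x. GD (QD (e m)) x - Gc (e m) x) = L4n U (\<lambda>x. GD (QD (e m)) x - GradT U (e m) x)"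
  proof (rule L4n_cong_AE(2))
    show "L4fun U (\<lambda>x. GD (QD (e m)) x - Gc (e m) x)" by (intro L4fun_diff(1) GD_L4 q Gc_L4 t)
    show "(\<lambda>x. GD (QD (e m)) x - GradT U (e m) x) \<in> borel_measurable M" by (intro L4fun_meas L4fun_diff(1) GD_L4 q GradT_L4 TS_sob t)
    show "AE x in M. GD (QD (e m)) x - Gc (e m) x = GD (QD (e m)) x - GradT U (e m) x" using GradT_Gc[OF t] by eventually_elim simp
  qed
  then show "L4n U (\<lambda>x. GD (QD (e m)) x - Gc (e m) x) \<le> \<rho> * Se m" using Q(3) by (simp add: Se_def)
  have "L2n U (\<lambda>x. HD (QD (e m)) x - Hc (e m) x) = L2n U (\<lambda>x. HD (QD (e m)) x - HT U (e m) x)"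
  proof (rule L2n_cong_AE(2))
    show "L2fun U (\<lambda>x. HD (QD (e m)) x - Hc (e m) x)" by (intro L2fun_diff(1) HD_L2 q Hc_L2 t)
    show "(\<lambda>x. HD (QD (e m)) x - HT U (e m) x) \<in> borel_measurable M" by (intro L2fun_meas L2fun_diff(1) HD_L2 q HT_L2 TS_sob t)
    show "AE x in M. HD (QD (e m)) x - Hc (e m) x = HD (QD (e m)) x - HT U (e m) x" using HT_Hc[OF t] by eventually_elim simp
  qed
  then show "L2n U (\<lambda>x. HD (QD (e m)) x - Hc (e m) x) \<le> \<rho> * Se m" using Q(4) by (simp add: Se_def)
qed

text \<open>The coefficients of \<open>xi\<close> are at most \<open>C2\<close> times the norm of
  \<Theta>, so an error of order \<rho> for each \<open>e m\<close> carries over to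
  \<open>xi\<close> with the same order.\<close>

lemma sum_coeff:
  assumes T: "\<Theta> \<in> VT" and q: "\<And>m. m < n \<Longrightarrow> q m \<le> \<rho> * s m" "\<And>m. 0 \<le> s m"
  shows "(\<Sum>m<n. \<bar>kap \<Theta> (Gc (e m))\<bar> * q m) \<le> C2 * (\<Sum>m<n. s m) * \<rho> * nD \<Theta>"
proof -
  have "(\<Sum>m<n. \<bar>kap \<Theta> (Gc (e m))\<bar> * q m) \<le> (\<Sum>m<n. (C2 * nD \<Theta>) * (\<rho> * s m))"
  proof (rule sum_mono)
    fix m assume "m \<in> {..<n}"
    then have m: "m < n" by simp
    have "\<bar>kap \<Theta> (Gc (e m))\<bar> * q m \<le> \<bar>kap \<Theta> (Gc (e m))\<bar> * (\<rho> * s m)" by (intro mult_left_mono q(1) m) simp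
    also have "\<dots> \<le> (C2 * nD \<Theta>) * (\<rho> * s m)" using rho q(2)[of m] by (intro mult_right_mono kap_e T m) simp
    finally show "\<bar>kap \<Theta> (Gc (e m))\<bar> * q m \<le> (C2 * nD \<Theta>) * (\<rho> * s m)" .
  qed
  also have "\<dots> = C2 * (\<Sum>m<n. s m) * \<rho> * nD \<Theta>" by (simp add: sum_distrib_left sum_distrib_right ac_simps)
  finally show ?thesis .
qed

lemma Ixi:
  assumes T: "\<Theta> \<in> VT"
  shows "Ixi \<Theta> \<in> VT" "L4n U (\<lambda>x. GD (Ixi \<Theta>) x - Gc (xi \<Theta>) x) \<le> C3 * \<rho> * nD \<Theta>" "L2n U (\<lambda>x. HD (Ixi \<Theta>) x - Hc (xi \<Theta>) x) \<le> C3 * \<rho> * nD \<Theta>"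
proof -
  show "Ixi \<Theta> \<in> VT" unfolding Ixi_def by (intro subspace_sum subspace_scale VT_subspace) (simp add: QD_e(1))
  let ?c = "\<lambda>m. kap \<Theta> (Gc (e m))"
  let ?dG = "\<lambda>m x. GD (QD (e m)) x - Gc (e m) x" and ?dH = "\<lambda>m x. HD (QD (e m)) x - Hc (e m) x"
  have dG: "L4fun U (?dG m)" and dH: "L2fun U (?dH m)" if "m < n" for m
    by (intro L4fun_diff(1) GD_L4 QD_e(1) Gc_L4(1) e_TS that) (intro L2fun_diff(1) HD_L2 QD_e(1) Hc_L2(1) e_TS that)
  have "GD (Ixi \<Theta>) = (\<lambda>x. \<Sum>m<n. ?c m *\<^sub>R GD (QD (e m)) x)" unfolding Ixi_def by (rule fun_lin_sum[where F=GD, OF VT_subspace GD_lin]) (simp_all add: QD_e(1))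
  moreover have "Gc (xi \<Theta>) = (\<lambda>x. \<Sum>m<n. ?c m *\<^sub>R Gc (e m) x)" unfolding xi_def by (rule fun_lin_sum[where F=Gc, OF TS_subspace Gc_lin]) (simp_all add: e_TS)
  ultimately have eG: "(\<lambda>x. GD (Ixi \<Theta>) x - Gc (xi \<Theta>) x) = (\<lambda>x. \<Sum>m<n. ?c m *\<^sub>R ?dG m x)"
    by (simp add: scaleR_diff_right sum_subtractf)
  have "HD (Ixi \<Theta>) = (\<lambda>x. \<Sum>m<n. ?c m *\<^sub>R HD (QD (e m)) x)" unfolding Ixi_def by (rule fun_lin_sum[where F=HD, OF VT_subspace HD_lin]) (simp_all add: QD_e(1))
  moreover have "Hc (xi \<Theta>) = (\<lambda>x. \<Sum>m<n. ?c m *\<^sub>R Hc (e m) x)" unfolding xi_def by (rule fun_lin_sum[where F=Hc, OF TS_subspace Hc_lin]) (simp_all add: e_TS)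
  ultimately have eH: "(\<lambda>x. HD (Ixi \<Theta>) x - Hc (xi \<Theta>) x) = (\<lambda>x. \<Sum>m<n. ?c m *\<^sub>R ?dH m x)"
    by (simp add: scaleR_diff_right sum_subtractf)
  have "L4n U (\<lambda>x. GD (Ixi \<Theta>) x - Gc (xi \<Theta>) x) \<le> (\<Sum>m<n. L4n U (\<lambda>x. ?c m *\<^sub>R ?dG m x))"
    unfolding eG by (rule conjunct2[OF L4fun_sum]) (simp add: L4fun_scale(1) dG)
  also have "\<dots> = (\<Sum>m<n. \<bar>?c m\<bar> * L4n U (?dG m))" by (intro sum.cong refl) (simp add: L4fun_scale(2) dG)
  also have "\<dots> \<le> C3 * \<rho> * nD \<Theta>" unfolding C3_def by (rule sum_coeff[OF T QD_e(2) data_nonneg(1)])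
  finally show "L4n U (\<lambda>x. GD (Ixi \<Theta>) x - Gc (xi \<Theta>) x) \<le> C3 * \<rho> * nD \<Theta>" .
  have "L2n U (\<lambda>x. HD (Ixi \<Theta>) x - Hc (xi \<Theta>) x) \<le> (\<Sum>m<n. L2n U (\<lambda>x. ?c m *\<^sub>R ?dH m x))"
    unfolding eH by (rule conjunct2[OF L2fun_sum]) (simp add: L2fun_scale(1) dH)
  also have "\<dots> = (\<Sum>m<n. \<bar>?c m\<bar> * L2n U (?dH m))" by (intro sum.cong refl) (simp add: L2fun_scale(2) dH)
  also have "\<dots> \<le> C3 * \<rho> * nD \<Theta>" unfolding C3_def by (rule sum_coeff[OF T QD_e(3) data_nonneg(1)])
  finally show "L2n U (\<lambda>x. HD (Ixi \<Theta>) x - Hc (xi \<Theta>) x) \<le> C3 * \<rho> * nD \<Theta>" .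
qed

end

context hess_regular
begin

text \<open>In the continuous linearised form at \<xi> the principal term is nearly the lower-order
  part of \<Theta>. Together with the lower-order terms of \<xi> it becomes those of \<Theta> +
  \<xi>, which are controlled by X = \<H>\<Theta> + \<H>\<xi>. The inf-sup condition thus bounds
  \<xi> by X up to small multiples of \<Theta>, and \<H>\<Theta> is X minus \<H>\<xi>.\<close>

lemma stability:
  assumes T: "\<Theta> \<in> VT"
  shows "b1 * nD \<Theta> \<le> L2n U (\<lambda>x. HD \<Theta> x + Hc (xi \<Theta>) x)"
proof -
  let ?t = "nD \<Theta>" and ?s = "L2n U (\<lambda>x. HD \<Theta> x + Hc (xi \<Theta>) x)"
  let ?X = "\<lambda>x. HD \<Theta> x + Hc (xi \<Theta>) x" and ?Y = "\<lambda>x. GD \<Theta> x + Gc (xi \<Theta>) x"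
  let ?P = "1 *\<^sub>R \<Theta> + 1 *\<^sub>R Ixi \<Theta>"
  note x = xi(1)[OF T] and I = Ixi[OF T]
  note hx = Hc_L2(1)[OF x] and gx = Gc_L4(1)[OF x] and hT = HD_L2[OF T] and gT = GD_L4[OF T]
  have X2: "L2fun U ?X" and Y4: "L4fun U ?Y" by (intro L2fun_add(1) hx hT) (intro L4fun_add(1) gx gT)
  have P: "?P \<in> VT" by (rule VT_comb[OF T I(1)])
  have dG: "L4fun U (\<lambda>x. GD (Ixi \<Theta>) x - Gc (xi \<Theta>) x)" and dH: "L2fun U (\<lambda>x. HD (Ixi \<Theta>) x - Hc (xi \<Theta>) x)"
    by (intro L4fun_diff(1) GD_L4 I(1) gx) (intro L2fun_diff(1) HD_L2 I(1) hx)
  have nP: "nD ?P \<le> ?s + C3 * \<rho> * ?t"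
  proof -
    have "HD ?P = (\<lambda>x. ?X x + (HD (Ixi \<Theta>) x - Hc (xi \<Theta>) x))" unfolding HD_lin[OF T I(1)] by simp
    then show ?thesis unfolding nD_def[of ?P] using L2fun_add(2)[OF X2 dH] I(3) by simp
  qed
  \<comment> \<open>X gives no direct hold on \<nabla>\<Theta> + \<nabla>\<xi>, as \<Theta> is
    discrete and \<xi> is not. The sum is compared with that of \<Theta> and the interpolant of
    \<xi>, a discrete tuple whose gradient its Hessian controls.\<close>
  have "L4n U ?Y \<le> G0 * nD ?P + C3 * \<rho> * ?t"
  proof -
    have "?Y = (\<lambda>x. GD ?P x - (GD (Ixi \<Theta>) x - Gc (xi \<Theta>) x))" unfolding GD_lin[OF T I(1)] by simp
    then show ?thesis using L4fun_diff(2)[OF GD_L4[OF P] dG] GD_G0[OF P] I(2) by simp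
  qed
  also have "\<dots> \<le> G0 * (?s + C3 * \<rho> * ?t) + C3 * \<rho> * ?t" by (intro add_right_mono mult_left_mono nP base_nonneg)
  finally have Yb: "L4n U ?Y \<le> G0 * ?s + (G0 + 1) * C3 * \<rho> * ?t" by (simp add: algebra_simps)
  let ?c = "C1 * ?t * \<epsilon> + Mh * (h2 * ((G0 * ?s + (G0 + 1) * C3 * \<rho> * ?t) * C0)) + Mh * (?s * (g4 * C0))"
  have "\<beta> * L2n U (Hc (xi \<Theta>)) \<le> ?c"
  proof (rule infsup[OF x])
    show "0 \<le> ?c" using base_nonneg data_nonneg(3) rho Mh(1) C0 eps0 by (intro add_nonneg_nonneg mult_nonneg_nonneg) simp_all
    fix \<phi> assume p: "\<phi> \<in> TS"
    note gp = Gc_L4(1)[OF p]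
    have e1: "BB (HT U \<Psi>) ?Y (Gc \<phi>) = BB (HT U \<Psi>) (GD \<Theta>) (Gc \<phi>) + BB (HT U \<Psi>) (Gc (xi \<Theta>)) (Gc \<phi>)"
      by (intro B_add(2) B_244(1) P_L2 gT gx gp)
    have e2: "BB ?X (GradT U \<Psi>) (Gc \<phi>) = BB (HD \<Theta>) (GradT U \<Psi>) (Gc \<phi>) + BB (Hc (xi \<Theta>)) (GradT U \<Psi>) (Gc \<phi>)"
      by (intro B_add(1) B_244(1) P_G4 hT hx gp)
    have 1: "\<bar>kap \<Theta> (Gc \<phi>) - ip (xi \<Theta>) \<phi>\<bar> \<le> C1 * ?t * \<epsilon> * L2n U (Hc \<phi>)" by (rule xi(2)[OF T p])
    have "\<bar>BB (HT U \<Psi>) ?Y (Gc \<phi>)\<bar> \<le> Mh * (h2 * (L4n U ?Y * L4n U (Gc \<phi>)))"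
      unfolding h2_def by (rule B_244(2)[OF P_L2 Y4 gp])
    also have "\<dots> \<le> Mh * (h2 * ((G0 * ?s + (G0 + 1) * C3 * \<rho> * ?t) * (C0 * L2n U (Hc \<phi>))))"
      using base_nonneg data_nonneg(3) rho by (intro mult_left_mono mult_mono Yb Gc0 p Mh(1)) simp_all
    finally have 2: "\<bar>BB (HT U \<Psi>) ?Y (Gc \<phi>)\<bar> \<le> Mh * (h2 * ((G0 * ?s + (G0 + 1) * C3 * \<rho> * ?t) * (C0 * L2n U (Hc \<phi>))))" .
    have "\<bar>BB ?X (GradT U \<Psi>) (Gc \<phi>)\<bar> \<le> Mh * (?s * (g4 * L4n U (Gc \<phi>)))"
      unfolding g4_def by (rule B_244(2)[OF X2 P_G4 gp])
    also have "\<dots> \<le> Mh * (?s * (g4 * (C0 * L2n U (Hc \<phi>))))"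
      by (intro mult_left_mono Gc0 p Mh(1) base_nonneg L2n_nonneg)
    finally have 3: "\<bar>BB ?X (GradT U \<Psi>) (Gc \<phi>)\<bar> \<le> Mh * (?s * (g4 * (C0 * L2n U (Hc \<phi>))))" .
    have "AA (Hc (xi \<Theta>)) (Hc \<phi>) + BB (HT U \<Psi>) (Gc (xi \<Theta>)) (Gc \<phi>) + BB (Hc (xi \<Theta>)) (GradT U \<Psi>) (Gc \<phi>)
      = BB (HT U \<Psi>) ?Y (Gc \<phi>) + BB ?X (GradT U \<Psi>) (Gc \<phi>) - (kap \<Theta> (Gc \<phi>) - ip (xi \<Theta>) \<phi>)"
      unfolding e1 e2 kap_def ip_def by simp
    then have "\<bar>AA (Hc (xi \<Theta>)) (Hc \<phi>) + BB (HT U \<Psi>) (Gc (xi \<Theta>)) (Gc \<phi>) + BB (Hc (xi \<Theta>)) (GradT U \<Psi>) (Gc \<phi>)\<bar>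
      \<le> C1 * ?t * \<epsilon> * L2n U (Hc \<phi>) + Mh * (h2 * ((G0 * ?s + (G0 + 1) * C3 * \<rho> * ?t) * (C0 * L2n U (Hc \<phi>)))) + Mh * (?s * (g4 * (C0 * L2n U (Hc \<phi>))))"
      using 1 2 3 by linarith
    also have "\<dots> = ?c * L2n U (Hc \<phi>)" by (simp only: distrib_right mult.assoc)
    finally show "\<bar>AA (Hc (xi \<Theta>)) (Hc \<phi>) + BB (HT U \<Psi>) (Gc (xi \<Theta>)) (Gc \<phi>) + BB (Hc (xi \<Theta>)) (GradT U \<Psi>) (Gc \<phi>)\<bar> \<le> ?c * L2n U (Hc \<phi>)" .
  qed
  also have "?c = (C1 * \<epsilon>) * ?t + C2 * ?s + (C5 * \<rho>) * ?t" by (simp add: C2_def C1_def C5_def algebra_simps)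
  \<comment> \<open>Half of \<beta> is given away to terms in \<Theta>; the other half survives in
    \<open>b1\<close>.\<close>
  also have "\<dots> \<le> (\<beta> / 4) * ?t + C2 * ?s + (\<beta> / 4) * ?t" by (intro add_mono mult_right_mono eps1 r5 nD_nonneg order_refl)
  finally have 1: "\<beta> * L2n U (Hc (xi \<Theta>)) \<le> (\<beta> / 2) * ?t + C2 * ?s" by simp
  have "HD \<Theta> = (\<lambda>x. ?X x - Hc (xi \<Theta>) x)" by simp
  then have "?t \<le> ?s + L2n U (Hc (xi \<Theta>))" unfolding nD_def using L2fun_diff(2)[OF X2 hx] by simp
  then have "\<beta> * ?t \<le> \<beta> * (?s + L2n U (Hc (xi \<Theta>)))" using beta by (intro mult_left_mono) simp_all
  then have "\<beta> * ?t \<le> 2 * (\<beta> + C2) * ?s" using 1 by (simp add: algebra_simps)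
  moreover have "0 < 2 * (\<beta> + C2)" by (intro mult_pos_pos add_pos_nonneg beta base_nonneg) simp
  ultimately show ?thesis unfolding b1_def times_divide_eq_left by (simp only: pos_divide_le_eq mult.commute[of ?s])
qed

text \<open>The discrete stand-in for \<Theta> + \<xi>.\<close>

definition Phi where "Phi \<Theta> = 1 *\<^sub>R \<Theta> + 1 *\<^sub>R Ixi \<Theta>"

lemma Phi: assumes T: "\<Theta> \<in> VT" shows "Phi \<Theta> \<in> VT" "nD (Phi \<Theta>) \<le> C7 * nD \<Theta>"
proof -
  note x = xi(1)[OF T] and I = Ixi[OF T]
  show "Phi \<Theta> \<in> VT" unfolding Phi_def by (rule VT_comb[OF T I(1)])
  let ?D = "\<lambda>x. HD (Ixi \<Theta>) x - Hc (xi \<Theta>) x"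
  have D: "L2fun U ?D" by (intro L2fun_diff(1) HD_L2 I(1) Hc_L2 x)
  have "HD (Phi \<Theta>) = (\<lambda>x. (HD \<Theta> x + Hc (xi \<Theta>) x) + ?D x)" unfolding Phi_def HD_lin[OF T I(1)] by simp
  then have "nD (Phi \<Theta>) \<le> L2n U (\<lambda>x. HD \<Theta> x + Hc (xi \<Theta>) x) + L2n U ?D"
    unfolding nD_def using L2fun_add(2)[OF L2fun_add(1)[OF HD_L2[OF T] Hc_L2(1)[OF x]] D] by simp
  also have "\<dots> \<le> (nD \<Theta> + C2 * nD \<Theta>) + C3 * \<rho> * nD \<Theta>"
    using L2fun_add(2)[OF HD_L2[OF T] Hc_L2(1)[OF x]] xi_norm[OF T] I(3) unfolding nD_def by linarith
  also have "C3 * \<rho> * nD \<Theta> \<le> C3 * 1 * nD \<Theta>" by (intro mult_right_mono mult_left_mono r1 data_nonneg nD_nonneg)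
  finally show "nD (Phi \<Theta>) \<le> C7 * nD \<Theta>" by (simp add: C7_def algebra_simps)
qed

text \<open>\<open>HT_consistency\<close> holds for each \<open>e m\<close> with its own constant
  \<open>He m\<close>, and the coefficients of \<open>xi\<close> add these up.\<close>

lemma Hc_xi_consistency:
  assumes T: "\<Theta> \<in> VT"
  shows "\<bar>AA (Hc (xi \<Theta>)) (HT U (ET \<Theta>)) - AA (Hc (xi \<Theta>)) (HD \<Theta>)\<bar> \<le> C2 * (\<Sum>m<n. He m) * \<rho> * nD \<Theta> * nD \<Theta>"
proof -
  let ?c = "\<lambda>m. kap \<Theta> (Gc (e m))"
  have lin: "AA (Hc (xi \<Theta>)) Z = (\<Sum>m<n. ?c m * AA (Hc (e m)) Z)" if Z: "L2fun U Z" for Z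
  proof -
    have "lin_on TS (\<lambda>u. AA (Hc u) Z)" unfolding lin_on_def
      by (simp add: Hc_lin A_sym[of _ Z] A_lin2[OF Z] Hc_L2(1))
    then show ?thesis unfolding xi_def by (rule lin_on_sum[OF _ TS_subspace]) (simp add: e_TS)
  qed
  have each: "\<bar>AA (Hc (e m)) (HT U (ET \<Theta>)) - AA (Hc (e m)) (HD \<Theta>)\<bar> \<le> \<rho> * (He m * nD \<Theta>)" if m: "m < n" for m
  proof -
    note t = e_TS[OF m]
    have "AA (Hc (e m)) Z = AA (HT U (e m)) Z" if Z: "L2fun U Z" for Z
    proof (rule A_cong_AE)
      show "AE x in M. Hc (e m) x = HT U (e m) x" using HT_Hc[OF t] by eventually_elim simp
    qed (simp_all add: Hc_meas t L2fun_meas[OF Z] L2fun_meas[OF HT_L2[OF TS_sob[OF t]]])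
    then show ?thesis using HT_consistency[OF TS_sob[OF t] T] HE_L2[OF T] HD_L2[OF T]
      by (simp only: He_def abs_minus_commute mult.assoc)
  qed
  have eq: "AA (Hc (xi \<Theta>)) (HT U (ET \<Theta>)) - AA (Hc (xi \<Theta>)) (HD \<Theta>) = (\<Sum>m<n. ?c m * (AA (Hc (e m)) (HT U (ET \<Theta>)) - AA (Hc (e m)) (HD \<Theta>)))"
    unfolding lin[OF HE_L2[OF T]] lin[OF HD_L2[OF T]] by (simp add: right_diff_distrib sum_subtractf)
  have "\<bar>AA (Hc (xi \<Theta>)) (HT U (ET \<Theta>)) - AA (Hc (xi \<Theta>)) (HD \<Theta>)\<bar> \<le> (\<Sum>m<n. \<bar>?c m\<bar> * \<bar>AA (Hc (e m)) (HT U (ET \<Theta>)) - AA (Hc (e m)) (HD \<Theta>)\<bar>)"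
    unfolding eq by (rule order_trans[OF sum_abs]) (simp only: abs_mult order_refl)
  also have "\<dots> \<le> C2 * (\<Sum>m<n. He m * nD \<Theta>) * \<rho> * nD \<Theta>"
    by (rule sum_coeff[where s="\<lambda>m. He m * nD \<Theta>", OF T]) (rule each, assumption, intro mult_nonneg_nonneg data_nonneg nD_nonneg)
  also have "\<dots> = C2 * (\<Sum>m<n. He m) * \<rho> * nD \<Theta> * nD \<Theta>"
    unfolding sum_distrib_right[symmetric, of He] by (simp only: ac_simps)
  finally show ?thesis .
qed

definition AD where "AD \<Theta> \<Phi> = AA (HD \<Theta>) (HD \<Phi>) + kap \<Theta> (GD \<Phi>)"

text \<open>Up to small terms the lower-order part at \<open>Phi\<close> is its value at the
  companion plus its value at \<xi>. The first is nearly the pairing of \<H>\<xi> with the Hessian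
  of the companion, hence with that of \<Theta>; the second is the squared norm of \<H>\<xi>. With
  the principal term they complete the square of \<H>\<Theta> + \<H>\<xi>, which
  \<open>stability\<close> bounds from below.\<close>

lemma coercivity:
  assumes T: "\<Theta> \<in> VT"
  shows "b1^2 / 2 * (nD \<Theta>)^2 \<le> AD \<Theta> (Phi \<Theta>)"
proof -
  let ?t = "nD \<Theta>" and ?X = "\<lambda>x. HD \<Theta> x + Hc (xi \<Theta>) x"
  let ?D = "\<lambda>x. HD (Ixi \<Theta>) x - Hc (xi \<Theta>) x" and ?G = "\<lambda>x. GD (Ixi \<Theta>) x - Gc (xi \<Theta>) x"
  let ?R = "\<lambda>x. GD \<Theta> x - GradT U (ET \<Theta>) x"
  note x = xi(1)[OF T] and I = Ixi[OF T]
  note hx = Hc_L2(1)[OF x] and gx = Gc_L4(1)[OF x] and hT = HD_L2[OF T] and gT = GD_L4[OF T]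
  have D: "L2fun U ?D" and G: "L4fun U ?G" and R: "L2fun U ?R" "L4fun U ?R" and X2: "L2fun U ?X"
    by (intro L2fun_diff(1) HD_L2 I(1) hx) (intro L4fun_diff(1) GD_L4 I(1) gx, intro L2fun_diff(1) GD_L2 T GE_L2,
        intro L4fun_diff(1) GD_L4 T GE_L4, intro L2fun_add(1) hx hT)
  have eH: "HD (Phi \<Theta>) = (\<lambda>x. (HD \<Theta> x + Hc (xi \<Theta>) x) + ?D x)" unfolding Phi_def HD_lin[OF T I(1)] by simp
  \<comment> \<open>The companion is inserted because \<xi> represents the lower-order part on
    conforming gradients only.\<close>
  have eG: "GD (Phi \<Theta>) = (\<lambda>x. (GradT U (ET \<Theta>) x + ?R x) + (Gc (xi \<Theta>) x + ?G x))" unfolding Phi_def GD_lin[OF T I(1)] by simp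
  have a: "AA (HD \<Theta>) (HD (Phi \<Theta>)) = AA (HD \<Theta>) (HD \<Theta>) + AA (HD \<Theta>) (Hc (xi \<Theta>)) + AA (HD \<Theta>) ?D"
    unfolding eH A_add2[OF hT X2 D] A_add2[OF hT hT hx] ..
  have s: "(L2n U ?X)^2 = AA (HD \<Theta>) (HD \<Theta>) + AA (HD \<Theta>) (Hc (xi \<Theta>)) + AA (Hc (xi \<Theta>)) (HD \<Theta>) + AA (Hc (xi \<Theta>)) (Hc (xi \<Theta>))"
    unfolding A_self[symmetric] A_add2[OF X2 hT hx] A_add1[OF hT hT hx] A_add1[OF hx hT hx] by (simp add: A_sym)
  have k: "kap \<Theta> (GD (Phi \<Theta>)) = kap \<Theta> (GradT U (ET \<Theta>)) + kap \<Theta> ?R + AA (Hc (xi \<Theta>)) (Hc (xi \<Theta>)) + kap \<Theta> ?G"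
    unfolding eG using kap_add[OF T L4fun_add(1)[OF GE_L4[OF T] R(2)] L4fun_add(1)[OF gx G]] kap_add[OF T GE_L4[OF T] R(2)] kap_add[OF T gx G] xi(3)[OF T]
    by (simp add: ip_def)
  have 1: "\<bar>AA (HD \<Theta>) ?D\<bar> \<le> ?t * (C3 * \<rho> * ?t)"
    using mult_left_mono[OF I(3) nD_nonneg[of \<Theta>]] A_bound[OF hT D] unfolding nD_def by linarith
  have 2: "\<bar>kap \<Theta> ?R\<bar> \<le> (Mh * (h4 * G0 + K) * ?t) * ((real CARD('k) * \<rho>) * ?t)"
    by (rule order_trans[OF kap_bound2[OF T R(1)]]) (intro mult_left_mono GE_err T mult_nonneg_nonneg add_nonneg_nonneg Mh(1) base_nonneg K0 nD_nonneg)
  have 3: "\<bar>kap \<Theta> ?G\<bar> \<le> (C1 * ?t) * (C3 * \<rho> * ?t)"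
    by (rule order_trans[OF kap_bound[OF T G]]) (intro mult_left_mono I(2) mult_nonneg_nonneg base_nonneg nD_nonneg)
  \<comment> \<open>The companion lies in X and need not be a test tuple, so the representation by
    \<xi> is extended by density.\<close>
  have "\<bar>AA (\<lambda>x. - Hc (xi \<Theta>) x) (HT U (ET \<Theta>)) + BB (HT U \<Psi>) (GD \<Theta>) (GradT U (ET \<Theta>)) + BB (HD \<Theta>) (GradT U \<Psi>) (GradT U (ET \<Theta>))\<bar> \<le> (C1 * ?t * \<epsilon>) * L2n U (HT U (ET \<Theta>))"
  proof (rule density_bound[OF ET_Xsp[OF T] L2fun_minus(1)[OF hx] P_L2 gT hT P_G4])
    fix \<phi> assume p: "\<phi> \<in> TS"
    show "\<bar>AA (\<lambda>x. - Hc (xi \<Theta>) x) (Hc \<phi>) + BB (HT U \<Psi>) (GD \<Theta>) (Gc \<phi>) + BB (HD \<Theta>) (GradT U \<Psi>) (Gc \<phi>)\<bar> \<le> (C1 * ?t * \<epsilon>) * L2n U (Hc \<phi>)"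
      using xi(2)[OF T p] by (simp add: kap_def ip_def Aform_def)
  qed
  also have "\<dots> \<le> (C1 * ?t * \<epsilon>) * (G0 * ?t)"
    unfolding G0_def by (intro mult_left_mono HE_bound T mult_nonneg_nonneg base_nonneg nD_nonneg eps0)
  finally have 4: "\<bar>kap \<Theta> (GradT U (ET \<Theta>)) - AA (Hc (xi \<Theta>)) (HT U (ET \<Theta>))\<bar> \<le> (C1 * ?t * \<epsilon>) * (G0 * ?t)"
    by (simp add: kap_def Aform_def)
  note 5 = Hc_xi_consistency[OF T]
  have "(L2n U ?X)^2 - AD \<Theta> (Phi \<Theta>) \<le> ?t * (C3 * \<rho> * ?t) + (Mh * (h4 * G0 + K) * ?t) * ((real CARD('k) * \<rho>) * ?t) + (C1 * ?t) * (C3 * \<rho> * ?t)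
     + (C1 * ?t * \<epsilon>) * (G0 * ?t) + C2 * (\<Sum>m<n. He m) * \<rho> * ?t * ?t"
    unfolding AD_def a k s using 1 2 3 4 5 by (simp only: abs_le_iff) linarith
  also have "\<dots> = (C6 * \<rho>) * ?t^2 + (C1 * \<epsilon> * G0) * ?t^2" by (simp add: C6_def algebra_simps power2_eq_square)
  also have "\<dots> \<le> (b1^2 / 4) * ?t^2 + (b1^2 / 4) * ?t^2" by (intro add_mono mult_right_mono r6 eps2) simp_all
  finally have "(L2n U ?X)^2 - AD \<Theta> (Phi \<Theta>) \<le> (b1^2 / 4) * ?t^2 + (b1^2 / 4) * ?t^2" .
  moreover have "(b1 * ?t)^2 \<le> (L2n U ?X)^2"
    using base_nonneg(7) by (intro power_mono stability T mult_nonneg_nonneg nD_nonneg) simp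
  ultimately show ?thesis unfolding power_mult_distrib times_divide_eq_left by linarith
qed

text \<open>Testing with \<open>Phi\<close> and dividing by the norm of \<Theta>; \<open>C7\<close>
  is the price for the size of the test function.\<close>

lemma discrete_inf_sup:
  assumes T: "\<Theta> \<in> VT" and c: "0 \<le> c" and b: "\<And>\<Phi>. \<Phi> \<in> VT \<Longrightarrow> \<bar>AD \<Theta> \<Phi>\<bar> \<le> c * nD \<Phi>"
  shows "bh * nD \<Theta> \<le> c"
proof (cases "nD \<Theta> = 0")
  case False
  then have t: "nD \<Theta> > 0" using nD_nonneg[of \<Theta>] by linarith
  have "b1^2 / 2 * (nD \<Theta>)^2 \<le> c * nD (Phi \<Theta>)" using coercivity[OF T] b[OF Phi(1)[OF T]] by linarith
  also have "\<dots> \<le> c * (C7 * nD \<Theta>)" by (rule mult_left_mono[OF Phi(2)[OF T] c])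
  finally have "(b1^2 / 2 * nD \<Theta>) * nD \<Theta> \<le> (c * C7) * nD \<Theta>" by (simp add: power2_eq_square algebra_simps)
  then have "b1^2 / 2 * nD \<Theta> \<le> c * C7" using t by (simp only: mult_le_cancel_right_pos)
  then show ?thesis using data_nonneg(6) by (simp add: bh_def field_simps)
qed (use c in simp)

end

section \<open>The Hessian scheme\<close>

text \<open>The added 1 lets the threshold be written as a quotient also for a = 0.\<close>

lemma small_factor:
  fixes a d r :: real
  assumes "0 \<le> a" "0 < d" "0 \<le> r" "r \<le> d / (a + 1)" shows "a * r \<le> d"
proof -
  have "(a + 1) * r \<le> d" using assms by (simp add: pos_le_divide_eq add_nonneg_pos mult.commute)
  then show ?thesis using assms(3) by (simp add: distrib_right)
qed

context hess_regular
begin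

definition bb where "bb \<Theta> \<Theta>' \<Phi> = BB (HD \<Theta>) (GD \<Theta>') (GD \<Phi>)"

lemma bb_BI: "\<Theta> \<in> VT \<Longrightarrow> \<Theta>' \<in> VT \<Longrightarrow> \<Phi> \<in> VT \<Longrightarrow> BI (HD \<Theta>) (GD \<Theta>') (GD \<Phi>)"
  by (intro B_244(1) HD_L2 GD_L4)

lemma bb_lin:
  "\<Theta>' \<in> VT \<Longrightarrow> \<Phi> \<in> VT \<Longrightarrow> lin_on VT (\<lambda>\<Theta>. bb \<Theta> \<Theta>' \<Phi>)"
  "\<Theta> \<in> VT \<Longrightarrow> \<Phi> \<in> VT \<Longrightarrow> lin_on VT (\<lambda>\<Theta>'. bb \<Theta> \<Theta>' \<Phi>)"
  "\<Theta> \<in> VT \<Longrightarrow> \<Theta>' \<in> VT \<Longrightarrow> lin_on VT (bb \<Theta> \<Theta>')"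
  unfolding lin_on_def bb_def
  by (simp_all add: HD_lin GD_lin B_lin1[OF bb_BI bb_BI] B_lin2[OF bb_BI bb_BI] B_lin3[OF bb_BI bb_BI])

lemma bb_bound:
  assumes T: "\<Theta> \<in> VT" "\<Theta>' \<in> VT" "\<Phi> \<in> VT"
  shows "\<bar>bb \<Theta> \<Theta>' \<Phi>\<bar> \<le> (Mh * G0 * G0) * nD \<Theta> * nD \<Theta>' * nD \<Phi>"
proof -
  have "\<bar>bb \<Theta> \<Theta>' \<Phi>\<bar> \<le> Mh * (nD \<Theta> * (L4n U (GD \<Theta>') * L4n U (GD \<Phi>)))"
    unfolding bb_def nD_def by (intro B_244(2) HD_L2 GD_L4 T)
  also have "\<dots> \<le> Mh * (nD \<Theta> * ((G0 * nD \<Theta>') * (G0 * nD \<Phi>)))"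
    using base_nonneg by (intro mult_left_mono mult_mono GD_G0 T Mh(1)) simp_all
  finally show ?thesis by (simp add: ac_simps)
qed

lemma A_lin_VT:
  "\<Phi> \<in> VT \<Longrightarrow> lin_on VT (\<lambda>\<Theta>. AA (HD \<Theta>) (HD \<Phi>))" "\<Theta> \<in> VT \<Longrightarrow> lin_on VT (\<lambda>\<Phi>. AA (HD \<Theta>) (HD \<Phi>))"
proof -
  show 2: "lin_on VT (\<lambda>\<Phi>. AA (HD \<Theta>) (HD \<Phi>))" if "\<Theta> \<in> VT" for \<Theta>
    unfolding lin_on_def by (simp add: HD_lin A_lin2 HD_L2 that)
  show "lin_on VT (\<lambda>\<Theta>. AA (HD \<Theta>) (HD \<Phi>))" if "\<Phi> \<in> VT"
    using 2[OF that] by (simp only: A_sym[of "HD \<Phi>"])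
qed

definition P where "P = QD \<Psi>"

lemma P: "P \<in> VT" "L2n U (\<lambda>x. FD P x - tup \<Psi> x) \<le> \<rho> * SP"
    "L4n U (\<lambda>x. GD P x - GradT U \<Psi> x) \<le> \<rho> * SP" "L2n U (\<lambda>x. HD P x - HT U \<Psi> x) \<le> \<rho> * SP"
  unfolding P_def SP_def by (rule QD_bound[OF P3 XP])+

lemma P_diff: "L4fun U (\<lambda>x. GD P x - GradT U \<Psi> x)" "L2fun U (\<lambda>x. HD P x - HT U \<Psi> x)"
  by (intro L4fun_diff(1) GD_L4 P(1) P_G4) (intro L2fun_diff(1) HD_L2 P(1) P_L2)

text \<open>The derivative of the scheme at \<open>P\<close> in direction \<Theta>. Linearising at
  the interpolant rather than at \<Psi> makes the equation for the correction exactly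
  quadratic.\<close>

definition aP where "aP \<Theta> \<Phi> = AA (HD \<Theta>) (HD \<Phi>) + bb P \<Theta> \<Phi> + bb \<Theta> P \<Phi>"

text \<open>Each trilinear term changes in one argument, by the interpolation error of
  \<Psi>.\<close>

lemma aP_AD:
  assumes T: "\<Theta> \<in> VT" "\<Phi> \<in> VT"
  shows "\<bar>aP \<Theta> \<Phi> - AD \<Theta> \<Phi>\<bar> \<le> (C8 * \<rho>) * nD \<Theta> * nD \<Phi>"
proof -
  let ?H = "\<lambda>x. HD P x - HT U \<Psi> x" and ?G = "\<lambda>x. GD P x - GradT U \<Psi> x"
  note f = GD_L4[OF T(1)] GD_L4[OF T(2)] HD_L2[OF T(1)] GD_L4[OF P(1)] HD_L2[OF P(1)]
  have e1: "BB ?H (GD \<Theta>) (GD \<Phi>) = bb P \<Theta> \<Phi> - BB (HT U \<Psi>) (GD \<Theta>) (GD \<Phi>)"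
    unfolding bb_def by (intro B_diff(1) B_244(1) P_L2 f)
  have e2: "BB (HD \<Theta>) ?G (GD \<Phi>) = bb \<Theta> P \<Phi> - BB (HD \<Theta>) (GradT U \<Psi>) (GD \<Phi>)"
    unfolding bb_def by (intro B_diff(2) B_244(1) P_G4 f)
  have "\<bar>BB ?H (GD \<Theta>) (GD \<Phi>)\<bar> \<le> Mh * (L2n U ?H * (L4n U (GD \<Theta>) * L4n U (GD \<Phi>)))"
    by (rule B_244(2)[OF P_diff(2) f(1,2)])
  also have "\<dots> \<le> Mh * ((\<rho> * SP) * ((G0 * nD \<Theta>) * (G0 * nD \<Phi>)))"
    using base_nonneg data_nonneg rho by (intro mult_left_mono mult_mono GD_G0 T Mh(1) P(4)) simp_all
  finally have 1: "\<bar>BB ?H (GD \<Theta>) (GD \<Phi>)\<bar> \<le> Mh * ((\<rho> * SP) * ((G0 * nD \<Theta>) * (G0 * nD \<Phi>)))" .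
  have "\<bar>BB (HD \<Theta>) ?G (GD \<Phi>)\<bar> \<le> Mh * (nD \<Theta> * (L4n U ?G * L4n U (GD \<Phi>)))"
    unfolding nD_def by (rule B_244(2)[OF f(3) P_diff(1) f(2)])
  also have "\<dots> \<le> Mh * (nD \<Theta> * ((\<rho> * SP) * (G0 * nD \<Phi>)))"
    using base_nonneg data_nonneg rho by (intro mult_left_mono mult_mono GD_G0 T Mh(1) P(3)) simp_all
  finally have 2: "\<bar>BB (HD \<Theta>) ?G (GD \<Phi>)\<bar> \<le> Mh * (nD \<Theta> * ((\<rho> * SP) * (G0 * nD \<Phi>)))" .
  have "aP \<Theta> \<Phi> - AD \<Theta> \<Phi> = BB ?H (GD \<Theta>) (GD \<Phi>) + BB (HD \<Theta>) ?G (GD \<Phi>)"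
    unfolding e1 e2 aP_def AD_def kap_def by simp
  then have "\<bar>aP \<Theta> \<Phi> - AD \<Theta> \<Phi>\<bar> \<le> Mh * ((\<rho> * SP) * ((G0 * nD \<Theta>) * (G0 * nD \<Phi>))) + Mh * (nD \<Theta> * ((\<rho> * SP) * (G0 * nD \<Phi>)))"
    using 1 2 by linarith
  also have "\<dots> = (C8 * \<rho>) * nD \<Theta> * nD \<Phi>" by (simp add: C8_def algebra_simps)
  finally show ?thesis .
qed

lemma aP_inf_sup:
  assumes T: "\<Theta> \<in> VT" and c: "0 \<le> c" and b: "\<And>\<Phi>. \<Phi> \<in> VT \<Longrightarrow> \<bar>aP \<Theta> \<Phi>\<bar> \<le> c * nD \<Phi>"
  shows "bh / 2 * nD \<Theta> \<le> c"
proof -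
  have "bh * nD \<Theta> \<le> c + (C8 * \<rho>) * nD \<Theta>"
  proof (rule discrete_inf_sup[OF T])
    show "0 \<le> c + (C8 * \<rho>) * nD \<Theta>" using c rho data_nonneg(10) by (intro add_nonneg_nonneg mult_nonneg_nonneg) simp_all
    show "\<bar>AD \<Theta> \<Phi>\<bar> \<le> (c + (C8 * \<rho>) * nD \<Theta>) * nD \<Phi>" if "\<Phi> \<in> VT" for \<Phi>
      using b[OF that] aP_AD[OF T that] unfolding distrib_right by linarith
  qed
  also have "(C8 * \<rho>) * nD \<Theta> \<le> bh / 2 * nD \<Theta>" by (intro mult_right_mono r8 nD_nonneg)
  finally show ?thesis by (simp add: field_simps)
qed

text \<open>The continuous equation tested with the companion is subtracted, and \<open>P\<close>
  and \<Phi> are exchanged for \<Psi> and the companion one argument at a time. Three differences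
  are interpolation errors, one is a consistency error, and in the last the gradient error of the
  companion meets the Hessian of \<Psi> in L4.\<close>

lemma residual_bound:
  assumes sol: "cont_sol U h L \<Psi>" and T: "\<Phi> \<in> VT"
  shows "\<bar>AA (HD P) (HD \<Phi>) + bb P P \<Phi> - L (ET \<Phi>)\<bar> \<le> (C9 * \<rho>) * nD \<Phi>"
proof -
  let ?H = "\<lambda>x. HD P x - HT U \<Psi> x" and ?G = "\<lambda>x. GD P x - GradT U \<Psi> x" and ?R = "\<lambda>x. GD \<Phi> x - GradT U (ET \<Phi>) x"
  note f = GD_L4[OF T] HD_L2[OF T] GD_L4[OF P(1)] HD_L2[OF P(1)] GE_L4[OF T] HE_L2[OF T]
  have R: "L2fun U ?R" by (intro L2fun_diff(1) GD_L2 GE_L2 T)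
  have L: "L (ET \<Phi>) = AA (HT U \<Psi>) (HT U (ET \<Phi>)) + BB (HT U \<Psi>) (GradT U \<Psi>) (GradT U (ET \<Phi>))"
    using sol ET_Xsp[OF T] unfolding cont_sol_def by simp
  have e1: "AA ?H (HD \<Phi>) = AA (HD P) (HD \<Phi>) - AA (HT U \<Psi>) (HD \<Phi>)" by (rule A_diff1[OF f(2,4) P_L2])
  have e2: "BB ?H (GD P) (GD \<Phi>) = bb P P \<Phi> - BB (HT U \<Psi>) (GD P) (GD \<Phi>)"
    unfolding bb_def by (intro B_diff(1) B_244(1) P_L2 f)
  have e3: "BB (HT U \<Psi>) ?G (GD \<Phi>) = BB (HT U \<Psi>) (GD P) (GD \<Phi>) - BB (HT U \<Psi>) (GradT U \<Psi>) (GD \<Phi>)"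
    by (intro B_diff(2) B_244(1) P_L2 P_G4 f)
  have e4: "BB (HT U \<Psi>) (GradT U \<Psi>) ?R = BB (HT U \<Psi>) (GradT U \<Psi>) (GD \<Phi>) - BB (HT U \<Psi>) (GradT U \<Psi>) (GradT U (ET \<Phi>))"
    by (intro B_diff(3) B_244(1) P_L2 P_G4 f)
  have rS: "0 \<le> \<rho> * SP" using rho data_nonneg(8) by simp
  have 1: "\<bar>AA ?H (HD \<Phi>)\<bar> \<le> (\<rho> * SP) * nD \<Phi>"
    by (rule order_trans[OF A_bound[OF P_diff(2) f(2)]]) (unfold nD_def, intro mult_right_mono P(4) L2n_nonneg)
  have 2: "\<bar>AA (HT U \<Psi>) (HD \<Phi>) - AA (HT U \<Psi>) (HT U (ET \<Phi>))\<bar> \<le> \<rho> * CP * nD \<Phi>"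
    unfolding CP_def by (rule HT_consistency[OF P3 T])
  have gP: "L4n U (GD P) \<le> g4 + SP"
  proof -
    have "GD P = (\<lambda>x. GradT U \<Psi> x + ?G x)" by simp
    then have "L4n U (GD P) \<le> g4 + L4n U ?G" using L4fun_add(2)[OF P_G4 P_diff(1)] by (simp add: g4_def)
    also have "L4n U ?G \<le> 1 * SP" by (rule order_trans[OF P(3)]) (intro mult_right_mono r1 data_nonneg)
    finally show ?thesis by simp
  qed
  have "\<bar>BB ?H (GD P) (GD \<Phi>)\<bar> \<le> Mh * (L2n U ?H * (L4n U (GD P) * L4n U (GD \<Phi>)))"
    by (rule B_244(2)[OF P_diff(2) f(3,1)])
  also have "\<dots> \<le> Mh * ((\<rho> * SP) * ((g4 + SP) * (G0 * nD \<Phi>)))"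
    using base_nonneg data_nonneg rS by (intro mult_left_mono mult_mono GD_G0 T gP Mh(1) P(4)) simp_all
  finally have 3: "\<bar>BB ?H (GD P) (GD \<Phi>)\<bar> \<le> Mh * ((\<rho> * SP) * ((g4 + SP) * (G0 * nD \<Phi>)))" .
  have "\<bar>BB (HT U \<Psi>) ?G (GD \<Phi>)\<bar> \<le> Mh * (h2 * (L4n U ?G * L4n U (GD \<Phi>)))"
    unfolding h2_def by (rule B_244(2)[OF P_L2 P_diff(1) f(1)])
  also have "\<dots> \<le> Mh * (h2 * ((\<rho> * SP) * (G0 * nD \<Phi>)))"
    using base_nonneg rS by (intro mult_left_mono mult_mono GD_G0 T Mh(1) P(3)) simp_all
  finally have 4: "\<bar>BB (HT U \<Psi>) ?G (GD \<Phi>)\<bar> \<le> Mh * (h2 * ((\<rho> * SP) * (G0 * nD \<Phi>)))" .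
  have "\<bar>BB (HT U \<Psi>) (GradT U \<Psi>) ?R\<bar> \<le> Mh * (h4 * g4 * L2n U ?R)"
    unfolding h4_def g4_def by (rule B_442(2)[OF P_L4 P_G4 R])
  also have "\<dots> \<le> Mh * (h4 * g4 * ((real CARD('k) * \<rho>) * nD \<Phi>))"
    using base_nonneg by (intro mult_left_mono GE_err T Mh(1)) simp_all
  finally have 5: "\<bar>BB (HT U \<Psi>) (GradT U \<Psi>) ?R\<bar> \<le> Mh * (h4 * g4 * ((real CARD('k) * \<rho>) * nD \<Phi>))" .
  have "AA (HD P) (HD \<Phi>) + bb P P \<Phi> - L (ET \<Phi>) = AA ?H (HD \<Phi>) + (AA (HT U \<Psi>) (HD \<Phi>) - AA (HT U \<Psi>) (HT U (ET \<Phi>)))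
    + BB ?H (GD P) (GD \<Phi>) + BB (HT U \<Psi>) ?G (GD \<Phi>) + BB (HT U \<Psi>) (GradT U \<Psi>) ?R"
    unfolding e1 e2 e3 e4 L by simp
  then have "\<bar>AA (HD P) (HD \<Phi>) + bb P P \<Phi> - L (ET \<Phi>)\<bar> \<le> (\<rho> * SP) * nD \<Phi> + \<rho> * CP * nD \<Phi> + Mh * ((\<rho> * SP) * ((g4 + SP) * (G0 * nD \<Phi>)))
    + Mh * (h2 * ((\<rho> * SP) * (G0 * nD \<Phi>))) + Mh * (h4 * g4 * ((real CARD('k) * \<rho>) * nD \<Phi>))"
    using 1 2 3 4 5 by linarith
  also have "\<dots> = (C9 * \<rho>) * nD \<Phi>" by (simp add: C9_def algebra_simps)
  finally show ?thesis .
qed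

lemma L_lin:
  assumes "Hminus1 U L" shows "lin_on VT (\<lambda>\<Phi>. L (ET \<Phi>))"
  unfolding lin_on_def
proof (intro ballI allI)
  fix u v a b assume uv: "u \<in> VT" "v \<in> VT"
  have s: "sob0 U 1 (ET w i)" if "w \<in> VT" for w i
    unfolding ET_def by (rule sob0_mono[OF comp(2)[OF VT_nth[OF that]]]) simp
  have "ET (a *\<^sub>R u + b *\<^sub>R v) = (\<lambda>i x. a * ET u i x + b * ET v i x)"
    unfolding ET_def comb_nth by (intro ext) (simp add: E_lin VT_nth uv)
  then show "L (ET (a *\<^sub>R u + b *\<^sub>R v)) = a * L (ET u) + b * L (ET v)"
    using assms s uv unfolding Hminus1_def by simp
qed

lemma lin_on_add: "lin_on S f \<Longrightarrow> lin_on S g \<Longrightarrow> lin_on S (\<lambda>u. f u + g u)"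
  and lin_on_minus: "lin_on S f \<Longrightarrow> lin_on S g \<Longrightarrow> lin_on S (\<lambda>u. f u - g u)"
  by (simp_all add: lin_on_def algebra_simps)

text \<open>With the solution written as \<open>P\<close> plus a correction, the scheme becomes a
  quadratic equation whose constant term is the residual of \<open>P\<close>; the inf-sup constant
  bh/2 and the residual C9 \<rho> determine the radius.\<close>

lemma scheme_solvable:
  assumes sol: "cont_sol U h L \<Psi>" and H: "Hminus1 U L"
  shows "\<exists>\<Theta>\<in>VT. nD \<Theta> \<le> 4 * C9 / bh * \<rho> \<and> (\<forall>\<Phi>\<in>VT. AA (HD (P + \<Theta>)) (HD \<Phi>) + bb (P + \<Theta>) (P + \<Theta>) \<Phi> = L (ET \<Phi>))"
proof -
  interpret fV: fin_space VT "(UNIV :: 'k set) \<times> {..<N}" "\<lambda>b i j. if (i, j) = b then 1 else 0" "\<lambda>b v. v (fst b) (snd b)"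
    by (rule fin_space_VT)
  obtain Cx where Cx: "\<forall>b\<in>(UNIV :: 'k set) \<times> {..<N}. \<forall>v\<in>VT. \<bar>v (fst b) (snd b)\<bar> \<le> Cx * nD v" using VT_coord by (rule exE)
  note bl = bb_lin and P1 = P(1)
  let ?R = "\<lambda>\<Phi>. AA (HD P) (HD \<Phi>) + bb P P \<Phi> - L (ET \<Phi>)"
  have "\<exists>\<Theta>\<in>VT. nD \<Theta> \<le> 2 * (C9 * \<rho>) / (bh / 2) \<and> (\<forall>\<Phi>\<in>VT. aP \<Theta> \<Phi> + ?R \<Phi> + bb \<Theta> \<Theta> \<Phi> = 0)"
  \<comment> \<open>\<open>Ca\<close> has to be a continuity constant of \<open>aP\<close>; it adds
    a bound for \<open>AD\<close> to half of \<open>bh\<close>, which covers the difference of the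
    two forms.\<close>
  proof (rule fV.quadratic_fixed_point[where a=aP and bb=bb and nm=nD and R="?R" and Ca="bh / 2 + (1 + (C8 + Mh * (h2 * G0 + g4) * G0) * 1)" and Cx=Cx and m="Mh * G0 * G0"])
    show "0 \<le> nD u" for u by simp
    show "nD (u + v) \<le> nD u + nD v" if "u \<in> VT" "v \<in> VT" for u v
      using HD_lin[OF that, of 1 1] L2fun_add(2)[OF HD_L2[OF that(1)] HD_L2[OF that(2)]] by (simp add: nD_def)
    show "nD (c *\<^sub>R u) = \<bar>c\<bar> * nD u" if "u \<in> VT" for c u
      using HD_lin[OF that that, of c 0] L2fun_scale(2)[OF HD_L2[OF that], of c] by (simp add: nD_def)
    show "u = 0" if "u \<in> VT" "nD u = 0" for u by (rule nD_def_pos[OF that])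
    show "\<bar>u (fst b) (snd b)\<bar> \<le> Cx * nD u" if "b \<in> UNIV \<times> {..<N}" "u \<in> VT" for b u using Cx that by blast
    show "lin_on VT (\<lambda>\<Theta>. aP \<Theta> \<Phi>)" if "\<Phi> \<in> VT" for \<Phi>
      unfolding aP_def by (intro lin_on_add A_lin_VT(1) bl(1,2) P1 that)
    show "lin_on VT (aP \<Theta>)" if "\<Theta> \<in> VT" for \<Theta>
      unfolding aP_def[abs_def] by (intro lin_on_add A_lin_VT(2) bl(3) P1 that)
    show "\<bar>aP \<Theta> \<Phi>\<bar> \<le> (bh / 2 + (1 + (C8 + Mh * (h2 * G0 + g4) * G0) * 1)) * nD \<Theta> * nD \<Phi>" if T: "\<Theta> \<in> VT" "\<Phi> \<in> VT" for \<Theta> \<Phi>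
    proof -
      have "\<bar>AA (HD \<Theta>) (HD \<Phi>)\<bar> \<le> nD \<Theta> * nD \<Phi>" unfolding nD_def by (rule A_bound[OF HD_L2[OF T(1)] HD_L2[OF T(2)]])
      moreover have "\<bar>kap \<Theta> (GD \<Phi>)\<bar> \<le> (C1 * nD \<Theta>) * (G0 * nD \<Phi>)"
        by (rule order_trans[OF kap_bound[OF T(1) GD_L4[OF T(2)]]]) (intro mult_left_mono GD_G0 T mult_nonneg_nonneg base_nonneg nD_nonneg)
      moreover have "(C8 * \<rho>) * nD \<Theta> * nD \<Phi> \<le> bh / 2 * nD \<Theta> * nD \<Phi>" by (intro mult_right_mono r8 nD_nonneg)
      moreover have "0 \<le> C8 * nD \<Theta> * nD \<Phi>" using data_nonneg(10) by simp
      moreover have "(bh / 2 + (1 + (C8 + Mh * (h2 * G0 + g4) * G0) * 1)) * nD \<Theta> * nD \<Phi>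
        = bh / 2 * nD \<Theta> * nD \<Phi> + nD \<Theta> * nD \<Phi> + C8 * nD \<Theta> * nD \<Phi> + (C1 * nD \<Theta>) * (G0 * nD \<Phi>)"
        by (simp add: C1_def algebra_simps)
      ultimately show ?thesis using aP_AD[OF T] unfolding AD_def by linarith
    qed
    show "bh / 2 * nD \<Theta> \<le> c" if "\<Theta> \<in> VT" "0 \<le> c" "\<And>\<Phi>. \<Phi> \<in> VT \<Longrightarrow> \<bar>aP \<Theta> \<Phi>\<bar> \<le> c * nD \<Phi>" for \<Theta> c
      by (rule aP_inf_sup[OF that])
    show "0 < bh / 2" using data_nonneg(7) by simp
    show "lin_on VT ?R" by (intro lin_on_minus lin_on_add A_lin_VT(2) bl(3) P1 L_lin H)
    show "\<bar>?R \<Phi>\<bar> \<le> (C9 * \<rho>) * nD \<Phi>" if "\<Phi> \<in> VT" for \<Phi> by (rule residual_bound[OF sol that])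
    show "0 \<le> C9 * \<rho>" using data_nonneg(11) rho by simp
    show "lin_on VT (\<lambda>\<Theta>. bb \<Theta> \<Theta>' \<Phi>)" if "\<Theta>' \<in> VT" "\<Phi> \<in> VT" for \<Theta>' \<Phi> by (rule bl(1)[OF that])
    show "lin_on VT (\<lambda>\<Theta>'. bb \<Theta> \<Theta>' \<Phi>)" if "\<Theta> \<in> VT" "\<Phi> \<in> VT" for \<Theta> \<Phi> by (rule bl(2)[OF that])
    show "lin_on VT (bb \<Theta> \<Theta>')" if "\<Theta> \<in> VT" "\<Theta>' \<in> VT" for \<Theta> \<Theta>' by (rule bl(3)[OF that])
    show "\<bar>bb \<Theta> \<Theta>' \<Phi>\<bar> \<le> Mh * G0 * G0 * nD \<Theta> * nD \<Theta>' * nD \<Phi>" if "\<Theta> \<in> VT" "\<Theta>' \<in> VT" "\<Phi> \<in> VT" for \<Theta> \<Theta>' \<Phi>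
      by (rule bb_bound[OF that])
    show "0 \<le> Mh * G0 * G0" using Mh(1) base_nonneg by simp
    show "8 * (Mh * G0 * G0) * (C9 * \<rho>) \<le> (bh / 2)^2" using r9 by (simp only: mult.assoc)
  qed
  then obtain \<Theta> where T: "\<Theta> \<in> VT" "nD \<Theta> \<le> 2 * (C9 * \<rho>) / (bh / 2)" and eq: "\<forall>\<Phi>\<in>VT. aP \<Theta> \<Phi> + ?R \<Phi> + bb \<Theta> \<Theta> \<Phi> = 0"
    by (elim bexE conjE) (rule that)
  have "AA (HD (P + \<Theta>)) (HD \<Phi>) + bb (P + \<Theta>) (P + \<Theta>) \<Phi> = L (ET \<Phi>)" if F: "\<Phi> \<in> VT" for \<Phi>
  proof -
    have S: "P + \<Theta> \<in> VT" by (rule subspace_add[OF VT_subspace P1 T(1)])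
    have "AA (HD (P + \<Theta>)) (HD \<Phi>) = AA (HD P) (HD \<Phi>) + AA (HD \<Theta>) (HD \<Phi>)"
      by (rule lin_on_simps(2)[OF A_lin_VT(1)[OF F] VT_subspace P1 T(1)])
    moreover have "bb (P + \<Theta>) (P + \<Theta>) \<Phi> = bb P (P + \<Theta>) \<Phi> + bb \<Theta> (P + \<Theta>) \<Phi>"
      by (rule lin_on_simps(2)[OF bl(1)[OF S F] VT_subspace P1 T(1)])
    moreover have "bb P (P + \<Theta>) \<Phi> = bb P P \<Phi> + bb P \<Theta> \<Phi>"
      by (rule lin_on_simps(2)[OF bl(2)[OF P1 F] VT_subspace P1 T(1)])
    moreover have "bb \<Theta> (P + \<Theta>) \<Phi> = bb \<Theta> P \<Phi> + bb \<Theta> \<Theta> \<Phi>"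
      by (rule lin_on_simps(2)[OF bl(2)[OF T(1) F] VT_subspace P1 T(1)])
    moreover have "aP \<Theta> \<Phi> + ?R \<Phi> + bb \<Theta> \<Theta> \<Phi> = 0" using eq F by blast
    ultimately show ?thesis unfolding aP_def by linarith
  qed
  moreover have "2 * (C9 * \<rho>) / (bh / 2) = 4 * C9 / bh * \<rho>" by simp
  ultimately show ?thesis using T by (intro bexI[of _ \<Theta>]) simp_all
qed

definition mm where "mm = sqrt (sqrt (measure M U))"
definition "C10 = 4 * C9 / bh"

text \<open>The gradient error is measured in L4, where interpolation and the discrete gradient are
  both controlled, and then lowered to L2 at the cost of \<open>mm\<close>.\<close>

lemma error_estimates:
  assumes T: "\<Theta> \<in> VT" "nD \<Theta> \<le> C10 * \<rho>"
  shows "L2n U (\<lambda>x. HT U \<Psi> x - HD (P + \<Theta>) x) \<le> (SP + C10) * \<rho>"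
    "L2n U (\<lambda>x. GradT U \<Psi> x - GD (P + \<Theta>) x) \<le> mm * (SP + G0 * C10) * \<rho>"
    "L2n U (\<lambda>x. tup \<Psi> x - FD (P + \<Theta>) x) \<le> (SP + G0 * C10) * \<rho>"
proof -
  have "P + \<Theta> = 1 *\<^sub>R P + 1 *\<^sub>R \<Theta>" by simp
  then have e: "HD (P + \<Theta>) = (\<lambda>x. HD P x + HD \<Theta> x)" "GD (P + \<Theta>) = (\<lambda>x. GD P x + GD \<Theta> x)" "FD (P + \<Theta>) = (\<lambda>x. FD P x + FD \<Theta> x)"
    using HD_lin[OF P(1) T(1), of 1 1] GD_lin[OF P(1) T(1), of 1 1] FD_lin[OF P(1) T(1), of 1 1] by simp_all
  have S: "P + \<Theta> \<in> VT" by (rule subspace_add[OF VT_subspace P(1) T(1)])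
  have GT: "G0 * nD \<Theta> \<le> G0 * (C10 * \<rho>)" by (intro mult_left_mono T(2) base_nonneg)
  have psi: "L2fun U (tup \<Psi>)" by (intro L2_tup(1) sob_L2[OF P3])
  have dF: "L2fun U (\<lambda>x. FD P x - tup \<Psi> x)" by (intro L2fun_diff(1) FD_L2 P(1) psi)
  have "(\<lambda>x. HT U \<Psi> x - HD (P + \<Theta>) x) = (\<lambda>x. - ((HD P x - HT U \<Psi> x) + HD \<Theta> x))" unfolding e by auto
  then have "L2n U (\<lambda>x. HT U \<Psi> x - HD (P + \<Theta>) x) \<le> \<rho> * SP + nD \<Theta>"
    using L2fun_minus(2)[OF L2fun_add(1)[OF P_diff(2) HD_L2[OF T(1)]]] L2fun_add(2)[OF P_diff(2) HD_L2[OF T(1)]] P(4) by (simp add: nD_def)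
  also have "\<dots> \<le> (SP + C10) * \<rho>" using T(2) by (simp add: algebra_simps)
  finally show "L2n U (\<lambda>x. HT U \<Psi> x - HD (P + \<Theta>) x) \<le> (SP + C10) * \<rho>" .
  have "(\<lambda>x. GradT U \<Psi> x - GD (P + \<Theta>) x) = (\<lambda>x. - ((GD P x - GradT U \<Psi> x) + GD \<Theta> x))" unfolding e by auto
  then have "L4n U (\<lambda>x. GradT U \<Psi> x - GD (P + \<Theta>) x) \<le> \<rho> * SP + G0 * nD \<Theta>"
    using L4fun_minus(2)[OF L4fun_add(1)[OF P_diff(1) GD_L4[OF T(1)]]] L4fun_add(2)[OF P_diff(1) GD_L4[OF T(1)]] P(3) GD_G0[OF T(1)] by simp
  also have "\<dots> \<le> (SP + G0 * C10) * \<rho>" using GT by (simp add: algebra_simps)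
  finally have "mm * L4n U (\<lambda>x. GradT U \<Psi> x - GD (P + \<Theta>) x) \<le> mm * ((SP + G0 * C10) * \<rho>)" by (intro mult_left_mono) (simp_all add: mm_def)
  then show "L2n U (\<lambda>x. GradT U \<Psi> x - GD (P + \<Theta>) x) \<le> mm * (SP + G0 * C10) * \<rho>"
    using L4fun_imp_L2fun(2)[OF fin_M L4fun_diff(1)[OF P_G4 GD_L4[OF S]]] by (simp add: mm_def mult.assoc)
  have "(\<lambda>x. tup \<Psi> x - FD (P + \<Theta>) x) = (\<lambda>x. - ((FD P x - tup \<Psi> x) + FD \<Theta> x))" unfolding e by auto
  then have "L2n U (\<lambda>x. tup \<Psi> x - FD (P + \<Theta>) x) \<le> \<rho> * SP + G0 * nD \<Theta>"
    using L2fun_minus(2)[OF L2fun_add(1)[OF dF FD_L2[OF T(1)]]] L2fun_add(2)[OF dF FD_L2[OF T(1)]] P(2) FD_bound[OF T(1)] by (simp add: G0_def)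
  also have "\<dots> \<le> (SP + G0 * C10) * \<rho>" using GT by (simp add: algebra_simps)
  finally show "L2n U (\<lambda>x. tup \<Psi> x - FD (P + \<Theta>) x) \<le> (SP + G0 * C10) * \<rho>" .
qed

end

context regular_data
begin

lemma scheme_estimates:
  assumes sol: "cont_sol U h L \<Psi>" and H: "Hminus1 U L"
  shows "\<exists>\<rho>0>0. \<exists>C. \<forall>\<rho> N PiD Gr Hs E. \<rho> \<le> \<rho>0 \<and> hess_scheme U N PiD Gr Hs E \<rho> \<Gamma> \<longrightarrow>
     (\<exists>\<Psi>D. scheme_sol U h L N Gr Hs E \<Psi>D
          \<and> L2n U (tup (\<lambda>i. Hs (\<lambda>j. \<Psi>D i j - PD U N PiD Gr Hs (\<Psi> i) j))) \<le> C * \<rho>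
          \<and> L2n U (\<lambda>x. HT U \<Psi> x - tup (\<lambda>i. Hs (\<Psi>D i)) x) \<le> C * \<rho>
          \<and> L2n U (\<lambda>x. GradT U \<Psi> x - tup (\<lambda>i. Gr (\<Psi>D i)) x) \<le> C * \<rho>
          \<and> L2n U (\<lambda>x. tup \<Psi> x - tup (\<lambda>i. PiD (\<Psi>D i)) x) \<le> C * \<rho>)"
    (is "\<exists>\<rho>0>0. \<exists>C. \<forall>\<rho> N PiD Gr Hs E. _ \<longrightarrow> ?Q C \<rho> N PiD Gr Hs E")
proof -
  let ?m = "8 * (Mh * G0 * G0) * C9"
  \<comment> \<open>One threshold for each assumption of \<open>hess_regular\<close>; all are built
    from constants of \<open>regular_data\<close>, in which no discretisation occurs.\<close>
  let ?S = "{1, \<beta> / 4 / (C5 + 1), b1^2 / 4 / (C6 + 1), bh / 2 / (C8 + 1), (bh / 2)^2 / (?m + 1)}"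
  define \<rho>0 where "\<rho>0 = Min ?S"
  define C10 where "C10 = 4 * C9 / bh"
  define mm where "mm = sqrt (sqrt (measure M U))"
  \<comment> \<open>The sum of the constants of the three estimates; it also dominates
    \<open>C10\<close>, the constant for the distance to the interpolant.\<close>
  define C where "C = (SP + C10) + mm * (SP + G0 * C10) + (SP + G0 * C10)"
  have m0: "0 \<le> ?m" using Mh(1) base_nonneg data_nonneg by simp
  have pos: "0 < \<beta> / 4" "0 < b1^2 / 4" "0 < bh / 2" "0 < (bh / 2)^2" using beta base_nonneg(7) data_nonneg(7) by simp_all
  have "0 < \<rho>0" unfolding \<rho>0_def using pos m0 data_nonneg by (simp add: add_nonneg_pos)
  have C10: "0 \<le> C10" unfolding C10_def using data_nonneg by simp
  have mm: "0 \<le> mm" unfolding mm_def by simp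
  have nn: "0 \<le> SP + C10" "0 \<le> SP + G0 * C10" "0 \<le> mm * (SP + G0 * C10)" using C10 mm data_nonneg(8) base_nonneg(4) by simp_all
  have main: "?Q C \<rho> N PiD Gr Hs E"
    if hyp: "\<rho> \<le> \<rho>0 \<and> hess_scheme U N PiD Gr Hs E \<rho> \<Gamma>" for \<rho> N PiD Gr Hs E
  proof -
    note le = conjunct1[OF hyp]
    interpret hs: hess_scheme U N PiD Gr Hs E \<rho> \<Gamma> by (rule conjunct2[OF hyp])
    note rp = hs.rho
    have le': "\<rho> \<le> s" if "s \<in> ?S" for s
      by (rule order_trans[OF le[unfolded \<rho>0_def] Min_le[OF _ that]]) simp
    interpret hr: hess_regular U h \<Psi> K \<beta> C0 \<Gamma> \<epsilon> n e N PiD Gr Hs E \<rho>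
    proof
      show "\<rho> \<le> 1" by (rule le') simp
      show "C5 * \<rho> \<le> \<beta> / 4" by (rule small_factor[OF data_nonneg(4) pos(1)]) (use rp le' in simp_all)
      show "C6 * \<rho> \<le> b1^2 / 4" by (rule small_factor[OF data_nonneg(5) pos(2)]) (use rp le' in simp_all)
      show "C8 * \<rho> \<le> bh / 2" by (rule small_factor[OF data_nonneg(10) pos(3)]) (use rp le' in simp_all)
      show "?m * \<rho> \<le> (bh / 2)^2" by (rule small_factor[OF m0 pos(4)]) (use rp le' in simp_all)
    qed
    obtain \<Theta> where T: "\<Theta> \<in> hr.VT" "hr.nD \<Theta> \<le> C10 * \<rho>"
      and eq: "\<forall>\<Phi>\<in>hr.VT. AA (hr.HD (hr.P + \<Theta>)) (hr.HD \<Phi>) + hr.bb (hr.P + \<Theta>) (hr.P + \<Theta>) \<Phi> = L (hr.ET \<Phi>)"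
      using hr.scheme_solvable[OF sol H, folded C10_def] by (elim bexE conjE) (rule that)
    let ?D = "hr.P + \<Theta>"
    have D: "?D \<in> hr.VT" by (rule subspace_add[OF hr.VT_subspace hr.P(1) T(1)])
    have le_C: "a * \<rho> \<le> C * \<rho>" if "a \<le> C" for a using that rp by (intro mult_right_mono) simp_all
    have cs: "C10 \<le> C" "SP + C10 \<le> C" "mm * (SP + G0 * C10) \<le> C" "SP + G0 * C10 \<le> C"
      using nn data_nonneg(8) unfolding C_def by linarith+
    \<comment> \<open>The constants were defined anew before a discretisation was fixed; here they
      are identified with those of the locale.\<close>
    have "hr.C10 = C10" "hr.mm = mm" by (simp_all add: hr.C10_def C10_def hr.mm_def mm_def)
    note est = hr.error_estimates[unfolded this, OF T]
    have "scheme_sol U h L N Gr Hs E ?D"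
      unfolding scheme_sol_def
    proof (intro conjI allI impI)
      show "?D i \<in> Vsp N" for i by (rule hr.VT_nth[OF D])
      fix \<Phi>D :: "'k \<Rightarrow> nat \<Rightarrow> real" assume "\<forall>i. \<Phi>D i \<in> Vsp N"
      then have "\<Phi>D \<in> hr.VT" by (simp add: hr.VT_def)
      then have "AA (hr.HD ?D) (hr.HD \<Phi>D) + hr.bb ?D ?D \<Phi>D = L (hr.ET \<Phi>D)" using eq by blast
      then show "AA (tup (\<lambda>i. Hs (?D i))) (tup (\<lambda>i. Hs (\<Phi>D i))) + BB (tup (\<lambda>i. Hs (?D i))) (tup (\<lambda>i. Gr (?D i))) (tup (\<lambda>i. Gr (\<Phi>D i))) = L (\<lambda>i. E (\<Phi>D i))"
        unfolding hr.bb_def hr.HD_def hr.GD_def hr.ET_def .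
    qed
    moreover have "L2n U (tup (\<lambda>i. Hs (\<lambda>j. ?D i j - PD U N PiD Gr Hs (\<Psi> i) j))) \<le> C * \<rho>"
    proof -
      have "(\<lambda>j. ?D i j - PD U N PiD Gr Hs (\<Psi> i) j) = \<Theta> i" for i by (simp add: hr.P_def hr.QD_def plus_fun_def)
      then show ?thesis using T(2) le_C[OF cs(1)] by (simp add: hr.nD_def hr.HD_def)
    qed
    moreover have "L2n U (\<lambda>x. HT U \<Psi> x - tup (\<lambda>i. Hs (?D i)) x) \<le> C * \<rho>"
      using est(1) le_C[OF cs(2)] unfolding hr.HD_def by linarith
    moreover have "L2n U (\<lambda>x. GradT U \<Psi> x - tup (\<lambda>i. Gr (?D i)) x) \<le> C * \<rho>"
      using est(2) le_C[OF cs(3)] unfolding hr.GD_def by linarith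
    moreover have "L2n U (\<lambda>x. tup \<Psi> x - tup (\<lambda>i. PiD (?D i)) x) \<le> C * \<rho>"
      using est(3) le_C[OF cs(4)] unfolding hr.FD_def by linarith
    ultimately show ?thesis by (intro exI[of _ ?D] conjI)
  qed
  show ?thesis
    by (rule exI[of _ \<rho>0], rule conjI[OF \<open>0 < \<rho>0\<close>], rule exI[of _ C], intro allI impI) (rule main)
qed

end

theorem theorem4p5:
  fixes \<Omega> :: "(real^'n) set"
    and h :: "real^'n^'k \<Rightarrow> real^'n^'k \<Rightarrow> real^'n^'n^'k"
    and L :: "('k \<Rightarrow> real^'n \<Rightarrow> real) \<Rightarrow> real"
    and \<Psi> :: "'k \<Rightarrow> real^'n \<Rightarrow> real"
    and \<Gamma> :: real
  assumes dim: "CARD('n) \<le> 3"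
    and dom: "open \<Omega>" "bounded \<Omega>" "convex \<Omega>" "\<Omega> \<noteq> {}"
    and h_bil: "bilinear h"
    and B_skew: "\<And>\<Xi> \<Theta>. L2fun \<Omega> \<Xi> \<Longrightarrow> L4fun \<Omega> \<Theta> \<Longrightarrow> Bform \<Omega> h \<Xi> \<Theta> \<Theta> = 0"
    and L_dual: "Hminus1 \<Omega> L"
    and reg: "regular_sol \<Omega> h L \<Psi>"
    and H3: "\<And>i. sob \<Omega> 3 (\<Psi> i)"
    and Gam: "\<Gamma> \<ge> 0"
  shows "\<exists>\<rho>0>0. \<exists>C. \<forall>\<rho> N PiD Gr Hs E.
     0 < \<rho> \<and> \<rho> \<le> \<rho>0 \<and> hess_disc \<Omega> N PiD Gr Hs \<and> companion \<Omega> N E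
     \<and> CD \<Omega> N PiD Gr Hs \<le> \<Gamma> \<and> GammaE \<Omega> N Hs E \<le> \<Gamma>
     \<and> omegaE \<Omega> N Gr Hs E \<le> \<rho> \<and> alphaD \<Omega> N PiD Gr Hs \<le> \<rho>
     \<and> gammaD \<Omega> N Gr Hs \<le> \<rho> \<and> deltaE \<Omega> N PiD Hs E \<le> \<rho>
     \<longrightarrow> (\<exists>\<Psi>D. scheme_sol \<Omega> h L N Gr Hs E \<Psi>D
          \<and> L2n \<Omega> (tup (\<lambda>i. Hs (\<lambda>j. \<Psi>D i j - PD \<Omega> N PiD Gr Hs (\<Psi> i) j))) \<le> C * \<rho>
          \<and> L2n \<Omega> (\<lambda>x. HT \<Omega> \<Psi> x - tup (\<lambda>i. Hs (\<Psi>D i)) x) \<le> C * \<rho>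
          \<and> L2n \<Omega> (\<lambda>x. GradT \<Omega> \<Psi> x - tup (\<lambda>i. Gr (\<Psi>D i)) x) \<le> C * \<rho>
          \<and> L2n \<Omega> (\<lambda>x. tup \<Psi> x - tup (\<lambda>i. PiD (\<Psi>D i)) x) \<le> C * \<rho>)"
proof -
  interpret t: trilinear_form \<Omega> h by unfold_locales (use dim dom h_bil in auto)
  have sol: "cont_sol \<Omega> h L \<Psi>" using reg unfolding regular_sol_def by simp
  then have X: "Xsp \<Omega> \<Psi>" unfolding cont_sol_def by simp
  obtain K where K: "0 \<le> K" "AE x in lebesgue_on \<Omega>. norm (GradT \<Omega> \<Psi> x) \<le> K"
    using t.GradT_AE_bounded[of \<Psi>, OF H3] by (elim exE conjE) (rule that)
  obtain \<beta> where b: "0 < \<beta>" "\<forall>\<xi>\<in>t.TS. \<forall>c\<ge>0. (\<forall>\<phi>\<in>t.TS. \<bar>Aform \<Omega> (t.Hc \<xi>) (t.Hc \<phi>) + Bform \<Omega> h (HT \<Omega> \<Psi>) (t.Gc \<xi>) (t.Gc \<phi>) + Bform \<Omega> h (t.Hc \<xi>) (GradT \<Omega> \<Psi>) (t.Gc \<phi>)\<bar> \<le> c * L2n \<Omega> (t.Hc \<phi>))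
     \<longrightarrow> \<beta> * L2n \<Omega> (t.Hc \<xi>) \<le> c"
    using t.inf_sup_test[OF reg] by (elim exE conjE) (rule that)
  obtain C0 where C0: "0 \<le> C0" "\<forall>\<phi>\<in>t.TS. L4n \<Omega> (t.Gc \<phi>) \<le> C0 * L2n \<Omega> (t.Hc \<phi>)"
    using t.Gc_bound by (elim exE conjE) (rule that)
  interpret rb: regular_base \<Omega> h \<Psi> K \<beta> C0 \<Gamma>
    by unfold_locales (use X H3 K b C0 Gam in blast)+
  \<comment> \<open>Small enough for both \<open>eps1\<close> and \<open>eps2\<close>. It is fixed
    before any discretisation, and so is the family \<open>e\<close> obtained from it.\<close>
  define \<epsilon> where "\<epsilon> = min (\<beta> / 4 / (rb.C1 + 1)) (rb.b1^2 / 4 / (rb.C1 * rb.G0 + 1))"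
  note nn = rb.base_nonneg
  have CG: "0 \<le> rb.C1 * rb.G0" by (intro mult_nonneg_nonneg nn)
  have p: "0 < \<beta> / 4" "0 < rb.b1^2 / 4" using b(1) nn(7) by simp_all
  have e0: "0 < \<epsilon>" unfolding \<epsilon>_def using p CG nn(5) by (simp add: add_nonneg_pos)
  have e1: "rb.C1 * \<epsilon> \<le> \<beta> / 4" by (rule small_factor[OF nn(5) p(1)]) (use e0 in \<open>simp_all add: \<epsilon>_def\<close>)
  have "(rb.C1 * rb.G0) * \<epsilon> \<le> rb.b1^2 / 4" by (rule small_factor[OF CG p(2)]) (use e0 in \<open>simp_all add: \<epsilon>_def\<close>)
  then have e2: "rb.C1 * \<epsilon> * rb.G0 \<le> rb.b1^2 / 4" by (simp add: ac_simps)
  obtain n e where o: "t.sip.orthonormal n e" and s: "\<forall>u\<in>t.TS. (\<forall>m<n. t.ip (e m) u = 0) \<longrightarrow> L4n \<Omega> (t.Gc u) \<le> \<epsilon> * t.sip.nrm u"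
    using t.splitting[OF e0] by (elim exE conjE) (rule that)
  interpret rd: regular_data \<Omega> h \<Psi> K \<beta> C0 \<Gamma> \<epsilon> n e
    by unfold_locales (use e0 e1 e2 o s in \<open>auto simp: less_imp_le\<close>)
  show ?thesis
  \<comment> \<open>The conclusions coincide, so the quantifiers are peeled off and only the
    hypotheses on a discretisation are repackaged as \<open>hess_scheme\<close>.\<close>
  proof (rule rd.scheme_estimates[OF sol L_dual, THEN ex_forward], erule conj_forward, assumption, erule ex_forward, (erule all_forward)+, erule imp_forward)
    fix \<rho>0 \<rho> N PiD Gr Hs E
    assume "0 < \<rho> \<and> \<rho> \<le> \<rho>0 \<and> hess_disc \<Omega> N PiD Gr Hs \<and> companion \<Omega> N E
     \<and> CD \<Omega> N PiD Gr Hs \<le> \<Gamma> \<and> GammaE \<Omega> N Hs E \<le> \<Gamma>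
     \<and> omegaE \<Omega> N Gr Hs E \<le> \<rho> \<and> alphaD \<Omega> N PiD Gr Hs \<le> \<rho>
     \<and> gammaD \<Omega> N Gr Hs \<le> \<rho> \<and> deltaE \<Omega> N PiD Hs E \<le> \<rho>"
    with Gam show "\<rho> \<le> \<rho>0 \<and> hess_scheme \<Omega> N PiD Gr Hs E \<rho> \<Gamma>"
      by (intro conjI; (unfold_locales)?) simp_all
  qed
qed

end
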